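(* Let $\mathbf R$ be a field, let $x=(x_1,\ldots,x_n)$ be variables, let $f(x)=(f_1(x),\ldots,f_n(x))$ be $n$ polynomials in $\mathbf R[x]$, and let $\delta_f=\sum_{i=1}^n(\deg(f_i)-1)$. Let $\mathbf R[x]/(f(x))_x$ be a finite-dimensional vector space over $\mathbf R$; in this case there exists a unit root functional $E(x_* )$ of the polynomials $f(x)$. Let $\varepsilon\ge 0$ be an integer, let $\mathcal A(x_* )$ be the set of all functionals annulling $(f(x))^{\le\delta_f+\varepsilon}_x$, let $\mathcal L(x_* )$ be the set of all functionals annulling $(f(x))_x$, and let $\mathcal U(x)=\mathbf R[x^{\le\delta_f+\varepsilon}]$. Then: 1) $\mathcal A(x_* )|_{\mathcal U(x)}$ with the operation induced by the extension operation $*$ for functionals is an associative and commutative algebra over $\mathbf R$; 2) there exists $d$ such that $\mathcal A(x_* )^d|_{\mathcal U(x)}=\mathcal A(x_* )^{d+1}|_{\mathcal U(x)}$, and for any such $d$ there holds $$\mathcal L(x_* )|_{\mathcal U(x)}=\mathcal A(x_* )^d|_{\mathcal U(x)}=(\mathcal A(x_* )|_{\mathcal U(x)})^d .$$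
   Context: $\mathbf R[x^{\le d}]$ is the space of polynomials of total degree $\le d$ (equal to $\{0\}$ if $d<0$). $(f(x))_x$ is the ideal of $\mathbf R[x]$ generated by $f_1,\ldots,f_n$, and $(f(x))^{\le d}_x=\{\sum_{i=1}^n f_i(x)g^i(x): g^i\in\mathbf R[x^{\le d-\deg(f_i)}]\}$. For the purpose of $\deg(f_i)$, put $\deg 0=0$. A functional is an $\mathbf R$-linear map $L:\mathbf R[x]\to\mathbf R$; it is also written $L(x_* )$, its value on $F$ is written $L(x_* ).F(x)$, and $L(y_* )$ denotes the same functional on polynomials in a second set of variables $y=(y_1,\ldots,y_n)$; on $\mathbf R[x,y]$, $L(y_* )$ acts coefficientwise over $\mathbf R[x]$. A functional annuls a set if it vanishes on every element of the set. $|_{\mathcal U}$ denotes restriction of functionals to $\mathcal U$ (applied elementwise to sets of functionals). Difference derivative: $\nabla=(\nabla^1,\ldots,\nabla^n)$ is a fixed $\mathbf R$-linear map $\mathbf R[x]\to\mathbf R[x,y]^n$ with $F(x)-F(y)=\sum_{k=1}^n(x_k-y_k)\,\nabla^kF(x,y)$ and with each $\nabla^kF(x,y)$ of total degree in $(x,y)$ at most $\deg F-1$ (zero if $F$ is constant); for example $\nabla^kF(x,y)=\dfrac{F(y_1,\ldots,y_{k-1},x_k,\ldots,x_n)-F(y_1,\ldots,y_k,x_{k+1},\ldots,x_n)}{x_k-y_k}$. $\|\nabla f(x,y)\|$ is the $n\times n$ matrix whose entry in row $k$, column $i$ is $\nabla^kf_i(x,y)$. Extension operation: for functionals $L_1,L_2$,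 the functional $L_1(x_* )*L_2(x_* )$ is defined by $$(L_1*L_2).F=L_1(x_* ).L_2(y_* ).\det\begin{Vmatrix}\nabla f(x,y)&\nabla F(x,y)\\ f(x)&F(x)\end{Vmatrix},$$ the determinant of the $(n+1)\times(n+1)$ matrix whose first $n$ rows are $(\nabla^kf_1,\ldots,\nabla^kf_n,\nabla^kF)$, $k=1,\ldots,n$, and whose last row is $(f_1(x),\ldots,f_n(x),F(x))$. The induced operation on $\mathcal A|_{\mathcal U}$ is $(L_1|_{\mathcal U})*(L_2|_{\mathcal U})=(L_1*L_2)|_{\mathcal U}$ for $L_1,L_2\in\mathcal A$ (that it is well defined with values in $\mathcal A|_{\mathcal U}$ is part of assertion 1); algebras are not required to be unital. Powers ($d\ge1$): $\mathcal A^1=\mathcal A$ and $\mathcal A^{p+1}$ is the $\mathbf R$-linear span of $\{L*L': L\in\mathcal A^p,\ L'\in\mathcal A\}$; powers of $\mathcal A|_{\mathcal U}$ are defined likewise with the induced operation. A unit root functional of $f$ is a functional $E(x_* )$ that annuls $(f(x))_x$ and satisfies $E(y_* ).\det\|\nabla f(x,y)\|=1+\sum_{i=1}^n f_i(x)g_i(x)$ for some $g_1,\ldots,g_n\in\mathbf R[x]$. *)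

theory Defs
  imports
    "HOL-Analysis.Determinants"
    "HOL-Library.Poly_Mapping"
    "HOL-Library.Function_Algebras"
begin

text \<open>
  Polynomials over \<open>'a\<close> in the variables \<open>X i\<close>, where \<open>i\<close> ranges over the type \<open>'v\<close>. The ring
  \<open>R[x]\<close> in \<open>n = CARD('n)\<close> variables is \<open>('n, 'a) mpoly\<close>; the ring \<open>R[x,y]\<close> is
  \<open>('n + 'n, 'a) mpoly\<close>, with \<open>x\<^sub>k = X (Inl k)\<close> and \<open>y\<^sub>k = X (Inr k)\<close>.
\<close>

type_synonym ('v, 'a) mpoly = "('v \<Rightarrow>\<^sub>0 nat) \<Rightarrow>\<^sub>0 'a"

definition X :: "'v \<Rightarrow> ('v, 'a::comm_ring_1) mpoly"
  where "X i = Poly_Mapping.single (Poly_Mapping.single i 1) 1"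

definition scale :: "'a::comm_ring_1 \<Rightarrow> ('v, 'a) mpoly \<Rightarrow> ('v, 'a) mpoly"
  where "scale c p = Poly_Mapping.single 0 c * p"

global_interpretation mpoly: vector_space "scale :: 'a::field \<Rightarrow> ('v, 'a) mpoly \<Rightarrow> ('v, 'a) mpoly"
  by unfold_locales
    (simp_all add: scale_def algebra_simps single_add mult_single flip: mult.assoc)

definition monom_degree :: "('v::finite \<Rightarrow>\<^sub>0 nat) \<Rightarrow> nat"
  where "monom_degree m = (\<Sum>i\<in>UNIV. Poly_Mapping.lookup m i)"

definition total_degree :: "('v::finite, 'a::zero) mpoly \<Rightarrow> nat"
  where "total_degree p = Max (insert 0 (monom_degree ` Poly_Mapping.keys p))"

definition polys_le :: "int \<Rightarrow> ('v::finite, 'a::zero) mpoly set"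
  where "polys_le d = {p. p = 0 \<or> int (total_degree p) \<le> d}"

definition subst :: "('v::finite \<Rightarrow> ('w, 'a::comm_ring_1) mpoly) \<Rightarrow> ('v, 'a) mpoly \<Rightarrow> ('w, 'a) mpoly"
  where "subst \<sigma> p =
    (\<Sum>m\<in>Poly_Mapping.keys p.
      scale (Poly_Mapping.lookup p m) (\<Prod>i\<in>UNIV. \<sigma> i ^ Poly_Mapping.lookup m i))"

abbreviation in_x :: "('n::finite, 'a::comm_ring_1) mpoly \<Rightarrow> ('n + 'n, 'a) mpoly"
  where "in_x \<equiv> subst (\<lambda>k. X (Inl k))"

abbreviation in_y :: "('n::finite, 'a::comm_ring_1) mpoly \<Rightarrow> ('n + 'n, 'a) mpoly"
  where "in_y \<equiv> subst (\<lambda>k. X (Inr k))"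


definition ideal_of :: "('n::finite \<Rightarrow> ('n, 'a::comm_ring_1) mpoly) \<Rightarrow> ('n, 'a) mpoly set"
  where "ideal_of f = {\<Sum>i\<in>UNIV. f i * g i |g. True}"

definition ideal_le :: "('n::finite \<Rightarrow> ('n, 'a::comm_ring_1) mpoly) \<Rightarrow> int \<Rightarrow> ('n, 'a) mpoly set"
  where "ideal_le f d =
    {\<Sum>i\<in>UNIV. f i * g i |g. \<forall>i. g i \<in> polys_le (d - int (total_degree (f i)))}"

definition delta :: "('n::finite \<Rightarrow> ('n, 'a::zero) mpoly) \<Rightarrow> int"
  where "delta f = (\<Sum>i\<in>UNIV. int (total_degree (f i)) - 1)"

text \<open>The quotient space \<open>R[x]/I\<close> is spanned by the classes of finitely many polynomials.\<close>

definition finite_dim_quotient :: "('n, 'a::field) mpoly set \<Rightarrow> bool"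
  where "finite_dim_quotient I \<longleftrightarrow>
    (\<exists>B. finite B \<and> (\<forall>p. \<exists>q\<in>mpoly.span B. p - q \<in> I))"


type_synonym ('n, 'a) functional = "('n, 'a) mpoly \<Rightarrow> 'a"

definition is_functional :: "('n, 'a::field) functional \<Rightarrow> bool"
  where "is_functional L \<longleftrightarrow> Vector_Spaces.linear scale (*) L"

definition annulling :: "('n, 'a::field) mpoly set \<Rightarrow> ('n, 'a) functional set"
  where "annulling S = {L. is_functional L \<and> (\<forall>p\<in>S. L p = 0)}"

text \<open>
  The value \<open>L(y\<^sub>*).G(x,y)\<close>: a term \<open>c x\<^sup>\<alpha> y\<^sup>\<beta>\<close> is sent to \<open>c L(y\<^sup>\<beta>) x\<^sup>\<alpha>\<close>. For a
  monomial \<open>m\<close> of \<open>R[x,y]\<close>, the exponents \<open>\<alpha>\<close>, \<open>\<beta>\<close> are \<open>m \<circ> Inl\<close>, \<open>m \<circ> Inr\<close>.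
\<close>

definition apply_y :: "('n, 'a::field) functional \<Rightarrow> ('n + 'n, 'a) mpoly \<Rightarrow> ('n, 'a) mpoly"
  where "apply_y L G =
    (\<Sum>m\<in>Poly_Mapping.keys G.
      Poly_Mapping.single (Poly_Mapping.map_key Inl m)
        (Poly_Mapping.lookup G m * L (Poly_Mapping.single (Poly_Mapping.map_key Inr m) 1)))"

text \<open>
  \<open>D k F\<close> is \<open>\<nabla>\<^sup>kF(x,y)\<close>. In the degree bound, \<open>polys_le (-1) = {0}\<close> takes care of constant \<open>F\<close>.
\<close>

definition difference_derivative ::
    "('n::finite \<Rightarrow> ('n, 'a::field) mpoly \<Rightarrow> ('n + 'n, 'a) mpoly) \<Rightarrow> bool"
  where "difference_derivative D \<longleftrightarrow>
    (\<forall>k. Vector_Spaces.linear scale scale (D k)) \<and>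
    (\<forall>F. in_x F - in_y F = (\<Sum>k\<in>UNIV. (X (Inl k) - X (Inr k)) * D k F)) \<and>
    (\<forall>F k. D k F \<in> polys_le (int (total_degree F) - 1))"

definition nabla_matrix ::
    "('n::finite \<Rightarrow> ('n, 'a::field) mpoly \<Rightarrow> ('n + 'n, 'a) mpoly) \<Rightarrow>
     ('n \<Rightarrow> ('n, 'a) mpoly) \<Rightarrow> ('n + 'n, 'a) mpoly ^ 'n ^ 'n"
  where "nabla_matrix D f = (\<chi> k i. D k (f i))"

text \<open>
  The \<open>(n+1) \<times> (n+1)\<close> matrix of the extension operation is indexed by \<open>'n option\<close>, with \<open>None\<close>
  as the index of the last row and of the last column.
\<close>

definition bordered_matrix ::
    "('n::finite \<Rightarrow> ('n, 'a::field) mpoly \<Rightarrow> ('n + 'n, 'a) mpoly) \<Rightarrow>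
     ('n \<Rightarrow> ('n, 'a) mpoly) \<Rightarrow> ('n, 'a) mpoly \<Rightarrow>
     ('n + 'n, 'a) mpoly ^ 'n option ^ 'n option"
  where "bordered_matrix D f F =
    (\<chi> r c.
      let h = (case c of Some i \<Rightarrow> f i | None \<Rightarrow> F)
      in (case r of Some k \<Rightarrow> D k h | None \<Rightarrow> in_x h))"

definition extension ::
    "('n::finite \<Rightarrow> ('n, 'a::field) mpoly \<Rightarrow> ('n + 'n, 'a) mpoly) \<Rightarrow>
     ('n \<Rightarrow> ('n, 'a) mpoly) \<Rightarrow>
     ('n, 'a) functional \<Rightarrow> ('n, 'a) functional \<Rightarrow> ('n, 'a) functional"
  where "extension D f L1 L2 = (\<lambda>F. L1 (apply_y L2 (det (bordered_matrix D f F))))"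

definition unit_root_functional ::
    "('n::finite \<Rightarrow> ('n, 'a::field) mpoly \<Rightarrow> ('n + 'n, 'a) mpoly) \<Rightarrow>
     ('n \<Rightarrow> ('n, 'a) mpoly) \<Rightarrow> ('n, 'a) functional \<Rightarrow> bool"
  where "unit_root_functional D f E \<longleftrightarrow>
    E \<in> annulling (ideal_of f) \<and>
    (\<exists>g. apply_y E (det (nabla_matrix D f)) = 1 + (\<Sum>i\<in>UNIV. f i * g i))"


definition fun_scale :: "'a::field \<Rightarrow> ('b \<Rightarrow> 'a) \<Rightarrow> 'b \<Rightarrow> 'a"
  where "fun_scale c L = (\<lambda>F. c * L F)"

global_interpretation functional: vector_space "fun_scale :: 'a::field \<Rightarrow> ('b \<Rightarrow> 'a) \<Rightarrow> 'b \<Rightarrow> 'a"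
  by unfold_locales (simp_all add: fun_scale_def fun_eq_iff algebra_simps)

text \<open>
  The restriction of \<open>L\<close> to \<open>U\<close> is represented by its extension by zero, so that restrictions
  can be added and scaled pointwise.
\<close>

definition restr :: "'b set \<Rightarrow> ('b \<Rightarrow> 'a::zero) \<Rightarrow> 'b \<Rightarrow> 'a"
  where "restr U L = (\<lambda>F. if F \<in> U then L F else 0)"

text \<open>
  This description determines the value for \<open>S\<close>, \<open>T\<close> in the restriction of \<open>A\<close> to \<open>U\<close> only if
  the restriction of \<open>star L1 L2\<close> depends on the restrictions of \<open>L1\<close> and \<open>L2\<close> alone.
\<close>

definition induced ::
    "'b set \<Rightarrow> ('b \<Rightarrow> 'a::zero) set \<Rightarrow> (('b \<Rightarrow> 'a) \<Rightarrow> ('b \<Rightarrow> 'a) \<Rightarrow> 'b \<Rightarrow> 'a) \<Rightarrow>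
     ('b \<Rightarrow> 'a) \<Rightarrow> ('b \<Rightarrow> 'a) \<Rightarrow> 'b \<Rightarrow> 'a"
  where "induced U A star S T =
    (THE M. \<exists>L1\<in>A. \<exists>L2\<in>A. restr U L1 = S \<and> restr U L2 = T \<and> M = restr U (star L1 L2))"

definition comm_assoc_algebra ::
    "('b \<Rightarrow> 'a::field) set \<Rightarrow> (('b \<Rightarrow> 'a) \<Rightarrow> ('b \<Rightarrow> 'a) \<Rightarrow> 'b \<Rightarrow> 'a) \<Rightarrow> bool"
  where "comm_assoc_algebra V star \<longleftrightarrow>
    functional.subspace V \<and>
    (\<forall>u\<in>V. \<forall>v\<in>V. star u v \<in> V) \<and>
    (\<forall>u\<in>V. \<forall>v\<in>V. \<forall>w\<in>V. star (u + v) w = star u w + star v w) \<and>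
    (\<forall>u\<in>V. \<forall>v\<in>V. \<forall>w\<in>V. star u (v + w) = star u v + star u w) \<and>
    (\<forall>c. \<forall>u\<in>V. \<forall>v\<in>V. star (fun_scale c u) v = fun_scale c (star u v)) \<and>
    (\<forall>c. \<forall>u\<in>V. \<forall>v\<in>V. star u (fun_scale c v) = fun_scale c (star u v)) \<and>
    (\<forall>u\<in>V. \<forall>v\<in>V. \<forall>w\<in>V. star (star u v) w = star u (star v w)) \<and>
    (\<forall>u\<in>V. \<forall>v\<in>V. star u v = star v u)"

text \<open>Powers are meaningful for positive exponents only; no value is specified for exponent 0.\<close>

fun alg_power ::
    "(('b \<Rightarrow> 'a::field) \<Rightarrow> ('b \<Rightarrow> 'a) \<Rightarrow> 'b \<Rightarrow> 'a) \<Rightarrow> ('b \<Rightarrow> 'a) set \<Rightarrow> nat \<Rightarrow> ('b \<Rightarrow> 'a) set"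
  where
    "alg_power star A (Suc 0) = A"
  | "alg_power star A (Suc (Suc p)) =
      functional.span {star L L' |L L'. L \<in> alg_power star A (Suc p) \<and> L' \<in> A}"

end

theory Submission
  imports Defs
begin

text \<open>
  Commutativity and associativity are proved after homogenising with an additional variable. A functional annulling
  \<open>(f)\<^sup>\<le>\<^sup>p\<close> is turned into one on homogeneous polynomials that lives in degree \<open>p\<close> and annuls the homogenised
  \<open>f\<^sub>i\<close> altogether; the extension operation turns into \<open>L\<^sub>1(x) L\<^sub>2(y) det V\<close>, where \<open>V\<close> is any square matrix whose
  columns \<open>v\<close> satisfy \<open>\<Sum>\<^sub>k (x\<^sub>k - y\<^sub>k) v\<^sub>k = h(x) - h(y)\<close> for \<open>h\<close> running through the \<open>f\<^sub>i\<close> and \<open>F\<close>. As the Koszul complex of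
  the \<open>x\<^sub>k - y\<^sub>k\<close> is exact, \<open>det V\<close> modulo the \<open>h(x)\<close> and \<open>h(y)\<close> does not depend on the choice of \<open>V\<close>. Interchanging
  \<open>x\<close> and \<open>y\<close> gives commutativity; associativity is an exchange identity for such determinants in three sets of
  variables, obtained from creation and contraction operators on an exterior algebra.

  Multiplication by a unit root functional fixes \<open>\<L>\<close>, so all powers of \<open>\<A>\<close> contain \<open>\<L>\<close>. On the other hand \<open>\<A>\<^sup>d\<close> annuls
  \<open>(f)\<^sup>\<le>\<^sup>N\<close> with \<open>N = \<delta> + d \<epsilon> + d - 1\<close>, which contains the finite-dimensional \<open>(f) \<inter> \<U>\<close> when \<open>d\<close> is large.
\<close>

section \<open>Polynomials, substitution and degrees\<close>

text \<open>The obstacle: a functional in \<A> annuls f_i g only for g of bounded degree, while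
  cofactors obtained from the Koszul complex come without degree control. On forms of one fixed
  degree p the bound holds by itself. It also takes care of the argument F: a functional living in
  degree p annuls all multiples of a form of larger degree, so the column of F can be reduced like a
  column f_i. The product of functionals of degrees p and q lives in degree p + q - \<delta> + 1,
  which exceeds p and q if both are at least \<delta>. In the exchange identity a remainder of
  degree at most \<delta> - 1 in the middle variables y is left over; the middle functional lives in
  degree at least \<delta> and annuls it. The products compared are (L1 L2) L3 and (L3 L2) L1, which
  correspond under reversal of the three points; commutativity turns this into associativity. The
  field may have any characteristic. Therefore odd elements are required to have square 0
  separately, and half of the square of a 2-form is replaced by a divided square.\<close>

lemma mpoly_sum_singles: "(\<Sum>m\<in>Poly_Mapping.keys p. Poly_Mapping.single m (Poly_Mapping.lookup p m)) = p"
proof (rule poly_mapping_eqI)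
  fix m
  have "(\<Sum>m'\<in>Poly_Mapping.keys p. Poly_Mapping.lookup (Poly_Mapping.single m' (Poly_Mapping.lookup p m')) m)
      = (\<Sum>m'\<in>Poly_Mapping.keys p. if m' = m then Poly_Mapping.lookup p m else 0)"
    by (rule sum.cong) (auto simp: lookup_single when_def)
  then show "Poly_Mapping.lookup (\<Sum>m\<in>Poly_Mapping.keys p. Poly_Mapping.single m (Poly_Mapping.lookup p m)) m
      = Poly_Mapping.lookup p m"
    by (simp add: lookup_sum sum.delta in_keys_iff)
qed

lemma mpoly_single_induct [case_names single add]:
  assumes "\<And>m c. P (Poly_Mapping.single m c)"
    and "\<And>p q. P p \<Longrightarrow> P q \<Longrightarrow> P (p + q)"
  shows "P (p :: ('v, 'a::comm_ring_1) mpoly)"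
proof -
  have "P (\<Sum>m\<in>M. Poly_Mapping.single m (Poly_Mapping.lookup p m))" if "finite M" for M
    using that by (induction M rule: finite_induct) (use assms(1)[of 0 0] in \<open>simp_all add: assms\<close>)
  from this[OF finite_keys[of p]] show ?thesis by (simp only: mpoly_sum_singles)
qed

lemma exponent_induct [case_names zero add]:
  assumes "P 0" and "\<And>i m. P m \<Longrightarrow> P (Poly_Mapping.single i 1 + m)"
  shows "P (m :: 'v::finite \<Rightarrow>\<^sub>0 nat)"
proof (induction "\<Sum>i\<in>UNIV. Poly_Mapping.lookup m i" arbitrary: m)
  case 0
  then have "m = 0" by (intro poly_mapping_eqI) simp
  then show ?case using assms(1) by simp
next
  case (Suc k)
  then have "(\<Sum>i\<in>UNIV. Poly_Mapping.lookup m i) \<noteq> 0" by linarith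
  then obtain i where i: "Poly_Mapping.lookup m i \<noteq> 0" by (meson sum.neutral)
  define m' where "m' = m - Poly_Mapping.single i 1"
  have m: "m = Poly_Mapping.single i 1 + m'"
    by (rule poly_mapping_eqI) (use i in \<open>auto simp: m'_def lookup_add lookup_minus lookup_single when_def\<close>)
  then have "(\<Sum>j\<in>UNIV. Poly_Mapping.lookup m j) = 1 + (\<Sum>j\<in>UNIV. Poly_Mapping.lookup m' j)"
    by (simp add: lookup_add sum.distrib lookup_single when_def)
  then have "P m'" using Suc by (intro Suc(1)) simp
  then show ?case using assms(2)[of m' i] m by simp
qed

lemma single_eq_X_mult:
  "Poly_Mapping.single (Poly_Mapping.single i 1 + m) c = X i * Poly_Mapping.single m c"
  by (simp add: X_def mult_single)

lemma mpoly_induct [case_names const X_mult add]: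
  assumes "\<And>c. P (Poly_Mapping.single 0 c)"
    and "\<And>i p. P p \<Longrightarrow> P (X i * p)"
    and "\<And>p q. P p \<Longrightarrow> P q \<Longrightarrow> P (p + q)"
  shows "P (p :: ('v::finite, 'a::comm_ring_1) mpoly)"
proof (induction p rule: mpoly_single_induct)
  case (single m c)
  show ?case
    by (induction m rule: exponent_induct) (use assms(1,2) in \<open>simp_all only: single_eq_X_mult\<close>)
next
  case (add p q)
  then show ?case by (rule assms(3))
qed

text \<open>A linear form prescribed by arbitrary values \<open>W\<close> on the monomials. By
  \<open>functional_eq_wtsum\<close> every functional is of this kind, so vanishing can be checked
  on the monomials that occur.\<close>

definition wtsum :: "(('v \<Rightarrow>\<^sub>0 nat) \<Rightarrow> 'a::comm_ring_1) \<Rightarrow> ('v, 'a) mpoly \<Rightarrow> 'a"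
  where "wtsum W Q = (\<Sum>m\<in>Poly_Mapping.keys Q. Poly_Mapping.lookup Q m * W m)"

lemma wtsum_single [simp]: "wtsum W (Poly_Mapping.single m c) = c * W m"
  by (simp add: wtsum_def)

lemma wtsum_0 [simp]: "wtsum W 0 = 0"
  by (simp add: wtsum_def)

lemma wtsum_add: "wtsum W (p + q) = wtsum W p + wtsum W q"
  unfolding wtsum_def by (rule setsum_keys_plus_distrib) (simp_all add: algebra_simps)

lemma wtsum_const_mult: "wtsum W (Poly_Mapping.single 0 c * p) = c * wtsum W p"
  by (induction p rule: mpoly_single_induct) (simp_all add: mult_single distrib_left wtsum_add)

lemma wtsum_uminus: "wtsum W (- p) = - wtsum W p"
  using wtsum_add[of W p "- p"] by (simp add: eq_neg_iff_add_eq_0 add.commute)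

lemma wtsum_diff: "wtsum W (p - q) = wtsum W p - wtsum W q"
  using wtsum_add[of W p "- q"] by (simp add: wtsum_uminus)

lemma wtsum_sum: "wtsum W (sum p I) = (\<Sum>i\<in>I. wtsum W (p i))"
  by (induction I rule: infinite_finite_induct) (simp_all add: wtsum_add)

lemma wtsum_cong: "(\<And>m. m \<in> Poly_Mapping.keys Q \<Longrightarrow> W m = W' m) \<Longrightarrow> wtsum W Q = wtsum W' Q"
  unfolding wtsum_def by simp

lemma wtsum_eq_0: "(\<And>m. m \<in> Poly_Mapping.keys Q \<Longrightarrow> W m = 0) \<Longrightarrow> wtsum W Q = 0"
  unfolding wtsum_def by simp

text \<open>Testing only the monomials that occur in \<open>q\<close> matters in the comparison with
  the extension operation, where the test succeeds because their degrees are known.\<close>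

lemma wtsum_mult:
  assumes "\<And>m. m \<in> Poly_Mapping.keys q \<Longrightarrow> wtsum W (p * Poly_Mapping.single m 1) = 0"
  shows "wtsum W (p * q) = 0"
proof -
  have eq: "p * Poly_Mapping.single m c = Poly_Mapping.single 0 c * (p * Poly_Mapping.single m 1)" for m c
    using mult.left_commute[of "Poly_Mapping.single 0 c" p "Poly_Mapping.single m 1"]
    by (simp add: mult_single)
  have "wtsum W (p * Poly_Mapping.single m (Poly_Mapping.lookup q m)) = 0" if "m \<in> Poly_Mapping.keys q" for m
    unfolding eq[of m "Poly_Mapping.lookup q m"] wtsum_const_mult assms[OF that] by simp
  then have "wtsum W (\<Sum>m\<in>Poly_Mapping.keys q. p * Poly_Mapping.single m (Poly_Mapping.lookup q m)) = 0"
    by (simp add: wtsum_sum)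
  then show ?thesis by (simp only: mpoly_sum_singles flip: sum_distrib_left)
qed

lemma functional_add: "is_functional L \<Longrightarrow> L (p + q) = L p + L q"
  unfolding is_functional_def by (rule module_hom.add[OF Vector_Spaces.linear.axioms(3)])

lemma functional_0: "is_functional L \<Longrightarrow> L 0 = 0"
  unfolding is_functional_def by (rule module_hom.zero[OF Vector_Spaces.linear.axioms(3)])

lemma functional_const_mult: "is_functional L \<Longrightarrow> L (Poly_Mapping.single 0 c * p) = c * L p"
  unfolding is_functional_def scale_def[symmetric] by (rule module_hom.scale[OF Vector_Spaces.linear.axioms(3)])

lemma functional_sum: "is_functional L \<Longrightarrow> L (sum p I) = (\<Sum>i\<in>I. L (p i))"
  unfolding is_functional_def by (rule module_hom.sum[OF Vector_Spaces.linear.axioms(3)])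

lemma functional_eq_wtsum: "is_functional L \<Longrightarrow> L = wtsum (\<lambda>m. L (Poly_Mapping.single m 1))"
proof
  fix p assume L: "is_functional L"
  show "L p = wtsum (\<lambda>m. L (Poly_Mapping.single m 1)) p"
  proof (induction p rule: mpoly_single_induct)
    case (single m c)
    then show ?case using functional_const_mult[OF L, of c "Poly_Mapping.single m 1"] by (simp add: mult_single)
  next
    case (add p q)
    then show ?case by (simp add: functional_add[OF L] wtsum_add)
  qed
qed

lemma is_functionalI:
  assumes "\<And>p q. L (p + q) = L p + L q" and "\<And>c p. L (Poly_Mapping.single 0 c * p) = c * L p"
  shows "is_functional (L :: ('n, 'a::field) functional)"
  unfolding is_functional_def
  by unfold_locales (simp_all add: assms scale_def distrib_left distrib_right single_add mult_single flip: mult.assoc)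

lemma is_functional_wtsum [simp]: "is_functional (wtsum W :: ('n, 'a::field) functional)"
  by (rule is_functionalI) (simp_all add: wtsum_add wtsum_const_mult)

lemma is_functional_comp:
  fixes L :: "('n, 'a::field) functional" and g :: "('m, 'a) mpoly \<Rightarrow> ('n, 'a) mpoly"
  assumes L: "is_functional L" and "\<And>p q. g (p + q) = g p + g q"
    and "\<And>c p. g (Poly_Mapping.single 0 c * p) = Poly_Mapping.single 0 c * g p"
  shows "is_functional (\<lambda>p. L (g p))"
  by (rule is_functionalI) (simp_all add: assms functional_add[OF L] functional_const_mult[OF L])

section \<open>Substitution homomorphisms\<close>

lemma scale_single: "scale c (Poly_Mapping.single m d) = Poly_Mapping.single m (c * d)"
  by (simp add: scale_def mult_single)

lemma subst_single:
  "subst \<sigma> (Poly_Mapping.single m c) = scale c (\<Prod>i\<in>UNIV. \<sigma> i ^ Poly_Mapping.lookup m i)"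
  by (simp add: subst_def scale_def)

lemma subst_0 [simp]: "subst \<sigma> 0 = 0"
  by (simp add: subst_def)

lemma subst_add: "subst \<sigma> (p + q) = subst \<sigma> p + subst \<sigma> q"
  unfolding subst_def
  by (rule setsum_keys_plus_distrib) (simp_all add: scale_def single_add distrib_right)

lemma subst_const [simp]: "subst \<sigma> (Poly_Mapping.single 0 c) = Poly_Mapping.single 0 c"
  by (simp add: subst_single scale_def)

lemma subst_1 [simp]: "subst \<sigma> 1 = 1"
  using subst_const[of \<sigma> 1] by simp

lemma subst_X [simp]: "subst \<sigma> (X i) = \<sigma> i"
proof -
  have "(\<Prod>j\<in>UNIV. \<sigma> j ^ Poly_Mapping.lookup (Poly_Mapping.single i (1::nat)) j) = (\<Prod>j\<in>UNIV. if j = i then \<sigma> j else 1)"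
    by (rule prod.cong) (auto simp: lookup_single when_def)
  then show ?thesis by (simp add: X_def subst_single scale_def)
qed

lemma subst_mult: "subst (\<sigma> :: 'v::finite \<Rightarrow> ('b, 'c::comm_ring_1) mpoly) (p * q) = subst \<sigma> p * subst \<sigma> q"
proof (induction p rule: mpoly_single_induct)
  case (single m c)
  show ?case
  proof (induction q rule: mpoly_single_induct)
    case (single m' c')
    have *: "Poly_Mapping.single 0 (c * c') = (Poly_Mapping.single 0 c * Poly_Mapping.single 0 c' :: ('b, 'c) mpoly)" for c c'
      by (simp add: mult_single)
    show ?case
      by (simp add: mult_single subst_single scale_def lookup_add power_add prod.distrib) (simp add: * ac_simps)
  qed (simp add: distrib_left subst_add)
qed (simp add: distrib_right subst_add)

lemma subst_uminus: "subst \<sigma> (- p) = - subst \<sigma> p"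
  using subst_add[of \<sigma> p "- p"] by (simp add: eq_neg_iff_add_eq_0 add.commute)

lemma subst_diff: "subst \<sigma> (p - q) = subst \<sigma> p - subst \<sigma> q"
  using subst_add[of \<sigma> p "- q"] by (simp add: subst_uminus)

lemma subst_sum: "subst \<sigma> (sum p I) = (\<Sum>i\<in>I. subst \<sigma> (p i))"
  by (induction I rule: infinite_finite_induct) (simp_all add: subst_add)

lemma subst_prod: "subst \<sigma> (prod p I) = (\<Prod>i\<in>I. subst \<sigma> (p i))"
  by (induction I rule: infinite_finite_induct) (simp_all add: subst_mult)

lemma subst_power: "subst \<sigma> (p ^ k) = subst \<sigma> p ^ k"
  by (induction k) (simp_all add: subst_mult)

lemma subst_of_int: "subst \<sigma> (of_int k) = of_int k"
  using subst_const[of \<sigma> "of_int k"] by simp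

lemma subst_det: "subst \<sigma> (det A) = det (\<chi> i j. subst \<sigma> (A $ i $ j))"
  by (simp add: det_def subst_sum subst_mult subst_prod subst_of_int)

lemma subst_subst: "subst \<tau> (subst \<sigma> p) = subst (\<lambda>i. subst \<tau> (\<sigma> i)) p"
  by (induction p rule: mpoly_induct) (simp_all add: subst_mult subst_add)

lemma subst_X_id [simp]: "subst X p = p"
  by (induction p rule: mpoly_induct) (simp_all add: subst_mult subst_add)

lemma prod_single: "finite I \<Longrightarrow> (\<Prod>i\<in>I. Poly_Mapping.single (m i) (1::'a::comm_ring_1)) = Poly_Mapping.single (\<Sum>i\<in>I. m i) 1"
  by (induction I rule: finite_induct) (simp_all add: mult_single)

lemma X_power: "X i ^ k = Poly_Mapping.single (Poly_Mapping.single i k) 1"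
  by (induction k) (simp_all add: X_def mult_single single_add[symmetric])

text \<open>The exponent of a renamed monomial. The map \<open>\<rho>\<close> may identify
  variables, as in setting x = y; exponents are then added.\<close>

definition rename_exp :: "('v::finite \<Rightarrow> 'w) \<Rightarrow> ('v \<Rightarrow>\<^sub>0 nat) \<Rightarrow> 'w \<Rightarrow>\<^sub>0 nat"
  where "rename_exp \<rho> m = (\<Sum>i\<in>UNIV. Poly_Mapping.single (\<rho> i) (Poly_Mapping.lookup m i))"

lemma subst_rename_single:
  "subst (\<lambda>i. X (\<rho> i)) (Poly_Mapping.single m c) = Poly_Mapping.single (rename_exp \<rho> m) c"
  by (simp add: subst_single X_power prod_single scale_single rename_exp_def)

lemma lookup_rename_exp:
  assumes "inj \<rho>"
  shows "Poly_Mapping.lookup (rename_exp \<rho> m) j = (if j \<in> range \<rho> then Poly_Mapping.lookup m (inv \<rho> j) else 0)"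
proof (cases "j \<in> range \<rho>")
  case True
  then obtain i where i: "j = \<rho> i" by auto
  have "Poly_Mapping.lookup (rename_exp \<rho> m) j = (\<Sum>k\<in>UNIV. if k = i then Poly_Mapping.lookup m k else 0)"
    unfolding rename_exp_def lookup_sum i
    by (rule sum.cong) (use assms in \<open>auto simp: lookup_single when_def inj_eq\<close>)
  then show ?thesis using i assms by (simp add: True)
next
  case False
  then show ?thesis
    unfolding rename_exp_def lookup_sum by (auto intro!: sum.neutral simp: lookup_single when_def)
qed

lemma rename_exp_add: "rename_exp \<rho> (m + m') = rename_exp \<rho> m + rename_exp \<rho> m'"
  by (simp add: rename_exp_def lookup_add single_add sum.distrib)

text \<open>For a product \<open>X i * p\<close> the difference splits into
  \<open>\<sigma> i\<close> times the difference for \<open>p\<close> plus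
  \<open>\<sigma> i - \<tau> i\<close> times a substitution of \<open>p\<close>. This supplies
  difference vectors, and shows that the kernel of a substitution lies in the ideal of the
  differences it annihilates.\<close>

lemma subst_diff_in_ideal:
  "\<exists>q. subst \<sigma> p - subst \<tau> p = (\<Sum>i\<in>UNIV. (\<sigma> i - \<tau> i) * q i)"
proof (induction p rule: mpoly_induct)
  case (const c)
  then show ?case by (auto intro!: exI[of _ "\<lambda>_. 0"])
next
  case (X_mult i p)
  then obtain q where q: "subst \<sigma> p - subst \<tau> p = (\<Sum>j\<in>UNIV. (\<sigma> j - \<tau> j) * q j)" by auto
  have "subst \<sigma> (X i * p) - subst \<tau> (X i * p)
      = \<sigma> i * (subst \<sigma> p - subst \<tau> p) + (\<sigma> i - \<tau> i) * subst \<tau> p"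
    by (simp add: subst_mult algebra_simps)
  also have "\<dots> = (\<Sum>j\<in>UNIV. (\<sigma> j - \<tau> j) * (\<sigma> i * q j + (if j = i then subst \<tau> p else 0)))"
    unfolding q by (simp add: distrib_left sum.distrib sum_distrib_left mult.left_commute if_distrib[of "(*) _"]
      cong: if_cong)
  finally show ?case by (rule exI[of _ "\<lambda>j. \<sigma> i * q j + (if j = i then subst \<tau> p else 0)"])
next
  case (add p p')
  then obtain q q' where "subst \<sigma> p - subst \<tau> p = (\<Sum>j\<in>UNIV. (\<sigma> j - \<tau> j) * q j)"
    "subst \<sigma> p' - subst \<tau> p' = (\<Sum>j\<in>UNIV. (\<sigma> j - \<tau> j) * q' j)" by auto
  then have "subst \<sigma> (p + p') - subst \<tau> (p + p') = (\<Sum>j\<in>UNIV. (\<sigma> j - \<tau> j) * (q j + q' j))"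
    by (simp add: subst_add distrib_left sum.distrib add_diff_add)
  then show ?case by (rule exI[of _ "\<lambda>j. q j + q' j"])
qed

section \<open>Degrees with respect to a set of variables\<close>

definition deg_in :: "'v set \<Rightarrow> ('v \<Rightarrow>\<^sub>0 nat) \<Rightarrow> nat"
  where "deg_in A m = (\<Sum>i\<in>A. Poly_Mapping.lookup m i)"

lemma deg_in_0 [simp]: "deg_in A 0 = 0"
  by (simp add: deg_in_def)

lemma deg_in_add: "deg_in A (m + m') = deg_in A m + deg_in A m'"
  by (simp add: deg_in_def lookup_add sum.distrib)

lemma deg_in_single: "finite A \<Longrightarrow> deg_in A (Poly_Mapping.single i k) = (if i \<in> A then k else 0)"
  by (simp add: deg_in_def lookup_single when_def)

lemma deg_in_mono: "finite B \<Longrightarrow> A \<subseteq> B \<Longrightarrow> deg_in A m \<le> deg_in B m"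
  unfolding deg_in_def by (rule sum_mono2) auto

text \<open>With \<open>(=)\<close> or \<open>(\<le>)\<close> for \<open>R\<close>, this expresses homogeneity or a degree bound with respect to the variables
  in \<open>A\<close>.\<close>

definition deg_rel :: "(int \<Rightarrow> int \<Rightarrow> bool) \<Rightarrow> 'v set \<Rightarrow> int \<Rightarrow> ('v, 'a::zero) mpoly \<Rightarrow> bool"
  where "deg_rel R A d p \<longleftrightarrow> (\<forall>m\<in>Poly_Mapping.keys p. R (int (deg_in A m)) d)"

text \<open>What products require, so that homogeneity and degree bounds share their proofs. Degrees
  are integers: for both relations a negative one forces the polynomial to be 0, as for the
  difference derivative of a constant.\<close>

definition additive_rel :: "(int \<Rightarrow> int \<Rightarrow> bool) \<Rightarrow> bool"
  where "additive_rel R \<longleftrightarrow> R 0 0 \<and> (\<forall>a b c d. R a b \<longrightarrow> R c d \<longrightarrow> R (a + c) (b + d))"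

lemma additive_rel_eq [simp]: "additive_rel (=)" and additive_rel_le [simp]: "additive_rel (\<le>)"
  by (auto simp: additive_rel_def)

lemma deg_rel_0 [simp]: "deg_rel R A d 0"
  by (simp add: deg_rel_def)

lemma deg_rel_single: "R (int (deg_in A m)) d \<Longrightarrow> deg_rel R A d (Poly_Mapping.single m c)"
  by (simp add: deg_rel_def)

lemma deg_rel_const [simp]: "additive_rel R \<Longrightarrow> deg_rel R A 0 (Poly_Mapping.single 0 c)"
  by (rule deg_rel_single) (simp add: additive_rel_def)

lemma deg_rel_1 [simp]: "additive_rel R \<Longrightarrow> deg_rel R A 0 (1 :: ('v, 'a::comm_ring_1) mpoly)"
  using deg_rel_const[of R A "1::'a"] by simp

lemma deg_rel_add: "deg_rel R A d p \<Longrightarrow> deg_rel R A d q \<Longrightarrow> deg_rel R A d (p + q)"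
  unfolding deg_rel_def using keys_add[of p q] by blast

lemma deg_rel_uminus: "deg_rel R A d p \<Longrightarrow> deg_rel R A d (- p :: ('v, 'a::comm_ring_1) mpoly)"
  unfolding deg_rel_def by (simp add: in_keys_iff)

lemma deg_rel_diff:
  "deg_rel R A d p \<Longrightarrow> deg_rel R A d q \<Longrightarrow> deg_rel R A d (p - q :: ('v, 'a::comm_ring_1) mpoly)"
  using deg_rel_add[of R A d p "- q"] by (simp add: deg_rel_uminus)

lemma deg_rel_sum:
  "(\<And>i. i \<in> I \<Longrightarrow> deg_rel R A d (p i)) \<Longrightarrow> deg_rel R A d (sum p I :: ('v, 'a::comm_ring_1) mpoly)"
  by (induction I rule: infinite_finite_induct) (simp_all add: deg_rel_add)

lemma deg_rel_mult:
  assumes "additive_rel R" "deg_rel R A d p" "deg_rel R A e q"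
  shows "deg_rel R A (d + e) (p * q :: ('v, 'a::comm_ring_1) mpoly)"
  unfolding deg_rel_def
proof
  fix m assume "m \<in> Poly_Mapping.keys (p * q)"
  then obtain a b where "m = a + b" "a \<in> Poly_Mapping.keys p" "b \<in> Poly_Mapping.keys q"
    using keys_mult[of p q] by blast
  then show "R (int (deg_in A m)) (d + e)"
    using assms by (simp add: deg_rel_def additive_rel_def deg_in_add)
qed

lemma deg_rel_prod:
  assumes "additive_rel R" "\<And>i. i \<in> I \<Longrightarrow> deg_rel R A (d i) (p i)"
  shows "deg_rel R A (sum d I) (prod p I :: ('v, 'a::comm_ring_1) mpoly)"
  using assms by (induction I rule: infinite_finite_induct) (simp_all add: deg_rel_mult)

text \<open>Every term of a determinant takes exactly one entry from each column, so degrees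
  attached to the columns add up.\<close>

lemma deg_rel_det:
  fixes M :: "('v, 'a::comm_ring_1) mpoly ^ 'k ^ 'k"
  assumes R: "additive_rel R" and M: "\<And>i j. deg_rel R A (d j) (M $ i $ j)"
  shows "deg_rel R A (\<Sum>j\<in>UNIV. d j) (det M)"
  unfolding det_def
proof (rule deg_rel_sum)
  fix p assume "p \<in> {p. p permutes (UNIV::'k set)}"
  then have "(\<Sum>i\<in>UNIV. d (p i)) = (\<Sum>j\<in>UNIV. d j)"
    by (intro sum.reindex_bij_betw) (simp add: permutes_imp_bij)
  then have "deg_rel R A (\<Sum>j\<in>UNIV. d j) (\<Prod>i\<in>UNIV. M $ i $ p i)"
    using deg_rel_prod[OF R, of UNIV A "\<lambda>i. d (p i)" "\<lambda>i. M $ i $ p i"] M by simp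
  then show "deg_rel R A (\<Sum>j\<in>UNIV. d j) (of_int (sign p) * (\<Prod>i\<in>UNIV. M $ i $ p i))"
    by (auto simp: sign_def deg_rel_uminus)
qed

lemma deg_rel_le_mono: "deg_rel (\<le>) A d p \<Longrightarrow> d \<le> e \<Longrightarrow> deg_rel (\<le>) A e p"
  unfolding deg_rel_def by force

lemma deg_rel_eq_imp_le: "deg_rel (=) UNIV d p \<Longrightarrow> deg_rel (\<le>) (A::'v::finite set) d p"
  unfolding deg_rel_def using deg_in_mono[of UNIV A] by fastforce

lemma polys_le_iff: "p \<in> polys_le d \<longleftrightarrow> deg_rel (\<le>) UNIV d (p :: ('v::finite, 'a::comm_ring_1) mpoly)"
proof (cases "p = 0")
  case False
  then have ne: "Poly_Mapping.keys p \<noteq> {}" by simp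
  have "int (Max (insert 0 (monom_degree ` Poly_Mapping.keys p))) \<le> d
      \<longleftrightarrow> (\<forall>m\<in>Poly_Mapping.keys p. int (monom_degree m) \<le> d)"
  proof (cases "d \<ge> 0")
    case True
    then have "int k \<le> d \<longleftrightarrow> k \<le> nat d" for k by auto
    then show ?thesis by simp
  next
    case False
    then show ?thesis using ne by force
  qed
  then show ?thesis using False
    by (simp add: polys_le_def total_degree_def deg_rel_def deg_in_def monom_degree_def)
qed (simp add: polys_le_def)

section \<open>Fermionic Fock space operators\<close>

text \<open>Elements of the exterior algebra are functions on sets of generators; only the linear
  operators on them form a type. Additivity makes these operators a ring, homogeneity makes scalars
  central, and ring simplification then applies to products of forms.\<close>

typedef (overloaded) ('g, 'r::comm_ring_1) fock_op =
  "{f :: ('g set \<Rightarrow> 'r) \<Rightarrow> 'g set \<Rightarrow> 'r.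
    (\<forall>\<phi> \<psi>. f (\<lambda>S. \<phi> S + \<psi> S) = (\<lambda>S. f \<phi> S + f \<psi> S)) \<and> (\<forall>s \<phi>. f (\<lambda>S. s * \<phi> S) = (\<lambda>S. s * f \<phi> S))}"
  morphisms op_apply Fock_op
  by (rule exI[of _ "\<lambda>\<phi> S. 0"]) simp

setup_lifting type_definition_fock_op

instantiation fock_op :: (type, comm_ring_1) ring_1
begin

lift_definition zero_fock_op :: "('a, 'b) fock_op" is "\<lambda>\<phi> S. 0" by simp
lift_definition one_fock_op :: "('a, 'b) fock_op" is "\<lambda>\<phi>. \<phi>" by simp
lift_definition plus_fock_op :: "('a, 'b) fock_op \<Rightarrow> ('a, 'b) fock_op \<Rightarrow> ('a, 'b) fock_op"
  is "\<lambda>f g \<phi> S. f \<phi> S + g \<phi> S" by (simp add: algebra_simps)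
lift_definition minus_fock_op :: "('a, 'b) fock_op \<Rightarrow> ('a, 'b) fock_op \<Rightarrow> ('a, 'b) fock_op"
  is "\<lambda>f g \<phi> S. f \<phi> S - g \<phi> S" by (simp add: algebra_simps)
lift_definition uminus_fock_op :: "('a, 'b) fock_op \<Rightarrow> ('a, 'b) fock_op"
  is "\<lambda>f \<phi> S. - f \<phi> S" by simp
lift_definition times_fock_op :: "('a, 'b) fock_op \<Rightarrow> ('a, 'b) fock_op \<Rightarrow> ('a, 'b) fock_op"
  is "\<lambda>f g \<phi>. f (g \<phi>)" by simp

instance
proof
  fix f g h :: "('a, 'b) fock_op"
  show "f * g * h = f * (g * h)" by transfer simp
  show "f + g + h = f + (g + h)" by transfer (simp add: add.assoc)
  show "f + g = g + f" by transfer (simp add: add.commute)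
  show "0 + f = f" by transfer simp
  show "- f + f = 0" by transfer simp
  show "f - g = f + - g" by transfer simp
  show "1 * f = f" by transfer simp
  show "f * 1 = f" by transfer simp
  show "(f + g) * h = f * h + g * h" by transfer simp
  show "f * (g + h) = f * g + f * h" by transfer simp
  have "(\<lambda>\<phi> S. 0) \<noteq> (\<lambda>\<phi> :: 'a set \<Rightarrow> 'b. \<phi>)"
    using fun_cong[of "\<lambda>\<phi> :: 'a set \<Rightarrow> 'b. \<lambda>S :: 'a set. 0::'b" "\<lambda>\<phi>. \<phi>" "\<lambda>_. 1"] by (auto simp: fun_eq_iff)
  then show "(0::('a, 'b) fock_op) \<noteq> 1" by transfer auto
qed

end

lemma op_apply_0 [simp]: "op_apply 0 \<phi> S = 0" by transfer simp
lemma op_apply_1 [simp]: "op_apply 1 \<phi> = \<phi>" by transfer simp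
lemma op_apply_add [simp]: "op_apply (f + g) \<phi> S = op_apply f \<phi> S + op_apply g \<phi> S" by transfer simp
lemma op_apply_diff [simp]: "op_apply (f - g) \<phi> S = op_apply f \<phi> S - op_apply g \<phi> S" by transfer simp
lemma op_apply_uminus [simp]: "op_apply (- f) \<phi> S = - op_apply f \<phi> S" by transfer simp
lemma op_apply_mult [simp]: "op_apply (f * g) \<phi> = op_apply f (op_apply g \<phi>)" by transfer simp
lemma op_apply_sum: "op_apply (sum f I) \<phi> S = (\<Sum>i\<in>I. op_apply (f i) \<phi> S)"
  by (induction I rule: infinite_finite_induct) simp_all

lemma op_apply_lin:
  "op_apply f (\<lambda>S. \<phi> S + \<psi> S) = (\<lambda>S. op_apply f \<phi> S + op_apply f \<psi> S)"
  "op_apply f (\<lambda>S. s * \<phi> S) = (\<lambda>S. s * op_apply f \<phi> S)"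
  using op_apply[of f] by auto

lemma fock_op_eqI: "(\<And>\<phi> S. op_apply f \<phi> S = op_apply g \<phi> S) \<Longrightarrow> f = g"
  by transfer (simp add: fun_eq_iff)

lift_definition scal :: "'r \<Rightarrow> ('g, 'r::comm_ring_1) fock_op"
  is "\<lambda>s \<phi> S. s * \<phi> S" by (simp add: algebra_simps)

lemma op_apply_scal [simp]: "op_apply (scal s) \<phi> S = s * \<phi> S" by transfer simp

lemma scal_commute: "f * scal s = scal s * (f :: ('g, 'r::comm_ring_1) fock_op)"
  by transfer simp

lemma scal_left_commute: "f * (scal s * g) = scal s * (f * g)"
  by (simp add: scal_commute flip: mult.assoc)

lemma scal_0 [simp]: "scal 0 = 0" and scal_1 [simp]: "scal 1 = 1"
  and scal_add: "scal (s + t) = scal s + scal t"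
  and scal_uminus: "scal (- s) = - scal s"
  and scal_diff: "scal (s - t) = scal s - scal t"
  and scal_mult: "scal (s * t) = scal s * scal t"
  by (rule fock_op_eqI, simp add: algebra_simps)+

lemma scal_sum: "scal (sum s I) = (\<Sum>i\<in>I. scal (s i))"
  by (induction I rule: infinite_finite_induct) (simp_all add: scal_add)

text \<open>The sign of moving \<open>k\<close> past the smaller generators in \<open>S\<close>;
  \<open>to_nat\<close> provides a linear order on the finite index type.\<close>

definition fock_sign :: "'g::finite \<Rightarrow> 'g set \<Rightarrow> 'r::comm_ring_1"
  where "fock_sign k S = (- 1) ^ card {l \<in> S. to_nat l < to_nat k}"

lemma fock_sign_square [simp]: "fock_sign k S * fock_sign k S = 1"
  by (simp add: fock_sign_def flip: power_add mult_2)

lemma fock_sign_insert: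
  "fock_sign k (insert l S) = (if l \<in> S \<or> to_nat k \<le> to_nat l then fock_sign k S else - fock_sign k S)"
proof (cases "l \<in> S \<or> to_nat k \<le> to_nat l")
  case True
  then have "{j \<in> insert l S. to_nat j < to_nat k} = {j \<in> S. to_nat j < to_nat k}" by auto
  then show ?thesis using True by (simp add: fock_sign_def)
next
  case False
  then have "{j \<in> insert l S. to_nat j < to_nat k} = insert l {j \<in> S. to_nat j < to_nat k}" by auto
  then show ?thesis using False by (simp add: fock_sign_def)
qed

lemma fock_sign_remove:
  "fock_sign k (S - {l}) = (if l \<notin> S \<or> to_nat k \<le> to_nat l then fock_sign k S else - fock_sign k S :: 'b::comm_ring_1)"
proof (cases "l \<in> S")
  case True
  then have "fock_sign k S = (if to_nat k \<le> to_nat l then fock_sign k (S - {l}) else - fock_sign k (S - {l}) :: 'b)"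
    using fock_sign_insert[of k l "S - {l}"] by (simp add: insert_absorb)
  then show ?thesis using True by simp
qed simp

text \<open>Exterior multiplication by the generator \<open>k\<close>; \<open>ann k\<close> below is
  the contraction by it. Together they satisfy the canonical anticommutation relations, see
  \<open>ann_cre\<close>.\<close>

lift_definition cre :: "'g::finite \<Rightarrow> ('g, 'r::comm_ring_1) fock_op"
  is "\<lambda>k \<phi> S. if k \<in> S then fock_sign k S * \<phi> (S - {k}) else 0"
  by (auto simp: algebra_simps)

lift_definition ann :: "'g::finite \<Rightarrow> ('g, 'r::comm_ring_1) fock_op"
  is "\<lambda>k \<phi> S. if k \<in> S then 0 else fock_sign k S * \<phi> (insert k S)"
  by (auto simp: algebra_simps)

lemma cre_scal: "cre k * scal s = scal s * cre k" "cre k * (scal s * g) = scal s * (cre k * g)"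
  and ann_scal: "ann k * scal s = scal s * ann k" "ann k * (scal s * g) = scal s * (ann k * g)"
  by (simp_all only: scal_commute scal_left_commute)

lemma op_apply_cre: "op_apply (cre k) \<phi> S = (if k \<in> S then fock_sign k S * \<phi> (S - {k}) else 0)"
  by transfer simp

lemma op_apply_ann: "op_apply (ann k) \<phi> S = (if k \<in> S then 0 else fock_sign k S * \<phi> (insert k S))"
  by transfer simp

lemma cre_square: "cre k * cre k = 0"
  by (rule fock_op_eqI) (simp add: op_apply_cre)

lemma cre_anticommute: "cre k * cre l = - (cre l * cre k)"
proof (cases "k = l")
  case False
  show ?thesis
  proof (rule fock_op_eqI)
    fix \<phi> :: "'a set \<Rightarrow> 'b" and S
    have "S - {k} - {l} = S - {l} - {k}" by auto
    moreover have "to_nat k \<noteq> to_nat l" using False by simp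
    ultimately show "op_apply (cre k * cre l) \<phi> S = op_apply (- (cre l * cre k)) \<phi> S"
      using False by (auto simp: op_apply_cre fock_sign_remove)
  qed
qed (simp add: cre_square)

lemma ann_cre: "ann k * cre l + cre l * ann k = (if k = l then 1 else 0)"
proof (rule fock_op_eqI)
  fix \<phi> :: "'a set \<Rightarrow> 'b" and S
  show "op_apply (ann k * cre l + cre l * ann k) \<phi> S = op_apply (if k = l then 1 else 0) \<phi> S"
  proof (cases "k = l")
    case True
    have "insert k (S - {k}) = S" if "k \<in> S" using that by auto
    moreover have "insert k S - {k} = S" if "k \<notin> S" using that by auto
    ultimately show ?thesis using True
      by (auto simp: op_apply_cre op_apply_ann fock_sign_insert fock_sign_remove simp flip: mult.assoc)
  next
    case False
    have "insert k S - {l} = insert k (S - {l})" using False by auto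
    moreover have "to_nat k \<noteq> to_nat l" using False by simp
    ultimately show ?thesis using False
      by (auto simp: op_apply_cre op_apply_ann fock_sign_insert fock_sign_remove)
  qed
qed

section \<open>One-forms and contraction by a vector\<close>

definition form :: "('g::finite \<Rightarrow> 'r) \<Rightarrow> ('g, 'r::comm_ring_1) fock_op"
  where "form v = (\<Sum>k\<in>UNIV. scal (v k) * cre k)"

definition contr :: "('g::finite \<Rightarrow> 'r) \<Rightarrow> ('g, 'r::comm_ring_1) fock_op"
  where "contr s = (\<Sum>k\<in>UNIV. scal (s k) * ann k)"

lemma form_diff: "form (\<lambda>k. u k - v k) = form u - form v"
  by (simp add: form_def scal_diff left_diff_distrib sum_subtractf)

lemma form_anticommute: "form u * form v = - (form v * form u)"
proof -
  have "form u * form v = (\<Sum>k\<in>UNIV. \<Sum>l\<in>UNIV. scal (u k * v l) * (cre k * cre l))"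
    by (simp add: form_def sum_product mult.assoc cre_scal scal_mult)
  also have "\<dots> = (\<Sum>k\<in>UNIV. \<Sum>l\<in>UNIV. - (scal (v l * u k) * (cre l * cre k)))"
    by (subst cre_anticommute) (simp add: mult.commute)
  also have "\<dots> = - (form v * form u)"
    by (subst sum.swap) (simp add: form_def sum_product mult.assoc cre_scal scal_mult sum_negf)
  finally show ?thesis .
qed

text \<open>In characteristic 2 this does not follow from \<open>form_anticommute\<close>, hence the
  induction on the set of generators.\<close>

lemma form_square: "form v * form v = 0"
proof -
  have "(\<Sum>k\<in>K. scal (v k) * cre k) * (\<Sum>k\<in>K. scal (v k) * cre k) = (0 :: ('a, 'b) fock_op)" for K
  proof (induction K rule: infinite_finite_induct)
    case (insert l K)
    let ?s = "\<Sum>k\<in>K. scal (v k) * cre k :: ('a, 'b) fock_op"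
    have "cre l * ?s = - (?s * cre l)"
      unfolding sum_distrib_left sum_distrib_right sum_negf[symmetric]
      by (rule sum.cong[OF refl]) (simp add: mult.assoc cre_scal, subst cre_anticommute, simp)
    then have "scal (v l) * cre l * ?s + ?s * (scal (v l) * cre l) = 0"
      by (simp add: mult.assoc scal_left_commute[of ?s])
    moreover have "scal (v l) * cre l * (scal (v l) * cre l) = (0 :: ('a, 'b) fock_op)"
      by (simp add: mult.assoc cre_scal cre_square)
    ultimately show ?case using insert by (simp add: algebra_simps)
  qed simp_all
  then show ?thesis by (simp add: form_def)
qed

text \<open>Contraction is an antiderivation, so its anticommutator with a form is the scalar
  pairing. Forms with pairing 0 anticommute with the contraction; these are the closed forms of the
  later arguments.\<close>

lemma contr_form: "contr s * form v + form v * contr s = scal (\<Sum>k\<in>UNIV. s k * v k)"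
proof -
  have "contr s * form v = (\<Sum>k\<in>UNIV. \<Sum>l\<in>UNIV. scal (s k * v l) * (ann k * cre l))"
    by (simp add: form_def contr_def sum_product mult.assoc ann_scal scal_mult)
  moreover have "form v * contr s = (\<Sum>l\<in>UNIV. \<Sum>k\<in>UNIV. scal (s k * v l) * (cre l * ann k))"
    by (simp add: form_def contr_def sum_product mult.assoc cre_scal mult.commute[of "s _"] scal_mult)
  then have "form v * contr s = (\<Sum>k\<in>UNIV. \<Sum>l\<in>UNIV. scal (s k * v l) * (cre l * ann k))"
    by (subst sum.swap) simp
  ultimately have "contr s * form v + form v * contr s
      = (\<Sum>k\<in>UNIV. \<Sum>l\<in>UNIV. scal (s k * v l) * (ann k * cre l + cre l * ann k))"
    by (simp add: distrib_left sum.distrib)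
  also have "\<dots> = (\<Sum>k\<in>UNIV. scal (s k * v k))"
    by (simp add: ann_cre if_distrib[of "(*) _"] cong: if_cong)
  finally show ?thesis by (simp add: scal_sum)
qed

section \<open>Coefficients, and operators modulo some of the generators\<close>

definition vac :: "'g set \<Rightarrow> 'r::comm_ring_1"
  where "vac S = (if S = {} then 1 else 0)"

definition coeff :: "'g set \<Rightarrow> ('g, 'r::comm_ring_1) fock_op \<Rightarrow> 'r"
  where "coeff E g = op_apply g vac E"

lemma coeff_add: "coeff E (g + h) = coeff E g + coeff E h"
  and coeff_diff: "coeff E (g - h) = coeff E g - coeff E h"
  and coeff_uminus: "coeff E (- g) = - coeff E g"
  and coeff_0 [simp]: "coeff E 0 = 0"
  and coeff_scal_mult: "coeff E (scal s * g) = s * coeff E g"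
  by (simp_all add: coeff_def)

lemma coeff_contr_right: "coeff E (g * contr s) = 0"
proof -
  have "op_apply (contr s) vac = (\<lambda>S. 0 * vac S)"
    by (rule ext) (auto simp: contr_def op_apply_sum op_apply_ann vac_def intro!: sum.neutral)
  moreover have "op_apply g (\<lambda>S. 0 * vac S) = (\<lambda>S. 0)"
    using op_apply_lin(2)[of g 0 vac] by simp
  ultimately show ?thesis by (simp add: coeff_def)
qed

text \<open>A contraction reaches the coefficient at \<open>E\<close> only by removing a generator
  outside \<open>E\<close>. If the values of \<open>s\<close> outside \<open>E\<close> are the
  generators of an ideal, contractions therefore vanish at \<open>E\<close> modulo this
  ideal.\<close>

lemma coeff_contr_left: "\<exists>q. coeff E (contr s * g) = (\<Sum>k\<in>-E. s k * q k)"
proof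
  show "coeff E (contr s * g) = (\<Sum>k\<in>-E. s k * (fock_sign k E * op_apply g vac (insert k E)))"
    unfolding coeff_def contr_def op_apply_mult op_apply_sum
    by (rule sum.mono_neutral_cong_right) (auto simp: op_apply_ann)
qed

text \<open>For the coefficient at \<open>E\<close>, generators outside \<open>E\<close> may be set
  to 0. This relation ignores them and still respects sums and products.\<close>

definition agree_on :: "'g set \<Rightarrow> ('g, 'r::comm_ring_1) fock_op \<Rightarrow> ('g, 'r) fock_op \<Rightarrow> bool"
  where "agree_on E g h \<longleftrightarrow>
    (\<forall>\<phi> \<psi>. (\<forall>S\<subseteq>E. \<phi> S = \<psi> S) \<longrightarrow> (\<forall>S\<subseteq>E. op_apply g \<phi> S = op_apply h \<psi> S))"

lemma agree_on_coeff: "agree_on E g h \<Longrightarrow> coeff E g = coeff E h"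
  by (simp add: agree_on_def coeff_def)

lemma agree_onI:
  "(\<And>\<phi> \<psi> S. (\<And>S. S \<subseteq> E \<Longrightarrow> \<phi> S = \<psi> S) \<Longrightarrow> S \<subseteq> E \<Longrightarrow> op_apply g \<phi> S = op_apply h \<psi> S) \<Longrightarrow> agree_on E g h"
  by (simp add: agree_on_def)

lemma agree_onD:
  "agree_on E g h \<Longrightarrow> (\<And>S. S \<subseteq> E \<Longrightarrow> \<phi> S = \<psi> S) \<Longrightarrow> S \<subseteq> E \<Longrightarrow> op_apply g \<phi> S = op_apply h \<psi> S"
  by (simp add: agree_on_def)

lemma agree_on_0: "agree_on E 0 0" and agree_on_1: "agree_on E 1 1"
  and agree_on_scal: "agree_on E (scal s) (scal s)"
  by (rule agree_onI, simp)+

lemma agree_on_add: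
  fixes g :: "('g, 'r::comm_ring_1) fock_op"
  assumes "agree_on E g h" "agree_on E g' h'"
  shows "agree_on E (g + g') (h + h')"
proof (rule agree_onI)
  fix \<phi> \<psi> :: "'g set \<Rightarrow> 'r" and S assume *: "\<And>S. S \<subseteq> E \<Longrightarrow> \<phi> S = \<psi> S" "S \<subseteq> E"
  show "op_apply (g + g') \<phi> S = op_apply (h + h') \<psi> S"
    using assms[THEN agree_onD, OF *] by simp
qed

lemma agree_on_diff:
  fixes g :: "('g, 'r::comm_ring_1) fock_op"
  assumes "agree_on E g h" "agree_on E g' h'"
  shows "agree_on E (g - g') (h - h')"
proof (rule agree_onI)
  fix \<phi> \<psi> :: "'g set \<Rightarrow> 'r" and S assume *: "\<And>S. S \<subseteq> E \<Longrightarrow> \<phi> S = \<psi> S" "S \<subseteq> E"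
  show "op_apply (g - g') \<phi> S = op_apply (h - h') \<psi> S"
    using assms[THEN agree_onD, OF *] by simp
qed

lemma agree_on_mult:
  fixes g :: "('g, 'r::comm_ring_1) fock_op"
  assumes "agree_on E g h" "agree_on E g' h'"
  shows "agree_on E (g * g') (h * h')"
proof (rule agree_onI)
  fix \<phi> \<psi> :: "'g set \<Rightarrow> 'r" and S assume *: "\<And>S. S \<subseteq> E \<Longrightarrow> \<phi> S = \<psi> S" "S \<subseteq> E"
  show "op_apply (g * g') \<phi> S = op_apply (h * h') \<psi> S"
    using agree_onD[OF assms(1) agree_onD[OF assms(2) *(1)] *(2)] by simp
qed

lemma agree_on_sum: "(\<And>i. i \<in> I \<Longrightarrow> agree_on E (g i) (h i)) \<Longrightarrow> agree_on E (sum g I) (sum h I)"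
  by (induction I rule: infinite_finite_induct) (simp_all add: agree_on_0 agree_on_add)

lemma agree_on_cre: "agree_on E (cre k) (cre k)"
  unfolding agree_on_def op_apply_cre by (simp add: subset_insertI2 Diff_subset_conv)

lemma agree_on_form:
  assumes "\<And>k. k \<in> E \<Longrightarrow> u k = v k"
  shows "agree_on E (form u) (form v)"
  unfolding form_def
proof (rule agree_on_sum)
  fix k
  show "agree_on E (scal (u k) * cre k) (scal (v k) * cre k)"
  proof (cases "k \<in> E")
    case False
    have "agree_on E (scal s * cre k) (scal t * cre k)" for s t
      using False by (auto simp: agree_on_def op_apply_cre)
    then show ?thesis .
  qed (simp add: assms agree_on_mult agree_on_scal agree_on_cre)
qed

text \<open>Counting generators from \<open>K\<close>: \<open>g\<close> multiplies with at least \<open>d\<close> of them.\<close>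

definition raises :: "'g set \<Rightarrow> nat \<Rightarrow> ('g, 'r::comm_ring_1) fock_op \<Rightarrow> bool"
  where "raises K d g \<longleftrightarrow>
    (\<forall>\<phi> t. (\<forall>S. card (S \<inter> K) < t \<longrightarrow> \<phi> S = 0) \<longrightarrow> (\<forall>S. card (S \<inter> K) < t + d \<longrightarrow> op_apply g \<phi> S = 0))"

lemma raises_mult:
  fixes g h :: "('g, 'r::comm_ring_1) fock_op"
  assumes "raises K d g" "raises K e h"
  shows "raises K (d + e) (g * h)"
  unfolding raises_def
proof (intro allI impI)
  fix \<phi> :: "'g set \<Rightarrow> 'r" and t S
  assume "\<forall>S. card (S \<inter> K) < t \<longrightarrow> \<phi> S = 0" and S: "card (S \<inter> K) < t + (d + e)"
  then have "\<forall>S. card (S \<inter> K) < t + e \<longrightarrow> op_apply h \<phi> S = 0"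
    using assms(2) unfolding raises_def by blast
  then have "\<forall>S. card (S \<inter> K) < (t + e) + d \<longrightarrow> op_apply g (op_apply h \<phi>) S = 0"
    using assms(1) unfolding raises_def by blast
  then show "op_apply (g * h) \<phi> S = 0" using S by simp
qed

lemma raises_0: "raises K d 0" and raises_1: "raises K 0 1"
  and raises_scal: "raises K 0 (scal s)"
  and raises_add: "raises K d g \<Longrightarrow> raises K d h \<Longrightarrow> raises K d (g + h)"
  and raises_diff: "raises K d g \<Longrightarrow> raises K d h \<Longrightarrow> raises K d (g - h)"
  by (simp_all add: raises_def)

lemma raises_sum: "(\<And>i. i \<in> I \<Longrightarrow> raises K d (g i)) \<Longrightarrow> raises K d (sum g I)"
  by (induction I rule: infinite_finite_induct) (simp_all add: raises_0 raises_add)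

lemma raises_mono: "raises K d g \<Longrightarrow> e \<le> d \<Longrightarrow> raises K e g"
  unfolding raises_def by (meson add_le_cancel_left order_less_le_trans)

lemma raises_cre: "raises K (if k \<in> K then 1 else 0) (cre k)"
  unfolding raises_def op_apply_cre
proof (intro allI impI)
  fix \<phi> :: "'a set \<Rightarrow> 'b" and t S
  assume \<phi>: "\<forall>S. card (S \<inter> K) < t \<longrightarrow> \<phi> S = 0" and S: "card (S \<inter> K) < t + (if k \<in> K then 1 else 0)"
  have "\<phi> (S - {k}) = 0" if "k \<in> S"
  proof -
    have "card ((S - {k}) \<inter> K) < t"
    proof (cases "k \<in> K")
      case True
      then have "S \<inter> K = insert k ((S - {k}) \<inter> K)" using that by auto
      then have "card (S \<inter> K) = Suc (card ((S - {k}) \<inter> K))" by (metis Diff_iff IntD1 card_insert_disjoint finite insertI1)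
      then show ?thesis using S True by simp
    next
      case False
      then have "(S - {k}) \<inter> K = S \<inter> K" by auto
      then show ?thesis using S False by simp
    qed
    then show ?thesis using \<phi> by blast
  qed
  then show "(if k \<in> S then fock_sign k S * \<phi> (S - {k}) else 0) = 0" by simp
qed

text \<open>More than \<open>card K\<close> factors from \<open>K\<close> repeat a
  generator.\<close>

lemma raises_coeff:
  assumes "raises K d g" "card (K :: 'g::finite set) < d"
  shows "coeff E g = 0"
proof -
  have "card (E \<inter> K) \<le> card K" by (rule card_mono) auto
  then have "card (E \<inter> K) < 0 + d" using assms(2) by simp
  moreover have "\<forall>S. card (S \<inter> K) < 0 \<longrightarrow> vac S = 0" by simp
  ultimately show ?thesis using assms(1) unfolding raises_def coeff_def by blast
qed

text \<open>This bounds the degree of the polynomial coefficients, in contrast to the exterior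
  degree counted by \<open>raises\<close>.\<close>

definition op_deg_le :: "'v set \<Rightarrow> int \<Rightarrow> ('g, ('v, 'a::comm_ring_1) mpoly) fock_op \<Rightarrow> bool"
  where "op_deg_le A d g \<longleftrightarrow>
    (\<forall>\<phi> e. (\<forall>S. deg_rel (\<le>) A e (\<phi> S)) \<longrightarrow> (\<forall>S. deg_rel (\<le>) A (e + d) (op_apply g \<phi> S)))"

lemma op_deg_le_mult: "op_deg_le A d g \<Longrightarrow> op_deg_le A e h \<Longrightarrow> op_deg_le A (d + e) (g * h)"
  unfolding op_deg_le_def op_apply_mult by (simp add: add.commute[of d e] flip: add.assoc)

lemma op_deg_le_0: "op_deg_le A d 0" and op_deg_le_1: "op_deg_le A 0 1"
  and op_deg_le_add: "op_deg_le A d g \<Longrightarrow> op_deg_le A d h \<Longrightarrow> op_deg_le A d (g + h)"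
  by (simp_all add: op_deg_le_def deg_rel_add)

lemma op_deg_le_scal: "deg_rel (\<le>) A d s \<Longrightarrow> op_deg_le A d (scal s)"
  unfolding op_deg_le_def using deg_rel_mult[OF additive_rel_le, of A d s] by (simp add: add.commute)

lemma op_deg_le_cre: "op_deg_le A 0 (cre k)"
  unfolding op_deg_le_def op_apply_cre by (auto simp: fock_sign_def minus_one_power_iff deg_rel_uminus)

lemma op_deg_le_sum: "(\<And>i. i \<in> I \<Longrightarrow> op_deg_le A d (g i)) \<Longrightarrow> op_deg_le A d (sum g I)"
  by (induction I rule: infinite_finite_induct) (simp_all add: op_deg_le_0 op_deg_le_add)

lemma op_deg_le_coeff:
  fixes g :: "('g, ('v, 'a::comm_ring_1) mpoly) fock_op"
  assumes "op_deg_le A d g"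
  shows "deg_rel (\<le>) A d (coeff E g)"
proof -
  have "\<forall>S. deg_rel (\<le>) A 0 (vac S :: ('v, 'a) mpoly)" by (simp add: vac_def)
  then have "deg_rel (\<le>) A (0 + d) (op_apply g vac E)"
    using assms unfolding op_deg_le_def by blast
  then show ?thesis by (simp add: coeff_def)
qed

section \<open>Products of anticommuting elements and determinants\<close>

lemma minus_one_power_commute: "x * (- 1) ^ n = (- 1) ^ n * (x::'m::ring_1)"
  by (induction n) simp_all

lemma anticommute_prod_list:
  fixes a :: "'m::ring_1"
  assumes "\<And>y. y \<in> set ys \<Longrightarrow> y * a = - (a * y)"
  shows "prod_list ys * a = (- 1) ^ length ys * (a * prod_list ys)"
  using assms
proof (induction ys)
  case (Cons y ys)
  then have IH: "prod_list ys * a = (- 1) ^ length ys * (a * prod_list ys)" and y: "y * a = - (a * y)"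
    by simp_all
  have "y * (prod_list ys * a) = (y * (- 1) ^ length ys) * (a * prod_list ys)"
    unfolding IH by (simp only: mult.assoc)
  also have "\<dots> = (- 1) ^ length ys * ((y * a) * prod_list ys)"
    by (simp only: minus_one_power_commute[of y] mult.assoc)
  also have "\<dots> = (- 1) ^ length (y # ys) * (a * prod_list (y # ys))"
    unfolding y by (simp add: mult.assoc)
  finally show ?case by (simp add: mult.assoc)
qed simp

lemma split_list_two:
  assumes "i \<in> set cs" "j \<in> set cs" "i \<noteq> j"
  shows "\<exists>us vs ws. cs = us @ i # vs @ j # ws \<or> cs = us @ j # vs @ i # ws"
proof -
  obtain us ys where cs: "cs = us @ i # ys" using assms(1) by (meson split_list)
  then consider "j \<in> set us" | "j \<in> set ys" using assms by auto
  then show ?thesis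
  proof cases
    case 1
    then obtain u v where "us = u @ j # v" by (meson split_list)
    then show ?thesis using cs by auto
  next
    case 2
    then obtain u v where "ys = u @ j # v" by (meson split_list)
    then show ?thesis using cs by auto
  qed
qed

context
  fixes \<sigma> :: "'k \<Rightarrow> 'm::ring_1"
  assumes anticommute: "\<And>k l. \<sigma> k * \<sigma> l = - (\<sigma> l * \<sigma> k)" and square: "\<And>k. \<sigma> k * \<sigma> k = 0"
begin

text \<open>\<open>\<sigma> a\<close> and \<open>\<sigma> b\<close> pass the part between them with
  the same sign, so the exchange costs only the sign of these two factors.\<close>

lemma anticommute_exchange:
  "prod_list (map \<sigma> (us @ a # vs @ b # ws)) = - prod_list (map \<sigma> (us @ b # vs @ a # ws))"
proof -
  define V where "V = prod_list (map \<sigma> vs)"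
  have V: "V * \<sigma> c = (- 1) ^ length vs * (\<sigma> c * V)" for c
    unfolding V_def using anticommute_prod_list[of "map \<sigma> vs" "\<sigma> c"] anticommute by auto
  have "\<sigma> a * (V * \<sigma> b) = - (\<sigma> b * (V * \<sigma> a))"
    unfolding V minus_one_power_commute[of "\<sigma> _", symmetric]
    by (simp add: anticommute[of a b] minus_one_power_commute[symmetric] flip: mult.assoc)
  then have "prod_list (map \<sigma> us) * (\<sigma> a * (V * \<sigma> b)) * prod_list (map \<sigma> ws)
      = - (prod_list (map \<sigma> us) * (\<sigma> b * (V * \<sigma> a)) * prod_list (map \<sigma> ws))"
    by simp
  then show ?thesis by (simp add: V_def mult.assoc)
qed

lemma anticommute_repeated: "prod_list (map \<sigma> (us @ a # vs @ a # ws)) = 0"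
proof -
  define V where "V = prod_list (map \<sigma> vs)"
  have V: "V * \<sigma> c = (- 1) ^ length vs * (\<sigma> c * V)" for c
    unfolding V_def using anticommute_prod_list[of "map \<sigma> vs" "\<sigma> c"] anticommute by auto
  have "\<sigma> a * (V * \<sigma> a) = 0"
    unfolding V by (simp only: minus_one_power_commute[of "\<sigma> a"] flip: mult.assoc)
      (simp add: mult.assoc[of _ "\<sigma> a" "\<sigma> a"] square)
  then have "prod_list (map \<sigma> us) * (\<sigma> a * (V * \<sigma> a)) * prod_list (map \<sigma> ws) = 0"
    by simp
  then show ?thesis by (simp add: V_def mult.assoc)
qed

lemma anticommute_transpose:
  assumes "distinct cs" "i \<in> set cs" "j \<in> set cs" "i \<noteq> j"
  shows "prod_list (map (\<lambda>c. \<sigma> (\<phi> (Transposition.transpose i j c))) cs) = - prod_list (map (\<lambda>c. \<sigma> (\<phi> c)) cs)"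
proof -
  have "prod_list (map (\<lambda>c. \<sigma> (\<phi> (Transposition.transpose k l c))) (us @ k # vs @ l # ws))
      = - prod_list (map (\<lambda>c. \<sigma> (\<phi> c)) (us @ k # vs @ l # ws))"
    if "distinct (us @ k # vs @ l # ws)" for k l us vs ws
  proof -
    have *: "map (\<lambda>c. \<sigma> (\<phi> (Transposition.transpose k l c))) xs = map \<sigma> (map \<phi> xs)" if "k \<notin> set xs" "l \<notin> set xs" for xs
      using that by (auto simp: Transposition.transpose_def)
    show ?thesis
      using that anticommute_exchange[of "map \<phi> us" "\<phi> l" "map \<phi> vs" "\<phi> k" "map \<phi> ws"]
      by (simp add: * comp_def del: map_map) (simp add: comp_def)
  qed
  then show ?thesis
    using split_list_two[OF assms(2-4)] assms(1) by (metis transpose_commute)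
qed

end

lemma prod_list_sum_expand:
  fixes \<sigma> :: "'k::finite \<Rightarrow> ('g, 'r::comm_ring_1) fock_op"
  assumes "distinct cs"
  shows "prod_list (map (\<lambda>c. \<Sum>r\<in>UNIV. scal (M r c) * \<sigma> r) cs)
    = (\<Sum>\<phi>\<in>PiE (set cs) (\<lambda>_. UNIV). scal (\<Prod>c\<in>set cs. M (\<phi> c) c) * prod_list (map (\<lambda>c. \<sigma> (\<phi> c)) cs))"
  using assms
proof (induction cs)
  case (Cons c cs)
  let ?F = "\<lambda>\<phi>. scal (\<Prod>c\<in>set cs. M (\<phi> c) c) * prod_list (map (\<lambda>c. \<sigma> (\<phi> c)) cs)"
  have c: "c \<notin> set cs" using Cons.prems by simp
  have upd: "?F (\<phi>(c := r)) = ?F \<phi>" for \<phi> r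
  proof -
    have "(\<Prod>d\<in>set cs. M ((\<phi>(c := r)) d) d) = (\<Prod>d\<in>set cs. M (\<phi> d) d)"
      by (rule prod.cong) (use c in auto)
    moreover have "map (\<lambda>d. \<sigma> ((\<phi>(c := r)) d)) cs = map (\<lambda>d. \<sigma> (\<phi> d)) cs" using c by auto
    ultimately show ?thesis by (simp only:)
  qed
  have "(\<Sum>\<phi>\<in>PiE (set (c # cs)) (\<lambda>_. UNIV). scal (\<Prod>c\<in>set (c # cs). M (\<phi> c) c) * prod_list (map (\<lambda>c. \<sigma> (\<phi> c)) (c # cs)))
      = (\<Sum>\<phi>\<in>PiE (insert c (set cs)) (\<lambda>_. UNIV). scal (M (\<phi> c) c) * \<sigma> (\<phi> c) * ?F \<phi>)"
    by (rule sum.cong) (simp_all add: c scal_mult mult.assoc scal_left_commute[of "\<sigma> _"])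
  also have "\<dots> = (\<Sum>(r, \<phi>)\<in>UNIV \<times> PiE (set cs) (\<lambda>_. UNIV). scal (M r c) * \<sigma> r * ?F \<phi>)"
    unfolding PiE_insert_eq using inj_combinator[OF c, of "\<lambda>_. UNIV"]
    by (subst sum.reindex) (simp_all add: upd case_prod_beta del: fun_upd_apply, simp)
  also have "\<dots> = (\<Sum>r\<in>UNIV. scal (M r c) * \<sigma> r) * (\<Sum>\<phi>\<in>PiE (set cs) (\<lambda>_. UNIV). ?F \<phi>)"
    by (simp add: sum_product sum.cartesian_product)
  finally show ?case using Cons by simp
qed simp

text \<open>The action of a matrix on the top exterior power. Choices of rows that are not
  permutations repeat a factor and vanish; permutations are reduced to the identity by
  transpositions.\<close>

lemma prod_list_eq_det:
  fixes \<sigma> :: "'k::finite \<Rightarrow> ('g, 'r::comm_ring_1) fock_op"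
  assumes \<sigma>: "\<And>k l. \<sigma> k * \<sigma> l = - (\<sigma> l * \<sigma> k)" "\<And>k. \<sigma> k * \<sigma> k = 0"
    and cs: "distinct cs" "set cs = (UNIV :: 'k set)"
  shows "prod_list (map (\<lambda>c. \<Sum>r\<in>UNIV. scal (M r c) * \<sigma> r) cs)
    = scal (det (\<chi> r c. M r c)) * prod_list (map \<sigma> cs)"
proof -
  define \<epsilon> where "\<epsilon> \<phi> = prod_list (map (\<lambda>c. \<sigma> (\<phi> c)) cs)" for \<phi>
  have "\<epsilon> \<phi> = 0" if "\<not> \<phi> permutes UNIV" for \<phi>
  proof -
    have "\<not> inj \<phi>" using that bij_imp_permutes[of \<phi> UNIV] finite_UNIV_inj_surj[of \<phi>] by (auto simp: bij_def)
    then obtain i j where ij: "\<phi> i = \<phi> j" "i \<noteq> j" by (auto simp: inj_def)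
    then obtain us vs ws where "cs = us @ i # vs @ j # ws \<or> cs = us @ j # vs @ i # ws"
      using split_list_two[of i cs j] cs(2) by auto
    then show ?thesis
      using anticommute_repeated[of \<sigma> "map \<phi> us" "\<phi> i" "map \<phi> vs" "map \<phi> ws", OF \<sigma>] ij
      by (auto simp: \<epsilon>_def comp_def)
  qed
  moreover have sgn: "\<epsilon> \<phi> = scal (of_int (sign \<phi>)) * prod_list (map \<sigma> cs)" if "\<phi> permutes UNIV" for \<phi>
    using finite_class.finite_UNIV that
  proof (induction rule: permutes_rev_induct)
    case id
    then show ?case by (simp add: \<epsilon>_def)
  next
    case (swap a b p)
    have 1: "\<epsilon> (p \<circ> Transposition.transpose a b) = - \<epsilon> p"
      unfolding \<epsilon>_def using anticommute_transpose[of \<sigma> cs a b p, OF \<sigma> cs(1)] cs(2) swap(3) by simp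
    have 2: "sign (p \<circ> Transposition.transpose a b) = - sign p"
      using swap by (subst sign_compose) (simp_all add: permutation_swap_id permutes_imp_permutation[of UNIV] sign_swap_id)
    have 3: "\<epsilon> p = scal (of_int (sign p)) * prod_list (map \<sigma> cs)" by (rule swap)
    show ?case unfolding 1 2 3 by (simp add: scal_uminus)
  qed
  moreover have "prod_list (map (\<lambda>c. \<Sum>r\<in>UNIV. scal (M r c) * \<sigma> r) cs)
      = (\<Sum>\<phi>\<in>UNIV. scal (\<Prod>c\<in>UNIV. M (\<phi> c) c) * \<epsilon> \<phi>)"
    unfolding prod_list_sum_expand[OF cs(1)] \<epsilon>_def by (simp add: cs(2) PiE_UNIV_domain)
  moreover have "\<dots> = (\<Sum>\<phi>\<in>{p. p permutes UNIV}. scal (\<Prod>c\<in>UNIV. M (\<phi> c) c) * \<epsilon> \<phi>)"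
    by (rule sum.mono_neutral_right) (use calculation(1) in auto)
  moreover have "\<dots> = (\<Sum>\<phi>\<in>{p. p permutes UNIV}. scal (of_int (sign \<phi>) * (\<Prod>c\<in>UNIV. M (\<phi> c) c)) * prod_list (map \<sigma> cs))"
    by (rule sum.cong) (simp_all add: sgn mult.commute flip: scal_mult mult.assoc)
  ultimately have "prod_list (map (\<lambda>c. \<Sum>r\<in>UNIV. scal (M r c) * \<sigma> r) cs)
      = (\<Sum>\<phi>\<in>{p. p permutes UNIV}. scal (of_int (sign \<phi>) * (\<Prod>c\<in>UNIV. M (\<phi> c) c))) * prod_list (map \<sigma> cs)"
    by (simp add: sum_distrib_right)
  \<comment> \<open>The expansion chooses a row for each column, whereas \<open>det_def\<close>
    chooses a column for each row.\<close>
  also have "(\<Sum>\<phi>\<in>{p. p permutes UNIV}. scal (of_int (sign \<phi>) * (\<Prod>c\<in>UNIV. M (\<phi> c) c)))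
      = (scal (det (transpose (\<chi> r c. M r c))) :: ('g, 'r) fock_op)"
    by (simp add: det_def scal_sum transpose_def del: det_transpose)
  finally show ?thesis by simp
qed

section \<open>Independence of the choice of difference derivatives\<close>

lemma fock_sign_cases: "fock_sign k S = 1 \<or> fock_sign k S = (- 1 :: 'r::comm_ring_1)"
  by (simp add: fock_sign_def minus_one_power_iff)

text \<open>The sign \<open>\<eta>\<close> is left undetermined; what counts later is that it is its
  own inverse.\<close>

lemma coeff_prod_cre:
  assumes "distinct ks"
  shows "\<exists>\<eta>::'r::comm_ring_1. (\<eta> = 1 \<or> \<eta> = - 1) \<and>
    (\<forall>S. op_apply (prod_list (map cre ks)) vac S = (if S = set ks then \<eta> else 0))"
  using assms
proof (induction ks)
  case Nil
  then show ?case by (intro exI[of _ 1]) (auto simp: vac_def)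
next
  case (Cons k ks)
  then obtain \<eta> :: 'r where \<eta>: "\<eta> = 1 \<or> \<eta> = - 1"
    "\<And>S. op_apply (prod_list (map cre ks)) vac S = (if S = set ks then \<eta> else 0)" by auto
  let ?\<eta> = "fock_sign k (set (k # ks)) * \<eta>"
  have "?\<eta> = 1 \<or> ?\<eta> = - 1" using \<eta>(1) fock_sign_cases[of k "set (k # ks)", where 'r = 'r] by auto
  moreover have "op_apply (prod_list (map cre (k # ks))) vac S = (if S = set (k # ks) then ?\<eta> else 0)" for S
  proof (cases "k \<in> S")
    case True
    then have "S - {k} = set ks \<longleftrightarrow> S = set (k # ks)" using Cons.prems by auto
    then show ?thesis using True by (simp add: op_apply_cre \<eta>)
  qed (auto simp: op_apply_cre)
  ultimately show ?case by blast
qed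

text \<open>Both summands are harmless for coefficients: a contraction on the right kills the
  vacuum, and one on the left lands in an ideal by \<open>coeff_contr_left\<close>.\<close>

definition comm_exact :: "('g, 'r::comm_ring_1) fock_op \<Rightarrow> ('g, 'r) fock_op \<Rightarrow> bool"
  where "comm_exact \<iota> x \<longleftrightarrow> (\<exists>g h. x = \<iota> * g + h * \<iota>)"

lemma comm_exactI: "x = \<iota> * g + h * \<iota> \<Longrightarrow> comm_exact \<iota> x"
  by (auto simp: comm_exact_def)

lemma comm_exact_0: "comm_exact \<iota> 0"
  by (rule comm_exactI[of _ _ 0 0]) simp

lemma comm_exact_uminus: "comm_exact \<iota> x \<Longrightarrow> comm_exact \<iota> (- x)"
proof -
  assume "comm_exact \<iota> x"
  then obtain g h where "x = \<iota> * g + h * \<iota>" by (auto simp: comm_exact_def)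
  then show ?thesis by (intro comm_exactI[of _ _ "- g" "- h"]) simp
qed

lemma comm_exact_coeff: "comm_exact (contr s) x \<Longrightarrow> \<exists>q. coeff E x = (\<Sum>k\<in>-E. s k * q k)"
  unfolding comm_exact_def using coeff_contr_left coeff_contr_right by (metis add.right_neutral coeff_add)

lemma anticommute_prod_list':
  fixes a :: "'m::ring_1"
  assumes "\<And>y. y \<in> set ys \<Longrightarrow> a * y = - (y * a)"
  shows "a * prod_list ys = (- 1) ^ length ys * (prod_list ys * a)"
proof -
  have "prod_list ys * a = (- 1) ^ length ys * (a * prod_list ys)"
    using assms by (intro anticommute_prod_list) simp
  then have "(- 1) ^ length ys * (prod_list ys * a) = ((- 1) ^ length ys * (- 1) ^ length ys) * (a * prod_list ys)"
    by (simp only: mult.assoc)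
  then show ?thesis by (simp flip: power_add mult_2)
qed

text \<open>Homotopies for single factors give one for the product: factors are replaced one at a
  time, and the contraction passes the remaining closed factors up to sign.\<close>

lemma comm_exact_prod_list_diff:
  fixes \<iota> :: "('g, 'r::comm_ring_1) fock_op"
  assumes A: "\<And>c. \<iota> * A c = - (A c * \<iota>)" and A': "\<And>c. \<iota> * A' c = - (A' c * \<iota>)"
    and S: "\<And>c. \<iota> * S c - S c * \<iota> = A c - A' c"
  shows "comm_exact \<iota> (prod_list (map A cs) - prod_list (map A' cs))"
proof (induction cs)
  case (Cons c cs)
  then obtain g h where gh: "prod_list (map A cs) - prod_list (map A' cs) = \<iota> * g + h * \<iota>"
    by (auto simp: comm_exact_def)
  have P: "\<iota> * prod_list (map A cs) = (- 1) ^ length cs * (prod_list (map A cs) * \<iota>)"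
    using anticommute_prod_list'[of "map A cs" \<iota>] A by auto
  have "prod_list (map A (c # cs)) - prod_list (map A' (c # cs))
      = (A c - A' c) * prod_list (map A cs) + A' c * (prod_list (map A cs) - prod_list (map A' cs))"
    by (simp add: algebra_simps)
  also have "\<dots> = \<iota> * (S c * prod_list (map A cs)) - S c * (\<iota> * prod_list (map A cs))
      - \<iota> * A' c * g + A' c * h * \<iota>"
    unfolding gh S[symmetric] A' by (simp add: algebra_simps)
  also have "\<dots> = \<iota> * (S c * prod_list (map A cs) - A' c * g)
      + (A' c * h - S c * ((- 1) ^ length cs * prod_list (map A cs))) * \<iota>"
    unfolding P by (simp add: algebra_simps)
  finally show ?case by (rule comm_exactI)
qed (simp add: comm_exact_0)

lemma contr_cre: "contr s * cre k = scal (s k) - cre k * contr s"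
proof -
  have "contr s * cre k + cre k * contr s = (\<Sum>j\<in>UNIV. scal (s j) * (ann j * cre k + cre k * ann j))"
    unfolding contr_def sum_distrib_left sum_distrib_right
    by (simp add: distrib_left sum.distrib mult.assoc cre_scal)
  also have "\<dots> = scal (s k)" by (simp add: ann_cre if_distrib[of "(*) _"] cong: if_cong)
  finally show ?thesis by (simp add: algebra_simps)
qed

lemma contr_cre_pair:
  "contr s * (cre k * cre l) - cre k * cre l * contr s = scal (s k) * cre l - scal (s l) * cre k"
proof -
  have "contr s * (cre k * cre l) = scal (s k) * cre l - cre k * (contr s * cre l)"
    by (simp add: contr_cre left_diff_distrib mult.assoc flip: mult.assoc[of "contr s"])
  then show ?thesis by (simp add: contr_cre right_diff_distrib cre_scal mult.assoc)
qed

text \<open>Only the antisymmetric part of \<open>w\<close> enters the commutator, which is exactly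
  the shape in which Koszul exactness supplies a 1-form.\<close>

lemma contr_pair:
  assumes "\<And>m. u m = (\<Sum>l\<in>UNIV. s l * (w l m - w m l))"
  shows "contr s * (\<Sum>k\<in>UNIV. \<Sum>l\<in>UNIV. scal (w k l) * (cre k * cre l))
    - (\<Sum>k\<in>UNIV. \<Sum>l\<in>UNIV. scal (w k l) * (cre k * cre l)) * contr s = form u"
proof -
  have "contr s * (\<Sum>k\<in>UNIV. \<Sum>l\<in>UNIV. scal (w k l) * (cre k * cre l))
      - (\<Sum>k\<in>UNIV. \<Sum>l\<in>UNIV. scal (w k l) * (cre k * cre l)) * contr s
    = (\<Sum>k\<in>UNIV. \<Sum>l\<in>UNIV. scal (w k l) * (contr s * (cre k * cre l) - cre k * cre l * contr s))"
    by (simp add: sum_distrib_left sum_distrib_right right_diff_distrib sum_subtractf mult.assoc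
        scal_left_commute[of "contr s"])
  also have "\<dots> = (\<Sum>k\<in>UNIV. \<Sum>l\<in>UNIV. scal (s k * w k l) * cre l) - (\<Sum>k\<in>UNIV. \<Sum>l\<in>UNIV. scal (s l * w k l) * cre k)"
    unfolding contr_cre_pair by (simp add: right_diff_distrib sum_subtractf mult.commute[of "s _"] scal_mult mult.assoc)
  also have "(\<Sum>k\<in>UNIV. \<Sum>l\<in>UNIV. scal (s k * w k l) * cre l) = (\<Sum>m\<in>UNIV. \<Sum>l\<in>UNIV. scal (s l * w l m) * cre m)"
    by (rule sum.swap)
  finally show ?thesis
    by (simp add: assms form_def scal_sum sum_distrib_right right_diff_distrib scal_diff left_diff_distrib sum_subtractf)
qed

text \<open>Each column receives an auxiliary generator carrying \<open>t c\<close>, which makes the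
  augmented column closed. By exactness corresponding columns of the two matrices are homotopic,
  hence so are the products of all columns. The coefficient at the original generators turns this
  homotopy into a combination of the \<open>t c\<close>.\<close>

lemma det_diff_in_ideal:
  fixes z :: "'k::finite \<Rightarrow> 'r::comm_ring_1"
  assumes exact: "\<And>u. (\<Sum>k\<in>UNIV. z k * u k) = 0 \<Longrightarrow> \<exists>w. \<forall>k. u k = (\<Sum>l\<in>UNIV. z l * (w l k - w k l))"
    and V: "\<And>c. (\<Sum>k\<in>UNIV. z k * V k c) = t c" and V': "\<And>c. (\<Sum>k\<in>UNIV. z k * V' k c) = t c"
  shows "\<exists>q. det (\<chi> k c. V k c) - det (\<chi> k c. V' k c) = (\<Sum>c\<in>UNIV. t c * q c)"
proof -
  obtain cs where cs: "distinct cs" "set cs = (UNIV :: 'k set)"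
    using finite_distinct_list[of "UNIV :: 'k set"] by auto
  define s where "s = case_sum z t"
  define \<iota> :: "('k + 'k, 'r) fock_op" where "\<iota> = contr s"
  \<comment> \<open>The entry \<open>- 1\<close> at the auxiliary generator contributes
    \<open>- t c\<close> to the pairing with \<open>s\<close> and cancels the sum over
    \<open>z\<close>.\<close>
  define A where "A V c = (form (case_sum (\<lambda>k. V k c) (\<lambda>d. if d = c then - 1 else 0)) :: ('k + 'k, 'r) fock_op)" for V c
  have A: "\<iota> * A V c = - (A V c * \<iota>)" if "\<And>c. (\<Sum>k\<in>UNIV. z k * V k c) = t c" for V c
  proof -
    have "\<iota> * A V c + A V c * \<iota> = 0"
      unfolding \<iota>_def A_def contr_form s_def
      by (simp add: UNIV_Plus_UNIV[symmetric] sum.Plus that if_distrib[of "(*) _"] cong: if_cong del: UNIV_Plus_UNIV)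
    then show ?thesis by (simp add: eq_neg_iff_add_eq_0)
  qed
  have "\<exists>S. \<iota> * S - S * \<iota> = A V c - A V' c" for c
  proof -
    have "(\<Sum>k\<in>UNIV. z k * (V k c - V' k c)) = 0"
      by (simp add: right_diff_distrib sum_subtractf V V')
    then obtain w where w: "\<And>k. V k c - V' k c = (\<Sum>l\<in>UNIV. z l * (w l k - w k l))"
      using exact[of "\<lambda>k. V k c - V' k c"] by blast
    \<comment> \<open>The auxiliary entries of the two augmented columns agree, so the 2-form
      involves original generators only.\<close>
    define w' where "w' x y = (case x of Inl k \<Rightarrow> (case y of Inl l \<Rightarrow> w k l | Inr _ \<Rightarrow> 0) | Inr _ \<Rightarrow> 0)" for x y :: "'k + 'k"
    have "(case_sum (\<lambda>k. V k c) (\<lambda>d. if d = c then - 1 else 0) m - case_sum (\<lambda>k. V' k c) (\<lambda>d. if d = c then - 1 else 0) m)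
        = (\<Sum>l\<in>UNIV. s l * (w' l m - w' m l))" for m :: "'k + 'k"
      by (cases m) (simp_all add: UNIV_Plus_UNIV[symmetric] sum.Plus w w'_def s_def del: UNIV_Plus_UNIV)
    from contr_pair[of _ s w', OF this] show ?thesis
      unfolding \<iota>_def A_def form_diff by blast
  qed
  then obtain S where S: "\<And>c. \<iota> * S c - S c * \<iota> = A V c - A V' c" by metis
  have "comm_exact \<iota> (prod_list (map (A V) cs) - prod_list (map (A V') cs))"
    using comm_exact_prod_list_diff[of \<iota> "A V" "A V'" S cs] A[of V] A[of V'] V V' S by blast
  then obtain q where q: "coeff (range Inl) (prod_list (map (A V) cs) - prod_list (map (A V') cs)) = (\<Sum>k\<in>-range Inl. s k * q k)"
    using comm_exact_coeff \<iota>_def by blast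
  have "distinct (map Inl cs :: ('k + 'k) list)" using cs(1) by (simp add: distinct_map)
  from coeff_prod_cre[OF this, where 'r = 'r] obtain \<eta> :: 'r where \<eta>': "\<eta> = 1 \<or> \<eta> = - 1"
    and \<eta>2: "\<And>S. op_apply (prod_list (map cre (map Inl cs :: ('k + 'k) list))) vac S = (if S = set (map Inl cs) then \<eta> else 0)"
    by blast
  have \<eta>: "\<eta> * \<eta> = 1" using \<eta>' by auto
  have det: "coeff (range Inl) (prod_list (map (A V) cs)) = det (\<chi> k c. V k c) * \<eta>" for V
  proof -
    \<comment> \<open>Modulo the auxiliary generators only the original columns are left, and their
      product is the determinant times the top form.\<close>
    have "agree_on (range Inl) (prod_list (map (A V) xs)) (prod_list (map (\<lambda>c. \<Sum>r\<in>UNIV. scal (V r c) * cre (Inl r)) xs))" for xs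
    proof (induction xs)
      case (Cons c xs)
      have "form (case_sum (\<lambda>k. V k c) (\<lambda>_. 0)) = (\<Sum>r\<in>UNIV. scal (V r c) * cre (Inl r) :: ('k + 'k, 'r) fock_op)"
        by (simp add: form_def UNIV_Plus_UNIV[symmetric] sum.Plus del: UNIV_Plus_UNIV)
      moreover have "agree_on (range Inl) (A V c) (form (case_sum (\<lambda>k. V k c) (\<lambda>_. 0)))"
        unfolding A_def by (rule agree_on_form) auto
      ultimately show ?case using Cons by (simp add: agree_on_mult)
    qed (simp add: agree_on_1)
    note agree = this
    have "prod_list (map (\<lambda>c. \<Sum>r\<in>UNIV. scal (V r c) * cre (Inl r)) cs)
        = scal (det (\<chi> k c. V k c)) * prod_list (map (\<lambda>r. cre (Inl r) :: ('k + 'k, 'r) fock_op) cs)"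
      by (rule prod_list_eq_det[OF cre_anticommute cre_square cs])
    then have "coeff (range Inl) (prod_list (map (A V) cs))
        = coeff (range Inl) (scal (det (\<chi> k c. V k c)) * prod_list (map (\<lambda>r. cre (Inl r) :: ('k + 'k, 'r) fock_op) cs))"
      using agree_on_coeff[OF agree[of cs]] by (simp only:)
    then show ?thesis using \<eta>2[of "range Inl"] cs(2) by (simp add: coeff_scal_mult coeff_def comp_def)
  qed
  have "(det (\<chi> k c. V k c) - det (\<chi> k c. V' k c)) * \<eta> = (\<Sum>k\<in>-range Inl. s k * q k)"
    using q by (simp add: coeff_diff det left_diff_distrib)
  also have "-range Inl = (range Inr :: ('k + 'k) set)"
    by (auto simp: image_iff) (metis sum.exhaust)
  also have "(\<Sum>k\<in>range Inr. s k * q k) = (\<Sum>c\<in>UNIV. t c * q (Inr c))"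
    by (simp add: sum.reindex s_def)
  finally have eq: "(det (\<chi> k c. V k c) - det (\<chi> k c. V' k c)) * \<eta> = (\<Sum>c\<in>UNIV. t c * q (Inr c))" .
  have "det (\<chi> k c. V k c) - det (\<chi> k c. V' k c) = (det (\<chi> k c. V k c) - det (\<chi> k c. V' k c)) * \<eta> * \<eta>"
    by (simp add: mult.assoc \<eta>)
  also have "\<dots> = (\<Sum>c\<in>UNIV. t c * (q (Inr c) * \<eta>))"
    unfolding eq by (simp add: sum_distrib_right mult.assoc)
  finally show ?thesis by (rule exI[of _ "\<lambda>c. q (Inr c) * \<eta>"])
qed

section \<open>Exactness of the Koszul complex\<close>

lemma lookup_X_mult: "Poly_Mapping.lookup (X i * u) (Poly_Mapping.single i 1 + m) = Poly_Mapping.lookup u m"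
proof (induction u rule: mpoly_single_induct)
  case (single m' c)
  then show ?case by (simp add: lookup_single when_def flip: single_eq_X_mult)
qed (simp add: distrib_left lookup_add)

text \<open>If \<open>X i * u = X j * u\<close>, then a monomial of \<open>u\<close> with the
  largest exponent of \<open>X i\<close> yields a monomial of \<open>u\<close> in which that
  exponent is larger by one.\<close>

lemma X_diff_nonzero_divisor:
  assumes "i \<noteq> j" "(X i - X j) * u = 0"
  shows "u = 0"
proof (rule ccontr)
  assume "u \<noteq> 0"
  then have ne: "Poly_Mapping.keys u \<noteq> {}" by simp
  define M where "M = Max ((\<lambda>m. Poly_Mapping.lookup m i) ` Poly_Mapping.keys u)"
  have "M \<in> (\<lambda>m. Poly_Mapping.lookup m i) ` Poly_Mapping.keys u"
    unfolding M_def using ne by (intro Max_in) auto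
  then obtain m where m: "m \<in> Poly_Mapping.keys u" "Poly_Mapping.lookup m i = M" by auto
  have eq: "X i * u = X j * u" using assms(2) by (simp add: algebra_simps)
  have "Poly_Mapping.single i 1 + m \<in> Poly_Mapping.keys (X j * u)"
    unfolding eq[symmetric] in_keys_iff lookup_X_mult using m(1) by (simp add: in_keys_iff)
  then obtain b where b: "b \<in> Poly_Mapping.keys u" "Poly_Mapping.single i 1 + m = Poly_Mapping.single j 1 + b"
    using keys_mult[of "X j" u] by (auto simp: X_def split: if_splits)
  have "Poly_Mapping.lookup (Poly_Mapping.single i 1 + m) i = Poly_Mapping.lookup (Poly_Mapping.single j 1 + b) i"
    using b(2) by simp
  then have "Poly_Mapping.lookup b i = Suc M" using assms(1) m(2) by (simp add: lookup_add lookup_single)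
  moreover have "Poly_Mapping.lookup b i \<le> M" unfolding M_def using b(1) by (intro Max_ge) auto
  ultimately show False by simp
qed

text \<open>The sequence \<open>X (\<xi> k) - X (\<eta> k)\<close> is regular; this is the exactness of its Koszul complex in degree 1.\<close>

lemma koszul_exact:
  fixes u :: "'k \<Rightarrow> ('v::finite, 'a::comm_ring_1) mpoly"
  assumes "inj \<eta>" and disj: "\<And>k l. \<xi> k \<noteq> \<eta> l" and "finite T"
    and "(\<Sum>k\<in>T. (X (\<xi> k) - X (\<eta> k)) * u k) = 0"
  shows "\<exists>w. \<forall>k\<in>T. u k = (\<Sum>l\<in>T. (X (\<xi> l) - X (\<eta> l)) * (w l k - w k l))"
  using assms(3,4)
proof (induction T arbitrary: u rule: finite_induct)
  case (insert t T)
  define z where "z k = (X (\<xi> k) - X (\<eta> k) :: ('v, 'a) mpoly)" for k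
  define \<sigma> where "\<sigma> v = (if v \<in> \<eta> ` T then X (\<xi> (inv \<eta> v)) else X v :: ('v, 'a) mpoly)" for v
  have \<sigma>: "subst \<sigma> (z k) = (if k \<in> T then 0 else z k)" for k
    using disj by (auto simp: z_def subst_diff \<sigma>_def inv_f_f[OF assms(1)] inj_eq[OF assms(1)] image_iff)
  have eq: "z t * u t + (\<Sum>k\<in>T. z k * u k) = 0" using insert by (simp add: z_def)
  then have "subst \<sigma> (z t * u t + (\<Sum>k\<in>T. z k * u k)) = 0" by simp
  then have "z t * subst \<sigma> (u t) = 0" using insert.hyps by (simp add: subst_add subst_sum subst_mult \<sigma>)
  then have 0: "subst \<sigma> (u t) = 0" unfolding z_def using X_diff_nonzero_divisor[OF disj] by blast
  \<comment> \<open>A polynomial annihilated by \<open>\<sigma>\<close> is a combination of the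
    differences that \<open>\<sigma>\<close> annihilates.\<close>
  obtain q where "subst X (u t) - subst \<sigma> (u t) = (\<Sum>v\<in>UNIV. (X v - \<sigma> v) * q v)"
    using subst_diff_in_ideal by blast
  then have "u t = (\<Sum>v\<in>UNIV. (X v - \<sigma> v) * q v)" using 0 by simp
  also have "\<dots> = (\<Sum>v\<in>\<eta> ` T. (X v - \<sigma> v) * q v)"
    by (rule sum.mono_neutral_right) (auto simp: \<sigma>_def)
  also have "\<dots> = (\<Sum>k\<in>T. z k * - q (\<eta> k))"
    using assms(1) by (subst sum.reindex) (auto simp: inj_on_def inj_def \<sigma>_def z_def inv_f_f algebra_simps intro!: sum.cong)
  finally have ut: "u t = (\<Sum>k\<in>T. z k * - q (\<eta> k))" .
  \<comment> \<open>Inserting the expression for \<open>u t\<close> leaves a relation over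
    \<open>T\<close> alone, to which the induction hypothesis applies.\<close>
  have "(\<Sum>k\<in>T. z k * (u k + z t * - q (\<eta> k))) = (\<Sum>k\<in>T. z k * u k) + z t * u t"
    unfolding ut by (simp add: right_diff_distrib sum_subtractf sum_negf sum_distrib_left mult.left_commute)
  then have "(\<Sum>k\<in>T. z k * (u k + z t * - q (\<eta> k))) = 0" using eq by (simp add: add.commute)
  then obtain w where w: "\<And>k. k \<in> T \<Longrightarrow> u k + z t * - q (\<eta> k) = (\<Sum>l\<in>T. z l * (w l k - w k l))"
    using insert.IH[of "\<lambda>k. u k + z t * - q (\<eta> k)"] unfolding z_def by blast
  define w' where "w' l k = (if l = t then (if k = t then 0 else q (\<eta> k)) else if k = t then 0 else w l k)" for l k
  have "u k = (\<Sum>l\<in>insert t T. z l * (w' l k - w' k l))" if "k \<in> insert t T" for k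
  proof (cases "k = t")
    case True
    have "(\<Sum>l\<in>T. z l * (w' l t - w' t l)) = (\<Sum>k\<in>T. z k * - q (\<eta> k))"
      using insert.hyps by (intro sum.cong) (auto simp: w'_def)
    then show ?thesis using True insert.hyps ut by simp
  next
    case False
    have "(\<Sum>l\<in>T. z l * (w' l k - w' k l)) = (\<Sum>l\<in>T. z l * (w l k - w k l))"
      using insert.hyps False by (intro sum.cong) (auto simp: w'_def)
    then show ?thesis using False w[of k] that insert.hyps by (simp add: w'_def algebra_simps)
  qed
  then show ?case unfolding z_def by blast
qed simp

lemma det_difference_vectors:
  fixes V V' :: "'k::finite \<Rightarrow> 'k \<Rightarrow> ('v::finite, 'a::comm_ring_1) mpoly"
  assumes "inj \<eta>" "\<And>k l. \<xi> k \<noteq> \<eta> l"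
    and "\<And>c. (\<Sum>k\<in>UNIV. (X (\<xi> k) - X (\<eta> k)) * V k c) = t c"
    and "\<And>c. (\<Sum>k\<in>UNIV. (X (\<xi> k) - X (\<eta> k)) * V' k c) = t c"
  shows "\<exists>q. det (\<chi> k c. V k c) - det (\<chi> k c. V' k c) = (\<Sum>c\<in>UNIV. t c * q c)"
  using koszul_exact[OF assms(1,2), of UNIV] by (intro det_diff_in_ideal[OF _ assms(3,4)]) auto

section \<open>The exchange identity\<close>

lemma anticommute_prod_list_map:
  "(\<And>y. f y * x = - (x * f y)) \<Longrightarrow>
    prod_list (map f ys) * x = (- 1) ^ length ys * (x * prod_list (map f ys))" for x :: "'m::ring_1"
  using anticommute_prod_list[of "map f ys" x] by fastforce

text \<open>A sum over the positions in the list, with \<open>p\<close> before, \<open>g\<close> at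
  and \<open>k\<close> after the position; \<open>tel_minus\<close> counts a sign for every factor
  passed. The two functions take \<open>k\<close> and \<open>p\<close> in opposite order.\<close>

primrec tel_plus :: "('c \<Rightarrow> 'm::ring_1) \<Rightarrow> ('c \<Rightarrow> 'm) \<Rightarrow> ('c \<Rightarrow> 'm) \<Rightarrow> 'c list \<Rightarrow> 'm" where
  "tel_plus g k p [] = 0"
| "tel_plus g k p (i # xs) = g i * prod_list (map k xs) + p i * tel_plus g k p xs"

primrec tel_minus :: "('c \<Rightarrow> 'm::ring_1) \<Rightarrow> ('c \<Rightarrow> 'm) \<Rightarrow> ('c \<Rightarrow> 'm) \<Rightarrow> 'c list \<Rightarrow> 'm" where
  "tel_minus g p k [] = 0"
| "tel_minus g p k (i # xs) = g i * prod_list (map k xs) - p i * tel_minus g p k xs"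

lemma tel_plus_telescope: "tel_plus (\<lambda>i. p i - k i) k p xs = prod_list (map p xs) - prod_list (map k xs)"
  by (induction xs) (simp_all add: left_diff_distrib right_diff_distrib)

text \<open>In the application, \<open>a i\<close>, \<open>b i\<close>, \<open>c i\<close> are the difference derivatives of one polynomial between
  the points \<open>(x,y)\<close>, \<open>(y,z)\<close>, \<open>(x,z)\<close>, read as 1-forms, \<open>G i\<close> is a second difference derivative, read as a
  2-form, and \<open>Q i\<close> is the divided square of \<open>G i\<close>.\<close>

locale exchange =
  fixes \<iota> :: "('g, 'r::comm_ring_1) fock_op" and a b c G Q :: "'c \<Rightarrow> ('g, 'r) fock_op"
  assumes closed: "\<And>i. \<iota> * a i = - (a i * \<iota>)" "\<And>i. \<iota> * b i = - (b i * \<iota>)" "\<And>i. \<iota> * c i = - (c i * \<iota>)"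
    and ab: "\<And>i j. b i * a j = - (a j * b i)" and ac: "\<And>i j. c i * a j = - (a j * c i)"
    and bc: "\<And>i j. c i * b j = - (b j * c i)"
    and square: "\<And>i. a i * a i = 0" "\<And>i. b i * b i = 0" "\<And>i. c i * c i = 0"
    and G_comm: "\<And>i j. a i * G j = G j * a i" "\<And>i j. b i * G j = G j * b i" "\<And>i j. c i * G j = G j * c i"
    and G: "\<And>i. \<iota> * G i - G i * \<iota> = c i - a i - b i"
    and Q: "\<And>i. \<iota> * Q i - Q i * \<iota> = G i * (c i - a i - b i)"
begin

definition "A xs = prod_list (map a xs)"
definition "B xs = prod_list (map b xs)"
definition "C xs = prod_list (map c xs)"

text \<open>Pairs are even, so that their products commute with the contraction
  (\<open>closed_PKR\<close>). Up to sign, \<open>AB\<close>, \<open>CB\<close> and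
  \<open>AC\<close> reorder the separate products into these.\<close>

definition "P xs = prod_list (map (\<lambda>i. a i * b i) xs)"
definition "K xs = prod_list (map (\<lambda>i. c i * b i) xs)"
definition "R xs = prod_list (map (\<lambda>i. a i * c i) xs)"

text \<open>\<open>U\<close>, \<open>V\<close> and \<open>W\<close> are homotopies between
  \<open>K\<close> and \<open>P\<close>, \<open>P\<close> and \<open>R\<close>, \<open>K\<close> and
  \<open>R\<close>. The signed sums \<open>H\<close> and \<open>H'\<close> reappear in the two
  determinants of \<open>exchange_det\<close>.\<close>

abbreviation "H \<equiv> tel_minus G a c"
abbreviation "H' \<equiv> tel_minus G c b"
abbreviation "U \<equiv> tel_plus (\<lambda>i. G i * b i) (\<lambda>i. c i * b i) (\<lambda>i. a i * b i)"
abbreviation "V \<equiv> tel_plus (\<lambda>i. G i * a i) (\<lambda>i. a i * b i) (\<lambda>i. a i * c i)"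
abbreviation "W \<equiv> tel_plus (\<lambda>i. G i * c i) (\<lambda>i. c i * b i) (\<lambda>i. a i * c i)"

text \<open>A second-order homotopy between the composite \<open>U xs + V xs\<close> and the direct
  \<open>W xs\<close>. It moves one factor by \<open>G i\<close> and a later one by
  \<open>U\<close>; where both moves fall on the same factor, half of the square of
  \<open>G i\<close> would be needed, and \<open>Q i\<close> takes its place.\<close>

primrec Y where
  "Y [] = 0"
| "Y (i # xs) = G i * a i * U xs - Q i * K xs + a i * c i * Y xs"

text \<open>The sign of interleaving two products of odd factors into a product of pairs.\<close>

primrec \<epsilon> :: "'c list \<Rightarrow> ('g, 'r) fock_op" where
  "\<epsilon> [] = 1"
| "\<epsilon> (i # xs) = (- 1) ^ length xs * \<epsilon> xs"

lemma prod_folds [simp]: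
  "prod_list (map a xs) = A xs"
  "prod_list (map b xs) = B xs"
  "prod_list (map c xs) = C xs"
  "prod_list (map (\<lambda>i. a i * b i) xs) = P xs"
  "prod_list (map (\<lambda>i. c i * b i) xs) = K xs"
  "prod_list (map (\<lambda>i. a i * c i) xs) = R xs"
  by (simp_all only: A_def B_def C_def P_def K_def R_def)

lemma prod_simps [simp]:
  "A [] = 1" "A (i # xs) = a i * A xs"
  "B [] = 1" "B (i # xs) = b i * B xs"
  "C [] = 1" "C (i # xs) = c i * C xs"
  "P [] = 1" "P (i # xs) = a i * b i * P xs"
  "K [] = 1" "K (i # xs) = c i * b i * K xs"
  "R [] = 1" "R (i # xs) = a i * c i * R xs"
  by (simp_all add: A_def B_def C_def P_def K_def R_def mult.assoc del: prod_folds)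

lemma \<iota>_G: "\<iota> * G i = G i * \<iota> + (c i - a i - b i)"
  using G[of i] by (simp add: algebra_simps)

lemma \<iota>_Q: "\<iota> * Q i = Q i * \<iota> + G i * (c i - a i - b i)"
  using Q[of i] by (simp add: algebra_simps)

lemma closed2: "\<iota> * (a i * x) = - (a i * (\<iota> * x))" "\<iota> * (b i * x) = - (b i * (\<iota> * x))"
  "\<iota> * (c i * x) = - (c i * (\<iota> * x))"
  "\<iota> * (G i * x) = G i * (\<iota> * x) + (c i - a i - b i) * x"
  "\<iota> * (Q i * x) = Q i * (\<iota> * x) + G i * ((c i - a i - b i) * x)"
  by (simp_all add: closed \<iota>_G \<iota>_Q distrib_right flip: mult.assoc)

lemma square2: "a i * (a i * x) = 0" "b i * (b i * x) = 0" "c i * (c i * x) = 0"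
  by (simp_all add: square flip: mult.assoc)

lemma order: "b i * a j = - (a j * b i)" "b i * (a j * x) = - (a j * (b i * x))"
  "c i * a j = - (a j * c i)" "c i * (a j * x) = - (a j * (c i * x))"
  "b i * c j = - (c j * b i)" "b i * (c j * x) = - (c j * (b i * x))"
  by (simp_all add: ab ac bc flip: mult.assoc)

lemma closed_PKR: "\<iota> * P xs = P xs * \<iota>" "\<iota> * K xs = K xs * \<iota>" "\<iota> * R xs = R xs * \<iota>"
  by (induction xs) (simp_all add: mult.assoc closed2)

lemma \<iota>_U: "\<iota> * U xs = - (U xs * \<iota>) + K xs - P xs"
proof (induction xs)
  case (Cons i xs)
  show ?case
    by (simp add: mult.assoc closed2 Cons closed_PKR distrib_left right_diff_distrib left_diff_distrib square2)
      (simp add: mult.assoc distrib_right)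
qed simp

lemma \<iota>_V: "\<iota> * V xs = - (V xs * \<iota>) + P xs - R xs"
proof (induction xs)
  case (Cons i xs)
  show ?case
    by (simp add: mult.assoc closed2 Cons closed_PKR distrib_left right_diff_distrib left_diff_distrib square2 order)
      (simp add: mult.assoc distrib_right)
qed simp

lemma \<iota>_Y: "\<iota> * Y xs = Y xs * \<iota> + U xs + V xs - W xs"
proof (induction xs)
  case (Cons i xs)
  show ?case
    by (simp add: mult.assoc closed2 Cons closed_PKR \<iota>_U distrib_left distrib_right right_diff_distrib left_diff_distrib square2 order)
qed simp

text \<open>The homotopy identities for \<open>V\<close> and \<open>Y\<close>, multiplied by the
  further factors \<open>G i\<close> and \<open>c i\<close>, produce all terms; the total homotopy
  is \<open>V xs * G i + Y xs * c i\<close>.\<close>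

lemma exchange_exact:
  "comm_exact \<iota> (U xs * c i + V xs * b i + (P xs - R xs) * G i - (W xs * c i - V xs * a i))"
proof (rule comm_exactI)
  have 1: "P xs - R xs = \<iota> * V xs + V xs * \<iota>" by (simp add: \<iota>_V)
  have 2: "U xs + V xs = \<iota> * Y xs - Y xs * \<iota> + W xs" by (simp add: \<iota>_Y)
  have 3: "(P xs - R xs) * G i = \<iota> * (V xs * G i) + V xs * G i * \<iota> + V xs * (c i - a i - b i)"
    unfolding 1 by (simp add: distrib_right mult.assoc \<iota>_G distrib_left)
  have 4: "(U xs + V xs) * c i = \<iota> * (Y xs * c i) + Y xs * c i * \<iota> + W xs * c i"
    unfolding 2 by (simp add: distrib_right left_diff_distrib mult.assoc closed)
  have "U xs * c i + V xs * b i + (P xs - R xs) * G i - (W xs * c i - V xs * a i)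
      = (U xs + V xs) * c i + (P xs - R xs) * G i - V xs * (c i - a i - b i) - W xs * c i"
    by (simp add: algebra_simps)
  also have "\<dots> = \<iota> * (V xs * G i + Y xs * c i) + (V xs * G i + Y xs * c i) * \<iota>"
    unfolding 3 4 by (simp add: algebra_simps)
  finally show "U xs * c i + V xs * b i + (P xs - R xs) * G i - (W xs * c i - V xs * a i)
      = \<iota> * (V xs * G i + Y xs * c i) + (V xs * G i + Y xs * c i) * \<iota>" .
qed

lemma \<epsilon>_cases: "\<epsilon> xs = 1 \<or> \<epsilon> xs = - 1"
proof (induction xs)
  case (Cons i xs)
  have "(- 1) ^ length xs = (1 :: ('g, 'r) fock_op) \<or> (- 1) ^ length xs = (- 1 :: ('g, 'r) fock_op)"
    by (cases "even (length xs)") simp_all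
  then show ?case using Cons by auto
qed simp

lemma odd_pass:
  "A xs * b i = (- 1) ^ length xs * (b i * A xs)" "C xs * b i = (- 1) ^ length xs * (b i * C xs)"
  "A xs * c i = (- 1) ^ length xs * (c i * A xs)" "A xs * G i = G i * A xs"
  "B xs * G i = G i * B xs" "C xs * G i = G i * C xs" "B xs * c i = (- 1) ^ length xs * (c i * B xs)"
proof -
  show "A xs * b i = (- 1) ^ length xs * (b i * A xs)"
    unfolding A_def by (rule anticommute_prod_list_map) (simp add: ab)
  show "C xs * b i = (- 1) ^ length xs * (b i * C xs)"
    unfolding C_def by (rule anticommute_prod_list_map) (rule bc)
  show "A xs * c i = (- 1) ^ length xs * (c i * A xs)"
    unfolding A_def by (rule anticommute_prod_list_map) (simp add: ac)
  show "B xs * c i = (- 1) ^ length xs * (c i * B xs)"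
    unfolding B_def by (rule anticommute_prod_list_map) (simp add: bc)
  show "A xs * G i = G i * A xs" by (induction xs) (simp_all add: mult.assoc, simp add: G_comm flip: mult.assoc)
  show "B xs * G i = G i * B xs" by (induction xs) (simp_all add: mult.assoc, simp add: G_comm flip: mult.assoc)
  show "C xs * G i = G i * C xs" by (induction xs) (simp_all add: mult.assoc, simp add: G_comm flip: mult.assoc)
qed

lemma H_pass: "H xs * b i = - ((- 1) ^ length xs * (b i * H xs))"
proof (induction xs)
  case (Cons j xs)
  have "H (j # xs) * b i = G j * (C xs * b i) - a j * (H xs * b i)"
    by (simp add: left_diff_distrib mult.assoc)
  also have "\<dots> = (- 1) ^ length xs * (G j * b i * C xs) + (- 1) ^ length xs * (a j * b i * H xs)"
    unfolding Cons odd_pass(2) by (cases "even (length xs)") (simp_all add: mult.assoc)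
  also have "\<dots> = (- 1) ^ length xs * (b i * (G j * C xs - a j * H xs))"
    by (simp add: right_diff_distrib distrib_left order flip: mult.assoc) (simp add: G_comm mult.assoc)
  finally show ?case by simp
qed simp

lemma H_append: "H (xs @ [i]) = H xs * c i + (- 1) ^ length xs * (A xs * G i)"
  by (induction xs) (simp_all add: algebra_simps minus_one_power_commute[of "a _"] flip: mult.assoc)

lemma H'_append: "H' (xs @ [i]) = H' xs * b i + (- 1) ^ length xs * (C xs * G i)"
  by (induction xs) (simp_all add: algebra_simps minus_one_power_commute[of "c _"] flip: mult.assoc)

lemma AB: "A xs * B xs = \<epsilon> xs * P xs"
proof (induction xs)
  case (Cons i xs)
  have "A (i # xs) * B (i # xs) = a i * (A xs * b i) * B xs" by (simp add: mult.assoc)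
  then show ?case unfolding odd_pass using Cons \<epsilon>_cases[of xs] by (cases "even (length xs)") (auto simp: mult.assoc)
qed simp

lemma CB: "C xs * B xs = \<epsilon> xs * K xs"
proof (induction xs)
  case (Cons i xs)
  have "C (i # xs) * B (i # xs) = c i * (C xs * b i) * B xs" by (simp add: mult.assoc)
  then show ?case unfolding odd_pass using Cons \<epsilon>_cases[of xs] by (cases "even (length xs)") (auto simp: mult.assoc)
qed simp

lemma AC: "A xs * C xs = \<epsilon> xs * R xs"
proof (induction xs)
  case (Cons i xs)
  have "A (i # xs) * C (i # xs) = a i * (A xs * c i) * C xs" by (simp add: mult.assoc)
  then show ?case unfolding odd_pass using Cons \<epsilon>_cases[of xs] by (cases "even (length xs)") (auto simp: mult.assoc)
qed simp

lemma HB: "H xs * B xs = \<epsilon> xs * U xs"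
proof (induction xs)
  case (Cons i xs)
  have "H (i # xs) * B (i # xs) = G i * (C xs * b i) * B xs - a i * (H xs * b i) * B xs"
    by (simp add: mult.assoc left_diff_distrib)
  also have "\<dots> = (- 1) ^ length xs * (G i * (b i * (C xs * B xs))) + (- 1) ^ length xs * (a i * (b i * (H xs * B xs)))"
    unfolding odd_pass H_pass by (cases "even (length xs)") (simp_all add: mult.assoc)
  finally show ?case unfolding Cons CB
    using \<epsilon>_cases[of xs] by (cases "even (length xs)") (auto simp: distrib_left mult.assoc)
qed simp

lemma AH': "A xs * H' xs = - ((- 1) ^ length xs * (\<epsilon> xs * V xs))"
proof (induction xs)
  case (Cons i xs)
  have "A (i # xs) * H' (i # xs) = a i * (A xs * G i) * B xs - a i * (A xs * c i) * H' xs"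
    by (simp add: mult.assoc right_diff_distrib)
  also have "\<dots> = G i * (a i * (A xs * B xs)) - (- 1) ^ length xs * (a i * (c i * (A xs * H' xs)))"
    unfolding odd_pass by (cases "even (length xs)") (simp_all add: G_comm flip: mult.assoc)
  finally show ?case unfolding Cons AB
    using \<epsilon>_cases[of xs] by (cases "even (length xs)") (auto simp: distrib_left mult.assoc)
qed simp

text \<open>The distinguished index \<open>i\<close> stands last in \<open>H\<close> and
  \<open>H'\<close> and is absent from \<open>A xs\<close> and \<open>B xs\<close>; it is the column
  of the argument. The terms with \<open>W\<close> and \<open>V\<close> will form the remainder of
  low degree.\<close>

lemma exchange:
  "\<exists>s. (s = 1 \<or> s = - 1) \<and>
    comm_exact \<iota> (H (xs @ [i]) * B xs - A xs * H' (xs @ [i]) - s * (W xs * c i - V xs * a i))"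
proof -
  define s where "s = (- 1) ^ length xs * \<epsilon> xs"
  have s: "s = 1 \<or> s = - 1"
    unfolding s_def using \<epsilon>_cases[of xs] by (cases "even (length xs)") auto
  have cB: "c i * B xs = (- 1) ^ length xs * (B xs * c i)"
    unfolding odd_pass by (simp flip: mult.assoc power_add mult_2)
  have "H (xs @ [i]) * B xs = H xs * (c i * B xs) + (- 1) ^ length xs * (A xs * (G i * B xs))"
    by (simp add: H_append distrib_right mult.assoc)
  also have "\<dots> = (- 1) ^ length xs * (H xs * B xs * c i) + (- 1) ^ length xs * (A xs * B xs * G i)"
    unfolding cB odd_pass(5)[symmetric] by (cases "even (length xs)") (simp_all add: mult.assoc)
  also have "\<dots> = s * (U xs * c i + P xs * G i)"
    unfolding HB AB s_def by (simp add: distrib_left mult.assoc)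
  finally have 1: "H (xs @ [i]) * B xs = s * (U xs * c i + P xs * G i)" .
  have "A xs * H' (xs @ [i]) = A xs * H' xs * b i + (- 1) ^ length xs * (A xs * C xs * G i)"
    by (cases "even (length xs)") (simp_all add: H'_append distrib_left right_diff_distrib mult.assoc)
  also have "\<dots> = s * (R xs * G i - V xs * b i)"
    unfolding AH' AC s_def by (simp add: right_diff_distrib mult.assoc)
  finally have 2: "A xs * H' (xs @ [i]) = s * (R xs * G i - V xs * b i)" .
  have "H (xs @ [i]) * B xs - A xs * H' (xs @ [i]) - s * (W xs * c i - V xs * a i)
      = s * (U xs * c i + V xs * b i + (P xs - R xs) * G i - (W xs * c i - V xs * a i))"
    unfolding 1 2 by (simp add: algebra_simps)
  then show ?thesis
    using s exchange_exact[of xs i] comm_exact_uminus[OF exchange_exact[of xs i]] by (intro exI[of _ s]) auto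
qed

lemmas exchange_unfolded = exchange[unfolded A_def B_def]

end

text \<open>If every summand has product 0 with its own commutator, the sum of the products over
  pairs of distinct summands serves as half of the square, without a division by 2.\<close>

lemma divided_square:
  fixes \<iota> :: "'m::ring_1"
  assumes "finite J" and comm: "\<And>i j. g i * (\<iota> * g j - g j * \<iota>) = (\<iota> * g j - g j * \<iota>) * g i"
    and zero: "\<And>j. g j * (\<iota> * g j - g j * \<iota>) = 0"
  shows "\<exists>Q. \<iota> * Q - Q * \<iota> = sum g J * (\<iota> * sum g J - sum g J * \<iota>)"
  using assms(1)
proof (induction J rule: finite_induct)
  case empty
  show ?case by (rule exI[of _ 0]) simp
next
  case (insert j J)
  define S where "S = sum g J"
  obtain Q where Q: "\<iota> * Q - Q * \<iota> = S * (\<iota> * S - S * \<iota>)" using insert.IH S_def by auto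
  have S: "S * (\<iota> * g j - g j * \<iota>) = (\<iota> * g j - g j * \<iota>) * S"
    unfolding S_def sum_distrib_left sum_distrib_right by (rule sum.cong[OF refl comm])
  have "\<iota> * (Q + g j * S) - (Q + g j * S) * \<iota>
      = (\<iota> * Q - Q * \<iota>) + ((\<iota> * g j - g j * \<iota>) * S + g j * (\<iota> * S - S * \<iota>))"
    by (simp add: algebra_simps)
  also have "\<dots> = (g j + S) * ((\<iota> * g j - g j * \<iota>) + (\<iota> * S - S * \<iota>))"
    unfolding Q S[symmetric] distrib_left distrib_right zero by simp
  also have "\<dots> = sum g (insert j J) * (\<iota> * sum g (insert j J) - sum g (insert j J) * \<iota>)"
    using insert.hyps by (simp add: S_def algebra_simps)
  finally show ?case by blast
qed

abbreviation form2 :: "('g::finite \<Rightarrow> 'g \<Rightarrow> 'r) \<Rightarrow> ('g, 'r::comm_ring_1) fock_op"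
  where "form2 w \<equiv> \<Sum>k\<in>UNIV. \<Sum>l\<in>UNIV. scal (w k l) * (cre k * cre l)"

lemma cre_pair_comm: "cre k * cre l * cre m = cre m * (cre k * cre l)"
proof -
  have "cre k * (cre l * cre m) = cre m * (cre k * cre l)"
    by (simp add: cre_anticommute[of l m]) (simp add: cre_anticommute[of k m] flip: mult.assoc)
  then show ?thesis by (simp add: mult.assoc)
qed

lemma cre_pair_square: "cre k * cre l * cre l = 0" "cre k * cre l * cre k = 0"
proof -
  show "cre k * cre l * cre l = 0" by (simp add: mult.assoc cre_square)
  show "cre k * cre l * cre k = 0" by (simp add: cre_pair_comm) (simp add: cre_square flip: mult.assoc)
qed

lemma form_form2_comm: "form v * form2 w = form2 w * form v"
proof -
  have "cre m * form2 w = form2 w * cre m" for m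
    by (simp add: sum_distrib_left sum_distrib_right cre_scal cre_pair_comm mult.assoc[of "scal _"])
  then have "scal (v m) * cre m * form2 w = form2 w * (scal (v m) * cre m)" for m
    by (simp add: scal_left_commute[of "form2 w"] mult.assoc)
  then show ?thesis unfolding form_def sum_distrib_left[of "form2 w"] sum_distrib_right[of _ _ "form2 w"]
    by (intro sum.cong) auto
qed

text \<open>A summand is a multiple of a product of two generators, and its commutator with the
  contraction contains one of the two again, so their product vanishes.\<close>

lemma divided_square_form2:
  "\<exists>Q. contr s * Q - Q * contr s = form2 w * (contr s * form2 w - form2 w * contr s)"
proof -
  define g where "g = (\<lambda>(k, l). scal (w k l) * (cre k * cre l))"
  have sum: "sum g UNIV = form2 w" by (simp add: g_def sum.cartesian_product)
  have d: "contr s * g j - g j * contr s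
      = scal (w (fst j) (snd j)) * (scal (s (fst j)) * cre (snd j) - scal (s (snd j)) * cre (fst j))" for j
    by (cases j) (simp add: g_def scal_left_commute[of "contr s"] mult.assoc contr_cre_pair[symmetric] right_diff_distrib)
  have gc: "g i * cre m = cre m * g i" for i m
    by (cases i) (simp add: g_def mult.assoc[of "scal _"] cre_pair_comm cre_scal)
  have "g i * (scal t * (scal u * cre m - scal u' * cre m')) = scal t * (scal u * cre m - scal u' * cre m') * g i" for i t u u' m m'
    by (simp add: scal_left_commute[of "g i"] right_diff_distrib left_diff_distrib gc mult.assoc)
  then have comm: "g i * (contr s * g j - g j * contr s) = (contr s * g j - g j * contr s) * g i" for i j
    unfolding d by blast
  have zero: "g j * (contr s * g j - g j * contr s) = 0" for j
  proof (cases j)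
    case (Pair k l)
    define Z where "Z = scal (s k) * cre l - scal (s l) * cre k"
    have "cre k * cre l * Z = 0"
      by (simp add: Z_def right_diff_distrib scal_left_commute[of "cre k * cre l"] cre_pair_square)
    then have "g j * Z = 0" by (simp add: Pair g_def mult.assoc)
    moreover have "g j * (scal (w k l) * Z) = scal (w k l) * (g j * Z)" by (rule scal_left_commute)
    ultimately show ?thesis unfolding d by (simp add: Pair Z_def)
  qed
  show ?thesis using divided_square[of UNIV g "contr s", OF _ comm zero] unfolding sum by simp
qed

section \<open>Estimates for telescoping sums\<close>

lemma agree_on_prod_list:
  "(\<And>i. agree_on E (p i) (p' i)) \<Longrightarrow> agree_on E (prod_list (map p xs)) (prod_list (map p' xs))"
  by (induction xs) (simp_all add: agree_on_1 agree_on_mult)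

lemma agree_on_tel_plus:
  "(\<And>i. agree_on E (g i) (g' i)) \<Longrightarrow> (\<And>i. agree_on E (k i) (k' i)) \<Longrightarrow> (\<And>i. agree_on E (p i) (p' i)) \<Longrightarrow>
    agree_on E (tel_plus g k p xs) (tel_plus g' k' p' xs)"
  by (induction xs) (simp_all add: agree_on_0 agree_on_mult agree_on_add agree_on_prod_list)

lemma agree_on_tel_minus:
  "(\<And>i. agree_on E (g i) (g' i)) \<Longrightarrow> (\<And>i. agree_on E (k i) (k' i)) \<Longrightarrow> (\<And>i. agree_on E (p i) (p' i)) \<Longrightarrow>
    agree_on E (tel_minus g p k xs) (tel_minus g' p' k' xs)"
  by (induction xs) (simp_all add: agree_on_0 agree_on_mult agree_on_diff agree_on_prod_list)

lemma raises_prod_list: "(\<And>i. raises N d (p i)) \<Longrightarrow> raises N (d * length xs) (prod_list (map p xs))"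
proof (induction xs)
  case (Cons i xs)
  then show ?case using raises_mult[of N d "p i" "d * length xs"] by simp
qed (simp add: raises_1)

lemma raises_tel_plus:
  assumes "\<And>i. raises N (Suc d) (g i)" "\<And>i. raises N d (k i)" "\<And>i. raises N d (p i)"
  shows "raises N (Suc (d * length xs)) (tel_plus g k p xs)"
proof (induction xs)
  case (Cons i xs)
  have "raises N (Suc d + d * length xs) (g i * prod_list (map k xs))"
    by (intro raises_mult assms raises_prod_list)
  moreover have "raises N (d + Suc (d * length xs)) (p i * tel_plus g k p xs)"
    by (intro raises_mult assms Cons)
  ultimately show ?case by (simp add: raises_add)
qed (simp add: raises_0)

lemma raises_tel_minus:
  assumes "\<And>i. raises N 1 (g i)" "\<And>i. raises N 0 (k i)" "\<And>i. raises N 0 (p i)"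
  shows "raises N 1 (tel_minus g p k xs)"
proof (induction xs)
  case (Cons i xs)
  have "raises N (1 + 0 * length xs) (g i * prod_list (map k xs))"
    by (intro raises_mult assms raises_prod_list)
  moreover have "raises N (0 + 1) (p i * tel_minus g p k xs)"
    by (intro raises_mult assms Cons)
  ultimately show ?case by (simp add: raises_diff)
qed (simp add: raises_0)

lemma raises_prod_list_diff:
  assumes "\<And>i. raises N 0 (k i)" "\<And>i. raises N 0 (k' i)" "\<And>i. raises N 1 (k i - k' i)"
  shows "raises N 1 (prod_list (map k xs) - prod_list (map k' xs))"
proof (induction xs)
  case (Cons i xs)
  have "prod_list (map k (i # xs)) - prod_list (map k' (i # xs))
      = (k i - k' i) * prod_list (map k xs) + k' i * (prod_list (map k xs) - prod_list (map k' xs))"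
    by (simp add: algebra_simps)
  moreover have "raises N (1 + 0 * length xs) ((k i - k' i) * prod_list (map k xs))"
    by (intro raises_mult assms raises_prod_list)
  moreover have "raises N (0 + 1) (k' i * (prod_list (map k xs) - prod_list (map k' xs)))"
    by (intro raises_mult assms Cons)
  ultimately show ?case by (simp add: raises_add)
qed (simp add: raises_0)

text \<open>One generator from \<open>N\<close> comes from \<open>g\<close>, a second one from the
  factor in which the two sums differ.\<close>

lemma raises_tel_minus_diff:
  assumes g: "\<And>i. raises N 1 (g i)" and k: "\<And>i. raises N 0 (k i)" "\<And>i. raises N 0 (k' i)" "\<And>i. raises N 1 (k i - k' i)"
    and p: "\<And>i. raises N 0 (p i)" "\<And>i. raises N 0 (p' i)" "\<And>i. raises N 1 (p i - p' i)"
  shows "raises N 2 (tel_minus g p k xs - tel_minus g p' k' xs)"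
proof (induction xs)
  case (Cons i xs)
  have "tel_minus g p k (i # xs) - tel_minus g p' k' (i # xs)
      = g i * (prod_list (map k xs) - prod_list (map k' xs))
        - p i * (tel_minus g p k xs - tel_minus g p' k' xs) - (p i - p' i) * tel_minus g p' k' xs"
    by (simp add: algebra_simps)
  moreover have "raises N (1 + 1) (g i * (prod_list (map k xs) - prod_list (map k' xs)))"
    by (intro raises_mult raises_prod_list_diff assms)
  moreover have "raises N (0 + 2) (p i * (tel_minus g p k xs - tel_minus g p' k' xs))"
    by (intro raises_mult assms Cons)
  moreover have "raises N (1 + 1) ((p i - p' i) * tel_minus g p' k' xs)"
    by (intro raises_mult raises_tel_minus assms)
  ultimately show ?case by (simp add: raises_diff numeral_2_eq_2)
qed (simp add: raises_0)

lemma op_deg_le_prod_list: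
  "(\<And>i. i \<in> set xs \<Longrightarrow> op_deg_le A (d i) (p i)) \<Longrightarrow> op_deg_le A (\<Sum>i\<leftarrow>xs. d i) (prod_list (map p xs))"
  by (induction xs) (simp_all add: op_deg_le_1 op_deg_le_mult)

lemma op_deg_le_tel_plus:
  assumes "\<And>i. i \<in> set xs \<Longrightarrow> op_deg_le A (d i - 1) (g i)" "\<And>i. i \<in> set xs \<Longrightarrow> op_deg_le A (d i) (k i)"
    "\<And>i. i \<in> set xs \<Longrightarrow> op_deg_le A (d i) (p i)"
  shows "op_deg_le A ((\<Sum>i\<leftarrow>xs. d i) - 1) (tel_plus g k p xs)"
  using assms
proof (induction xs)
  case (Cons i xs)
  have "op_deg_le A ((d i - 1) + (\<Sum>i\<leftarrow>xs. d i)) (g i * prod_list (map k xs))"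
    using Cons.prems by (intro op_deg_le_mult op_deg_le_prod_list) auto
  moreover have "op_deg_le A (d i + ((\<Sum>i\<leftarrow>xs. d i) - 1)) (p i * tel_plus g k p xs)"
    using Cons by (intro op_deg_le_mult) auto
  ultimately show ?case by (simp add: op_deg_le_add algebra_simps)
qed (simp add: op_deg_le_0)

lemma tel_plus_sum:
  "finite I \<Longrightarrow> (\<Sum>j\<in>I. x j * tel_plus (g j) k p xs) = tel_plus (\<lambda>i. \<Sum>j\<in>I. x j * g j i) k p xs"
  if "\<And>i j. p i * x j = x j * p i" for x :: "'j \<Rightarrow> 'm::ring_1"
proof (induction xs)
  case (Cons i xs)
  have "x j * (p i * y) = p i * (x j * y)" for j y using that by (metis mult.assoc)
  then show ?case using Cons
    by (simp add: distrib_left sum.distrib sum_distrib_right sum_distrib_left mult.assoc flip: Cons(1))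
qed simp

text \<open>Moving the odd element \<open>x j\<close> to the front past the factors \<open>p\<close>
  cancels the alternating signs.\<close>

lemma tel_minus_eq_sum:
  fixes x :: "'j \<Rightarrow> 'm::ring_1"
  assumes "finite I" and "\<And>i j. p i * x j = - (x j * p i)"
  shows "tel_minus (\<lambda>i. \<Sum>j\<in>I. x j * g j i) p k xs = (\<Sum>j\<in>I. x j * tel_plus (g j) k p xs)"
proof (induction xs)
  case (Cons i xs)
  have "p i * (x j * y) = - (x j * (p i * y))" for j y
    using assms(2) by (metis mult.assoc minus_mult_left)
  then show ?case using Cons
    by (simp add: distrib_left sum.distrib sum_distrib_right sum_distrib_left mult.assoc sum_negf)
qed simp

text \<open>Products of \<open>CARD('k)\<close> many 1-forms in the generators \<open>\<sigma> k\<close> are multiples of the top form.\<close>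

lemma tel_plus_top:
  fixes \<sigma> :: "'k::finite \<Rightarrow> ('g, 'r::comm_ring_1) fock_op"
  assumes \<sigma>: "\<And>k l. \<sigma> k * \<sigma> l = - (\<sigma> l * \<sigma> k)" "\<And>k. \<sigma> k * \<sigma> k = 0"
    and cs: "distinct cs" "set cs = (UNIV :: 'k set)"
    and forms: "\<And>c. \<exists>m. g c = (\<Sum>r\<in>UNIV. scal (m r) * \<sigma> r)" "\<And>c. \<exists>m. k c = (\<Sum>r\<in>UNIV. scal (m r) * \<sigma> r)"
      "\<And>c. \<exists>m. p c = (\<Sum>r\<in>UNIV. scal (m r) * \<sigma> r)"
  shows "\<exists>s. tel_plus g k p cs = scal s * prod_list (map \<sigma> cs)"
proof -
  define top where "top = prod_list (map \<sigma> cs)"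
  have "\<exists>s. prod_list (map \<phi> us) * tel_plus g k p xs = scal s * top"
    if "us @ xs = cs" "\<And>c. \<exists>m. \<phi> c = (\<Sum>r\<in>UNIV. scal (m r) * \<sigma> r)" for us xs \<phi>
    using that
  proof (induction xs arbitrary: us \<phi>)
    case Nil
    then show ?case by (intro exI[of _ 0]) simp
  next
    case (Cons i xs)
    have dist: "distinct (us @ i # xs)" using Cons.prems cs by simp
    define \<psi> where "\<psi> c = (if c \<in> set us then \<phi> c else if c = i then g i else k c)" for c
    have "\<exists>m. \<psi> c = (\<Sum>r\<in>UNIV. scal (m r) * \<sigma> r)" for c
      using Cons.prems forms by (auto simp: \<psi>_def)
    then have "\<forall>c. \<exists>m. \<psi> c = (\<Sum>r\<in>UNIV. scal (m r) * \<sigma> r)" by blast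
    then obtain M where M: "\<And>c. \<psi> c = (\<Sum>r\<in>UNIV. scal (M c r) * \<sigma> r)" by (rule choice[THEN exE]) blast
    have "prod_list (map \<phi> us) * (g i * prod_list (map k xs)) = prod_list (map \<psi> (us @ i # xs))"
    proof -
      have "map \<psi> us = map \<phi> us" by (auto simp: \<psi>_def)
      moreover have "map \<psi> xs = map k xs" using dist by (auto simp: \<psi>_def)
      moreover have "\<psi> i = g i" using dist by (simp add: \<psi>_def)
      ultimately show ?thesis by (simp del: map_eq_conv)
    qed
    also have "\<dots> = scal (det (\<chi> r c. M c r)) * top"
      unfolding top_def Cons.prems(1) M using prod_list_eq_det[OF \<sigma> cs, of "\<lambda>r c. M c r"] by simp
    finally have 1: "prod_list (map \<phi> us) * (g i * prod_list (map k xs)) = scal (det (\<chi> r c. M c r)) * top" .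
    define \<phi>' where "\<phi>' c = (if c = i then p i else \<phi> c)" for c
    have "map \<phi>' us = map \<phi> us" using dist by (auto simp: \<phi>'_def)
    moreover have "\<phi>' i = p i" by (simp add: \<phi>'_def)
    ultimately have "prod_list (map \<phi> us) * (p i * tel_plus g k p xs) = prod_list (map \<phi>' (us @ [i])) * tel_plus g k p xs"
      by (simp add: mult.assoc del: map_eq_conv)
    moreover have "\<exists>s. prod_list (map \<phi>' (us @ [i])) * tel_plus g k p xs = scal s * top"
      by (rule Cons.IH) (use Cons.prems forms in \<open>auto simp: \<phi>'_def\<close>)
    then obtain s where "prod_list (map \<phi>' (us @ [i])) * tel_plus g k p xs = scal s * top" by blast
    ultimately have "prod_list (map \<phi> us) * tel_plus g k p (i # xs) = scal (det (\<chi> r c. M c r) + s) * top"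
      using 1 by (simp add: distrib_left scal_add distrib_right)
    then show ?case by blast
  qed
  from this[of "[]" cs k] forms show ?thesis by (simp add: top_def)
qed

lemma deg_rel_units: "\<eta> = 1 \<or> \<eta> = - 1 \<Longrightarrow> deg_rel (\<le>) A d p \<Longrightarrow> deg_rel (\<le>) A d (\<eta> * p)"
  for p :: "('v, 'a::comm_ring_1) mpoly"
  by (auto simp: deg_rel_uminus)

lemma sum_Plus_UNIV: "(\<Sum>x\<in>UNIV. f x) = (\<Sum>k\<in>UNIV. f (Inl k)) + (\<Sum>k\<in>UNIV. f (Inr k))"
  for f :: "'a::finite + 'b::finite \<Rightarrow> 'c::comm_monoid_add"
  by (simp add: UNIV_Plus_UNIV[symmetric] sum.Plus del: UNIV_Plus_UNIV)

lemma scal_top_cancel: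
  assumes "distinct ks" "scal u * prod_list (map cre ks) = scal v * prod_list (map cre ks)"
  shows "u = v"
proof -
  obtain \<eta> :: 'b where \<eta>: "\<eta> = 1 \<or> \<eta> = - 1"
    "\<And>S. op_apply (prod_list (map cre ks)) vac S = (if S = set ks then \<eta> else 0)"
    using coeff_prod_cre[OF assms(1)] by blast
  have "coeff (set ks) (scal u * prod_list (map cre ks)) = coeff (set ks) (scal v * prod_list (map cre ks))"
    using assms(2) by simp
  then show ?thesis using \<eta> by (auto simp: coeff_scal_mult coeff_def)
qed

text \<open>In the application \<open>zx\<close> is x - y, \<open>zy\<close> is y - z, and
  \<open>a\<close>, \<open>b\<close>, \<open>c\<close> are difference derivatives between (x,y),
  (y,z), (x,z). Moving x or z to y turns \<open>det c\<close> into \<open>det b\<close> or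
  \<open>det a\<close>, so \<open>w\<close> and \<open>w'\<close> are difference vectors of
  \<open>det c\<close> in one of its two points. The determinants with a replaced column then
  compute the two bracketings of a triple product, and \<open>\<kappa>\<close> has low degree in the
  middle variables \<open>Y\<close>.\<close>

lemma exchange_det:
  fixes zx zy :: "'k::finite \<Rightarrow> ('v, 'a::comm_ring_1) mpoly" and a b c :: "'k \<Rightarrow> 'k \<Rightarrow> ('v, 'a) mpoly"
    and G :: "'k \<Rightarrow> 'k \<Rightarrow> 'k \<Rightarrow> ('v, 'a) mpoly" and o' :: 'k
  assumes G1: "\<And>l i. (\<Sum>k\<in>UNIV. zx k * G k l i) = c l i - b l i"
    and G2: "\<And>k i. (\<Sum>l\<in>UNIV. zy l * G k l i) = a k i - c k i"
    and t: "\<And>i. (\<Sum>k\<in>UNIV. zx k * a k i) = t i" "\<And>i. (\<Sum>k\<in>UNIV. zy k * b k i) = t' i"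
      "\<And>i. (\<Sum>k\<in>UNIV. (zx k + zy k) * c k i) = t i + t' i"
    and c_deg: "\<And>k i. deg_rel (\<le>) Y 0 (c k i)"
    and a_deg: "\<And>k i. i \<noteq> o' \<Longrightarrow> deg_rel (\<le>) Y (d i - 1) (a k i)"
    and b_deg: "\<And>k i. i \<noteq> o' \<Longrightarrow> deg_rel (\<le>) Y (d i - 1) (b k i)"
    and G_deg: "\<And>k l i. i \<noteq> o' \<Longrightarrow> deg_rel (\<le>) Y (d i - 2) (G k l i)"
  shows "\<exists>w w' q q' \<kappa>.
    (\<Sum>k\<in>UNIV. zx k * w k) = det (\<chi> k i. c k i) - det (\<chi> k i. b k i) \<and>
    (\<Sum>k\<in>UNIV. zy k * w' k) = det (\<chi> k i. a k i) - det (\<chi> k i. c k i) \<and>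
    deg_rel (\<le>) Y ((\<Sum>i\<in>UNIV - {o'}. d i - 1) - 1) \<kappa> \<and>
    det (\<chi> k i. if i = o' then w k else a k i) - det (\<chi> k i. if i = o' then w' k else b k i)
      = (\<Sum>i\<in>UNIV. t i * q i) + (\<Sum>i\<in>UNIV. t' i * q' i) + \<kappa>"
proof -
  obtain xs where xs: "distinct xs" "set xs = UNIV - {o'}"
    using finite_distinct_list[of "UNIV - {o'}"] by auto
  define cs where "cs = xs @ [o']"
  have cs: "distinct cs" "set cs = UNIV" using xs by (auto simp: cs_def)
  have card: "CARD('k) = Suc (length xs)"
    using distinct_card[OF cs(1)] cs(2) by (simp add: cs_def)
  \<comment> \<open>Four families of generators: two are paired with \<open>zx\<close> and
    \<open>zy\<close>, and two auxiliary ones carry \<open>t\<close> and \<open>t'\<close>.\<close>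
  define s where "s = case_sum (case_sum zx zy) (case_sum t t')"
  define \<iota> :: "(('k + 'k) + ('k + 'k), ('v, 'a) mpoly) fock_op" where "\<iota> = contr s"
  define e :: "'k \<Rightarrow> (('k + 'k) + ('k + 'k), ('v, 'a) mpoly) fock_op" where "e k = cre (Inl (Inl k))" for k
  define e' :: "'k \<Rightarrow> (('k + 'k) + ('k + 'k), ('v, 'a) mpoly) fock_op" where "e' k = cre (Inl (Inr k))" for k
  define \<delta> where "\<delta> i j = (if j = i then - 1 else 0 :: ('v, 'a) mpoly)" for i j :: 'k
  define va where "va i = (case_sum (case_sum (\<lambda>k. a k i) (\<lambda>_. 0)) (case_sum (\<delta> i) (\<lambda>_. 0))
      :: ('k + 'k) + ('k + 'k) \<Rightarrow> ('v, 'a) mpoly)" for i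
  define vb where "vb i = (case_sum (case_sum (\<lambda>_. 0) (\<lambda>k. b k i)) (case_sum (\<lambda>_. 0) (\<delta> i))
      :: ('k + 'k) + ('k + 'k) \<Rightarrow> ('v, 'a) mpoly)" for i
  define vc where "vc i = case_sum (case_sum (\<lambda>k. c k i) (\<lambda>k. c k i)) (case_sum (\<delta> i) (\<delta> i))" for i
  \<comment> \<open>The 2-form joins a generator of the first family to one of the second.
    Contraction by \<open>zx\<close> is governed by \<open>G1\<close> and contraction by
    \<open>zy\<close> by \<open>G2\<close>; together they give
    \<open>fc i - fa i - fb i\<close>.\<close>
  define wG where "wG i x y = (case x of Inl (Inl k) \<Rightarrow> (case y of Inl (Inr l) \<Rightarrow> G k l i | _ \<Rightarrow> 0) | _ \<Rightarrow> 0)"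
    for i and x y :: "('k + 'k) + ('k + 'k)"
  define fa fb fc fG where "fa i = form (va i)" and "fb i = form (vb i)" and "fc i = form (vc i)"
    and "fG i = form2 (wG i)" for i
  have closed: "\<iota> * form v = - (form v * \<iota>)" if "(\<Sum>k\<in>UNIV. s k * v k) = 0" for v
    using contr_form[of s v] that by (simp add: \<iota>_def eq_neg_iff_add_eq_0)
  have sums: "(\<Sum>k\<in>UNIV. s k * va i k) = 0" "(\<Sum>k\<in>UNIV. s k * vb i k) = 0" "(\<Sum>k\<in>UNIV. s k * vc i k) = 0" for i
    using t(3)[of i] by (simp_all add: s_def va_def vb_def vc_def \<delta>_def sum_Plus_UNIV t(1,2) if_distrib[of "(*) _"]
        distrib_right sum.distrib cong: if_cong)
  have G_bracket: "\<iota> * fG i - fG i * \<iota> = fc i - fa i - fb i" for i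
  proof -
    have "vc i m - va i m - vb i m = (\<Sum>l\<in>UNIV. s l * (wG i l m - wG i m l))" for m
    proof (cases m)
      case (Inl n)
      then show ?thesis
        using G1[of _ i] G2[of _ i] by (cases n) (simp_all add: s_def va_def vb_def vc_def wG_def sum_Plus_UNIV sum_negf)
    next
      case (Inr n)
      then show ?thesis by (cases n) (simp_all add: s_def va_def vb_def vc_def wG_def sum_Plus_UNIV \<delta>_def)
    qed
    from contr_pair[OF this] show ?thesis
      unfolding \<iota>_def fG_def fa_def fb_def fc_def by (simp add: form_diff)
  qed
  have "\<exists>Q. \<iota> * Q - Q * \<iota> = fG i * (fc i - fa i - fb i)" for i
    using divided_square_form2[of s "wG i"] unfolding G_bracket[symmetric] fG_def \<iota>_def .
  then have "\<forall>i. \<exists>Q. \<iota> * Q - Q * \<iota> = fG i * (fc i - fa i - fb i)" by blast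
  then obtain fQ where fQ: "\<And>i. \<iota> * fQ i - fQ i * \<iota> = fG i * (fc i - fa i - fb i)"
    by (rule choice[THEN exE]) blast
  interpret exchange \<iota> fa fb fc fG fQ
    by (unfold_locales;
        (rule G_bracket fQ | (unfold fa_def fb_def fc_def; (rule closed[OF sums(1)] closed[OF sums(2)]
          closed[OF sums(3)] form_square form_anticommute | (unfold fG_def, rule form_form2_comm)))))
  \<comment> \<open>The parts that are visible at \<open>E\<close>: the auxiliary entries are
    dropped, and \<open>c\<close> is split into its two halves.\<close>
  define a0 where "a0 i = (\<Sum>k\<in>UNIV. scal (a k i) * e k)" for i
  define b0 where "b0 i = (\<Sum>k\<in>UNIV. scal (b k i) * e' k)" for i
  define c1 where "c1 i = (\<Sum>k\<in>UNIV. scal (c k i) * e k)" for i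
  define c2 where "c2 i = (\<Sum>k\<in>UNIV. scal (c k i) * e' k)" for i
  define gx where "gx k i = (\<Sum>l\<in>UNIV. scal (G k l i) * e' l)" for k i
  define gy where "gy l i = (\<Sum>k\<in>UNIV. scal (- G k l i) * e k)" for l i
  define E :: "(('k + 'k) + ('k + 'k)) set" where "E = range Inl"
  define Ex :: "(('k + 'k) + ('k + 'k)) set" where "Ex = range (Inl \<circ> Inl)"
  define Ey :: "(('k + 'k) + ('k + 'k)) set" where "Ey = range (Inl \<circ> Inr)"
  have cardE: "card Ex = Suc (length xs)" "card Ey = Suc (length xs)"
    unfolding Ex_def Ey_def by (simp_all add: card_image inj_on_def card)
  have e_anti: "e k * e l = - (e l * e k)" "e' k * e' l = - (e' l * e' k)" "e k * e' l = - (e' l * e k)" for k l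
    unfolding e_def e'_def by (rule cre_anticommute)+
  have e_sq: "e k * e k = 0" "e' k * e' k = 0" for k
    unfolding e_def e'_def by (rule cre_square)+
  have agree: "agree_on E (fa i) (a0 i)" "agree_on E (fb i) (b0 i)" "agree_on E (fc i) (c1 i + c2 i)" "agree_on E (fG i) (fG i)" for i
  proof -
    have "a0 i = form (case_sum (case_sum (\<lambda>k. a k i) (\<lambda>_. 0)) (\<lambda>_. 0))"
      "b0 i = form (case_sum (case_sum (\<lambda>_. 0) (\<lambda>k. b k i)) (\<lambda>_. 0))"
      "c1 i + c2 i = form (case_sum (case_sum (\<lambda>k. c k i) (\<lambda>k. c k i)) (\<lambda>_. 0))"
      by (simp_all add: form_def a0_def b0_def c1_def c2_def e_def e'_def sum_Plus_UNIV)
    then show "agree_on E (fa i) (a0 i)" "agree_on E (fb i) (b0 i)" "agree_on E (fc i) (c1 i + c2 i)"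
      by (auto simp: E_def fa_def fb_def fc_def va_def vb_def vc_def intro!: agree_on_form)
    show "agree_on E (fG i) (fG i)"
      unfolding fG_def by (intro agree_on_sum agree_on_mult agree_on_scal agree_on_cre)
  qed
  \<comment> \<open>The generator of the first or of the second family is pulled out in front of the
    2-form, the latter at the cost of the sign in \<open>gy\<close>.\<close>
  have fG_x: "fG i = (\<Sum>k\<in>UNIV. e k * gx k i)" for i
    by (simp add: fG_def wG_def sum_Plus_UNIV gx_def e_def e'_def sum_distrib_left cre_scal)
  have fG_y: "fG i = (\<Sum>l\<in>UNIV. e' l * gy l i)" for i
    unfolding fG_x gx_def gy_def sum_distrib_left
    by (subst sum.swap) (simp add: e_anti(3) scal_uminus scal_left_commute[of "e _"] scal_left_commute[of "e' _"] sum_negf)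
  have raises_e: "raises Ex 1 (e k)" "raises Ey 1 (e' k)" "raises Ex 0 (e' k)" "raises Ey 0 (e k)" for k
    using raises_cre[of Ex "Inl (Inl k)"] raises_cre[of Ey "Inl (Inr k)"] raises_cre[of Ex "Inl (Inr k)"] raises_cre[of Ey "Inl (Inl k)"]
    by (auto simp: e_def e'_def Ex_def Ey_def image_iff)
  have raises_scal_mult: "raises N d (scal u * x)" if "raises N d x" for N d u and x :: "(('k + 'k) + ('k + 'k), ('v, 'a) mpoly) fock_op"
    using raises_mult[OF raises_scal that, of u] by simp
  have raises_0x: "raises Ex 0 (a0 i)" "raises Ex 0 (b0 i)" "raises Ex 0 (c1 i)" "raises Ex 0 (c2 i)"
    and raises_1x: "raises Ex 1 (a0 i)" "raises Ex 1 (c1 i)"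
    and raises_0y: "raises Ey 0 (a0 i)" "raises Ey 0 (b0 i)" "raises Ey 0 (c1 i)" "raises Ey 0 (c2 i)"
    and raises_1y: "raises Ey 1 (b0 i)" "raises Ey 1 (c2 i)" for i
    unfolding a0_def b0_def c1_def c2_def
    by (intro raises_sum raises_scal_mult raises_e raises_mono[OF raises_e(1)] raises_mono[OF raises_e(2)] zero_le)+
  have raises_c: "raises Ex 0 (c1 i + c2 i)" "raises Ey 0 (c1 i + c2 i)" "raises Ex 1 (c1 i + c2 i - c2 i)"
    "raises Ey 1 (c1 i + c2 i - c1 i)" for i
    using raises_add[OF raises_0x(3,4)] raises_add[OF raises_0y(3,4)] raises_1x(2) raises_1y(2) by simp_all
  have raises_G: "raises Ex 1 (fG i)" "raises Ey 1 (fG i)" for i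
  proof -
    have "raises Ex (1 + 0) (e k * gx k i)" for k
      unfolding gx_def by (intro raises_mult raises_e raises_sum raises_scal_mult)
    then show "raises Ex 1 (fG i)" unfolding fG_x by (intro raises_sum) simp
    have "raises Ey (1 + 0) (e' k * gy k i)" for k
      unfolding gy_def by (intro raises_mult raises_e raises_sum raises_scal_mult)
    then show "raises Ey 1 (fG i)" unfolding fG_y by (intro raises_sum) simp
  qed

  define top1 where "top1 = prod_list (map e cs)"
  define top2 where "top2 = prod_list (map e' cs)"
  have top1: "top1 = prod_list (map cre (map (Inl \<circ> Inl) cs))"
    and top2: "top2 = prod_list (map cre (map (Inl \<circ> Inr) cs))"
    unfolding top1_def top2_def by (rule arg_cong[of _ _ prod_list], simp add: e_def e'_def)+
  have top1_cancel: "scal u * top1 = scal v * top1 \<Longrightarrow> u = v"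
    and top2_cancel: "scal u * top2 = scal v * top2 \<Longrightarrow> u = v" for u v
    unfolding top1 top2 by (erule scal_top_cancel[rotated], simp add: distinct_map cs(1) inj_on_def)+
  have det1: "prod_list (map (\<lambda>i. \<Sum>r\<in>UNIV. scal (M r i) * e r) cs) = scal (det (\<chi> r i. M r i)) * top1"
    and det2: "prod_list (map (\<lambda>i. \<Sum>r\<in>UNIV. scal (M r i) * e' r) cs) = scal (det (\<chi> r i. M r i)) * top2" for M
    unfolding top1_def top2_def by (rule prod_list_eq_det[OF _ _ cs], (rule e_anti e_sq)+)+
  have "a0 = (\<lambda>i. \<Sum>k\<in>UNIV. scal (a k i) * e k)" "b0 = (\<lambda>i. \<Sum>k\<in>UNIV. scal (b k i) * e' k)"
    "c1 = (\<lambda>i. \<Sum>k\<in>UNIV. scal (c k i) * e k)" "c2 = (\<lambda>i. \<Sum>k\<in>UNIV. scal (c k i) * e' k)"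
    by (simp_all add: fun_eq_iff a0_def b0_def c1_def c2_def)
  then have prods: "prod_list (map a0 cs) = scal (det (\<chi> k i. a k i)) * top1"
    "prod_list (map b0 cs) = scal (det (\<chi> k i. b k i)) * top2"
    "prod_list (map c1 cs) = scal (det (\<chi> k i. c k i)) * top1"
    "prod_list (map c2 cs) = scal (det (\<chi> k i. c k i)) * top2"
    using det1[of a] det2[of b] det1[of c] det2[of c] by simp_all
  define Exy where "Exy = map (Inl \<circ> Inl) cs @ (map (Inl \<circ> Inr) cs :: (('k + 'k) + ('k + 'k)) list)"
  have "distinct Exy"
    using cs(1) by (auto simp: Exy_def distinct_map inj_on_def)
  have "set Exy = E"
    unfolding Exy_def E_def using cs(2) by (auto simp: image_iff) (metis sum.exhaust)
  obtain \<eta> :: "('v, 'a) mpoly" where \<eta>: "\<eta> = 1 \<or> \<eta> = - 1" and "\<And>S. op_apply (prod_list (map cre Exy)) vac S = (if S = set Exy then \<eta> else 0)"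
    using coeff_prod_cre[OF \<open>distinct Exy\<close>] by blast
  then have coeff_top: "coeff E (top1 * top2) = \<eta>"
    using \<open>set Exy = E\<close> by (simp add: coeff_def top1 top2 Exy_def)

  \<comment> \<open>There is one form in the generators \<open>e'\<close> for each column, so the
    sum is a multiple of \<open>top2\<close>; the multiplier defines \<open>w\<close>.\<close>
  have "\<exists>w. tel_plus (gx k) b0 c2 cs = scal w * top2" for k
    unfolding top2_def
    by (rule tel_plus_top[OF e_anti(2) e_sq(2) cs]) (auto simp: gx_def b0_def c2_def)
  then have "\<forall>k. \<exists>w. tel_plus (gx k) b0 c2 cs = scal w * top2" by blast
  then obtain w where w: "\<And>k. tel_plus (gx k) b0 c2 cs = scal (w k) * top2"
    by (rule choice[THEN exE]) blast
  have "\<exists>w. tel_plus (gy k) c1 a0 cs = scal w * top1" for k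
    unfolding top1_def
    by (rule tel_plus_top[OF e_anti(1) e_sq(1) cs]) (auto simp: gy_def a0_def c1_def)
  then have "\<forall>k. \<exists>w. tel_plus (gy k) c1 a0 cs = scal w * top1" by blast
  then obtain wy where wy: "\<And>k. tel_plus (gy k) c1 a0 cs = scal (wy k) * top1"
    by (rule choice[THEN exE]) blast
  \<comment> \<open>The sign compensates the one in \<open>gy\<close>.\<close>
  define w' where "w' k = - wy k" for k

  \<comment> \<open>Pairing with \<open>zx\<close> turns \<open>gx\<close> into the difference
    \<open>c2 i - b0 i\<close>, and the sum telescopes to a difference of two products, that is, of
    two determinants.\<close>
  have w_eq: "(\<Sum>k\<in>UNIV. zx k * w k) = det (\<chi> k i. c k i) - det (\<chi> k i. b k i)"
  proof (rule top2_cancel)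
    have gxs: "(\<Sum>k\<in>UNIV. scal (zx k) * gx k i) = c2 i - b0 i" for i
    proof -
      have "(\<Sum>k\<in>UNIV. scal (zx k) * gx k i) = (\<Sum>l\<in>UNIV. \<Sum>k\<in>UNIV. scal (zx k * G k l i) * e' l)"
        unfolding gx_def sum_distrib_left by (subst sum.swap) (simp add: scal_mult mult.assoc)
      also have "\<dots> = (\<Sum>l\<in>UNIV. scal (c l i - b l i) * e' l)"
        by (simp add: G1[symmetric] scal_sum sum_distrib_right)
      finally show ?thesis by (simp add: c2_def b0_def scal_diff left_diff_distrib sum_subtractf)
    qed
    have "scal (\<Sum>k\<in>UNIV. zx k * w k) * top2 = (\<Sum>k\<in>UNIV. scal (zx k) * tel_plus (gx k) b0 c2 cs)"
      by (simp add: w scal_sum scal_mult sum_distrib_right mult.assoc)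
    also have "\<dots> = tel_plus (\<lambda>i. c2 i - b0 i) b0 c2 cs"
      unfolding gxs[symmetric] by (rule tel_plus_sum) (simp_all add: scal_commute)
    also have "\<dots> = scal (det (\<chi> k i. c k i) - det (\<chi> k i. b k i)) * top2"
      unfolding tel_plus_telescope prods by (simp add: scal_diff left_diff_distrib)
    finally show "scal (\<Sum>k\<in>UNIV. zx k * w k) * top2 = scal (det (\<chi> k i. c k i) - det (\<chi> k i. b k i)) * top2" .
  qed
  have w'_eq: "(\<Sum>k\<in>UNIV. zy k * w' k) = det (\<chi> k i. a k i) - det (\<chi> k i. c k i)"
  proof (rule top1_cancel)
    have gys: "(\<Sum>l\<in>UNIV. scal (- zy l) * gy l i) = a0 i - c1 i" for i
    proof -
      have "(\<Sum>l\<in>UNIV. scal (- zy l) * gy l i) = (\<Sum>k\<in>UNIV. \<Sum>l\<in>UNIV. scal (zy l * G k l i) * e k)"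
        unfolding gy_def sum_distrib_left by (subst sum.swap) (simp add: scal_mult scal_uminus mult.assoc)
      also have "\<dots> = (\<Sum>k\<in>UNIV. scal (a k i - c k i) * e k)"
        by (simp add: G2[symmetric] scal_sum sum_distrib_right)
      finally show ?thesis by (simp add: a0_def c1_def scal_diff left_diff_distrib sum_subtractf)
    qed
    have "scal (\<Sum>k\<in>UNIV. zy k * w' k) * top1 = (\<Sum>k\<in>UNIV. scal (- zy k) * tel_plus (gy k) c1 a0 cs)"
      by (simp add: wy w'_def scal_sum scal_mult scal_uminus sum_distrib_right mult.assoc sum_negf)
    also have "\<dots> = tel_plus (\<lambda>i. a0 i - c1 i) c1 a0 cs"
      unfolding gys[symmetric] by (rule tel_plus_sum) (simp_all add: scal_commute)
    also have "\<dots> = scal (det (\<chi> k i. a k i) - det (\<chi> k i. c k i)) * top1"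
      unfolding tel_plus_telescope prods by (simp add: scal_diff left_diff_distrib)
    finally show "scal (\<Sum>k\<in>UNIV. zy k * w' k) * top1 = scal (det (\<chi> k i. a k i) - det (\<chi> k i. c k i)) * top1" .
  qed

  define Da where "Da = det (\<chi> k i. if i = o' then w k else a k i)"
  define Db where "Db = det (\<chi> k i. if i = o' then w' k else b k i)"
  have Da: "coeff E (prod_list (map fa xs) * tel_minus fG fc fb cs) = \<eta> * Da"
  proof -
    have "coeff E (prod_list (map fa xs) * tel_minus fG fc fb cs)
        = coeff E (prod_list (map a0 xs) * tel_minus fG (\<lambda>i. c1 i + c2 i) b0 cs)"
      by (intro agree_on_coeff agree_on_mult agree_on_prod_list agree_on_tel_minus agree)
    also have "\<dots> = coeff E (prod_list (map a0 xs) * tel_minus fG c2 b0 cs)"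
    proof -
      \<comment> \<open>The factors \<open>a0\<close> use up all but one of the generators
        \<open>e\<close> and \<open>fG\<close> uses the last, so terms with a further one from
        \<open>c1\<close> vanish and \<open>c1 + c2\<close> may be replaced by
        \<open>c2\<close>.\<close>
      have "raises Ex (1 * length xs + 2)
          (prod_list (map a0 xs) * (tel_minus fG (\<lambda>i. c1 i + c2 i) b0 cs - tel_minus fG c2 b0 cs))"
        by (intro raises_mult raises_prod_list raises_tel_minus_diff raises_0x raises_1x raises_c raises_G)
          (simp add: raises_0)
      from raises_coeff[OF this] show ?thesis by (simp add: cardE right_diff_distrib coeff_diff)
    qed
    also have "tel_minus fG c2 b0 cs = (\<Sum>k\<in>UNIV. scal (w k) * e k) * top2"
    proof -
      have "c2 i * e k = - (e k * c2 i)" for i k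
        by (simp add: c2_def sum_distrib_left sum_distrib_right sum_negf mult.assoc e_anti(3)
            scal_left_commute[of "e _"])
      then show ?thesis
        unfolding fG_x by (subst tel_minus_eq_sum) (simp_all add: w sum_distrib_right scal_left_commute[of "e _"] mult.assoc)
    qed
    also have "prod_list (map a0 xs) * ((\<Sum>k\<in>UNIV. scal (w k) * e k) * top2) = scal Da * (top1 * top2)"
    proof -
      have "map (\<lambda>i. \<Sum>r\<in>UNIV. scal (if i = o' then w r else a r i) * e r) xs = map a0 xs"
        using xs(2) by (auto simp: a0_def)
      then have "prod_list (map a0 xs) * (\<Sum>k\<in>UNIV. scal (w k) * e k)
          = prod_list (map (\<lambda>i. \<Sum>r\<in>UNIV. scal (if i = o' then w r else a r i) * e r) cs)"
        by (simp add: cs_def del: map_eq_conv)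
      then show ?thesis unfolding det1 Da_def by (simp flip: mult.assoc)
    qed
    finally show ?thesis by (simp add: coeff_scal_mult coeff_top mult.commute)
  qed
  have Db: "coeff E (tel_minus fG fa fc cs * prod_list (map fb xs)) = \<eta> * Db"
  proof -
    have "coeff E (tel_minus fG fa fc cs * prod_list (map fb xs))
        = coeff E (tel_minus fG a0 (\<lambda>i. c1 i + c2 i) cs * prod_list (map b0 xs))"
      by (intro agree_on_coeff agree_on_mult agree_on_prod_list agree_on_tel_minus agree)
    also have "\<dots> = coeff E (tel_minus fG a0 c1 cs * prod_list (map b0 xs))"
    proof -
      have "raises Ey (2 + 1 * length xs)
          ((tel_minus fG a0 (\<lambda>i. c1 i + c2 i) cs - tel_minus fG a0 c1 cs) * prod_list (map b0 xs))"
        by (intro raises_mult raises_prod_list raises_tel_minus_diff raises_0y raises_1y raises_c raises_G)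
          (simp add: raises_0)
      from raises_coeff[OF this] show ?thesis by (simp add: cardE left_diff_distrib coeff_diff)
    qed
    also have "tel_minus fG a0 c1 cs = (\<Sum>k\<in>UNIV. scal (wy k) * e' k) * top1"
    proof -
      have "a0 i * e' k = - (e' k * a0 i)" for i k
        by (simp add: a0_def sum_distrib_left sum_distrib_right sum_negf mult.assoc e_anti(3)
            scal_left_commute[of "e' _"])
      then show ?thesis
        unfolding fG_y by (subst tel_minus_eq_sum) (simp_all add: wy sum_distrib_right scal_left_commute[of "e' _"] mult.assoc)
    qed
    also have "(\<Sum>k\<in>UNIV. scal (wy k) * e' k) * top1 * prod_list (map b0 xs) = scal Db * (top1 * top2)"
    proof -
      \<comment> \<open>The odd factor in front is moved past \<open>top1\<close> and the factors
        \<open>b0\<close> to the end, which is the place of column \<open>o'\<close>.\<close>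
      define \<omega> where "\<omega> = (\<Sum>k\<in>UNIV. scal (w' k) * e' k)"
      have \<omega>: "(\<Sum>k\<in>UNIV. scal (wy k) * e' k) = - \<omega>"
        by (simp add: \<omega>_def w'_def scal_uminus sum_negf)
      have "e k * \<omega> = - (\<omega> * e k)" for k
        by (simp add: \<omega>_def sum_distrib_left sum_distrib_right sum_negf mult.assoc e_anti(3) scal_left_commute[of "e _"])
      then have 1: "top1 * \<omega> = (- 1) ^ Suc (length xs) * (\<omega> * top1)"
        unfolding top1_def using anticommute_prod_list_map[of e \<omega> cs] by (simp add: cs_def)
      have "e' k * \<omega> = - (\<omega> * e' k)" for k
        by (simp add: \<omega>_def sum_distrib_left sum_distrib_right sum_negf mult.assoc e_anti(2)[of k] scal_left_commute[of "e' _"])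
      then have "b0 i * \<omega> = - (\<omega> * b0 i)" for i
        by (simp add: b0_def sum_distrib_left sum_distrib_right sum_negf mult.assoc scal_left_commute[of \<omega>])
      then have 2: "prod_list (map b0 xs) * \<omega> = (- 1) ^ length xs * (\<omega> * prod_list (map b0 xs))"
        by (rule anticommute_prod_list_map)
      have "map (\<lambda>i. \<Sum>r\<in>UNIV. scal (if i = o' then w' r else b r i) * e' r) xs = map b0 xs"
        using xs(2) by (auto simp: b0_def)
      then have "prod_list (map b0 xs) * \<omega>
          = prod_list (map (\<lambda>i. \<Sum>r\<in>UNIV. scal (if i = o' then w' r else b r i) * e' r) cs)"
        by (simp add: cs_def \<omega>_def del: map_eq_conv)
      then have 3: "top1 * (prod_list (map b0 xs) * \<omega>) = scal Db * (top1 * top2)"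
        unfolding det2 Db_def by (simp add: scal_left_commute[of top1])
      have "- \<omega> * top1 * prod_list (map b0 xs) = top1 * (prod_list (map b0 xs) * \<omega>)"
        unfolding 2 by (cases "even (length xs)") (use 1 in \<open>simp_all flip: mult.assoc\<close>)
      then show ?thesis unfolding \<omega> 3 .
    qed
    finally show ?thesis by (simp add: coeff_scal_mult coeff_top mult.commute)
  qed

  obtain u where u: "u = 1 \<or> u = - 1"
    and exact: "comm_exact \<iota> (H (xs @ [o']) * prod_list (map fb xs) - prod_list (map fa xs) * H' (xs @ [o'])
      - u * (W xs * fc o' - V xs * fa o'))"
    using exchange_unfolded[of xs o'] by blast
  define \<kappa>0 where "\<kappa>0 = coeff E (W xs * fc o')"
  \<comment> \<open>Each position contributes an \<open>a0\<close>; \<open>fG\<close> and the last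
    factor contribute one more generator \<open>e\<close> each, which exceeds their number.\<close>
  have V0: "coeff E (V xs * fa o') = 0"
  proof -
    have "coeff E (V xs * fa o') = coeff E (tel_plus (\<lambda>i. fG i * a0 i) (\<lambda>i. a0 i * b0 i) (\<lambda>i. a0 i * (c1 i + c2 i)) xs * a0 o')"
      by (intro agree_on_coeff agree_on_mult agree_on_tel_plus agree)
    moreover
    have "raises Ex (Suc (1 * length xs) + 1) (tel_plus (\<lambda>i. fG i * a0 i) (\<lambda>i. a0 i * b0 i) (\<lambda>i. a0 i * (c1 i + c2 i)) xs * a0 o')"
    proof (intro raises_mult[of _ "Suc (1 * length xs)"] raises_tel_plus raises_1x)
      fix i
      show "raises Ex (Suc 1) (fG i * a0 i)" using raises_mult[OF raises_G(1) raises_1x(1), of i i] by simp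
      show "raises Ex 1 (a0 i * b0 i)" using raises_mult[OF raises_1x(1) raises_0x(2), of i i] by simp
      show "raises Ex 1 (a0 i * (c1 i + c2 i))" using raises_mult[OF raises_1x(1) raises_c(1), of i i] by simp
    qed
    from raises_coeff[OF this, of E]
    have "coeff E (tel_plus (\<lambda>i. fG i * a0 i) (\<lambda>i. a0 i * b0 i) (\<lambda>i. a0 i * (c1 i + c2 i)) xs * a0 o') = 0"
      by (simp add: cardE)
    ultimately show ?thesis by simp
  qed
  \<comment> \<open>The entries of \<open>c\<close> are free of \<open>Y\<close>. Each index
    \<open>i\<close> contributes degree at most \<open>d i - 1\<close>, and at the single position
    of \<open>fG\<close> only \<open>d i - 2\<close>.\<close>
  have \<kappa>0: "deg_rel (\<le>) Y ((\<Sum>i\<in>UNIV - {o'}. d i - 1) - 1) \<kappa>0"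
  proof -
    have "\<kappa>0 = coeff E (tel_plus (\<lambda>i. fG i * (c1 i + c2 i)) (\<lambda>i. (c1 i + c2 i) * b0 i) (\<lambda>i. a0 i * (c1 i + c2 i)) xs * (c1 o' + c2 o'))"
      unfolding \<kappa>0_def by (intro agree_on_coeff agree_on_mult agree_on_tel_plus agree)
    moreover have "op_deg_le Y (((\<Sum>i\<leftarrow>xs. d i - 1) - 1) + 0)
      (tel_plus (\<lambda>i. fG i * (c1 i + c2 i)) (\<lambda>i. (c1 i + c2 i) * b0 i) (\<lambda>i. a0 i * (c1 i + c2 i)) xs * (c1 o' + c2 o'))"
    proof -
      have sc: "op_deg_le Y m (scal x * cre k)" if "deg_rel (\<le>) Y m x" for m x and k :: "('k + 'k) + ('k + 'k)"
        using op_deg_le_mult[OF op_deg_le_scal[OF that] op_deg_le_cre] by simp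
      have c0: "op_deg_le Y 0 (c1 i + c2 i)" for i
        unfolding c1_def c2_def e_def e'_def by (intro op_deg_le_add op_deg_le_sum sc c_deg)
      have *: "op_deg_le Y (d i - 1) (a0 i)" "op_deg_le Y (d i - 1) (b0 i)" "op_deg_le Y (d i - 2) (fG i)" if "i \<in> set xs" for i
      proof -
        have i: "i \<noteq> o'" using that xs(2) by auto
        show "op_deg_le Y (d i - 1) (a0 i)" "op_deg_le Y (d i - 1) (b0 i)"
          unfolding a0_def b0_def e_def e'_def by (intro op_deg_le_sum sc a_deg b_deg i)+
        have "op_deg_le Y (0 + (d i - 2)) (e k * gx k i)" for k
          unfolding e_def e'_def gx_def by (intro op_deg_le_mult op_deg_le_cre op_deg_le_sum sc G_deg i)
        then show "op_deg_le Y (d i - 2) (fG i)" unfolding fG_x by (intro op_deg_le_sum) simp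
      qed
      show ?thesis
      proof (intro op_deg_le_mult op_deg_le_tel_plus c0)
        fix i assume "i \<in> set xs"
        note * = *[OF this]
        show "op_deg_le Y (d i - 1 - 1) (fG i * (c1 i + c2 i))" using op_deg_le_mult[OF *(3) c0, of i] by simp
        show "op_deg_le Y (d i - 1) ((c1 i + c2 i) * b0 i)" using op_deg_le_mult[OF c0 *(2), of i] by simp
        show "op_deg_le Y (d i - 1) (a0 i * (c1 i + c2 i))" using op_deg_le_mult[OF *(1) c0, of i] by simp
      qed
    qed
    moreover have "(\<Sum>i\<leftarrow>xs. d i - 1) = (\<Sum>i\<in>UNIV - {o'}. d i - 1)"
      using xs by (simp add: sum_list_distinct_conv_sum_set)
    ultimately show ?thesis using op_deg_le_coeff by fastforce
  qed
  obtain q where q: "coeff E (H (xs @ [o']) * prod_list (map fb xs) - prod_list (map fa xs) * H' (xs @ [o'])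
      - u * (W xs * fc o' - V xs * fa o')) = (\<Sum>k\<in>-E. s k * q k)"
    using comm_exact_coeff exact unfolding \<iota>_def by blast
  have "- E = range Inr" unfolding E_def by (auto simp: image_iff) (metis sum.exhaust)
  then have q': "(\<Sum>k\<in>-E. s k * q k) = (\<Sum>i\<in>UNIV. t i * q (Inr (Inl i))) + (\<Sum>i\<in>UNIV. t' i * q (Inr (Inr i)))"
    by (simp add: sum.reindex sum_Plus_UNIV s_def)
  \<comment> \<open>The same sign as the operator \<open>u\<close>, now as a polynomial.\<close>
  define u' :: "('v, 'a) mpoly" where "u' = (if u = 1 then 1 else - 1)"
  have "coeff E (u * (W xs * fc o' - V xs * fa o')) = u' * \<kappa>0"
    using u by (auto simp: u'_def coeff_diff coeff_uminus \<kappa>0_def V0)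
  then have "\<eta> * Db - \<eta> * Da - u' * \<kappa>0 = (\<Sum>i\<in>UNIV. t i * q (Inr (Inl i))) + (\<Sum>i\<in>UNIV. t' i * q (Inr (Inr i)))"
    using q unfolding q' coeff_diff Da[unfolded cs_def] Db[unfolded cs_def] by simp
  then have eq: "\<eta> * Db - \<eta> * Da = (\<Sum>i\<in>UNIV. t i * q (Inr (Inl i))) + (\<Sum>i\<in>UNIV. t' i * q (Inr (Inr i))) + u' * \<kappa>0"
    by (simp add: algebra_simps)
  have "Da - Db = - \<eta> * (\<eta> * Db - \<eta> * Da)"
    using \<eta> by auto
  also have "\<dots> = - \<eta> * ((\<Sum>i\<in>UNIV. t i * q (Inr (Inl i))) + (\<Sum>i\<in>UNIV. t' i * q (Inr (Inr i))) + u' * \<kappa>0)"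
    unfolding eq ..
  finally have "Da - Db = - \<eta> * ((\<Sum>i\<in>UNIV. t i * q (Inr (Inl i))) + (\<Sum>i\<in>UNIV. t' i * q (Inr (Inr i))) + u' * \<kappa>0)" .
  then have "Da - Db = (\<Sum>i\<in>UNIV. t i * (- \<eta> * q (Inr (Inl i)))) + (\<Sum>i\<in>UNIV. t' i * (- \<eta> * q (Inr (Inr i)))) + (- \<eta> * u') * \<kappa>0"
    by (simp add: distrib_left sum_distrib_left mult.left_commute mult.assoc sum_negf)
  moreover have "deg_rel (\<le>) Y ((\<Sum>i\<in>UNIV - {o'}. d i - 1) - 1) ((- \<eta> * u') * \<kappa>0)"
    by (rule deg_rel_units[OF _ \<kappa>0]) (use \<eta> in \<open>auto simp: u'_def\<close>)
  ultimately show ?thesis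
    unfolding Da_def Db_def
    by (rule_tac exI[of _ w], rule_tac exI[of _ w'], rule_tac exI[of _ "\<lambda>i. - \<eta> * q (Inr (Inl i))"],
        rule_tac exI[of _ "\<lambda>i. - \<eta> * q (Inr (Inr i))"], rule_tac exI[of _ "(- \<eta> * u') * \<kappa>0"])
      (intro conjI w_eq w'_eq)
qed

section \<open>Tensor products of functionals\<close>

datatype pt = Px | Py | Pz

lemma UNIV_pt: "UNIV = {Px, Py, Pz}"
  by (auto intro: pt.exhaust)

instance pt :: finite
  by standard (simp add: UNIV_pt)

definition part :: "pt \<Rightarrow> (pt \<times> 'k \<Rightarrow>\<^sub>0 nat) \<Rightarrow> 'k \<Rightarrow>\<^sub>0 nat"
  where "part p m = Poly_Mapping.map_key (Pair p) m"

lemma lookup_part [simp]: "Poly_Mapping.lookup (part p m) k = Poly_Mapping.lookup m (p, k)"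
  unfolding part_def by (subst map_key.rep_eq) (auto simp: inj_def)

lemma part_add: "part p (m + m') = part p m + part p m'"
  by (rule poly_mapping_eqI) (simp add: lookup_add)

abbreviation ins :: "pt \<Rightarrow> ('k::finite, 'a::comm_ring_1) mpoly \<Rightarrow> (pt \<times> 'k, 'a) mpoly"
  where "ins p \<equiv> subst (\<lambda>k. X (p, k))"

abbreviation ins_exp :: "pt \<Rightarrow> ('k::finite \<Rightarrow>\<^sub>0 nat) \<Rightarrow> pt \<times> 'k \<Rightarrow>\<^sub>0 nat"
  where "ins_exp p \<equiv> rename_exp (Pair p)"

lemma lookup_ins_exp: "Poly_Mapping.lookup (ins_exp p m) (q, k) = (if q = p then Poly_Mapping.lookup m k else 0)"
proof -
  have "inj (Pair p :: 'a \<Rightarrow> pt \<times> 'a)" by (auto simp: inj_def)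
  then show ?thesis by (auto simp: lookup_rename_exp inv_f_f image_iff)
qed

lemma part_ins_exp: "part q (ins_exp p m) = (if q = p then m else 0)"
  by (rule poly_mapping_eqI) (simp add: lookup_ins_exp)

text \<open>The functionals act in the variables x, y and z separately and the results are
  multiplied. For two points the third slot is filled by \<open>const_coeff\<close>, whose value on
  the trivial monomial is 1.\<close>

definition tens :: "(pt \<Rightarrow> ('k, 'a::field) functional) \<Rightarrow> (pt \<times> 'k, 'a) mpoly \<Rightarrow> 'a"
  where "tens \<Lambda> = wtsum (\<lambda>m. \<Prod>p\<in>UNIV. \<Lambda> p (Poly_Mapping.single (part p m) 1))"

lemma tens_add: "tens \<Lambda> (P + Q) = tens \<Lambda> P + tens \<Lambda> Q"
  and tens_diff: "tens \<Lambda> (P - Q) = tens \<Lambda> P - tens \<Lambda> Q"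
  and tens_const_mult: "tens \<Lambda> (Poly_Mapping.single 0 c * P) = c * tens \<Lambda> P"
  and tens_sum: "tens \<Lambda> (sum Q' I) = (\<Sum>i\<in>I. tens \<Lambda> (Q' i))"
  by (simp_all add: tens_def wtsum_add wtsum_diff wtsum_const_mult wtsum_sum)

lemma tens_single: "tens \<Lambda> (Poly_Mapping.single m c) = c * (\<Prod>p\<in>UNIV. \<Lambda> p (Poly_Mapping.single (part p m) 1))"
  by (simp add: tens_def)

lemma tens_ins_mult_single:
  assumes L: "is_functional (\<Lambda> p)"
  shows "tens \<Lambda> (ins p F * Poly_Mapping.single m 1)
    = \<Lambda> p (F * Poly_Mapping.single (part p m) 1) * (\<Prod>q\<in>UNIV - {p}. \<Lambda> q (Poly_Mapping.single (part q m) 1))"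
proof (induction F rule: mpoly_single_induct)
  case (single n c)
  have "\<Lambda> p (Poly_Mapping.single (n + part p m) c) = c * \<Lambda> p (Poly_Mapping.single (n + part p m) 1)"
    using functional_const_mult[OF L, of c "Poly_Mapping.single (n + part p m) 1"] by (simp add: mult_single)
  moreover have "(\<Prod>q\<in>UNIV - {p}. \<Lambda> q (Poly_Mapping.single (part q (ins_exp p n + m)) 1))
      = (\<Prod>q\<in>UNIV - {p}. \<Lambda> q (Poly_Mapping.single (part q m) 1))"
    by (rule prod.cong) (simp_all add: part_add part_ins_exp)
  ultimately show ?case
    using prod.remove[of UNIV p "\<lambda>q. \<Lambda> q (Poly_Mapping.single (part q (ins_exp p n + m)) 1)"]
    by (simp add: subst_rename_single mult_single tens_single part_add part_ins_exp mult.assoc)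
next
  case (add F F')
  then show ?case by (simp add: subst_add distrib_right tens_add functional_add[OF L])
qed

text \<open>This allows the ideal combinations produced by determinants to be dropped, whatever
  their cofactors are.\<close>

lemma tens_ins_mult_eq_0:
  assumes "is_functional (\<Lambda> p)" "\<And>g. \<Lambda> p (F * g) = 0"
  shows "tens \<Lambda> (ins p F * Q) = 0"
proof -
  have key: "tens \<Lambda> (ins p F * Poly_Mapping.single m 1) = 0" for m
    using tens_ins_mult_single[of \<Lambda> p, OF assms(1)] assms(2) by simp
  show ?thesis unfolding tens_def by (rule wtsum_mult, rule key[unfolded tens_def])
qed

text \<open>The map of points need not be injective: \<open>id(Px := Py)\<close> substitutes y for
  x.\<close>

definition ren :: "(pt \<Rightarrow> pt) \<Rightarrow> (pt \<times> 'k::finite, 'a::comm_ring_1) mpoly \<Rightarrow> (pt \<times> 'k, 'a) mpoly"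
  where "ren \<pi> = subst (\<lambda>v. X (\<pi> (fst v), snd v))"

lemma ren_add: "ren \<pi> (P + Q) = ren \<pi> P + ren \<pi> Q"
  and ren_diff: "ren \<pi> (P - Q) = ren \<pi> P - ren \<pi> Q"
  and ren_mult: "ren \<pi> (P * Q) = ren \<pi> P * ren \<pi> Q"
  and ren_sum: "ren \<pi> (sum Q' I) = (\<Sum>i\<in>I. ren \<pi> (Q' i))"
  and ren_X: "ren \<pi> (X (p, k)) = X (\<pi> p, k)"
  and ren_0: "ren \<pi> 0 = 0"
  and ren_ins: "ren \<pi> (ins p F) = ins (\<pi> p) F"
  and ren_ren: "ren \<pi>' (ren \<pi> P) = ren (\<lambda>p. \<pi>' (\<pi> p)) P"
  and ren_det: "ren \<pi> (det M) = det (\<chi> i j. ren \<pi> (M $ i $ j))"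
  by (simp_all add: ren_def subst_add subst_diff subst_mult subst_sum subst_subst subst_det)

lemma ren_single: "ren \<pi> (Poly_Mapping.single m c) = Poly_Mapping.single (rename_exp (\<lambda>v. (\<pi> (fst v), snd v)) m) c"
  unfolding ren_def by (rule subst_rename_single)

lemma deg_in_rename_exp:
  fixes \<rho> :: "'v::finite \<Rightarrow> 'w::finite"
  shows "deg_in UNIV (rename_exp \<rho> m) = deg_in UNIV m"
proof -
  have "deg_in UNIV (rename_exp \<rho> m) = (\<Sum>i\<in>UNIV. \<Sum>j\<in>UNIV. (if \<rho> i = j then Poly_Mapping.lookup m i else 0))"
    unfolding deg_in_def rename_exp_def lookup_sum
    by (subst sum.swap) (simp add: lookup_single when_def)
  then show ?thesis by (simp add: deg_in_def)
qed

lemma deg_rel_rename: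
  fixes \<rho> :: "'v::finite \<Rightarrow> 'w::finite"
  assumes "deg_rel R UNIV d p"
  shows "deg_rel R UNIV d (subst (\<lambda>i. X (\<rho> i)) p :: ('w, 'a::comm_ring_1) mpoly)"
proof -
  have "subst (\<lambda>i. X (\<rho> i)) p = (\<Sum>m\<in>Poly_Mapping.keys p. Poly_Mapping.single (rename_exp \<rho> m) (Poly_Mapping.lookup p m))"
    by (subst mpoly_sum_singles[of p, symmetric]) (simp only: subst_sum subst_rename_single)
  also have "deg_rel R UNIV d \<dots>"
    using assms by (intro deg_rel_sum deg_rel_single) (simp add: deg_in_rename_exp deg_rel_def)
  finally show ?thesis .
qed

lemma deg_rel_ren: "deg_rel R UNIV d P \<Longrightarrow> deg_rel R UNIV d (ren \<pi> P)"
  unfolding ren_def by (rule deg_rel_rename)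

abbreviation pt_vars :: "pt \<Rightarrow> (pt \<times> 'k) set"
  where "pt_vars p \<equiv> {p} \<times> UNIV"

abbreviation free_of :: "pt \<Rightarrow> (pt \<times> 'k, 'a::zero) mpoly \<Rightarrow> bool"
  where "free_of p \<equiv> deg_rel (\<le>) (pt_vars p) 0"

lemma deg_in_pt_vars: "deg_in (pt_vars p) m = deg_in UNIV (part p m)" for m :: "pt \<times> 'k::finite \<Rightarrow>\<^sub>0 nat"
proof -
  have "pt_vars p = Pair p ` (UNIV :: 'k set)" by auto
  then show ?thesis by (simp add: deg_in_def sum.reindex inj_on_def)
qed

lemma deg_in_eq_0: "finite A \<Longrightarrow> deg_in A m = 0 \<longleftrightarrow> (\<forall>i\<in>A. Poly_Mapping.lookup m i = 0)"
  by (simp add: deg_in_def)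

lemma free_of_part: "free_of p Q \<Longrightarrow> m \<in> Poly_Mapping.keys Q \<Longrightarrow> part p m = 0"
  for Q :: "(pt \<times> 'k::finite, 'a::zero) mpoly"
  unfolding deg_rel_def deg_in_pt_vars by (intro poly_mapping_eqI) (force simp: deg_in_eq_0)

lemma ren_cong:
  fixes Q :: "(pt \<times> 'k::finite, 'a::comm_ring_1) mpoly"
  assumes "free_of r Q" "\<And>p. p \<noteq> r \<Longrightarrow> \<pi> p = \<pi>' p"
  shows "ren \<pi> Q = ren \<pi>' Q"
proof -
  have key: "ren \<pi> (Poly_Mapping.single m c) = ren \<pi>' (Poly_Mapping.single m c)" if "m \<in> Poly_Mapping.keys Q" for m c
  proof -
    have 0: "Poly_Mapping.lookup m (r, k) = 0" for k
      using free_of_part[OF assms(1) that] by (metis lookup_part lookup_zero)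
    have "rename_exp (\<lambda>v. (\<pi> (fst v), snd v)) m = rename_exp (\<lambda>v. (\<pi>' (fst v), snd v)) m"
      unfolding rename_exp_def
    proof (rule sum.cong[OF refl])
      fix v :: "pt \<times> 'k"
      show "Poly_Mapping.single (\<pi> (fst v), snd v) (Poly_Mapping.lookup m v) = Poly_Mapping.single (\<pi>' (fst v), snd v) (Poly_Mapping.lookup m v)"
        using assms(2)[of "fst v"] 0[of "snd v"] by (cases "fst v = r") (simp_all, metis prod.collapse single_zero)
    qed
    then show ?thesis by (simp add: ren_single)
  qed
  have "ren \<pi> (\<Sum>m\<in>Poly_Mapping.keys Q. Poly_Mapping.single m (Poly_Mapping.lookup Q m))
      = ren \<pi>' (\<Sum>m\<in>Poly_Mapping.keys Q. Poly_Mapping.single m (Poly_Mapping.lookup Q m))"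
    unfolding ren_sum by (rule sum.cong[OF refl]) (rule key)
  then show ?thesis by (simp only: mpoly_sum_singles)
qed

lemma ren_id: "ren (\<lambda>p. p) Q = Q"
  by (simp add: ren_def)

lemma free_of_ren:
  fixes Q :: "(pt \<times> 'k::finite, 'a::comm_ring_1) mpoly"
  assumes "\<And>p. p \<noteq> r \<Longrightarrow> \<pi> p \<noteq> s" "free_of r Q"
  shows "free_of s (ren \<pi> Q)"
proof -
  have "free_of s (ren \<pi> (Poly_Mapping.single m c))" if "m \<in> Poly_Mapping.keys Q" for m c
  proof -
    have 0: "Poly_Mapping.lookup m (r, k) = 0" for k
      using free_of_part[OF assms(2) that] by (metis lookup_part lookup_zero)
    have "Poly_Mapping.lookup (rename_exp (\<lambda>v. (\<pi> (fst v), snd v)) m) (s, k) = 0" for k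
      unfolding rename_exp_def lookup_sum
    proof (rule sum.neutral, rule ballI)
      fix v :: "pt \<times> 'k"
      show "Poly_Mapping.lookup (Poly_Mapping.single (\<pi> (fst v), snd v) (Poly_Mapping.lookup m v)) (s, k) = 0"
        using assms(1)[of "fst v"] 0[of "snd v"] by (cases "fst v = r") (auto simp: lookup_single when_def)
    qed
    then show ?thesis by (auto simp: ren_single deg_in_eq_0 intro!: deg_rel_single)
  qed
  then have "free_of s (ren \<pi> (\<Sum>m\<in>Poly_Mapping.keys Q. Poly_Mapping.single m (Poly_Mapping.lookup Q m)))"
    unfolding ren_sum by (intro deg_rel_sum) blast
  then show ?thesis by (simp only: mpoly_sum_singles)
qed

lemma free_of_ins: "p \<noteq> q \<Longrightarrow> free_of q (ins p F :: (pt \<times> 'k::finite, 'a::comm_ring_1) mpoly)"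
proof (induction F rule: mpoly_single_induct)
  case (single m c)
  then show ?case by (auto simp: subst_rename_single deg_in_eq_0 lookup_ins_exp intro!: deg_rel_single)
qed (simp add: subst_add deg_rel_add)

lemma tens_ren:
  fixes Q :: "(pt \<times> 'k::finite, 'a::field) mpoly"
  assumes "bij \<pi>"
  shows "tens \<Lambda> (ren \<pi> Q) = tens (\<lambda>p. \<Lambda> (\<pi> p)) Q"
proof (induction Q rule: mpoly_single_induct)
  case (single m c)
  have inj: "inj (\<lambda>v :: pt \<times> 'k. (\<pi> (fst v), snd v))" using bij_is_inj[OF assms] by (auto simp: inj_def)
  have "part (\<pi> p) (rename_exp (\<lambda>v. (\<pi> (fst v), snd v)) m) = part p m" for p
  proof (rule poly_mapping_eqI)
    fix k :: 'k
    have "inv (\<lambda>v. (\<pi> (fst v), snd v)) (\<pi> p, k) = (p, k)"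
      using inv_f_f[OF inj, of "(p, k)"] by simp
    moreover have "(\<pi> p, k) \<in> range (\<lambda>v. (\<pi> (fst v), snd v))"
      by (rule range_eqI[of _ _ "(p, k)"]) simp
    ultimately show "Poly_Mapping.lookup (part (\<pi> p) (rename_exp (\<lambda>v. (\<pi> (fst v), snd v)) m)) k = Poly_Mapping.lookup (part p m) k"
      by (simp add: lookup_rename_exp[OF inj])
  qed
  then have "(\<Prod>p\<in>UNIV. \<Lambda> (\<pi> p) (Poly_Mapping.single (part p m) 1))
      = (\<Prod>p\<in>UNIV. \<Lambda> (\<pi> p) (Poly_Mapping.single (part (\<pi> p) (rename_exp (\<lambda>v. (\<pi> (fst v), snd v)) m)) 1))"
    by simp
  also have "\<dots> = (\<Prod>p\<in>UNIV. \<Lambda> p (Poly_Mapping.single (part p (rename_exp (\<lambda>v. (\<pi> (fst v), snd v)) m)) 1))"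
    by (rule prod.reindex_bij_betw[OF assms])
  finally show ?case by (simp add: ren_single tens_single)
qed (simp add: ren_add tens_add)

definition const_coeff :: "('k, 'a::field) functional"
  where "const_coeff F = Poly_Mapping.lookup F 0"

lemma const_coeff_single: "const_coeff (Poly_Mapping.single m c) = (if m = 0 then c else 0)"
  by (simp add: const_coeff_def lookup_single when_def)

text \<open>A functional whose point occurs in one factor only can be split off;
  \<open>const_coeff\<close> then holds the vacant slot.\<close>

lemma tens_ins_mult_free:
  fixes R :: "(pt \<times> 'k::finite, 'a::field) mpoly"
  assumes "is_functional (\<Lambda> p)" "free_of p R"
  shows "tens \<Lambda> (ins p g * R) = \<Lambda> p g * tens (\<Lambda>(p := const_coeff)) R"
proof -
  have "tens \<Lambda> (ins p g * Poly_Mapping.single m c) = \<Lambda> p g * tens (\<Lambda>(p := const_coeff)) (Poly_Mapping.single m c)"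
    if "m \<in> Poly_Mapping.keys R" for m c
  proof -
    have 0: "part p m = 0" by (rule free_of_part[OF assms(2) that])
    have "ins p g * Poly_Mapping.single m c = Poly_Mapping.single 0 c * (ins p g * Poly_Mapping.single m 1)"
      by (subst mult.left_commute) (simp add: mult_single)
    moreover have "(\<Prod>q\<in>UNIV - {p}. (\<Lambda>(p := const_coeff)) q (Poly_Mapping.single (part q m) 1))
        = (\<Prod>q\<in>UNIV - {p}. \<Lambda> q (Poly_Mapping.single (part q m) 1))"
      by (rule prod.cong) auto
    then have "(\<Prod>q\<in>UNIV. (\<Lambda>(p := const_coeff)) q (Poly_Mapping.single (part q m) 1))
        = (\<Prod>q\<in>UNIV - {p}. \<Lambda> q (Poly_Mapping.single (part q m) 1))"
      using prod.remove[of UNIV p "\<lambda>q. (\<Lambda>(p := const_coeff)) q (Poly_Mapping.single (part q m) 1)"]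
      by (simp add: 0 const_coeff_def)
    ultimately show ?thesis
      by (simp add: tens_const_mult tens_ins_mult_single[of \<Lambda> p, OF assms(1)] tens_single 0)
  qed
  then have "tens \<Lambda> (ins p g * (\<Sum>m\<in>Poly_Mapping.keys R. Poly_Mapping.single m (Poly_Mapping.lookup R m)))
      = \<Lambda> p g * tens (\<Lambda>(p := const_coeff)) (\<Sum>m\<in>Poly_Mapping.keys R. Poly_Mapping.single m (Poly_Mapping.lookup R m))"
    by (simp add: sum_distrib_left tens_sum)
  then show ?thesis by (simp only: mpoly_sum_singles)
qed

section \<open>The product of functionals for homogeneous polynomials\<close>

definition is_diff_matrix ::
  "('k \<Rightarrow> 'k \<Rightarrow> (pt \<times> 'k::finite, 'a::comm_ring_1) mpoly) \<Rightarrow> ('k \<Rightarrow> ('k, 'a) mpoly) \<Rightarrow> pt \<Rightarrow> pt \<Rightarrow> bool"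
  where "is_diff_matrix V h p q \<longleftrightarrow>
    (\<forall>c. (\<Sum>k\<in>UNIV. (X (p, k) - X (q, k)) * V k c) = ins p (h c) - ins q (h c))"

lemma det_col_linear:
  fixes a :: "'k::finite \<Rightarrow> 'k \<Rightarrow> 'r::comm_ring_1"
  assumes "finite J"
  shows "det (\<chi> k c. if c = o' then \<Sum>j\<in>J. s j * w j k else a k c)
    = (\<Sum>j\<in>J. s j * det (\<chi> k c. if c = o' then w j k else a k c))"
proof -
  have tr: "det (\<chi> k c. if c = o' then v k else a k c) = det (\<chi> c. if c = o' then (\<chi> k. v k) else (\<chi> k. a k c))" for v
  proof -
    have "transpose (\<chi> k c. if c = o' then v k else a k c) = (\<chi> c. if c = o' then (\<chi> k. v k) else (\<chi> k. a k c))"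
      by (simp add: transpose_def vec_eq_iff)
    from arg_cong[OF this, of det] show ?thesis unfolding det_transpose .
  qed
  have eq: "(\<chi> k. \<Sum>j\<in>J. s j * w j k) = (\<Sum>j\<in>J. s j *s (\<chi> k. w j k))"
    by (simp add: vec_eq_iff)
  show ?thesis
    unfolding tr eq
    using det_linear_row_sum[OF assms, of o' "\<lambda>_ j. s j *s (\<chi> k. w j k)" "\<lambda>c. \<chi> k. a k c"]
      det_row_mul[of o' _ "\<lambda>_. \<chi> k. w _ k" "\<lambda>c. \<chi> k. a k c"]
    by (simp cong: if_cong)
qed

lemma det_col_diff:
  "det (\<chi> k c. if c = o' then w k else a k c) - det (\<chi> k c. if c = o' then w' k else a k c)
    = det (\<chi> k c. if c = o' then w k - w' k else a k c)" for a :: "'k::finite \<Rightarrow> 'k \<Rightarrow> 'r::comm_ring_1"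
  using det_col_linear[of "UNIV :: bool set" o' "\<lambda>b. if b then 1 else - 1" "\<lambda>b. if b then w else w'" a]
  by (simp add: UNIV_bool add.commute cong: if_cong)

text \<open>By exactness a column with pairing 0 may be compared with the zero column. Both matrices
  have the same pairings, with 0 at \<open>o'\<close>, so only the other pairings occur in the
  difference.\<close>

lemma det_last_column:
  fixes a :: "'k::finite \<Rightarrow> 'k \<Rightarrow> (pt \<times> 'k, 'a::comm_ring_1) mpoly"
  assumes "p \<noteq> q" and u: "(\<Sum>k\<in>UNIV. (X (p, k) - X (q, k)) * u k) = 0"
    and a: "\<And>c. c \<noteq> o' \<Longrightarrow> (\<Sum>k\<in>UNIV. (X (p, k) - X (q, k)) * a k c) = t c"
  shows "\<exists>r. det (\<chi> k c. if c = o' then u k else a k c) = (\<Sum>c\<in>UNIV - {o'}. t c * r c)"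
proof -
  define t' where "t' = t(o' := 0)"
  have "\<exists>r. det (\<chi> k c. if c = o' then u k else a k c) - det (\<chi> k c. if c = o' then 0 else a k c) = (\<Sum>c\<in>UNIV. t' c * r c)"
  proof (rule det_difference_vectors[of "Pair q" "Pair p"])
    fix c
    show "(\<Sum>k\<in>UNIV. (X (p, k) - X (q, k)) * (if c = o' then u k else a k c)) = t' c"
      using u a[of c] by (cases "c = o'") (simp_all add: t'_def)
    show "(\<Sum>k\<in>UNIV. (X (p, k) - X (q, k)) * (if c = o' then 0 else a k c)) = t' c"
      using a[of c] by (cases "c = o'") (simp_all add: t'_def)
  qed (use assms(1) in \<open>auto simp: inj_def\<close>)
  then obtain r where r: "det (\<chi> k c. if c = o' then u k else a k c) - det (\<chi> k c. if c = o' then 0 else a k c) = (\<Sum>c\<in>UNIV. t' c * r c)" ..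
  have "det (\<chi> k c. if c = o' then 0 else a k c) = 0"
    using det_col_linear[of "{} :: nat set" o' "\<lambda>_. 0" "\<lambda>_ _. 0" a] by (simp cong: if_cong)
  moreover have "(\<Sum>c\<in>UNIV. t' c * r c) = (\<Sum>c\<in>UNIV - {o'}. t c * r c)"
    by (subst sum.remove[of _ o']) (auto simp: t'_def intro!: sum.cong)
  ultimately show ?thesis using r by auto
qed

text \<open>The two determinants differ by a combination of the \<open>h c\<close> at
  \<open>p\<close> and at \<open>q\<close>, and each of the two functionals annuls all multiples of
  these.\<close>

lemma tens_det_independent:
  fixes \<Lambda> :: "pt \<Rightarrow> ('k::finite, 'a::field) functional"
  assumes "p \<noteq> q" "is_diff_matrix V h p q" "is_diff_matrix V' h p q"
    and L: "is_functional (\<Lambda> p)" "is_functional (\<Lambda> q)"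
    and kill: "\<And>c g. \<Lambda> p (h c * g) = 0" "\<And>c g. \<Lambda> q (h c * g) = 0"
  shows "tens \<Lambda> (det (\<chi> k c. V k c)) = tens \<Lambda> (det (\<chi> k c. V' k c))"
proof -
  have "\<exists>r. det (\<chi> k c. V k c) - det (\<chi> k c. V' k c) = (\<Sum>c\<in>UNIV. (ins p (h c) - ins q (h c)) * r c)"
    by (rule det_difference_vectors[of "Pair q" "Pair p"])
      (use assms(1-3) in \<open>auto simp: inj_def is_diff_matrix_def\<close>)
  then obtain r where "det (\<chi> k c. V k c) - det (\<chi> k c. V' k c) = (\<Sum>c\<in>UNIV. (ins p (h c) - ins q (h c)) * r c)" ..
  moreover have "tens \<Lambda> ((ins p (h c) - ins q (h c)) * r c) = 0" for c
    by (simp add: left_diff_distrib tens_diff tens_ins_mult_eq_0[of \<Lambda> p, OF L(1) kill(1)] tens_ins_mult_eq_0[of \<Lambda> q, OF L(2) kill(2)])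
  ultimately have "tens \<Lambda> (det (\<chi> k c. V k c) - det (\<chi> k c. V' k c)) = 0" by (simp add: tens_sum)
  then show ?thesis by (simp add: tens_diff)
qed

text \<open>A difference derivative \<open>c\<close> between \<open>x\<close> and \<open>z\<close> together with a second difference derivative \<open>G\<close>
  compatible with it.\<close>

definition is_second_diff ::
  "int \<Rightarrow> ('k::finite, 'a::comm_ring_1) mpoly \<Rightarrow> ('k \<Rightarrow> (pt \<times> 'k, 'a) mpoly) \<Rightarrow> ('k \<Rightarrow> 'k \<Rightarrow> (pt \<times> 'k, 'a) mpoly) \<Rightarrow> bool"
  where "is_second_diff d h c G \<longleftrightarrow>
    (\<forall>k. deg_rel (=) UNIV (d - 1) (c k) \<and> free_of Py (c k)) \<and>
    (\<forall>k l. deg_rel (=) UNIV (d - 2) (G k l)) \<and>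
    (\<Sum>k\<in>UNIV. (X (Px, k) - X (Pz, k)) * c k) = ins Px h - ins Pz h \<and>
    (\<forall>l. (\<Sum>k\<in>UNIV. (X (Px, k) - X (Py, k)) * G k l) = c l - ren (id(Px := Py)) (c l)) \<and>
    (\<forall>k. (\<Sum>l\<in>UNIV. (X (Py, l) - X (Pz, l)) * G k l) = ren (id(Pz := Py)) (c k) - c k)"

lemma deg_rel_X: "finite A \<Longrightarrow> R (if i \<in> A then 1 else 0) d \<Longrightarrow> deg_rel R A d (X i :: ('v, 'a::comm_ring_1) mpoly)"
  unfolding X_def by (rule deg_rel_single) (auto simp: deg_in_single split: if_splits)

text \<open>Product rule: a further variable multiplies the old data by its value at x and adds, at
  its own index, the polynomial at z to \<open>c\<close> and the first difference between y and z to
  \<open>G\<close>.\<close>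

lemma second_diff_exists_single: "\<exists>c G. is_second_diff (int (deg_in UNIV m)) (Poly_Mapping.single m 1 :: ('k::finite, 'a::comm_ring_1) mpoly) c G"
proof (induction m rule: exponent_induct)
  case zero
  then show ?case by (intro exI[of _ "\<lambda>_. 0"] exI[of _ "\<lambda>_ _. 0"]) (simp add: is_second_diff_def ren_0)
next
  case (add i m)
  define d where "d = int (deg_in UNIV m)"
  define h :: "('k, 'a) mpoly" where "h = Poly_Mapping.single m 1"
  obtain c G where cG: "is_second_diff d h c G" using add d_def h_def by blast
  have c1: "(\<Sum>k\<in>UNIV. (X (Px, k) - X (Pz, k)) * c k) = ins Px h - ins Pz h"
    and c2: "\<And>l. (\<Sum>k\<in>UNIV. (X (Px, k) - X (Py, k)) * G k l) = c l - ren (id(Px := Py)) (c l)"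
    and c3: "\<And>k. (\<Sum>l\<in>UNIV. (X (Py, l) - X (Pz, l)) * G k l) = ren (id(Pz := Py)) (c k) - c k"
    using cG unfolding is_second_diff_def by blast+
  define c' where "c' k = X (Px, i) * c k + (if k = i then ins Pz h else 0)" for k
  define G' where "G' k l = X (Px, i) * G k l + (if k = i then ren (id(Px := Py)) (c l) else 0)" for k l
  have d': "int (deg_in UNIV (Poly_Mapping.single i 1 + m)) = 1 + d"
    by (simp add: deg_in_add deg_in_single d_def)
  have h': "Poly_Mapping.single (Poly_Mapping.single i 1 + m) 1 = X i * h"
    unfolding h_def by (rule single_eq_X_mult)
  have hd: "deg_rel (=) UNIV d h" by (simp add: h_def d_def deg_rel_single)
  have "is_second_diff (1 + d) (X i * h) c' G'"
    unfolding is_second_diff_def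
  proof (intro conjI allI)
    fix k l
    have "deg_rel (=) UNIV (1 + (d - 1)) (X (Px, i) * c k)"
      using cG by (intro deg_rel_mult deg_rel_X) (auto simp: is_second_diff_def)
    moreover have "deg_rel (=) UNIV d (ins Pz h)" by (rule deg_rel_rename[OF hd])
    ultimately show "deg_rel (=) UNIV (1 + d - 1) (c' k)"
      unfolding c'_def by (intro deg_rel_add) auto
    have "free_of Py (X (Px, i) * c k)"
      using deg_rel_mult[of "(\<le>)" "pt_vars Py" 0 "X (Px, i)" 0 "c k"] cG by (simp add: is_second_diff_def deg_rel_X)
    then show "free_of Py (c' k)" unfolding c'_def by (intro deg_rel_add) (auto simp: free_of_ins)
    have "deg_rel (=) UNIV (1 + (d - 2)) (X (Px, i) * G k l)"
      using cG by (intro deg_rel_mult deg_rel_X) (auto simp: is_second_diff_def)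
    moreover have "deg_rel (=) UNIV (d - 1) (ren (id(Px := Py)) (c l))"
      using cG by (intro deg_rel_ren) (simp add: is_second_diff_def)
    ultimately show "deg_rel (=) UNIV (1 + d - 2) (G' k l)"
      unfolding G'_def by (intro deg_rel_add) auto
  next
    have "(\<Sum>k\<in>UNIV. (X (Px, k) - X (Pz, k)) * c' k)
        = X (Px, i) * (\<Sum>k\<in>UNIV. (X (Px, k) - X (Pz, k)) * c k) + (X (Px, i) - X (Pz, i)) * ins Pz h"
      by (simp add: c'_def distrib_left sum.distrib sum_distrib_left mult.left_commute if_distrib[of "(*) _"] cong: if_cong)
    also have "\<dots> = ins Px (X i * h) - ins Pz (X i * h)"
      unfolding c1 by (simp add: subst_mult algebra_simps)
    finally show "(\<Sum>k\<in>UNIV. (X (Px, k) - X (Pz, k)) * c' k) = ins Px (X i * h) - ins Pz (X i * h)" .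
  next
    fix l
    have "(\<Sum>k\<in>UNIV. (X (Px, k) - X (Py, k)) * G' k l)
        = X (Px, i) * (\<Sum>k\<in>UNIV. (X (Px, k) - X (Py, k)) * G k l) + (X (Px, i) - X (Py, i)) * ren (id(Px := Py)) (c l)"
      by (simp add: G'_def distrib_left sum.distrib sum_distrib_left mult.left_commute if_distrib[of "(*) _"] cong: if_cong)
    also have "\<dots> = c' l - ren (id(Px := Py)) (c' l)"
      unfolding c2 by (simp add: c'_def ren_add ren_mult ren_X ren_ins ren_0 algebra_simps)
    finally show "(\<Sum>k\<in>UNIV. (X (Px, k) - X (Py, k)) * G' k l) = c' l - ren (id(Px := Py)) (c' l)" .
  next
    fix k
    have "ren (id(Px := Py)) (ins Px h - ins Pz h) = ren (id(Px := Py)) (\<Sum>k\<in>UNIV. (X (Px, k) - X (Pz, k)) * c k)"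
      unfolding c1 ..
    then have b: "(\<Sum>l\<in>UNIV. (X (Py, l) - X (Pz, l)) * ren (id(Px := Py)) (c l)) = ins Py h - ins Pz h"
      by (simp add: ren_diff ren_ins ren_sum ren_mult ren_X)
    have "(\<Sum>l\<in>UNIV. (X (Py, l) - X (Pz, l)) * G' k l)
        = X (Px, i) * (\<Sum>l\<in>UNIV. (X (Py, l) - X (Pz, l)) * G k l)
          + (if k = i then \<Sum>l\<in>UNIV. (X (Py, l) - X (Pz, l)) * ren (id(Px := Py)) (c l) else 0)"
      by (simp add: G'_def distrib_left sum.distrib sum_distrib_left mult.left_commute)
    also have "\<dots> = ren (id(Pz := Py)) (c' k) - c' k"
      unfolding b c3 by (simp add: c'_def ren_add ren_mult ren_X ren_ins ren_0 algebra_simps)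
    finally show "(\<Sum>l\<in>UNIV. (X (Py, l) - X (Pz, l)) * G' k l) = ren (id(Pz := Py)) (c' k) - c' k" .
  qed
  then show ?case unfolding d' h' by blast
qed

lemma ren_const_mult: "ren \<pi> (Poly_Mapping.single 0 c * P) = Poly_Mapping.single 0 c * ren \<pi> P"
  by (simp add: ren_mult) (simp add: ren_def)

lemma second_diff_const_mult:
  fixes h :: "('a::finite, 'b::comm_ring_1) mpoly"
  assumes "is_second_diff d h c G"
  shows "is_second_diff d (Poly_Mapping.single 0 s * h) (\<lambda>k. Poly_Mapping.single 0 s * c k) (\<lambda>k l. Poly_Mapping.single 0 s * G k l)"
proof -
  have deg: "deg_rel R A e (Poly_Mapping.single 0 s * P)" if "deg_rel R A e P" "additive_rel R" for R A e and P :: "(pt \<times> 'a, 'b) mpoly"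
    using deg_rel_mult[OF that(2) deg_rel_const[OF that(2)] that(1)] by simp
  define \<sigma> :: "(pt \<times> 'a, 'b) mpoly" where "\<sigma> = Poly_Mapping.single 0 s"
  have ren_\<sigma>: "ren \<pi> (\<sigma> * P) = \<sigma> * ren \<pi> P" for \<pi> P
    unfolding \<sigma>_def by (rule ren_const_mult)
  have sum_\<sigma>: "(\<Sum>k\<in>UNIV. z k * (\<sigma> * P k)) = \<sigma> * (\<Sum>k\<in>UNIV. z k * P k)" for z P :: "'a \<Rightarrow> (pt \<times> 'a, 'b) mpoly"
    by (simp add: sum_distrib_left mult.left_commute)
  have ins_\<sigma>: "ins p (Poly_Mapping.single 0 s * h) = \<sigma> * ins p h" for p
    by (simp add: subst_mult \<sigma>_def)
  show ?thesis
    using assms unfolding is_second_diff_def \<sigma>_def[symmetric] ren_\<sigma> sum_\<sigma> ins_\<sigma>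
    by (simp add: deg[of _ _ _ _, folded \<sigma>_def] right_diff_distrib)
qed

lemma second_diff_add:
  assumes "is_second_diff d h c G" "is_second_diff d h' c' G'"
  shows "is_second_diff d (h + h') (\<lambda>k. c k + c' k) (\<lambda>k l. G k l + G' k l)"
  using assms unfolding is_second_diff_def
  by (simp add: deg_rel_add ren_add subst_add distrib_left sum.distrib add_diff_add)

lemma second_diff_exists:
  assumes "deg_rel (=) UNIV d (h :: ('k::finite, 'a::comm_ring_1) mpoly)"
  shows "\<exists>c G. is_second_diff d h c G"
proof -
  have "\<exists>c G. is_second_diff d (\<Sum>m\<in>M. Poly_Mapping.single m (Poly_Mapping.lookup h m)) c G"
    if "finite M" "M \<subseteq> Poly_Mapping.keys h" for M
    using that
  proof (induction M rule: finite_induct)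
    case empty
    then show ?case by (intro exI[of _ "\<lambda>_. 0"] exI[of _ "\<lambda>_ _. 0"]) (simp add: is_second_diff_def ren_0)
  next
    case (insert m M)
    have "int (deg_in UNIV m) = d" using insert.prems assms by (simp add: deg_rel_def)
    then obtain c G where "is_second_diff d (Poly_Mapping.single m 1 :: ('k, 'a) mpoly) c G"
      using second_diff_exists_single[of m] by metis
    from second_diff_const_mult[OF this, of "Poly_Mapping.lookup h m"]
    have "\<exists>c G. is_second_diff d (Poly_Mapping.single m (Poly_Mapping.lookup h m)) c G"
      by (auto simp: mult_single)
    then obtain c1 G1 where "is_second_diff d (Poly_Mapping.single m (Poly_Mapping.lookup h m)) c1 G1"
      by blast
    moreover obtain c2 G2 where "is_second_diff d (\<Sum>m\<in>M. Poly_Mapping.single m (Poly_Mapping.lookup h m)) c2 G2"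
      using insert by auto
    ultimately have "is_second_diff d (\<Sum>m\<in>insert m M. Poly_Mapping.single m (Poly_Mapping.lookup h m))
        (\<lambda>k. c1 k + c2 k) (\<lambda>k l. G1 k l + G2 k l)"
      using second_diff_add insert.hyps by (simp only: sum.insert not_False_eq_True)
    then show ?case by blast
  qed
  from this[OF finite_keys subset_refl] show ?thesis by (simp only: mpoly_sum_singles)
qed

lemma is_diff_matrix_ren:
  assumes "is_diff_matrix V h p q"
  shows "is_diff_matrix (\<lambda>k c. ren \<pi> (V k c)) h (\<pi> p) (\<pi> q)"
  unfolding is_diff_matrix_def
proof
  fix c
  have "ren \<pi> (\<Sum>k\<in>UNIV. (X (p, k) - X (q, k)) * V k c) = ren \<pi> (ins p (h c) - ins q (h c))"
    using assms by (simp add: is_diff_matrix_def)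
  then show "(\<Sum>k\<in>UNIV. (X (\<pi> p, k) - X (\<pi> q, k)) * ren \<pi> (V k c)) = ins (\<pi> p) (h c) - ins (\<pi> q) (h c)"
    by (simp add: ren_sum ren_mult ren_diff ren_X ren_ins)
qed

lemma is_diff_matrix_sym:
  assumes "is_diff_matrix V h p q"
  shows "is_diff_matrix V h q p"
  unfolding is_diff_matrix_def
proof
  fix c
  have "(\<Sum>k\<in>UNIV. (X (q, k) - X (p, k)) * V k c) = - (\<Sum>k\<in>UNIV. (X (p, k) - X (q, k)) * V k c)"
    by (simp add: left_diff_distrib sum_subtractf)
  then show "(\<Sum>k\<in>UNIV. (X (q, k) - X (p, k)) * V k c) = ins q (h c) - ins p (h c)"
    using assms by (simp add: is_diff_matrix_def)
qed

lemma deg_in_UNIV_parts: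
  "deg_in UNIV m = deg_in UNIV (part Px m) + deg_in UNIV (part Py m) + deg_in UNIV (part Pz m)"
  for m :: "pt \<times> 'k::finite \<Rightarrow>\<^sub>0 nat"
proof -
  have "deg_in UNIV m = (\<Sum>p\<in>UNIV. \<Sum>k\<in>UNIV. Poly_Mapping.lookup m (p, k))"
    unfolding deg_in_def by (simp add: sum.cartesian_product)
  then show ?thesis by (simp add: deg_in_def UNIV_pt)
qed

text \<open>Column \<open>o'\<close> is reserved for the argument of the functionals, so nothing is
  assumed about \<open>f o'\<close>. The additional homogenising variable makes the number of
  variables equal to the number of columns including the one of the argument, which replaces the
  bordered matrix by a plain one.\<close>

locale hom_system =
  fixes f :: "'k::finite \<Rightarrow> ('k, 'a::field) mpoly" and o' :: 'k and d :: "'k \<Rightarrow> int"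
  assumes f_hom: "i \<noteq> o' \<Longrightarrow> deg_rel (=) UNIV (d i) (f i)"
begin

definition \<delta> :: int
  where "\<delta> = (\<Sum>i\<in>UNIV - {o'}. d i - 1)"

text \<open>Living in degree \<open>p\<close> replaces the degree bound on the cofactors, which are
  arbitrary here.\<close>

definition adm :: "int \<Rightarrow> ('k, 'a) functional \<Rightarrow> bool"
  where "adm p \<Lambda> \<longleftrightarrow> is_functional \<Lambda> \<and>
    (\<forall>m. int (deg_in UNIV m) \<noteq> p \<longrightarrow> \<Lambda> (Poly_Mapping.single m 1) = 0) \<and>
    (\<forall>i g. i \<noteq> o' \<longrightarrow> \<Lambda> (f i * g) = 0)"

abbreviation cols :: "('k, 'a) mpoly \<Rightarrow> 'k \<Rightarrow> ('k, 'a) mpoly"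
  where "cols F \<equiv> f(o' := F)"

text \<open>Stated for every difference matrix \<open>V\<close>, so that a proof may use whichever
  matrix suits the symmetry at hand.\<close>

definition is_product ::
  "('k, 'a) functional \<Rightarrow> ('k, 'a) functional \<Rightarrow> ('k, 'a) functional \<Rightarrow> int \<Rightarrow> bool"
  where "is_product \<Lambda>1 \<Lambda>2 \<Lambda>12 D \<longleftrightarrow>
    (\<forall>F V. deg_rel (=) UNIV D F \<longrightarrow> is_diff_matrix V (cols F) Px Py \<longrightarrow>
      \<Lambda>12 F = tens (case_pt \<Lambda>1 \<Lambda>2 const_coeff) (det (\<chi> k c. V k c)))"

lemma adm_functional: "adm p \<Lambda> \<Longrightarrow> is_functional \<Lambda>"
  by (simp add: adm_def)

text \<open>For degree reasons the argument is annulled with all its multiples, which puts its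
  column on a par with those of \<open>f\<close>.\<close>

lemma adm_high_degree:
  assumes "adm p \<Lambda>" "deg_rel (=) UNIV D F" "p < D"
  shows "\<Lambda> (F * g) = 0"
proof -
  have "\<Lambda> (Poly_Mapping.single m 1) = 0" if mem: "m \<in> Poly_Mapping.keys (F * g)" for m
  proof -
    obtain a b where m: "m = a + b" "a \<in> Poly_Mapping.keys F" using keys_mult[of F g] mem by blast
    then have "int (deg_in UNIV a) = D" using assms(2) by (simp add: deg_rel_def)
    then have "int (deg_in UNIV m) \<noteq> p" using assms(3) m by (simp add: deg_in_add)
    then show ?thesis using assms(1) by (simp add: adm_def)
  qed
  then have "wtsum (\<lambda>m. \<Lambda> (Poly_Mapping.single m 1)) (F * g) = 0" by (rule wtsum_eq_0)
  with fun_cong[OF functional_eq_wtsum[OF adm_functional[OF assms(1)]], of "F * g"] show ?thesis by (rule trans)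
qed

lemma adm_cols: "adm p \<Lambda> \<Longrightarrow> deg_rel (=) UNIV D F \<Longrightarrow> p < D \<Longrightarrow> \<Lambda> (cols F c * g) = 0"
  by (cases "c = o'") (simp add: adm_high_degree[of p \<Lambda> D F], simp add: adm_def)

lemma second_diff_matrix_exists:
  assumes "deg_rel (=) UNIV D F"
  shows "\<exists>C G. \<forall>c. is_second_diff (if c = o' then D else d c) (cols F c) (\<lambda>k. C k c) (\<lambda>k l. G k l c)"
proof -
  have "\<forall>c. \<exists>C. \<exists>G. is_second_diff (if c = o' then D else d c) (cols F c) C G"
    using assms f_hom by (auto intro!: second_diff_exists)
  then obtain C where "\<forall>c. \<exists>G. is_second_diff (if c = o' then D else d c) (cols F c) (C c) G" by (rule choice[THEN exE])
  then obtain G where "\<forall>c. is_second_diff (if c = o' then D else d c) (cols F c) (C c) (G c)" by (rule choice[THEN exE])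
  then show ?thesis by (intro exI[of _ "\<lambda>k c. C c k"] exI[of _ "\<lambda>k l c. G c k l"]) simp
qed

lemma second_diff_is_diff_matrix:
  assumes "\<And>c. is_second_diff (e c) (h c) (\<lambda>k. C k c) (\<lambda>k l. G k l c)"
  shows "is_diff_matrix C h Px Pz"
  using assms unfolding is_second_diff_def is_diff_matrix_def by blast

lemma tens_det_cols:
  assumes L: "adm p (\<Lambda> r)" "adm q (\<Lambda> s)" and F: "deg_rel (=) UNIV D F" "p < D" "q < D" and "r \<noteq> s"
    and V: "is_diff_matrix V (cols F) r s" "is_diff_matrix V' (cols F) r s"
  shows "tens \<Lambda> (det (\<chi> k c. V k c)) = tens \<Lambda> (det (\<chi> k c. V' k c))"
  by (rule tens_det_independent[OF \<open>r \<noteq> s\<close> V adm_functional[OF L(1)] adm_functional[OF L(2)]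
        adm_cols[OF L(1) F(1,2)] adm_cols[OF L(2) F(1,3)]])

text \<open>Exchanging x and y in a difference matrix gives a difference matrix again, because both
  sides of the defining equation change sign. The same renaming exchanges the two
  functionals.\<close>

lemma is_product_comm:
  assumes L: "adm p \<Lambda>1" "adm q \<Lambda>2" and "is_product \<Lambda>1 \<Lambda>2 \<Lambda>12 D" "is_product \<Lambda>2 \<Lambda>1 \<Lambda>21 D"
    and F: "deg_rel (=) UNIV D F" "p < D" "q < D"
  shows "\<Lambda>12 F = \<Lambda>21 F"
proof -
  obtain C G where CG: "\<And>c. is_second_diff (if c = o' then D else d c) (cols F c) (\<lambda>k. C k c) (\<lambda>k l. G k l c)"
    using second_diff_matrix_exists[OF F(1)] by blast
  from is_diff_matrix_ren[OF second_diff_is_diff_matrix[where h = "cols F" and C = C and G = G, OF CG], of "id(Pz := Py)"]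
  have V: "is_diff_matrix (\<lambda>k c. ren (id(Pz := Py)) (C k c)) (cols F) Px Py" by simp
  define V where "V k c = ren (id(Pz := Py)) (C k c)" for k c
  define \<pi> where "\<pi> = (\<lambda>p. case p of Px \<Rightarrow> Py | Py \<Rightarrow> Px | Pz \<Rightarrow> Pz)"
  have \<pi>: "bij \<pi>" by (rule involuntory_imp_bij) (simp add: \<pi>_def split: pt.split)
  have "\<Lambda>21 F = tens (case_pt \<Lambda>2 \<Lambda>1 const_coeff) (det (\<chi> k c. V k c))"
    using assms(4) F(1) V by (simp add: is_product_def V_def)
  also have "case_pt \<Lambda>2 \<Lambda>1 const_coeff = (\<lambda>p. case_pt \<Lambda>1 \<Lambda>2 const_coeff (\<pi> p))"
    by (simp add: fun_eq_iff \<pi>_def split: pt.split)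
  also have "tens \<dots> (det (\<chi> k c. V k c)) = tens (case_pt \<Lambda>1 \<Lambda>2 const_coeff) (det (\<chi> k c. ren \<pi> (V k c)))"
    using tens_ren[OF \<pi>, of "case_pt \<Lambda>1 \<Lambda>2 const_coeff" "det (\<chi> k c. V k c)"] by (simp add: ren_det)
  also have "\<dots> = \<Lambda>12 F"
  proof -
    have "is_diff_matrix (\<lambda>k c. ren \<pi> (V k c)) (cols F) Px Py"
      using is_diff_matrix_ren[OF is_diff_matrix_sym[OF V], of \<pi>] by (simp add: \<pi>_def V_def)
    then show ?thesis using assms(3) F(1) by (simp add: is_product_def)
  qed
  finally show ?thesis by simp
qed

text \<open>This unfolds an inner product: with z as a parameter, \<open>\<Lambda>12\<close> is
  applied to \<open>Q\<close> as a polynomial in x, by means of a last column that is a difference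
  vector of \<open>Q\<close> between x and y.\<close>

lemma tens_product:
  assumes L: "adm p \<Lambda>1" "adm q \<Lambda>2" "adm r \<Lambda>3" "adm D12 \<Lambda>12" and prod: "is_product \<Lambda>1 \<Lambda>2 \<Lambda>12 D12"
    and a: "\<And>c. c \<noteq> o' \<Longrightarrow> (\<Sum>k\<in>UNIV. (X (Px, k) - X (Py, k)) * a k c) = ins Px (f c) - ins Py (f c)"
      "\<And>k c. c \<noteq> o' \<Longrightarrow> free_of Pz (a k c)"
    and Q: "free_of Py Q" "deg_rel (=) UNIV (D12 + r) Q"
    and w: "(\<Sum>k\<in>UNIV. (X (Px, k) - X (Py, k)) * w k) = Q - ren (id(Px := Py)) Q"
  shows "tens (case_pt \<Lambda>12 const_coeff \<Lambda>3) Q = tens (case_pt \<Lambda>1 \<Lambda>2 \<Lambda>3) (det (\<chi> k c. if c = o' then w k else a k c))"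
proof -
  let ?T = "tens (case_pt \<Lambda>1 \<Lambda>2 \<Lambda>3)"
  define mono where "mono \<alpha> = (Poly_Mapping.single \<alpha> 1 :: ('k, 'a) mpoly)" for \<alpha>
  have "\<exists>v. (\<Sum>k\<in>UNIV. (X (Px, k) - X (Py, k)) * v k) = ins Px (mono \<alpha>) - ins Py (mono \<alpha>) \<and> (\<forall>k. free_of Pz (v k))" for \<alpha>
  proof -
    obtain c G where c: "is_second_diff (int (deg_in UNIV \<alpha>)) (mono \<alpha>) c G"
      using second_diff_exists_single[of \<alpha>] by (auto simp: mono_def)
    have "ren (id(Pz := Py)) (\<Sum>k\<in>UNIV. (X (Px, k) - X (Pz, k)) * c k) = ren (id(Pz := Py)) (ins Px (mono \<alpha>) - ins Pz (mono \<alpha>))"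
      using c by (simp add: is_second_diff_def)
    moreover have "free_of Pz (ren (id(Pz := Py)) (c k))" for k
      using c by (intro free_of_ren[of Py]) (auto simp: is_second_diff_def split: if_splits)
    ultimately show ?thesis
      by (intro exI[of _ "\<lambda>k. ren (id(Pz := Py)) (c k)"]) (simp add: ren_sum ren_mult ren_diff ren_X ren_ins)
  qed
  then have "\<forall>\<alpha>. \<exists>v. (\<Sum>k\<in>UNIV. (X (Px, k) - X (Py, k)) * v k) = ins Px (mono \<alpha>) - ins Py (mono \<alpha>) \<and> (\<forall>k. free_of Pz (v k))" by blast
  then obtain v where v': "\<forall>\<alpha>. (\<Sum>k\<in>UNIV. (X (Px, k) - X (Py, k)) * v \<alpha> k) = ins Px (mono \<alpha>) - ins Py (mono \<alpha>) \<and> (\<forall>k. free_of Pz (v \<alpha> k))"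
    by (rule choice[THEN exE])
  then have v: "\<And>\<alpha>. (\<Sum>k\<in>UNIV. (X (Px, k) - X (Py, k)) * v \<alpha> k) = ins Px (mono \<alpha>) - ins Py (mono \<alpha>)"
    and v_free: "\<And>\<alpha> k. free_of Pz (v \<alpha> k)" by blast+
  \<comment> \<open>\<open>Q\<close> is split into monomials in x with coefficients
    \<open>s m\<close> in z; \<open>w0\<close> is its difference vector formed monomial by
    monomial.\<close>
  define s where "s m = Poly_Mapping.single 0 (Poly_Mapping.lookup Q m) * ins Pz (mono (part Pz m))" for m
  define w0 where "w0 k = (\<Sum>m\<in>Poly_Mapping.keys Q. s m * v (part Px m) k)" for k
  have mono_ins: "ins p (mono \<alpha>) = Poly_Mapping.single (ins_exp p \<alpha>) 1" for p \<alpha>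
    by (simp add: mono_def subst_rename_single)
  have Q_eq: "Q = (\<Sum>m\<in>Poly_Mapping.keys Q. s m * ins Px (mono (part Px m)))"
  proof -
    have "s m * ins Px (mono (part Px m)) = Poly_Mapping.single m (Poly_Mapping.lookup Q m)" if "m \<in> Poly_Mapping.keys Q" for m
    proof -
      have "ins_exp Pz (part Pz m) + ins_exp Px (part Px m) = m"
      proof (rule poly_mapping_eqI)
        fix j :: "pt \<times> 'k"
        obtain p k where j: "j = (p, k)" by force
        have "Poly_Mapping.lookup m (Py, k) = 0" using free_of_part[OF Q(1) that] by (metis lookup_part lookup_zero)
        then show "Poly_Mapping.lookup (ins_exp Pz (part Pz m) + ins_exp Px (part Px m)) j = Poly_Mapping.lookup m j"
          unfolding j by (cases p) (simp_all add: lookup_add lookup_ins_exp)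
      qed
      then show ?thesis by (simp add: s_def mono_ins mult_single)
    qed
    then show ?thesis using mpoly_sum_singles[of Q] by simp
  qed
  have "ren (id(Px := Py)) Q = (\<Sum>m\<in>Poly_Mapping.keys Q. s m * ins Py (mono (part Px m)))"
  proof -
    have "ren (id(Px := Py)) (s m) = s m" for m
      by (simp add: s_def ren_const_mult ren_ins)
    then show ?thesis by (subst Q_eq) (simp add: ren_sum ren_mult ren_ins)
  qed
  then have "Q - ren (id(Px := Py)) Q = (\<Sum>m\<in>Poly_Mapping.keys Q. s m * (ins Px (mono (part Px m)) - ins Py (mono (part Px m))))"
    using Q_eq by (simp add: right_diff_distrib sum_subtractf)
  also have "\<dots> = (\<Sum>m\<in>Poly_Mapping.keys Q. \<Sum>k\<in>UNIV. (X (Px, k) - X (Py, k)) * (s m * v (part Px m) k))"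
    unfolding v[symmetric] sum_distrib_left by (simp add: mult.left_commute)
  also have "\<dots> = (\<Sum>k\<in>UNIV. (X (Px, k) - X (Py, k)) * w0 k)"
    unfolding w0_def sum_distrib_left by (rule sum.swap)
  \<comment> \<open>The pairings of \<open>w\<close> and \<open>w0\<close> agree, so replacing one
    by the other changes the determinant only by multiples of the \<open>f c\<close> at x and at
    y.\<close>
  finally have w0: "(\<Sum>k\<in>UNIV. (X (Px, k) - X (Py, k)) * (w k - w0 k)) = 0"
    using w by (simp add: right_diff_distrib sum_subtractf)
  obtain r' where "det (\<chi> k c. if c = o' then w k - w0 k else a k c) = (\<Sum>c\<in>UNIV - {o'}. (ins Px (f c) - ins Py (f c)) * r' c)"
    using det_last_column[of Px Py "\<lambda>k. w k - w0 k" o' a "\<lambda>c. ins Px (f c) - ins Py (f c)", OF _ w0 a(1)] by auto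
  moreover have "?T ((ins Px (f c) - ins Py (f c)) * r' c) = 0" if "c \<noteq> o'" for c
    using tens_ins_mult_eq_0[of "case_pt \<Lambda>1 \<Lambda>2 \<Lambda>3" Px] tens_ins_mult_eq_0[of "case_pt \<Lambda>1 \<Lambda>2 \<Lambda>3" Py] L that
    by (simp add: left_diff_distrib tens_diff adm_def)
  ultimately have "?T (det (\<chi> k c. if c = o' then w k - w0 k else a k c)) = 0"
    by (simp add: tens_sum)
  then have "?T (det (\<chi> k c. if c = o' then w k else a k c)) = ?T (det (\<chi> k c. if c = o' then w0 k else a k c))"
    unfolding det_col_diff[symmetric] tens_diff by simp
  also have "\<dots> = ?T (\<Sum>m\<in>Poly_Mapping.keys Q. s m * det (\<chi> k c. if c = o' then v (part Px m) k else a k c))"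
    unfolding w0_def by (subst det_col_linear) simp_all
  also have "\<dots> = (\<Sum>m\<in>Poly_Mapping.keys Q. Poly_Mapping.lookup Q m * (\<Lambda>12 (mono (part Px m)) * \<Lambda>3 (mono (part Pz m))))"
    unfolding tens_sum
  proof (rule sum.cong[OF refl])
    fix m assume m: "m \<in> Poly_Mapping.keys Q"
    define R where "R = det (\<chi> k c. if c = o' then v (part Px m) k else a k c)"
    have "deg_rel (\<le>) (pt_vars Pz) (\<Sum>c\<in>(UNIV :: 'k set). 0) R"
      unfolding R_def by (rule deg_rel_det) (auto simp: v_free a(2))
    then have "free_of Pz R" by simp
    from tens_ins_mult_free[of "case_pt \<Lambda>1 \<Lambda>2 \<Lambda>3", OF _ this] L(3)
    have "?T (ins Pz (mono (part Pz m)) * R) = \<Lambda>3 (mono (part Pz m)) * tens ((case_pt \<Lambda>1 \<Lambda>2 \<Lambda>3)(Pz := const_coeff)) R"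
      by (simp add: adm_def)
    also have "(case_pt \<Lambda>1 \<Lambda>2 \<Lambda>3)(Pz := const_coeff) = case_pt \<Lambda>1 \<Lambda>2 const_coeff"
      by (auto simp: fun_eq_iff split: pt.split)
    also have "\<Lambda>3 (mono (part Pz m)) * tens (case_pt \<Lambda>1 \<Lambda>2 const_coeff) R = \<Lambda>12 (mono (part Px m)) * \<Lambda>3 (mono (part Pz m))"
    proof (cases "int (deg_in UNIV (part Px m)) = D12")
      case True
      have "is_diff_matrix (\<lambda>k c. if c = o' then v (part Px m) k else a k c) (cols (mono (part Px m))) Px Py"
        using v a(1) by (simp add: is_diff_matrix_def)
      moreover have "deg_rel (=) UNIV D12 (mono (part Px m))"
        using True by (simp add: mono_def deg_rel_single)
      ultimately have "\<Lambda>12 (mono (part Px m)) = tens (case_pt \<Lambda>1 \<Lambda>2 const_coeff) R"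
        using prod unfolding is_product_def R_def by blast
      then show ?thesis by simp
    next
      \<comment> \<open>As \<open>Q\<close> is homogeneous, a part in x of degree other than
        \<open>D12\<close> leaves a part in z of degree other than \<open>r\<close>, which
        \<open>\<Lambda>3\<close> annuls.\<close>
      case False
      have "int (deg_in UNIV m) = D12 + r" using Q(2) m by (simp add: deg_rel_def)
      then have "int (deg_in UNIV (part Pz m)) \<noteq> r"
        using False free_of_part[OF Q(1) m] by (simp add: deg_in_UNIV_parts)
      then show ?thesis using L(3) by (simp add: adm_def mono_def)
    qed
    finally show "?T (s m * det (\<chi> k c. if c = o' then v (part Px m) k else a k c)) = Poly_Mapping.lookup Q m * (\<Lambda>12 (mono (part Px m)) * \<Lambda>3 (mono (part Pz m)))"
      by (simp add: s_def mult.assoc tens_const_mult R_def)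
  qed
  also have "\<dots> = tens (case_pt \<Lambda>12 const_coeff \<Lambda>3) (\<Sum>m\<in>Poly_Mapping.keys Q. Poly_Mapping.single m (Poly_Mapping.lookup Q m))"
    unfolding tens_sum
  proof (rule sum.cong[OF refl])
    fix m assume "m \<in> Poly_Mapping.keys Q"
    then have "part Py m = 0" by (rule free_of_part[OF Q(1)])
    then show "Poly_Mapping.lookup Q m * (\<Lambda>12 (mono (part Px m)) * \<Lambda>3 (mono (part Pz m)))
        = tens (case_pt \<Lambda>12 const_coeff \<Lambda>3) (Poly_Mapping.single m (Poly_Mapping.lookup Q m))"
      by (simp add: tens_single UNIV_pt mono_def const_coeff_def)
  qed
  finally show ?thesis by (simp add: mpoly_sum_singles)
qed

text \<open>Both triple products apply \<open>\<Lambda>1\<close> in x, \<open>\<Lambda>2\<close> in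
  y and \<open>\<Lambda>3\<close> in z to a determinant, and \<open>exchange_det\<close> compares
  the two determinants. The reversed bracketing on the right is the mirror image of the left one
  under exchanging x and z.\<close>

lemma is_product_assoc:
  assumes L: "adm p \<Lambda>1" "adm q \<Lambda>2" "adm r \<Lambda>3" and L2: "adm (p + q - \<delta> + 1) \<Lambda>12" "adm (r + q - \<delta> + 1) \<Lambda>32"
    and ge: "\<delta> \<le> p" "\<delta> \<le> q" "\<delta> \<le> r" and D: "D = p + q + r - 2 * \<delta> + 2"
    and prod: "is_product \<Lambda>1 \<Lambda>2 \<Lambda>12 (p + q - \<delta> + 1)" "is_product \<Lambda>12 \<Lambda>3 \<Lambda>123 D"
      "is_product \<Lambda>3 \<Lambda>2 \<Lambda>32 (r + q - \<delta> + 1)" "is_product \<Lambda>32 \<Lambda>1 \<Lambda>321 D"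
    and F: "deg_rel (=) UNIV D F"
  shows "\<Lambda>123 F = \<Lambda>321 F"
proof -
  obtain C G where CG: "\<And>c. is_second_diff (if c = o' then D else d c) (cols F c) (\<lambda>k. C k c) (\<lambda>k l. G k l c)"
    using second_diff_matrix_exists[OF F] by blast
  have C: "is_diff_matrix C (cols F) Px Pz"
    by (rule second_diff_is_diff_matrix[where h = "cols F" and C = C and G = G, OF CG])
  have C_deg: "deg_rel (=) UNIV ((if c = o' then D else d c) - 1) (C k c)"
    and C_free: "free_of Py (C k c)"
    and G_deg: "deg_rel (=) UNIV ((if c = o' then D else d c) - 2) (G k l c)"
    and G1: "(\<Sum>k\<in>UNIV. (X (Px, k) - X (Py, k)) * G k l c) = C l c - ren (id(Px := Py)) (C l c)"
    and G2: "(\<Sum>l\<in>UNIV. (X (Py, l) - X (Pz, l)) * G k l c) = ren (id(Pz := Py)) (C k c) - C k c" for k l c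
    using CG[of c] unfolding is_second_diff_def by blast+
  \<comment> \<open>All difference matrices come from the single \<open>C\<close>: \<open>a\<close>
    by setting z to y, and \<open>b\<close> by setting x to y.\<close>
  define a where "a k c = ren (id(Pz := Py)) (C k c)" for k c
  define b where "b k c = ren (id(Px := Py)) (C k c)" for k c
  have a: "is_diff_matrix a (cols F) Px Py" and b: "is_diff_matrix b (cols F) Py Pz"
    using is_diff_matrix_ren[OF C, of "id(Pz := Py)"] is_diff_matrix_ren[OF C, of "id(Px := Py)"]
    by (simp_all add: a_def[abs_def] b_def[abs_def])
  have "\<exists>w w' u u' \<kappa>.
    (\<Sum>k\<in>UNIV. (X (Px, k) - X (Py, k)) * w k) = det (\<chi> k i. C k i) - det (\<chi> k i. b k i) \<and>
    (\<Sum>k\<in>UNIV. (X (Py, k) - X (Pz, k)) * w' k) = det (\<chi> k i. a k i) - det (\<chi> k i. C k i) \<and>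
    deg_rel (\<le>) (pt_vars Py) ((\<Sum>i\<in>UNIV - {o'}. d i - 1) - 1) \<kappa> \<and>
    det (\<chi> k i. if i = o' then w k else a k i) - det (\<chi> k i. if i = o' then w' k else b k i)
      = (\<Sum>i\<in>UNIV. (ins Px (cols F i) - ins Py (cols F i)) * u i)
        + (\<Sum>i\<in>UNIV. (ins Py (cols F i) - ins Pz (cols F i)) * u' i) + \<kappa>"
  proof (rule exchange_det[where G = G])
    show "(\<Sum>k\<in>UNIV. (X (Px, k) - X (Py, k)) * a k i) = ins Px (cols F i) - ins Py (cols F i)"
      "(\<Sum>k\<in>UNIV. (X (Py, k) - X (Pz, k)) * b k i) = ins Py (cols F i) - ins Pz (cols F i)" for i
      using a b unfolding is_diff_matrix_def by blast+
    show "(\<Sum>k\<in>UNIV. (X (Px, k) - X (Py, k) + (X (Py, k) - X (Pz, k))) * C k i)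
        = ins Px (cols F i) - ins Py (cols F i) + (ins Py (cols F i) - ins Pz (cols F i))" for i
      using C unfolding is_diff_matrix_def by simp
    show "deg_rel (\<le>) (pt_vars Py) (d i - 1) (a k i)" "deg_rel (\<le>) (pt_vars Py) (d i - 1) (b k i)"
      "deg_rel (\<le>) (pt_vars Py) (d i - 2) (G k l i)" if "i \<noteq> o'" for k l i
      using C_deg[of i k] G_deg[of i k l] that
      by (auto simp: a_def b_def intro!: deg_rel_eq_imp_le deg_rel_ren)
  qed (use G1 G2 C_free in \<open>auto simp: a_def b_def\<close>)
  then obtain w w' u u' \<kappa> where
    w: "(\<Sum>k\<in>UNIV. (X (Px, k) - X (Py, k)) * w k) = det (\<chi> k i. C k i) - det (\<chi> k i. b k i)"
    and w': "(\<Sum>k\<in>UNIV. (X (Py, k) - X (Pz, k)) * w' k) = det (\<chi> k i. a k i) - det (\<chi> k i. C k i)"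
    and \<kappa>: "deg_rel (\<le>) (pt_vars Py) (\<delta> - 1) \<kappa>"
    and eq: "det (\<chi> k i. if i = o' then w k else a k i) - det (\<chi> k i. if i = o' then w' k else b k i)
      = (\<Sum>i\<in>UNIV. (ins Px (cols F i) - ins Py (cols F i)) * u i)
        + (\<Sum>i\<in>UNIV. (ins Py (cols F i) - ins Pz (cols F i)) * u' i) + \<kappa>"
    unfolding \<delta>_def by blast
  \<comment> \<open>A product is evaluated at x and y, but as the outer step of a triple product it
    must be read at x and z, y being left for the inner step. The renamings move the points
    accordingly; \<open>\<sigma>\<close> is the mirror symmetry.\<close>
  define swap where "swap = (\<lambda>p. case p of Px \<Rightarrow> Px | Py \<Rightarrow> Pz | Pz \<Rightarrow> Py)"
  define \<sigma> where "\<sigma> = (\<lambda>p. case p of Px \<Rightarrow> Pz | Py \<Rightarrow> Py | Pz \<Rightarrow> Px)"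
  define \<rho> where "\<rho> = (\<lambda>p. case p of Px \<Rightarrow> Py | Py \<Rightarrow> Pz | Pz \<Rightarrow> Px)"
  have bij: "bij swap" "bij \<sigma>"
    by (rule involuntory_imp_bij, simp add: swap_def \<sigma>_def split: pt.split)+
  have swap_tens: "tens (case_pt \<Lambda> \<Lambda>' const_coeff) Q = tens (case_pt \<Lambda> const_coeff \<Lambda>') (ren swap Q)" for \<Lambda> \<Lambda>' Q
  proof -
    have "case_pt \<Lambda> \<Lambda>' const_coeff = (\<lambda>p. case_pt \<Lambda> const_coeff \<Lambda>' (swap p))"
      by (simp add: fun_eq_iff swap_def split: pt.split)
    then show ?thesis by (simp add: tens_ren[OF bij(1)])
  qed
  define Q where "Q = det (\<chi> k c. C k c)"
  have Q_free: "free_of Py Q"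
  proof -
    have "deg_rel (\<le>) (pt_vars Py) (\<Sum>c\<in>(UNIV :: 'k set). 0) Q"
      unfolding Q_def by (rule deg_rel_det) (auto simp: C_free)
    then show ?thesis by simp
  qed
  have Q_deg: "deg_rel (=) UNIV (\<delta> + D - 1) Q"
  proof -
    have "deg_rel (=) UNIV (\<Sum>c\<in>UNIV. (if c = o' then D else d c) - 1) Q"
      unfolding Q_def by (rule deg_rel_det) (auto simp: C_deg)
    also have "(\<Sum>c\<in>UNIV. (if c = o' then D else d c) - 1) = (D - 1) + \<delta>"
      by (subst sum.remove[of _ o']) (auto simp: \<delta>_def intro!: sum.cong)
    finally show ?thesis by (simp add: algebra_simps)
  qed

  have "\<Lambda>123 F = tens (case_pt \<Lambda>12 \<Lambda>3 const_coeff) (det (\<chi> k c. a k c))"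
    using prod(2) F a by (simp add: is_product_def)
  also have "\<dots> = tens (case_pt \<Lambda>12 const_coeff \<Lambda>3) Q"
  proof -
    have "ren swap (a k c) = C k c" for k c
      unfolding a_def ren_ren
      by (subst ren_cong[OF C_free, of _ "\<lambda>p. p"]) (auto simp: swap_def ren_id split: pt.split)
    then show ?thesis by (simp add: swap_tens ren_det Q_def)
  qed
  also have "\<dots> = tens (case_pt \<Lambda>1 \<Lambda>2 \<Lambda>3) (det (\<chi> k c. if c = o' then w k else a k c))"
  proof (rule tens_product[OF L L2(1) prod(1) _ _ Q_free])
    show "(\<Sum>k\<in>UNIV. (X (Px, k) - X (Py, k)) * a k c) = ins Px (f c) - ins Py (f c)" if "c \<noteq> o'" for c
      using a[unfolded is_diff_matrix_def, rule_format, of c] that by simp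
    show "free_of Pz (a k c)" for k c
      unfolding a_def by (rule free_of_ren[OF _ C_free]) (auto split: if_splits)
    show "deg_rel (=) UNIV (p + q - \<delta> + 1 + r) Q" using Q_deg D by (simp add: algebra_simps)
    show "(\<Sum>k\<in>UNIV. (X (Px, k) - X (Py, k)) * w k) = Q - ren (id(Px := Py)) Q"
      unfolding w Q_def by (simp add: ren_det b_def[abs_def])
  qed
  finally have 1: "\<Lambda>123 F = tens (case_pt \<Lambda>1 \<Lambda>2 \<Lambda>3) (det (\<chi> k c. if c = o' then w k else a k c))" .

  \<comment> \<open>The matrix \<open>C\<close> read from y to x in place of x to z, as the mirrored
    bracketing requires.\<close>
  define a' where "a' k c = ren \<rho> (C k c)" for k c
  have a': "is_diff_matrix a' (cols F) Px Py"
    using is_diff_matrix_sym[OF is_diff_matrix_ren[OF C, of \<rho>]] by (simp add: a'_def[abs_def] \<rho>_def)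
  have "\<Lambda>321 F = tens (case_pt \<Lambda>32 \<Lambda>1 const_coeff) (det (\<chi> k c. a' k c))"
    using prod(4) F a' by (simp add: is_product_def)
  also have "\<dots> = tens (case_pt \<Lambda>32 const_coeff \<Lambda>1) (ren \<sigma> Q)"
  proof -
    have "(\<lambda>p. swap (\<rho> p)) = \<sigma>" by (simp add: fun_eq_iff swap_def \<rho>_def \<sigma>_def split: pt.split)
    then show ?thesis by (simp add: swap_tens ren_det Q_def a'_def ren_ren)
  qed
  also have "\<dots> = tens (case_pt \<Lambda>3 \<Lambda>2 \<Lambda>1) (det (\<chi> k c. if c = o' then ren \<sigma> (w' k) else a' k c))"
  proof (rule tens_product[OF L(3,2,1) L2(2) prod(3)])
    show "(\<Sum>k\<in>UNIV. (X (Px, k) - X (Py, k)) * a' k c) = ins Px (f c) - ins Py (f c)" if "c \<noteq> o'" for c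
      using a'[unfolded is_diff_matrix_def, rule_format, of c] that by simp
    show "free_of Pz (a' k c)" for k c
      unfolding a'_def by (rule free_of_ren[OF _ C_free]) (auto simp: \<rho>_def split: pt.splits)
    show "free_of Py (ren \<sigma> Q)"
      by (rule free_of_ren[OF _ Q_free]) (auto simp: \<sigma>_def split: pt.splits)
    show "deg_rel (=) UNIV (r + q - \<delta> + 1 + p) (ren \<sigma> Q)"
      by (rule deg_rel_ren) (use Q_deg D in \<open>simp add: algebra_simps\<close>)
    have "ren \<sigma> (\<Sum>k\<in>UNIV. (X (Py, k) - X (Pz, k)) * w' k) = ren \<sigma> (det (\<chi> k i. a k i) - det (\<chi> k i. C k i))"
      unfolding w' ..
    then have "(\<Sum>k\<in>UNIV. (X (Py, k) - X (Px, k)) * ren \<sigma> (w' k)) = ren \<sigma> (det (\<chi> k i. a k i)) - ren \<sigma> Q"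
      by (simp add: ren_sum ren_mult ren_diff ren_X \<sigma>_def Q_def)
    moreover have "(\<Sum>k\<in>UNIV. (X (Px, k) - X (Py, k)) * ren \<sigma> (w' k)) = - (\<Sum>k\<in>UNIV. (X (Py, k) - X (Px, k)) * ren \<sigma> (w' k))"
      by (simp add: left_diff_distrib sum_subtractf)
    moreover have "ren \<sigma> (det (\<chi> k i. a k i)) = ren (id(Px := Py)) (ren \<sigma> Q)"
    proof -
      have "ren \<sigma> (a k c) = ren (id(Px := Py)) (ren \<sigma> (C k c))" for k c
        unfolding a_def ren_ren by (rule ren_cong[OF C_free]) (auto simp: \<sigma>_def split: pt.split)
      then show ?thesis by (simp add: Q_def ren_det)
    qed
    ultimately show "(\<Sum>k\<in>UNIV. (X (Px, k) - X (Py, k)) * ren \<sigma> (w' k)) = ren \<sigma> Q - ren (id(Px := Py)) (ren \<sigma> Q)"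
      by simp
  qed
  also have "\<dots> = tens (case_pt \<Lambda>1 \<Lambda>2 \<Lambda>3) (det (\<chi> k c. if c = o' then w' k else b k c))"
  proof -
    have "case_pt \<Lambda>3 \<Lambda>2 \<Lambda>1 = (\<lambda>p. case_pt \<Lambda>1 \<Lambda>2 \<Lambda>3 (\<sigma> p))"
      by (simp add: fun_eq_iff \<sigma>_def split: pt.split)
    moreover have "ren \<sigma> (a' k c) = b k c" for k c
      unfolding a'_def b_def ren_ren by (rule ren_cong[OF C_free]) (auto simp: \<sigma>_def \<rho>_def split: pt.split)
    moreover have "ren \<sigma> (ren \<sigma> (w' k)) = w' k" for k
    proof -
      have "(\<lambda>p. \<sigma> (\<sigma> p)) = (\<lambda>p. p)" by (simp add: fun_eq_iff \<sigma>_def split: pt.split)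
      then show ?thesis by (simp add: ren_ren ren_id)
    qed
    ultimately show ?thesis
      by (simp add: ren_det if_distrib[of "ren \<sigma>"] cong: if_cong flip: tens_ren[OF bij(2)])
  qed
  finally have 2: "\<Lambda>321 F = tens (case_pt \<Lambda>1 \<Lambda>2 \<Lambda>3) (det (\<chi> k c. if c = o' then w' k else b k c))" .

  let ?T = "tens (case_pt \<Lambda>1 \<Lambda>2 \<Lambda>3)"
  \<comment> \<open>\<open>D\<close> exceeds each of the three degrees by at least 2, so the column
    of \<open>F\<close> is annulled at every point.\<close>
  have lt: "p < D" "q < D" "r < D" using D ge by simp_all
  have kill: "?T (ins Px (cols F i) * g) = 0" "?T (ins Py (cols F i) * g) = 0" "?T (ins Pz (cols F i) * g) = 0" for i g
    using tens_ins_mult_eq_0[of "case_pt \<Lambda>1 \<Lambda>2 \<Lambda>3" Px "cols F i" g] tens_ins_mult_eq_0[of "case_pt \<Lambda>1 \<Lambda>2 \<Lambda>3" Py "cols F i" g]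
      tens_ins_mult_eq_0[of "case_pt \<Lambda>1 \<Lambda>2 \<Lambda>3" Pz "cols F i" g]
      adm_functional[OF L(1)] adm_functional[OF L(2)] adm_functional[OF L(3)]
      adm_cols[OF L(1) F lt(1)] adm_cols[OF L(2) F lt(2)] adm_cols[OF L(3) F lt(3)]
    by simp_all
  \<comment> \<open>In y the remainder has degree at most \<open>\<delta> - 1\<close>, whereas
    \<open>\<Lambda>2\<close> lives in degree q \<ge> \<delta>.\<close>
  have "?T \<kappa> = 0"
    unfolding tens_def
  proof (rule wtsum_eq_0)
    fix m assume "m \<in> Poly_Mapping.keys \<kappa>"
    then have "int (deg_in UNIV (part Py m)) \<noteq> q"
      using \<kappa> ge(2) unfolding deg_rel_def deg_in_pt_vars by force
    then have "\<Lambda>2 (Poly_Mapping.single (part Py m) 1) = 0" using L(2) by (simp add: adm_def)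
    then show "(\<Prod>p\<in>UNIV. case_pt \<Lambda>1 \<Lambda>2 \<Lambda>3 p (Poly_Mapping.single (part p m) 1)) = 0"
      by (simp add: UNIV_pt)
  qed
  then have "?T (det (\<chi> k i. if i = o' then w k else a k i) - det (\<chi> k i. if i = o' then w' k else b k i)) = 0"
    unfolding eq by (simp add: tens_add tens_sum left_diff_distrib tens_diff kill del: fun_upd_apply)
  then show ?thesis using 1 2 by (simp add: tens_diff)
qed

end

section \<open>Homogenisation\<close>

definition map_exp :: "(('v \<Rightarrow>\<^sub>0 nat) \<Rightarrow> ('w \<Rightarrow>\<^sub>0 nat)) \<Rightarrow> ('v, 'a::comm_ring_1) mpoly \<Rightarrow> ('w, 'a) mpoly"
  where "map_exp \<phi> G = (\<Sum>m\<in>Poly_Mapping.keys G. Poly_Mapping.single (\<phi> m) (Poly_Mapping.lookup G m))"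

lemma map_exp_single [simp]: "map_exp \<phi> (Poly_Mapping.single m c) = Poly_Mapping.single (\<phi> m) c"
  by (simp add: map_exp_def)

lemma map_exp_add: "map_exp \<phi> (p + q) = map_exp \<phi> p + map_exp \<phi> q"
  unfolding map_exp_def by (rule setsum_keys_plus_distrib) (simp_all add: single_add)

lemma map_exp_0 [simp]: "map_exp \<phi> 0 = 0"
  by (simp add: map_exp_def)

lemma map_exp_diff: "map_exp \<phi> (p - q) = map_exp \<phi> p - map_exp \<phi> q"
  using map_exp_add[of \<phi> "p - q" q] by simp

lemma map_exp_sum: "map_exp \<phi> (sum p I) = (\<Sum>i\<in>I. map_exp \<phi> (p i))"
  by (induction I rule: infinite_finite_induct) (simp_all add: map_exp_add)

lemma deg_rel_map_exp:
  "(\<And>m. m \<in> Poly_Mapping.keys G \<Longrightarrow> R (int (deg_in A (\<phi> m))) d) \<Longrightarrow> deg_rel R A d (map_exp \<phi> G)"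
  unfolding map_exp_def by (intro deg_rel_sum deg_rel_single)

lemma rename_exp_rename_exp: "rename_exp \<rho> (rename_exp \<rho>' m) = rename_exp (\<lambda>i. \<rho> (\<rho>' i)) m"
proof -
  have "subst (\<lambda>i. X (\<rho> i)) (subst (\<lambda>i. X (\<rho>' i)) (Poly_Mapping.single m (1::int))) = subst (\<lambda>i. X (\<rho> (\<rho>' i))) (Poly_Mapping.single m 1)"
    by (simp only: subst_subst subst_X)
  then show ?thesis by (simp only: subst_rename_single) (metis keys_single singleton_inject zero_neq_one)
qed

lemma rename_exp_single: "rename_exp \<rho> (Poly_Mapping.single i k) = Poly_Mapping.single (\<rho> i) k"
proof -
  have "(\<Sum>j\<in>UNIV. Poly_Mapping.single (\<rho> j) (Poly_Mapping.lookup (Poly_Mapping.single i k) j))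
      = (\<Sum>j\<in>UNIV. if j = i then Poly_Mapping.single (\<rho> i) k else 0)"
    by (rule sum.cong) (auto simp: lookup_single when_def)
  then show ?thesis by (simp add: rename_exp_def)
qed

text \<open>For a monomial of degree above \<open>e\<close> the exponent of the new variable is cut
  off at 0; the result has degree \<open>e\<close> only within the bound, see
  \<open>deg_in_hexp\<close>.\<close>

definition hexp :: "int \<Rightarrow> ('n::finite \<Rightarrow>\<^sub>0 nat) \<Rightarrow> 'n option \<Rightarrow>\<^sub>0 nat"
  where "hexp e m = Poly_Mapping.single None (nat (e - int (deg_in UNIV m))) + rename_exp Some m"

abbreviation homog :: "int \<Rightarrow> ('n::finite, 'a::comm_ring_1) mpoly \<Rightarrow> ('n option, 'a) mpoly"
  where "homog e \<equiv> map_exp (hexp e)"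

definition dehom :: "('n::finite option, 'a::comm_ring_1) mpoly \<Rightarrow> ('n, 'a) mpoly"
  where "dehom = subst (\<lambda>v. case v of None \<Rightarrow> 1 | Some i \<Rightarrow> X i)"

definition dexp :: "('n::finite option \<Rightarrow>\<^sub>0 nat) \<Rightarrow> 'n \<Rightarrow>\<^sub>0 nat"
  where "dexp \<mu> = (\<Sum>i\<in>UNIV. Poly_Mapping.single i (Poly_Mapping.lookup \<mu> (Some i)))"

lemma lookup_dexp [simp]: "Poly_Mapping.lookup (dexp \<mu>) i = Poly_Mapping.lookup \<mu> (Some i)"
  by (simp add: dexp_def lookup_sum lookup_single when_def)

lemma dexp_add: "dexp (\<mu> + \<nu>) = dexp \<mu> + dexp \<nu>"
  by (rule poly_mapping_eqI) (simp add: lookup_add)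

lemma sum_option: "(\<Sum>v\<in>UNIV. g v) = g None + (\<Sum>i\<in>UNIV. g (Some i))"
  for g :: "'n::finite option \<Rightarrow> 'b::comm_monoid_add"
  by (simp add: UNIV_option_conv sum.reindex)

lemma prod_option: "(\<Prod>v\<in>UNIV. g v) = g None * (\<Prod>i\<in>UNIV. g (Some i))"
  for g :: "'n::finite option \<Rightarrow> 'b::comm_monoid_mult"
  by (simp add: UNIV_option_conv prod.reindex)

lemma deg_in_option: "deg_in UNIV \<mu> = Poly_Mapping.lookup \<mu> None + deg_in UNIV (dexp \<mu>)"
  by (simp add: deg_in_def sum_option)

lemma dehom_add: "dehom (p + q) = dehom p + dehom q"
  and dehom_sum: "dehom (sum g I) = (\<Sum>i\<in>I. dehom (g i))"
  and dehom_mult: "dehom (p * q) = dehom p * dehom q"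
  by (simp_all add: dehom_def subst_add subst_sum subst_mult)

lemma dehom_single: "dehom (Poly_Mapping.single \<mu> c) = Poly_Mapping.single (dexp \<mu>) c"
  by (simp add: dehom_def subst_single prod_option X_power prod_single scale_single dexp_def)

lemma homog_single: "homog e (Poly_Mapping.single m c) = X None ^ nat (e - int (deg_in UNIV m)) * subst (\<lambda>i. X (Some i)) (Poly_Mapping.single m c)"
  by (simp add: hexp_def X_power subst_rename_single mult_single)

lemma dehom_homog: "dehom (homog e F) = F"
proof (induction F rule: mpoly_single_induct)
  case (single m c)
  show ?case unfolding homog_single by (simp add: dehom_def subst_mult subst_power subst_subst)
qed (simp add: map_exp_add dehom_def subst_add)

lemma hexp_dexp: "int (deg_in UNIV \<mu>) = e \<Longrightarrow> hexp e (dexp \<mu>) = \<mu>"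
proof (rule poly_mapping_eqI)
  fix v
  assume "int (deg_in UNIV \<mu>) = e"
  then have "nat (e - int (deg_in UNIV (dexp \<mu>))) = Poly_Mapping.lookup \<mu> None"
    by (auto simp: deg_in_option)
  moreover have "inj (Some :: 'a \<Rightarrow> 'a option)" by simp
  ultimately show "Poly_Mapping.lookup (hexp e (dexp \<mu>)) v = Poly_Mapping.lookup \<mu> v"
    by (cases v) (simp_all add: hexp_def lookup_add lookup_rename_exp inv_f_f lookup_single image_iff)
qed

lemma homog_dehom:
  assumes "deg_rel (=) UNIV e F"
  shows "homog e (dehom F) = F"
proof -
  have "homog e (dehom (\<Sum>m\<in>Poly_Mapping.keys F. Poly_Mapping.single m (Poly_Mapping.lookup F m)))
      = (\<Sum>m\<in>Poly_Mapping.keys F. Poly_Mapping.single m (Poly_Mapping.lookup F m))"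
    unfolding dehom_sum map_exp_sum dehom_single map_exp_single
    by (intro sum.cong refl) (simp only: hexp_dexp[OF assms[unfolded deg_rel_def, rule_format]])
  then show ?thesis by (simp only: mpoly_sum_singles)
qed

lemma deg_in_hexp: "int (deg_in UNIV m) \<le> e \<Longrightarrow> int (deg_in UNIV (hexp e m)) = e"
  by (simp add: hexp_def deg_in_add deg_in_single deg_in_rename_exp)

lemma deg_rel_homog: "F \<in> polys_le e \<Longrightarrow> deg_rel (=) UNIV e (homog e F)"
  by (rule deg_rel_map_exp) (simp add: polys_le_iff deg_rel_def deg_in_hexp)

lemma dehom_polys_le: "deg_rel (=) UNIV e F \<Longrightarrow> dehom F \<in> polys_le e"
proof -
  assume F: "deg_rel (=) UNIV e F"
  have "deg_rel (\<le>) UNIV e (dehom (\<Sum>m\<in>Poly_Mapping.keys F. Poly_Mapping.single m (Poly_Mapping.lookup F m)))"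
    unfolding dehom_sum dehom_single
    using F by (intro deg_rel_sum deg_rel_single) (auto simp: deg_rel_def deg_in_option)
  then show ?thesis by (simp only: mpoly_sum_singles polys_le_iff)
qed

text \<open>\<open>L\<close> is applied after dehomogenising, and in degree \<open>p\<close> only.
  The values of \<open>L\<close> on polynomials of degree above \<open>p\<close> are forgotten, see
  \<open>hfun_cong\<close>.\<close>

definition hfun :: "int \<Rightarrow> ('n::finite, 'a::field) functional \<Rightarrow> ('n option, 'a) functional"
  where "hfun p L = wtsum (\<lambda>\<mu>. if int (deg_in UNIV \<mu>) = p then L (Poly_Mapping.single (dexp \<mu>) 1) else 0)"

lemma hfun_hom:
  assumes "is_functional L" "deg_rel (=) UNIV e F"
  shows "hfun p L F = (if e = p then L (dehom F) else 0)"
proof -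
  have key: "L (Poly_Mapping.single m c) = c * L (Poly_Mapping.single m 1)" for m c
    using functional_const_mult[OF assms(1), of c "Poly_Mapping.single m 1"] by (simp add: mult_single)
  have "L (dehom (\<Sum>m\<in>Poly_Mapping.keys F. Poly_Mapping.single m (Poly_Mapping.lookup F m)))
      = wtsum (\<lambda>\<mu>. L (Poly_Mapping.single (dexp \<mu>) 1)) F"
    unfolding dehom_sum dehom_single functional_sum[OF assms(1)] wtsum_def by (rule sum.cong[OF refl]) (rule key)
  then have "L (dehom F) = wtsum (\<lambda>\<mu>. L (Poly_Mapping.single (dexp \<mu>) 1)) F" by (simp only: mpoly_sum_singles)
  moreover have "hfun p L F = wtsum (\<lambda>\<mu>. if e = p then L (Poly_Mapping.single (dexp \<mu>) 1) else 0) F"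
    unfolding hfun_def using assms(2) by (intro wtsum_cong) (auto simp: deg_rel_def)
  ultimately show ?thesis by (cases "e = p") (simp_all add: wtsum_eq_0)
qed

lemma hfun_single: "hfun p L (Poly_Mapping.single \<mu> 1) = (if int (deg_in UNIV \<mu>) = p then L (Poly_Mapping.single (dexp \<mu>) 1) else 0)"
  by (simp add: hfun_def)

lemma ideal_leI: "g \<in> polys_le (e - int (total_degree (f i))) \<Longrightarrow> f i * g \<in> ideal_le f e"
  for f :: "'n::finite \<Rightarrow> ('n, 'a::comm_ring_1) mpoly"
proof -
  assume g: "g \<in> polys_le (e - int (total_degree (f i)))"
  have "f i * g = (\<Sum>j\<in>UNIV. f j * (if j = i then g else 0))"
    by (simp add: if_distrib[of "(*) _"] cong: if_cong)
  moreover have "\<forall>j. (if j = i then g else 0) \<in> polys_le (e - int (total_degree (f j)))"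
    using g by (simp add: polys_le_def)
  ultimately show ?thesis
    unfolding ideal_le_def by (intro CollectI exI[of _ "\<lambda>j. if j = i then g else 0"] conjI)
qed

text \<open>The family of the homogenised polynomials; the column \<open>None\<close> is left for the argument of the functional.\<close>

definition hsys :: "('n::finite \<Rightarrow> ('n, 'a::comm_ring_1) mpoly) \<Rightarrow> 'n option \<Rightarrow> ('n option, 'a) mpoly"
  where "hsys f v = (case v of None \<Rightarrow> 0 | Some i \<Rightarrow> homog (int (total_degree (f i))) (f i))"

definition hdeg :: "('n::finite \<Rightarrow> ('n, 'a::comm_ring_1) mpoly) \<Rightarrow> 'n option \<Rightarrow> int"
  where "hdeg f v = (case v of None \<Rightarrow> 0 | Some i \<Rightarrow> int (total_degree (f i)))"

lemma polys_le_total_degree: "p \<in> polys_le (int (total_degree p))"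
  by (simp add: polys_le_def)

lemma hom_system_hsys: "hom_system (hsys f) None (hdeg f)"
  by unfold_locales (auto simp: hsys_def hdeg_def split: option.split intro!: deg_rel_homog polys_le_total_degree)

lemma delta_hsys: "hom_system.\<delta> None (hdeg f) = delta f" for f :: "'n::finite \<Rightarrow> ('n, 'a::field) mpoly"
proof -
  have "(UNIV :: 'n option set) - {None} = range Some" by (auto simp: UNIV_option_conv)
  then show ?thesis
    unfolding hom_system.\<delta>_def[OF hom_system_hsys] by (simp add: delta_def hdeg_def sum.reindex)
qed

text \<open>In degree \<open>p\<close>, a multiple of the homogenised \<open>f i\<close>
  dehomogenises to \<open>f i\<close> times a polynomial of degree at most p minus the degree of
  \<open>f i\<close>. Here annulling a bounded part of the ideal becomes annulling all
  multiples.\<close>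

lemma adm_hfun:
  assumes L: "L \<in> annulling (ideal_le f p)"
  shows "hom_system.adm (hsys f) None p (hfun p L)"
  unfolding hom_system.adm_def[OF hom_system_hsys]
proof (intro conjI allI impI)
  show "is_functional (hfun p L)" by (simp add: hfun_def)
  show "hfun p L (Poly_Mapping.single m 1) = 0" if "int (deg_in UNIV m) \<noteq> p" for m
    using that by (simp add: hfun_single)
  have L': "is_functional L" using L by (simp add: annulling_def)
  show "hfun p L (hsys f v * g) = 0" if "v \<noteq> None" for v g
  proof -
    obtain i where v: "v = Some i" using \<open>v \<noteq> None\<close> by auto
    have key: "hfun p L (hsys f v * Poly_Mapping.single m 1) = 0" for m
    proof -
      have deg: "deg_rel (=) UNIV (int (total_degree (f i)) + int (deg_in UNIV m)) (hsys f v * Poly_Mapping.single m 1)"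
        unfolding v hsys_def by (intro deg_rel_mult) (auto intro!: deg_rel_homog polys_le_total_degree deg_rel_single)
      show ?thesis
      proof (cases "int (total_degree (f i)) + int (deg_in UNIV m) = p")
        case True
        have "Poly_Mapping.single (dexp m) (1::'b) \<in> polys_le (p - int (total_degree (f i)))"
          using True unfolding polys_le_iff by (intro deg_rel_single) (simp add: deg_in_option)
        then have "L (f i * Poly_Mapping.single (dexp m) 1) = 0"
          using L ideal_leI unfolding annulling_def by blast
        moreover have "dehom (hsys f v * Poly_Mapping.single m 1) = f i * Poly_Mapping.single (dexp m) 1"
          unfolding v hsys_def by (simp add: dehom_mult dehom_homog dehom_single)
        ultimately show ?thesis using hfun_hom[OF L' deg] by simp
      qed (simp add: hfun_hom[OF L' deg])
    qed
    show ?thesis unfolding hfun_def by (rule wtsum_mult, rule key[unfolded hfun_def])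
  qed
qed

section \<open>Row operations on determinants\<close>

lemma deg_rel_det_rows:
  fixes M :: "('v, 'a::comm_ring_1) mpoly ^ 'k ^ 'k"
  assumes R: "additive_rel R" and M: "\<And>i j. deg_rel R A (r i + d j) (M $ i $ j)"
  shows "deg_rel R A ((\<Sum>i\<in>UNIV. r i) + (\<Sum>j\<in>UNIV. d j)) (det M)"
  unfolding det_def
proof (rule deg_rel_sum)
  fix p assume "p \<in> {p. p permutes (UNIV::'k set)}"
  then have "(\<Sum>i\<in>UNIV. d (p i)) = (\<Sum>j\<in>UNIV. d j)"
    by (intro sum.reindex_bij_betw) (simp add: permutes_imp_bij)
  then have "deg_rel R A ((\<Sum>i\<in>UNIV. r i) + (\<Sum>j\<in>UNIV. d j)) (\<Prod>i\<in>UNIV. M $ i $ p i)"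
    using deg_rel_prod[OF R, of UNIV A "\<lambda>i. r i + d (p i)" "\<lambda>i. M $ i $ p i"] M by (simp add: sum.distrib)
  then show "deg_rel R A ((\<Sum>i\<in>UNIV. r i) + (\<Sum>j\<in>UNIV. d j)) (of_int (sign p) * (\<Prod>i\<in>UNIV. M $ i $ p i))"
    by (auto simp: sign_def deg_rel_uminus)
qed

lemma det_row_linear:
  fixes M :: "'k::finite \<Rightarrow> 'k \<Rightarrow> 'r::comm_ring_1"
  assumes "finite J"
  shows "det (\<chi> r c. if r = o' then \<Sum>j\<in>J. s j * w j c else M r c)
    = (\<Sum>j\<in>J. s j * det (\<chi> r c. if r = o' then w j c else M r c))"
proof -
  have tr: "det (\<chi> r c. if r = o' then v r c else M r c) = det (\<chi> k c. if c = o' then v c k else M c k)" for v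
    using det_transpose[of "\<chi> r c. if r = o' then v r c else M r c"] by (simp add: transpose_def cong: if_cong)
  show ?thesis
    using det_col_linear[OF assms, of o' s w "\<lambda>k c. M c k"] by (simp add: tr)
qed

lemma det_row_expand:
  fixes M :: "'k::finite \<Rightarrow> 'k \<Rightarrow> 'r::comm_ring_1"
  shows "det (\<chi> r c. if r = o' then v c else M r c)
    = (\<Sum>j\<in>UNIV. v j * det (\<chi> r c. if r = o' then (if c = j then 1 else 0) else M r c))"
  using det_row_linear[of UNIV o' v "\<lambda>j c. if c = j then 1 else 0" M]
  by (simp add: if_distrib[of "(*) _"] cong: if_cong)

lemma det_row_combination:
  fixes M :: "'k::finite \<Rightarrow> 'k \<Rightarrow> 'r::comm_ring_1"
  shows "det (\<chi> r c. if r = o' then v c + (\<Sum>k\<in>UNIV - {o'}. z k * M k c) else M r c)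
    = det (\<chi> r c. if r = o' then v c else M r c)"
proof -
  define s where "s k = (if k = o' then 1 else z k)" for k
  define w where "w k c = (if k = o' then v c else M k c)" for k c
  have "v c + (\<Sum>k\<in>UNIV - {o'}. z k * M k c) = (\<Sum>k\<in>UNIV. s k * w k c)" for c
    by (subst sum.remove[of UNIV o']) (auto simp: s_def w_def intro!: sum.cong)
  then have "det (\<chi> r c. if r = o' then v c + (\<Sum>k\<in>UNIV - {o'}. z k * M k c) else M r c)
      = (\<Sum>k\<in>UNIV. s k * det (\<chi> r c. if r = o' then w k c else M r c))"
    using det_row_linear[of UNIV o' s w M] by (simp cong: if_cong)
  also have "det (\<chi> r c. if r = o' then w k c else M r c) = 0" if "k \<noteq> o'" for k
    using that by (intro det_identical_rows[of k o']) (auto simp: row_def vec_eq_iff w_def)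
  then have "(\<Sum>k\<in>UNIV. s k * det (\<chi> r c. if r = o' then w k c else M r c))
      = (\<Sum>k\<in>UNIV. if k = o' then det (\<chi> r c. if r = o' then v c else M r c) else 0)"
    by (intro sum.cong) (auto simp: s_def w_def cong: if_cong)
  finally show ?thesis by simp
qed

section \<open>The extension operation as a product of homogenised functionals\<close>

lemma deg_in_rename_exp_outside: "(\<And>v. \<rho> v \<notin> A) \<Longrightarrow> deg_in A (rename_exp \<rho> m) = 0"
  unfolding deg_in_def rename_exp_def lookup_sum
  by (intro sum.neutral ballI) (auto simp: lookup_single when_def)

lemma deg_rel_rename_outside:
  assumes "\<And>v. \<rho> v \<notin> A"
  shows "deg_rel (\<le>) A 0 (subst (\<lambda>i. X (\<rho> i)) p)"
proof (induction p rule: mpoly_single_induct)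
  case (single m c)
  show ?case unfolding subst_rename_single
    by (intro deg_rel_single) (simp add: deg_in_rename_exp_outside assms)
qed (simp add: subst_add deg_rel_add)

definition lift_var :: "'n + 'n \<Rightarrow> pt \<times> 'n option"
  where "lift_var v = (case v of Inl i \<Rightarrow> (Px, Some i) | Inr i \<Rightarrow> (Py, Some i))"

definition lift_exp :: "int \<Rightarrow> ('n::finite + 'n \<Rightarrow>\<^sub>0 nat) \<Rightarrow> pt \<times> 'n option \<Rightarrow>\<^sub>0 nat"
  where "lift_exp e m = Poly_Mapping.single (Px, None) (nat (e - int (deg_in UNIV m))) + rename_exp lift_var m"

text \<open>Polynomials in \<open>x\<close> and \<open>y\<close> are homogenised by the additional coordinate of the point \<open>x\<close> alone.\<close>

abbreviation lift :: "int \<Rightarrow> ('n::finite + 'n, 'a::comm_ring_1) mpoly \<Rightarrow> (pt \<times> 'n option, 'a) mpoly"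
  where "lift e \<equiv> map_exp (lift_exp e)"

text \<open>An intermediate point with the homogenising coordinate of x and the other coordinates of
  y. The way from x to it is described by the given difference derivative, the way from it to y
  changes a single variable.\<close>

definition mix_var :: "'n option \<Rightarrow> pt \<times> 'n option"
  where "mix_var v = (case v of None \<Rightarrow> (Px, None) | Some i \<Rightarrow> (Py, Some i))"

abbreviation mixed :: "('n::finite option, 'a::comm_ring_1) mpoly \<Rightarrow> (pt \<times> 'n option, 'a) mpoly"
  where "mixed \<equiv> subst (\<lambda>v. X (mix_var v))"

lemma lift_X_mult: "lift e (X v * G) = X (lift_var v) * lift (e - 1) G"
proof (induction G rule: mpoly_single_induct)
  case (single m c)
  have "lift_exp e (Poly_Mapping.single v 1 + m) = Poly_Mapping.single (lift_var v) 1 + lift_exp (e - 1) m"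
    by (simp add: lift_exp_def rename_exp_add rename_exp_single deg_in_add deg_in_single add.left_commute algebra_simps)
  then show ?case
    unfolding map_exp_single single_eq_X_mult[symmetric] by (simp only:)
qed (simp add: map_exp_add distrib_left)

lemma lift_in_x: "lift e (in_x F) = ins Px (homog e F)"
proof (induction F rule: mpoly_single_induct)
  case (single m c)
  show ?case
    by (simp add: subst_rename_single lift_exp_def hexp_def rename_exp_add rename_exp_single rename_exp_rename_exp
        deg_in_rename_exp lift_var_def)
qed (simp add: map_exp_add subst_add)

lemma lift_in_y: "lift e (in_y F) = mixed (homog e F)"
proof (induction F rule: mpoly_single_induct)
  case (single m c)
  show ?case
    by (simp add: subst_rename_single lift_exp_def hexp_def rename_exp_add rename_exp_single rename_exp_rename_exp
        deg_in_rename_exp lift_var_def mix_var_def)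
qed (simp add: map_exp_add subst_add)

lemma deg_rel_lift: "G \<in> polys_le e \<Longrightarrow> deg_rel (=) UNIV e (lift e G)"
  by (rule deg_rel_map_exp)
    (simp add: polys_le_iff deg_rel_def lift_exp_def deg_in_add deg_in_single deg_in_rename_exp)

lemma free_of_lift: "free_of Pz (lift e G)"
  by (rule deg_rel_map_exp)
    (simp add: lift_exp_def deg_in_add deg_in_single deg_in_rename_exp_outside lift_var_def split: sum.split)

text \<open>Between the mixed point and y all coordinate differences vanish except the one at
  \<open>None\<close>, so only one term of a difference derivative is left.\<close>

lemma mixed_difference:
  assumes "deg_rel (=) UNIV e (F :: ('n::finite option, 'a::comm_ring_1) mpoly)"
  shows "\<exists>q. deg_rel (=) UNIV (e - 1) q \<and> free_of Pz q \<and>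
    (X (Px, None) - X (Py, None)) * q = mixed F - ins Py F"
proof -
  obtain c G where "is_second_diff e F c G" using second_diff_exists[OF assms] by blast
  then have deg: "deg_rel (=) UNIV (e - 1) (c k)"
    and eq: "(\<Sum>k\<in>UNIV. (X (Px, k) - X (Pz, k)) * c k) = ins Px F - ins Pz F" for k
    by (auto simp: is_second_diff_def)
  define \<tau> :: "pt \<times> 'n option \<Rightarrow> pt \<times> 'n option" where "\<tau> v = (if fst v = Px then mix_var (snd v) else (Py, snd v))" for v
  define q where "q = subst (\<lambda>v. X (\<tau> v)) (c None)"
  have "subst (\<lambda>v. X (\<tau> v)) (\<Sum>k\<in>UNIV. (X (Px, k) - X (Pz, k)) * c k) = (X (Px, None) - X (Py, None)) * q"
    by (simp add: subst_add subst_sum subst_mult subst_diff sum_option \<tau>_def mix_var_def q_def)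
  moreover have "subst (\<lambda>v. X (\<tau> v)) (ins Px F - ins Pz F) = mixed F - ins Py F"
    by (simp add: subst_diff subst_subst \<tau>_def)
  moreover have "free_of Pz q"
    unfolding q_def by (rule deg_rel_rename_outside) (auto simp: \<tau>_def mix_var_def split: option.split)
  moreover have "deg_rel (=) UNIV (e - 1) q" unfolding q_def by (rule deg_rel_rename[OF deg])
  ultimately show ?thesis using eq by (intro exI[of _ q]) simp
qed

section \<open>Truncated pairings of two functionals\<close>

definition pairing :: "('n::finite, 'a::field) functional \<Rightarrow> ('n, 'a) functional \<Rightarrow> (pt \<times> 'n option \<Rightarrow>\<^sub>0 nat) \<Rightarrow> 'a"
  where "pairing L1 L2 \<mu> = L1 (Poly_Mapping.single (dexp (part Px \<mu>)) 1) * L2 (Poly_Mapping.single (dexp (part Py \<mu>)) 1)"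

text \<open>Dehomogenising forgets degrees; the truncation by the degree in x retains as much of
  them as the comparison with \<open>tens\<close> needs.\<close>

definition cut :: "(int \<Rightarrow> bool) \<Rightarrow> ('n::finite, 'a::field) functional \<Rightarrow> ('n, 'a) functional \<Rightarrow> (pt \<times> 'n option, 'a) mpoly \<Rightarrow> 'a"
  where "cut \<theta> L1 L2 = wtsum (\<lambda>\<mu>. if \<theta> (int (deg_in UNIV (part Px \<mu>))) then pairing L1 L2 \<mu> else 0)"

lemma functional_single_mult:
  assumes "is_functional L"
  shows "c * L (Poly_Mapping.single (m + a) 1) = L (Poly_Mapping.single m c * Poly_Mapping.single a 1)"
  using functional_const_mult[OF assms, of c "Poly_Mapping.single (m + a) 1"] by (simp add: mult_single)

lemma cut_ins_Px:
  assumes L: "is_functional L1" and F: "deg_rel (=) UNIV e F"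
  shows "cut \<theta> L1 L2 (ins Px F * Poly_Mapping.single \<mu> 1)
    = (if \<theta> (e + int (deg_in UNIV (part Px \<mu>)))
       then L1 (dehom F * Poly_Mapping.single (dexp (part Px \<mu>)) 1) * L2 (Poly_Mapping.single (dexp (part Py \<mu>)) 1) else 0)"
proof -
  let ?b = "\<theta> (e + int (deg_in UNIV (part Px \<mu>)))"
  let ?w = "L2 (Poly_Mapping.single (dexp (part Py \<mu>)) 1)"
  have key: "cut \<theta> L1 L2 (ins Px (Poly_Mapping.single m c) * Poly_Mapping.single \<mu> 1)
      = (if ?b then L1 (dehom (Poly_Mapping.single m c) * Poly_Mapping.single (dexp (part Px \<mu>)) 1) * ?w else 0)"
    if "m \<in> Poly_Mapping.keys F" for m c
  proof -
    have "int (deg_in UNIV m) = e" using that F by (simp add: deg_rel_def)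
    then have "int (deg_in UNIV (part Px (ins_exp Px m + \<mu>))) = e + int (deg_in UNIV (part Px \<mu>))"
      by (simp add: part_add part_ins_exp deg_in_add)
    moreover have "c * pairing L1 L2 (ins_exp Px m + \<mu>)
        = L1 (dehom (Poly_Mapping.single m c) * Poly_Mapping.single (dexp (part Px \<mu>)) 1) * ?w"
      unfolding pairing_def dehom_single functional_single_mult[OF L, symmetric]
      by (simp add: part_add part_ins_exp dexp_add)
    ultimately show ?thesis by (simp add: cut_def subst_rename_single mult_single)
  qed
  have "cut \<theta> L1 L2 (ins Px (\<Sum>m\<in>Poly_Mapping.keys F. Poly_Mapping.single m (Poly_Mapping.lookup F m)) * Poly_Mapping.single \<mu> 1)
     = (\<Sum>m\<in>Poly_Mapping.keys F. if ?b then L1 (dehom (Poly_Mapping.single m (Poly_Mapping.lookup F m)) * Poly_Mapping.single (dexp (part Px \<mu>)) 1) * ?w else 0)"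
    unfolding subst_sum sum_distrib_right cut_def wtsum_sum
    by (rule sum.cong[OF refl]) (rule key[unfolded cut_def])
  also have "\<dots> = (if ?b then L1 (dehom (\<Sum>m\<in>Poly_Mapping.keys F. Poly_Mapping.single m (Poly_Mapping.lookup F m)) * Poly_Mapping.single (dexp (part Px \<mu>)) 1) * ?w else 0)"
    by (cases ?b) (simp_all only: dehom_sum sum_distrib_right functional_sum[OF L] if_True if_False sum.neutral_const)
  finally show ?thesis by (simp only: mpoly_sum_singles)
qed

lemma cut_ins_Py:
  assumes L: "is_functional L2"
  shows "cut \<theta> L1 L2 (ins Py F * Poly_Mapping.single \<mu> 1)
    = (if \<theta> (int (deg_in UNIV (part Px \<mu>)))
       then L1 (Poly_Mapping.single (dexp (part Px \<mu>)) 1) * L2 (dehom F * Poly_Mapping.single (dexp (part Py \<mu>)) 1) else 0)"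
proof (induction F rule: mpoly_single_induct)
  case (single m c)
  have "c * pairing L1 L2 (ins_exp Py m + \<mu>)
      = L1 (Poly_Mapping.single (dexp (part Px \<mu>)) 1) * L2 (dehom (Poly_Mapping.single m c) * Poly_Mapping.single (dexp (part Py \<mu>)) 1)"
    unfolding pairing_def dehom_single functional_single_mult[OF L, symmetric]
    by (simp add: part_add part_ins_exp dexp_add)
  then show ?case by (simp add: cut_def subst_rename_single mult_single part_add part_ins_exp)
next
  case (add F F')
  then show ?case
    by (simp add: subst_add distrib_right cut_def wtsum_add dehom_add functional_add[OF L] distrib_left)
qed

lemma part_single: "part p (Poly_Mapping.single (p', k) a) = (if p = p' then Poly_Mapping.single k a else 0)"
  by (rule poly_mapping_eqI) (auto simp: lookup_single when_def)

lemma dexp_single_None: "dexp (Poly_Mapping.single None a) = 0"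
  by (rule poly_mapping_eqI) (simp add: lookup_single)

text \<open>The homogenising variables are invisible to \<open>pairing\<close>, but the one at x
  raises the degree in x by one and the one at y does not. Two neighbouring truncations are thus
  subtracted, and exactly degree \<open>p\<close> survives.\<close>

lemma cut_difference:
  "cut (\<lambda>j. p < j) L1 L2 ((X (Px, None) - X (Py, None)) * \<nu>)
    = wtsum (\<lambda>\<mu>. if int (deg_in UNIV (part Px \<mu>)) = p then pairing L1 L2 \<mu> else 0) \<nu>"
proof (induction \<nu> rule: mpoly_single_induct)
  case (single m c)
  show ?case
    unfolding left_diff_distrib single_eq_X_mult[symmetric]
    by (auto simp: cut_def wtsum_diff part_add part_single pairing_def dexp_add dexp_single_None deg_in_add deg_in_single)
next
  case (add P Q)
  then show ?case by (simp only: distrib_left cut_def wtsum_add)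
qed

text \<open>In total degree \<open>p + q\<close>, degree \<open>p\<close> in x forces degree
  \<open>q\<close> in y, so a condition on x alone decides. The factor on the right is there to be
  absorbed in a row of a determinant.\<close>

lemma tens_hfun:
  fixes \<nu> :: "(pt \<times> 'n::finite option, 'a::field) mpoly"
  assumes \<nu>: "deg_rel (=) UNIV (p + q) \<nu>" "free_of Pz \<nu>"
  shows "tens (case_pt (hfun p L1) (hfun q L2) const_coeff) \<nu>
    = cut (\<lambda>j. p < j) L1 L2 ((X (Px, None) - X (Py, None)) * \<nu>)"
  unfolding cut_difference tens_def
proof (rule wtsum_cong)
  fix \<mu> assume \<mu>: "\<mu> \<in> Poly_Mapping.keys \<nu>"
  have z: "part Pz \<mu> = 0" by (rule free_of_part[OF \<nu>(2) \<mu>])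
  have "int (deg_in UNIV (part Px \<mu>)) + int (deg_in UNIV (part Py \<mu>)) = p + q"
    using \<nu>(1) \<mu> z by (auto simp: deg_rel_def deg_in_UNIV_parts)
  then show "(\<Prod>r\<in>UNIV. case_pt (hfun p L1) (hfun q L2) const_coeff r (Poly_Mapping.single (part r \<mu>) 1))
      = (if int (deg_in UNIV (part Px \<mu>)) = p then pairing L1 L2 \<mu> else 0)"
    using z const_coeff_single[of "0 :: 'n option \<Rightarrow>\<^sub>0 nat" "1 :: 'a"]
    by (auto simp: UNIV_pt hfun_single pairing_def)
qed

lemma apply_y_single: "apply_y L (Poly_Mapping.single m c)
    = Poly_Mapping.single (Poly_Mapping.map_key Inl m) (c * L (Poly_Mapping.single (Poly_Mapping.map_key Inr m) 1))"
  by (simp add: apply_y_def)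

lemma apply_y_add: "apply_y L (P + Q) = apply_y L P + apply_y L Q"
  unfolding apply_y_def by (rule setsum_keys_plus_distrib) (simp_all add: distrib_right single_add)

definition unlift :: "(pt \<times> 'n::finite option, 'a::comm_ring_1) mpoly \<Rightarrow> ('n + 'n, 'a) mpoly"
  where "unlift = subst (\<lambda>v. case v of (Px, Some i) \<Rightarrow> X (Inl i) | (Py, Some i) \<Rightarrow> X (Inr i) | _ \<Rightarrow> 1)"

lemma map_key_add: "inj g \<Longrightarrow> Poly_Mapping.map_key g (m + m') = Poly_Mapping.map_key g m + Poly_Mapping.map_key g m'"
  by (rule poly_mapping_eqI) (simp add: map_key.rep_eq lookup_add)

lemma prod_pt: "(\<Prod>v\<in>UNIV. g v) = (\<Prod>k\<in>UNIV. g (Px, k)) * (\<Prod>k\<in>UNIV. g (Py, k)) * (\<Prod>k\<in>UNIV. g (Pz, k))"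
  for g :: "pt \<times> 'k::finite \<Rightarrow> 'b::comm_monoid_mult"
proof -
  have "(\<Prod>v\<in>UNIV. g v) = (\<Prod>p\<in>UNIV. \<Prod>k\<in>UNIV. g (p, k))"
    by (simp add: prod.cartesian_product)
  then show ?thesis by (simp add: UNIV_pt mult.assoc)
qed

lemma unlift_single:
  "unlift (Poly_Mapping.single \<mu> c)
    = Poly_Mapping.single (rename_exp Inl (dexp (part Px \<mu>)) + rename_exp Inr (dexp (part Py \<mu>))) c"
  by (simp add: unlift_def subst_single prod_pt prod_option X_power prod_single mult_single scale_single rename_exp_def)

lemma map_key_rename_exp: 
  assumes "inj g" shows "Poly_Mapping.map_key g (rename_exp g m) = m"
  by (rule poly_mapping_eqI) (simp add: assms map_key.rep_eq lookup_rename_exp)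

lemma map_key_rename_exp_disjoint: 
  assumes "inj g" "inj h" "\<And>i j. g i \<noteq> h j" shows "Poly_Mapping.map_key g (rename_exp h m) = 0"
  using assms(3) by (intro poly_mapping_eqI) (auto simp: assms(1,2) map_key.rep_eq lookup_rename_exp)

lemma apply_y_unlift:
  assumes "is_functional L1"
  shows "L1 (apply_y L2 (unlift G)) = cut (\<lambda>_. True) L1 L2 G"
proof (induction G rule: mpoly_single_induct)
  case (single \<mu> c)
  have "inj (Inl :: 'a \<Rightarrow> 'a + 'a)" "inj (Inr :: 'a \<Rightarrow> 'a + 'a)" by simp_all
  moreover have "L1 (Poly_Mapping.single a (c * w)) = c * (L1 (Poly_Mapping.single a 1) * w)" for a w
    using functional_const_mult[OF assms, of "c * w" "Poly_Mapping.single a 1"] by (simp add: mult_single)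
  ultimately show ?case
    by (simp add: unlift_single apply_y_single cut_def pairing_def map_key_add map_key_rename_exp map_key_rename_exp_disjoint)
next
  case (add P Q)
  then show ?case
    by (simp add: unlift_def subst_add apply_y_add functional_add[OF assms] cut_def wtsum_add)
qed

lemma unlift_ins_Px: "unlift (ins Px F) = in_x (dehom F)"
  unfolding unlift_def dehom_def subst_subst
  by (rule arg_cong[where f = "\<lambda>\<sigma>. subst \<sigma> F"]) (simp add: fun_eq_iff split: option.split)

lemma unlift_lift: "unlift (lift e G) = G"
proof (induction G rule: mpoly_single_induct)
  case (single m c)
  have "rename_exp Inl (dexp (part Px (lift_exp e m))) + rename_exp Inr (dexp (part Py (lift_exp e m))) = m"
  proof (rule poly_mapping_eqI)
    have "inj (Inl :: 'a \<Rightarrow> 'a + 'a)" "inj (Inr :: 'a \<Rightarrow> 'a + 'a)" by simp_all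
    moreover have inj: "inj (lift_var :: 'a + 'a \<Rightarrow> _)" by (auto simp: inj_def lift_var_def split: sum.splits)
    moreover have "Poly_Mapping.lookup (rename_exp lift_var m) (lift_var v) = Poly_Mapping.lookup m v" for v
      by (simp add: lookup_rename_exp[OF inj] inv_f_f[OF inj])
    from this[of "Inl i" for i] this[of "Inr i" for i]
    have "Poly_Mapping.lookup (rename_exp lift_var m) (Px, Some i) = Poly_Mapping.lookup m (Inl i)"
      "Poly_Mapping.lookup (rename_exp lift_var m) (Py, Some i) = Poly_Mapping.lookup m (Inr i)" for i
      by (simp_all add: lift_var_def)
    ultimately show "Poly_Mapping.lookup (rename_exp Inl (dexp (part Px (lift_exp e m))) + rename_exp Inr (dexp (part Py (lift_exp e m)))) v = Poly_Mapping.lookup m v" for v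
      by (cases v) (auto simp: lookup_add lookup_rename_exp inv_f_f lift_exp_def lookup_single image_iff)
  qed
  then show ?case by (simp add: unlift_single)
qed (simp add: map_exp_add unlift_def subst_add)

lemma apply_y_const_mult: "apply_y L (Poly_Mapping.single 0 c * P) = Poly_Mapping.single 0 c * apply_y L P"
  by (induction P rule: mpoly_single_induct) (simp_all add: mult_single apply_y_single distrib_left apply_y_add mult.assoc)

lemma
  assumes "difference_derivative D"
  shows difference_derivative_add: "D k (F + G) = D k F + D k G"
    and difference_derivative_const_mult: "D k (Poly_Mapping.single 0 c * F) = Poly_Mapping.single 0 c * D k F"
    and difference_derivative_eq: "in_x F - in_y F = (\<Sum>k\<in>UNIV. (X (Inl k) - X (Inr k)) * D k F)"
    and difference_derivative_polys_le: "F \<in> polys_le e \<Longrightarrow> D k F \<in> polys_le (e - 1)"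
proof -
  have lin: "module_hom scale scale (D k)" for k
    using assms by (simp add: difference_derivative_def Vector_Spaces.linear_iff_module_hom)
  show "D k (F + G) = D k F + D k G" by (rule module_hom.add[OF lin])
  show "D k (Poly_Mapping.single 0 c * F) = Poly_Mapping.single 0 c * D k F"
    using module_hom.scale[OF lin, of k c F] by (simp add: scale_def)
  show "in_x F - in_y F = (\<Sum>k\<in>UNIV. (X (Inl k) - X (Inr k)) * D k F)"
    using assms by (simp add: difference_derivative_def)
  have "D k F \<in> polys_le (int (total_degree F) - 1)" using assms by (simp add: difference_derivative_def)
  then show "D k F \<in> polys_le (e - 1)" if "F \<in> polys_le e"
    using that module_hom.zero[OF lin, of k] by (cases "F = 0") (auto simp: polys_le_def)
qed

lemma bordered_matrix_column:
  "bordered_matrix D f F = (\<chi> r c. if c = None then (case r of Some k \<Rightarrow> D k F | None \<Rightarrow> in_x F)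
    else (case c of Some i \<Rightarrow> (case r of Some k \<Rightarrow> D k (f i) | None \<Rightarrow> in_x (f i))))"
  by (simp add: bordered_matrix_def vec_eq_iff split: option.split)

lemma is_functional_extension:
  assumes D: "difference_derivative D" and L1: "is_functional L1"
  shows "is_functional (extension D f L1 L2)"
proof (rule is_functionalI)
  define a where "a r c = (case c of Some i \<Rightarrow> (case r of Some k \<Rightarrow> D k (f i) | None \<Rightarrow> in_x (f i)))" for r c :: "'a option"
  define u where "u F r = (case r of Some k \<Rightarrow> D k F | None \<Rightarrow> in_x F)" for r F
  have m: "bordered_matrix D f F = (\<chi> r c. if c = None then u F r else a r c)" for F
    unfolding bordered_matrix_column vec_eq_iff by (auto simp: a_def u_def split: option.split)
  have u1: "u (F + G) r = (\<Sum>b\<in>UNIV. 1 * u (if b then F else G) r)"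
    and u2: "u (Poly_Mapping.single 0 c * F) r = (\<Sum>b\<in>{()}. Poly_Mapping.single 0 c * u F r)" for F G r c
    by (simp_all add: u_def UNIV_bool difference_derivative_add[OF D] difference_derivative_const_mult[OF D] subst_add subst_mult split: option.split)
  show "extension D f L1 L2 (F + G) = extension D f L1 L2 F + extension D f L1 L2 G" for F G
    unfolding extension_def m u1 det_col_linear[OF finite]
    by (simp add: UNIV_bool apply_y_add functional_add[OF L1])
  show "extension D f L1 L2 (Poly_Mapping.single 0 c * F) = c * extension D f L1 L2 F" for c F
    unfolding extension_def m u2 det_col_linear[OF finite]
    by (simp add: apply_y_const_mult functional_const_mult[OF L1])
qed

text \<open>The determinant of a particular difference matrix, multiplied by the difference of the
  homogenising coordinates, becomes a difference of two bordered determinants with last row at x and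
  at y. Truncation in the degree of x kills the second and leaves the first unchanged; the first
  dehomogenises to the determinant of the extension operation.\<close>

lemma is_product_extension:
  fixes f :: "'n::finite \<Rightarrow> ('n, 'a::field) mpoly"
  assumes D: "difference_derivative D"
    and L1: "L1 \<in> annulling (ideal_le f p)" and L2: "L2 \<in> annulling (ideal_le f q)"
    and pq: "delta f \<le> p" "delta f \<le> q" and E: "E = p + q - delta f + 1"
  shows "hom_system.is_product (hsys f) None (hfun p L1) (hfun q L2) (hfun E (extension D f L1 L2)) E"
proof -
  interpret hom_system "hsys f" None "hdeg f" by (rule hom_system_hsys)
  have fun1: "is_functional L1" and fun2: "is_functional L2" using L1 L2 by (simp_all add: annulling_def)
  have pE: "p < E" "q < E" using pq E by simp_all
  have "hfun E (extension D f L1 L2) F = tens (case_pt (hfun p L1) (hfun q L2) const_coeff) (det (\<chi> k c. V k c))"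
    if F: "deg_rel (=) UNIV E F" and V: "is_diff_matrix V (cols F) Px Py" for F V
  proof -
    define h0 where "h0 c = (case c of Some i \<Rightarrow> f i | None \<Rightarrow> dehom F)" for c
    define e where "e c = (case c of Some i \<Rightarrow> int (total_degree (f i)) | None \<Rightarrow> E)" for c
    define h where "h c = homog (e c) (h0 c)" for c
    have h_cols: "h = cols F"
      by (auto simp: h_def h0_def e_def hsys_def homog_dehom[OF F] fun_eq_iff split: option.split)
    have h0: "h0 c \<in> polys_le (e c)" for c
      by (auto simp: h0_def e_def dehom_polys_le[OF F] polys_le_total_degree split: option.split)
    have h_hom: "deg_rel (=) UNIV (e c) (h c)" for c unfolding h_def by (rule deg_rel_homog[OF h0])
    have dehom_h: "dehom (h c) = h0 c" for c by (simp add: h_def dehom_homog)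
    have "\<forall>c. \<exists>q. deg_rel (=) UNIV (e c - 1) q \<and> free_of Pz q \<and> (X (Px, None) - X (Py, None)) * q = mixed (h c) - ins Py (h c)"
      using mixed_difference[OF h_hom] by blast
    from choice[OF this] obtain w where w: "\<And>c. deg_rel (=) UNIV (e c - 1) (w c)" "\<And>c. free_of Pz (w c)"
      "\<And>c. (X (Px, None) - X (Py, None)) * w c = mixed (h c) - ins Py (h c)" by blast
    \<comment> \<open>The rows \<open>Some i\<close> lead from x to the mixed point, the row
      \<open>None\<close> from there to y.\<close>
    define M where "M k c = (case k of Some i \<Rightarrow> lift (e c - 1) (D i (h0 c)) | None \<Rightarrow> w c)" for k c
    have M_hom: "deg_rel (=) UNIV (e c - 1) (M k c)" and M_free: "free_of Pz (M k c)" for k c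
      by (auto simp: M_def w deg_rel_lift[OF difference_derivative_polys_le[OF D h0]] free_of_lift split: option.split)
    have M_sum: "(\<Sum>i\<in>UNIV. (X (Px, Some i) - X (Py, Some i)) * M (Some i) c) = ins Px (h c) - mixed (h c)" for c
    proof -
      have "lift (e c) (in_x (h0 c) - in_y (h0 c)) = (\<Sum>i\<in>UNIV. (X (Px, Some i) - X (Py, Some i)) * M (Some i) c)"
        by (simp add: difference_derivative_eq[OF D] map_exp_sum map_exp_diff left_diff_distrib lift_X_mult lift_var_def M_def)
      then show ?thesis by (simp add: map_exp_diff lift_in_x lift_in_y h_def)
    qed
    have M_diff: "is_diff_matrix M (cols F) Px Py"
      unfolding is_diff_matrix_def h_cols[symmetric] by (simp add: sum_option M_sum) (simp add: M_def w)
    have "tens (case_pt (hfun p L1) (hfun q L2) const_coeff) (det (\<chi> k c. V k c)) = tens (case_pt (hfun p L1) (hfun q L2) const_coeff) (det (\<chi> k c. M k c))"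
      by (rule tens_det_cols[OF _ _ F pE _ V M_diff]) (use adm_hfun[OF L1] adm_hfun[OF L2] in simp_all)
    also have "\<dots> = cut (\<lambda>j. p < j) L1 L2 ((X (Px, None) - X (Py, None)) * det (\<chi> k c. M k c))"
    proof (rule tens_hfun)
      have "(\<Sum>c\<in>UNIV. e c - 1) = p + q"
        by (simp add: sum_option e_def E delta_def)
      then show "deg_rel (=) UNIV (p + q) (det (\<chi> k c. M k c))"
        using deg_rel_det[of "(=)" UNIV "\<lambda>c. e c - 1" "\<chi> k c. M k c"] M_hom by simp
      show "free_of Pz (det (\<chi> k c. M k c))"
        using deg_rel_det[of "(\<le>)" "pt_vars Pz" "\<lambda>_. 0" "\<chi> k c. M k c"] M_free by simp
    qed
    \<comment> \<open>The factor is absorbed in row \<open>None\<close>, whose entries become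
      differences of values of \<open>h\<close>.\<close>
    also have "(X (Px, None) - X (Py, None)) * det (\<chi> k c. M k c)
        = det (\<chi> k c. if k = None then \<Sum>_\<in>{()}. (X (Px, None) - X (Py, None)) * w c else M k c)"
      unfolding det_row_linear[OF finite.insertI[OF finite.emptyI]]
      by (simp, intro arg_cong[where f = "(*) _"] arg_cong[where f = det]) (simp add: vec_eq_iff M_def split: option.split)
    also have "\<dots> = det (\<chi> k c. if k = None then mixed (h c) - ins Py (h c) else M k c)"
      by (simp add: w cong: if_cong)
    also have "\<dots> = det (\<chi> k c. if k = None then \<Sum>b\<in>UNIV. (if b then 1 else - 1) * (if b then mixed (h c) else ins Py (h c)) else M k c)"
      by (simp add: UNIV_bool cong: if_cong)
    also have "\<dots> = det (\<chi> k c. if k = None then mixed (h c) else M k c) - det (\<chi> k c. if k = None then ins Py (h c) else M k c)"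
      unfolding det_row_linear[OF finite] by (simp add: UNIV_bool cong: if_cong)
    \<comment> \<open>Adding multiples of the other rows changes the values at the mixed point into
      those at x, by \<open>M_sum\<close>.\<close>
    also have "det (\<chi> k c. if k = None then mixed (h c) else M k c) = det (\<chi> k c. if k = None then ins Px (h c) else M k c)"
    proof -
      have "UNIV - {None} = range (Some :: 'n \<Rightarrow> 'n option)" by (auto simp: UNIV_option_conv)
      then have "mixed (h c) = ins Px (h c) + (\<Sum>k\<in>UNIV - {None}. (X (Py, k) - X (Px, k)) * M k c)" for c
        using M_sum[of c] by (simp add: sum.reindex left_diff_distrib sum_subtractf algebra_simps)
      then show ?thesis by (simp only: det_row_combination)
    qed
    finally have tens: "tens (case_pt (hfun p L1) (hfun q L2) const_coeff) (det (\<chi> k c. V k c))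
      = cut (\<lambda>j. p < j) L1 L2 (det (\<chi> k c. if k = None then ins Px (h c) else M k c))
        - cut (\<lambda>j. p < j) L1 L2 (det (\<chi> k c. if k = None then ins Py (h c) else M k c))"
      by (simp add: cut_def wtsum_diff)
    define C where "C j = det (\<chi> r c. if r = None then if c = j then 1 else 0 else M r c)" for j
    have expand: "det (\<chi> k c. if k = None then v c else M k c) = (\<Sum>j\<in>UNIV. v j * C j)" for v
      unfolding C_def by (rule det_row_expand)
    \<comment> \<open>Consequently a cofactor monomial of degree above \<open>p\<close> in x has
      degree at most \<open>q - e j\<close> in y, which is the bound up to which \<open>L2\<close>
      annuls multiples of \<open>f\<close>.\<close>
    have C: "int (deg_in UNIV (part Px \<mu>)) + int (deg_in UNIV (part Py \<mu>)) = p + q + 1 - e j" if "\<mu> \<in> Poly_Mapping.keys (C j)" for \<mu> j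
    proof -
      have "deg_rel (=) UNIV ((\<Sum>r\<in>(UNIV :: 'n option set). case r of None \<Rightarrow> - e j | Some i \<Rightarrow> - 1) + (\<Sum>c\<in>UNIV. e c)) (C j)"
        unfolding C_def
      proof (rule deg_rel_det_rows[where r = "case_option (- e j) (\<lambda>_. - 1)" and d = e])
        fix r c :: "'n option"
        have "deg_rel (=) UNIV (- 1 + e c) (M (Some i) c)" for i using M_hom[of c "Some i"] by simp
        then show "deg_rel (=) UNIV ((case r of None \<Rightarrow> - e j | Some i \<Rightarrow> - 1) + e c)
            ((\<chi> r c. if r = None then if c = j then 1 else 0 else M r c) $ r $ c)"
          by (auto split: option.split)
      qed simp
      moreover have "(\<Sum>r\<in>(UNIV :: 'n option set). case r of None \<Rightarrow> - e j | Some i \<Rightarrow> - 1) + (\<Sum>c\<in>UNIV. e c) = p + q + 1 - e j"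
        by (simp add: sum_option e_def E delta_def sum_subtractf)
      ultimately have "int (deg_in UNIV \<mu>) = p + q + 1 - e j" using that by (simp add: deg_rel_def)
      moreover have "free_of Pz (C j)"
        unfolding C_def using deg_rel_det[of "(\<le>)" "pt_vars Pz" "\<lambda>_. 0" "\<chi> r c. if r = None then if c = j then 1 else 0 else M r c"] M_free
        by simp
      from free_of_part[OF this that] have "part Pz \<mu> = 0" .
      ultimately show ?thesis by (simp add: deg_in_UNIV_parts)
    qed
    have single_polys_le: "Poly_Mapping.single (dexp (part r \<mu>)) (1 :: 'a) \<in> polys_le d"
      if "int (deg_in UNIV (part r \<mu>)) \<le> d" for r and \<mu> :: "pt \<times> 'n option \<Rightarrow>\<^sub>0 nat" and d
      using that unfolding polys_le_iff by (intro deg_rel_single) (simp add: deg_in_option)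
    \<comment> \<open>Monomials surviving the truncation are annulled by \<open>L2\<close> for a
      column \<open>Some i\<close>. For \<open>None\<close> there are none, as
      \<open>e None = E\<close> exceeds \<open>q\<close>.\<close>
    have "cut (\<lambda>j. p < j) L1 L2 (ins Py (h j) * C j) = 0" for j
      unfolding cut_def
    proof (rule wtsum_mult, fold cut_def)
      fix \<mu> assume \<mu>: "\<mu> \<in> Poly_Mapping.keys (C j)"
      have "L2 (h0 j * Poly_Mapping.single (dexp (part Py \<mu>)) 1) = 0" if "p < int (deg_in UNIV (part Px \<mu>))"
      proof -
        have deg: "int (deg_in UNIV (part Py \<mu>)) \<le> q - e j" using C[OF \<mu>] that by simp
        then obtain i where j: "j = Some i" using pE by (cases j) (auto simp: e_def)
        then have "h0 j * Poly_Mapping.single (dexp (part Py \<mu>)) 1 \<in> ideal_le f q"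
          using deg by (auto simp: h0_def e_def intro!: ideal_leI single_polys_le)
        then show ?thesis using L2 by (simp add: annulling_def)
      qed
      then show "cut (\<lambda>j. p < j) L1 L2 (ins Py (h j) * Poly_Mapping.single \<mu> 1) = 0"
        unfolding cut_ins_Py[OF fun2] dehom_h by simp
    qed
    then have "cut (\<lambda>j. p < j) L1 L2 (det (\<chi> k c. if k = None then ins Py (h c) else M k c)) = 0"
      unfolding expand by (simp add: cut_def wtsum_sum)
    \<comment> \<open>The terms removed by the truncation have degree at most \<open>p\<close> in x.
      For a column \<open>Some i\<close> they are annulled by \<open>L1\<close>; for
      \<open>None\<close> there are none, as \<open>E\<close> exceeds \<open>p\<close>.\<close>
    moreover have "cut (\<lambda>j. p < j) L1 L2 (det (\<chi> k c. if k = None then ins Px (h c) else M k c))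
      = cut (\<lambda>_. True) L1 L2 (det (\<chi> k c. if k = None then ins Px (h c) else M k c))"
    proof -
      have "cut (\<lambda>j. p < j) L1 L2 (ins Px (h j) * C j) - cut (\<lambda>_. True) L1 L2 (ins Px (h j) * C j) = 0" for j
      proof -
        have W: "cut (\<lambda>j. p < j) L1 L2 Q - cut (\<lambda>_. True) L1 L2 Q
          = wtsum (\<lambda>\<mu>. (if p < int (deg_in UNIV (part Px \<mu>)) then pairing L1 L2 \<mu> else 0) - pairing L1 L2 \<mu>) Q" for Q
          by (simp add: cut_def wtsum_def right_diff_distrib sum_subtractf)
        show ?thesis unfolding W
        proof (rule wtsum_mult, fold W)
          fix \<mu> assume \<mu>: "\<mu> \<in> Poly_Mapping.keys (C j)"
          have "L1 (h0 j * Poly_Mapping.single (dexp (part Px \<mu>)) 1) = 0" if le: "e j + int (deg_in UNIV (part Px \<mu>)) \<le> p"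
          proof -
            obtain i where j: "j = Some i" using le pE by (cases j) (auto simp: e_def)
            then have "h0 j * Poly_Mapping.single (dexp (part Px \<mu>)) 1 \<in> ideal_le f p"
              using le by (auto simp: h0_def e_def intro!: ideal_leI single_polys_le)
            then show ?thesis using L1 by (simp add: annulling_def)
          qed
          then show "cut (\<lambda>j. p < j) L1 L2 (ins Px (h j) * Poly_Mapping.single \<mu> 1)
              - cut (\<lambda>_. True) L1 L2 (ins Px (h j) * Poly_Mapping.single \<mu> 1) = 0"
            unfolding cut_ins_Px[OF fun1 h_hom] dehom_h by auto
        qed
      qed
      then show ?thesis
        unfolding expand by (simp add: cut_def wtsum_sum)
    qed
    moreover have "unlift (det (\<chi> k c. if k = None then ins Px (h c) else M k c)) = det (bordered_matrix D f (dehom F))"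
    proof -
      have "unlift (det (\<chi> k c. if k = None then ins Px (h c) else M k c)) = det (\<chi> k c. unlift (if k = None then ins Px (h c) else M k c))"
        by (simp add: unlift_def subst_det)
      also have "(\<chi> k c. unlift (if k = None then ins Px (h c) else M k c)) = bordered_matrix D f (dehom F)"
        by (simp add: vec_eq_iff bordered_matrix_def Let_def unlift_ins_Px dehom_h M_def unlift_lift h0_def split: option.split)
      finally show ?thesis .
    qed
    ultimately show ?thesis
      using tens apply_y_unlift[OF fun1, of L2 "det (\<chi> k c. if k = None then ins Px (h c) else M k c)"]
      unfolding hfun_hom[OF is_functional_extension[OF D fun1] F] by (simp add: extension_def)
  qed
  then show ?thesis unfolding is_product_def by blast
qed

lemma diff_matrix_exists: "\<exists>V. is_diff_matrix V h Px Py"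
proof -
  have "\<forall>c. \<exists>q. ins Px (h c) - ins Py (h c) = (\<Sum>k\<in>UNIV. (X (Px, k) - X (Py, k)) * q k)"
    using subst_diff_in_ideal by blast
  from choice[OF this] obtain q where "\<forall>c. ins Px (h c) - ins Py (h c) = (\<Sum>k\<in>UNIV. (X (Px, k) - X (Py, k)) * q c k)" by blast
  then have "is_diff_matrix (\<lambda>k c. q c k) h Px Py" by (simp add: is_diff_matrix_def)
  then show ?thesis by blast
qed

text \<open>By the product rule the last column for f_j g may be taken as g(x) times column j plus
  f_j(y) times a difference vector of g. The first part repeats a column, the second has a factor
  all of whose multiples are annulled by the functional in y.\<close>

lemma extension_annulling:
  fixes f :: "'n::finite \<Rightarrow> ('n, 'a::field) mpoly"
  assumes D: "difference_derivative D"
    and L1: "L1 \<in> annulling (ideal_le f p)" and L2: "L2 \<in> annulling (ideal_le f q)"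
    and pq: "delta f \<le> p" "delta f \<le> q"
  shows "extension D f L1 L2 \<in> annulling (ideal_le f (p + q - delta f + 1))"
proof -
  interpret hom_system "hsys f" None "hdeg f" by (rule hom_system_hsys)
  define E where "E = p + q - delta f + 1"
  have fun1: "is_functional L1" and fun2: "is_functional L2" using L1 L2 by (simp_all add: annulling_def)
  note ext = is_functional_extension[OF D fun1]
  have "extension D f L1 L2 (f j * g) = 0" if g: "g \<in> polys_le (E - int (total_degree (f j)))" for j g
  proof -
    define fh where "fh = homog (int (total_degree (f j))) (f j)"
    define gh where "gh = homog (E - int (total_degree (f j))) g"
    have "deg_rel (=) UNIV (int (total_degree (f j)) + (E - int (total_degree (f j)))) (fh * gh)"
      unfolding fh_def gh_def by (intro deg_rel_mult additive_rel_eq deg_rel_homog polys_le_total_degree g)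
    then have hom: "deg_rel (=) UNIV E (fh * gh)" by simp
    obtain V where V: "is_diff_matrix V (hsys f) Px Py" using diff_matrix_exists by blast
    obtain v where "is_diff_matrix v (\<lambda>_ :: 'n option. gh) Px Py" using diff_matrix_exists by blast
    then have v: "(\<Sum>k\<in>UNIV. (X (Px, k) - X (Py, k)) * v k None) = ins Px gh - ins Py gh"
      by (simp add: is_diff_matrix_def)
    define s where "s b = (if b then ins Px gh else ins Py fh)" for b
    define w where "w b k = (if b then V k (Some j) else v k None)" for b k
    define V' where "V' k c = (if c = None then \<Sum>b\<in>UNIV. s b * w b k else V k c)" for k c
    have "(\<Sum>k\<in>UNIV. (X (Px, k) - X (Py, k)) * (\<Sum>b\<in>UNIV. s b * w b k)) = ins Px (fh * gh) - ins Py (fh * gh)"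
    proof -
      have "(\<Sum>k\<in>UNIV. (X (Px, k) - X (Py, k)) * V k (Some j)) = ins Px fh - ins Py fh"
        using V by (simp add: is_diff_matrix_def hsys_def fh_def)
      moreover have "(\<Sum>k\<in>UNIV. (X (Px, k) - X (Py, k)) * (\<Sum>b\<in>UNIV. s b * w b k))
          = ins Px gh * (\<Sum>k\<in>UNIV. (X (Px, k) - X (Py, k)) * V k (Some j)) + ins Py fh * (\<Sum>k\<in>UNIV. (X (Px, k) - X (Py, k)) * v k None)"
        by (simp add: UNIV_bool s_def w_def distrib_left sum.distrib sum_distrib_left mult.left_commute)
      moreover have "ins Px gh * (ins Px fh - ins Py fh) + ins Py fh * (ins Px gh - ins Py gh) = ins Px (fh * gh) - ins Py (fh * gh)"
        by (simp add: subst_mult algebra_simps)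
      ultimately show ?thesis by (simp only: v)
    qed
    then have "is_diff_matrix V' (cols (fh * gh)) Px Py"
      using V by (auto simp: is_diff_matrix_def V'_def)
    then have "hfun E (extension D f L1 L2) (fh * gh) = tens (case_pt (hfun p L1) (hfun q L2) const_coeff) (det (\<chi> k c. V' k c))"
      using is_product_extension[OF D L1 L2 pq E_def] hom by (simp add: is_product_def)
    also have "det (\<chi> k c. V' k c) = (\<Sum>b\<in>UNIV. s b * det (\<chi> k c. if c = None then w b k else V k c))"
      unfolding V'_def by (rule det_col_linear) simp
    also have "det (\<chi> k c. if c = None then w True k else V k c) = 0"
      by (rule det_identical_columns[of None "Some j"]) (simp_all add: column_def w_def)
    then have "(\<Sum>b\<in>UNIV. s b * det (\<chi> k c. if c = None then w b k else V k c))
        = ins Py fh * det (\<chi> k c. if c = None then w False k else V k c)"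
      by (simp add: UNIV_bool s_def)
    also have "tens (case_pt (hfun p L1) (hfun q L2) const_coeff) (ins Py fh * det (\<chi> k c. if c = None then w False k else V k c)) = 0"
    proof (rule tens_ins_mult_eq_0)
      show "is_functional (case_pt (hfun p L1) (hfun q L2) const_coeff Py)" by (simp add: hfun_def)
      show "case_pt (hfun p L1) (hfun q L2) const_coeff Py (fh * h) = 0" for h
        using adm_hfun[OF L2] unfolding adm_def by (auto simp: hsys_def fh_def dest!: spec[of _ "Some j"])
    qed
    finally show ?thesis
      unfolding hfun_hom[OF ext hom] by (simp add: dehom_mult fh_def gh_def dehom_homog)
  qed
  then show ?thesis
    unfolding annulling_def ideal_le_def E_def[symmetric] by (auto simp: ext functional_sum[OF ext])
qed

section \<open>Unit root functionals\<close>

lemma ideal_of_0 [simp]: "0 \<in> ideal_of f"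
  unfolding ideal_of_def by (rule CollectI, rule exI[of _ "\<lambda>_. 0"]) simp

lemma ideal_of_add: "p \<in> ideal_of f \<Longrightarrow> q \<in> ideal_of f \<Longrightarrow> p + q \<in> ideal_of f"
  unfolding ideal_of_def
proof clarify
  fix g h
  show "\<exists>u. (\<Sum>i\<in>UNIV. f i * g i) + (\<Sum>i\<in>UNIV. f i * h i) = (\<Sum>i\<in>UNIV. f i * u i) \<and> True"
    by (rule exI[of _ "\<lambda>i. g i + h i"]) (simp add: distrib_left sum.distrib)
qed

lemma ideal_of_mult: "p \<in> ideal_of f \<Longrightarrow> q * p \<in> ideal_of f"
  unfolding ideal_of_def
proof clarify
  fix g
  show "\<exists>u. q * (\<Sum>i\<in>UNIV. f i * g i) = (\<Sum>i\<in>UNIV. f i * u i) \<and> True"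
    by (rule exI[of _ "\<lambda>i. q * g i"]) (simp add: sum_distrib_left mult.left_commute)
qed

lemma ideal_of_sum: "(\<And>i. i \<in> I \<Longrightarrow> p i \<in> ideal_of f) \<Longrightarrow> sum p I \<in> ideal_of f"
  by (induction I rule: infinite_finite_induct) (simp_all add: ideal_of_add)

text \<open>Otherwise representatives of the powers of \<open>p\<close> in a finitely generated span
  would be linearly independent in any number.\<close>

lemma finite_dim_quotient_monic:
  fixes f :: "'n::finite \<Rightarrow> ('n, 'a::field) mpoly"
  assumes "finite_dim_quotient (ideal_of f)"
  shows "\<exists>m a. p ^ m + (\<Sum>j<m. scale (a j) (p ^ j)) \<in> ideal_of f"
proof (rule ccontr)
  assume "\<not> ?thesis"
  then have N: "p ^ m + (\<Sum>j<m. scale (a j) (p ^ j)) \<notin> ideal_of f" for m a by blast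
  obtain B where B: "finite B" "\<forall>p. \<exists>q\<in>mpoly.span B. p - q \<in> ideal_of f"
    using assms by (auto simp: finite_dim_quotient_def)
  have "\<forall>j. \<exists>q. q \<in> mpoly.span B \<and> p ^ j - q \<in> ideal_of f" using B(2) by blast
  from choice[OF this] obtain R where R: "\<And>j. R j \<in> mpoly.span B" "\<And>j. p ^ j - R j \<in> ideal_of f" by blast
  have indep: "inj_on R {..<m} \<and> mpoly.independent (R ` {..<m})" for m
  proof (induction m)
    case (Suc m)
    have "R m \<notin> mpoly.span (R ` {..<m})"
    proof
      assume "R m \<in> mpoly.span (R ` {..<m})"
      then obtain u where "R m = (\<Sum>v\<in>R ` {..<m}. scale (u v) v)"
        by (auto simp: mpoly.span_finite)
      then have "R m = (\<Sum>j<m. scale (u (R j)) (R j))" using Suc by (simp add: sum.reindex)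
      then have "p ^ m + (\<Sum>j<m. scale (- u (R j)) (p ^ j))
          = (p ^ m - R m) + (\<Sum>j<m. scale (- u (R j)) (p ^ j - R j))"
        by (simp add: mpoly.scale_right_diff_distrib sum_subtractf sum_negf)
      also have "\<dots> \<in> ideal_of f"
        unfolding scale_def by (intro ideal_of_add ideal_of_sum ideal_of_mult R)
      finally show False using N[of m "\<lambda>j. - u (R j)"] by simp
    qed
    moreover from this have "R m \<notin> R ` {..<m}" by (metis mpoly.span_base)
    ultimately show ?case using Suc by (simp add: lessThan_Suc mpoly.independent_insert)
  qed (simp add: mpoly.independent_empty)
  have "card (R ` {..<Suc (card B)}) \<le> card B"
    using mpoly.independent_span_bound[OF B(1), of "R ` {..<Suc (card B)}"] indep R(1) by auto
  moreover have "card (R ` {..<Suc (card B)}) = Suc (card B)"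
    using indep[of "Suc (card B)"] by (simp add: card_image)
  ultimately show False by simp
qed

text \<open>For positive \<open>e\<close>, these are the values on powers of one variable of the
  linear form that is 1 on the power \<open>e - 1\<close>, is 0 on the lower ones and annuls all
  multiples of the monic polynomial of degree \<open>e\<close> with lower coefficients
  \<open>a\<close>.\<close>

fun lin_rec :: "(nat \<Rightarrow> 'a::comm_ring_1) \<Rightarrow> nat \<Rightarrow> nat \<Rightarrow> 'a"
  where "lin_rec a e n = (if Suc n < e then 0 else if Suc n = e then 1
    else - (\<Sum>i<e. a i * lin_rec a e (n - e + i)))"

declare lin_rec.simps [simp del]

lemma lin_rec_recurrence: "lin_rec a e (e + j) + (\<Sum>i<e. a i * lin_rec a e (i + j)) = 0"
  by (subst lin_rec.simps[of a e "e + j"]) (simp add: add.commute)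

lemma lin_rec_low: "n < e \<Longrightarrow> lin_rec a e n = (if Suc n = e then 1 else 0)"
  by (subst lin_rec.simps) simp

definition rec_functional :: "('n::finite \<Rightarrow> nat \<Rightarrow> 'a::field) \<Rightarrow> ('n \<Rightarrow> nat) \<Rightarrow> ('n, 'a) functional"
  where "rec_functional a e = wtsum (\<lambda>m. \<Prod>k\<in>UNIV. lin_rec (a k) (e k) (Poly_Mapping.lookup m k))"

lemma is_functional_rec_functional [simp]: "is_functional (rec_functional a e)"
  by (simp add: rec_functional_def)

lemma X_power_mult_single: "X k ^ j * Poly_Mapping.single m c = Poly_Mapping.single (Poly_Mapping.single k j + m) c"
  by (simp add: X_power mult_single)

lemma rec_functional_annuls:
  fixes a :: "'n::finite \<Rightarrow> nat \<Rightarrow> 'a::field"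
  shows "rec_functional a e ((X k ^ e k + (\<Sum>j<e k. scale (a k j) (X k ^ j))) * q) = 0"
  unfolding rec_functional_def
proof (rule wtsum_mult)
  fix m
  define W where "W = (\<lambda>m. \<Prod>l\<in>UNIV. lin_rec (a l) (e l) (Poly_Mapping.lookup m l))"
  define c where "c = (\<Prod>l\<in>UNIV - {k}. lin_rec (a l) (e l) (Poly_Mapping.lookup m l))"
  have W: "W (Poly_Mapping.single k j + m) = lin_rec (a k) (e k) (j + Poly_Mapping.lookup m k) * c" for j
    unfolding W_def c_def
    by (subst prod.remove[of UNIV k]) (auto simp: lookup_add lookup_single intro!: prod.cong)
  have "wtsum W ((X k ^ e k + (\<Sum>j<e k. scale (a k j) (X k ^ j))) * Poly_Mapping.single m 1)
      = (lin_rec (a k) (e k) (e k + Poly_Mapping.lookup m k) + (\<Sum>j<e k. a k j * lin_rec (a k) (e k) (j + Poly_Mapping.lookup m k))) * c"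
    by (simp add: distrib_right sum_distrib_right scale_def mult.assoc X_power_mult_single wtsum_add wtsum_sum wtsum_const_mult W)
  then show "wtsum W ((X k ^ e k + (\<Sum>j<e k. scale (a k j) (X k ^ j))) * Poly_Mapping.single m 1) = 0"
    by (simp only: lin_rec_recurrence) simp
qed

lemma deg_rel_prod_diff:
  fixes P Q :: "'i \<Rightarrow> ('v, 'a::comm_ring_1) mpoly"
  assumes "finite I" "\<And>i. i \<in> I \<Longrightarrow> deg_rel (\<le>) A (d i) (P i)" "\<And>i. i \<in> I \<Longrightarrow> deg_rel (\<le>) A (d i) (Q i)"
    and "\<And>i. i \<in> I \<Longrightarrow> deg_rel (\<le>) A (d i - 1) (P i - Q i)"
  shows "deg_rel (\<le>) A ((\<Sum>i\<in>I. d i) - 1) (prod P I - prod Q I)"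
  using assms
proof (induction I rule: finite_induct)
  case (insert j I)
  have "deg_rel (\<le>) A ((d j - 1) + (\<Sum>i\<in>I. d i)) ((P j - Q j) * prod P I)"
    using insert by (intro deg_rel_mult deg_rel_prod) auto
  moreover have "deg_rel (\<le>) A (d j + ((\<Sum>i\<in>I. d i) - 1)) (Q j * (prod P I - prod Q I))"
    using insert by (intro deg_rel_mult) auto
  ultimately have "deg_rel (\<le>) A (d j + sum d I - 1) ((P j - Q j) * prod P I + Q j * (prod P I - prod Q I))"
    by (intro deg_rel_add) (simp_all add: algebra_simps)
  moreover have "prod P (insert j I) - prod Q (insert j I) = (P j - Q j) * prod P I + Q j * (prod P I - prod Q I)"
    using insert by (simp add: algebra_simps)
  ultimately show ?case using insert by simp
qed simp

section \<open>Evaluation in the variables y\<close>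

lemma apply_y_in_x_mult: "apply_y L (in_x p * P) = p * apply_y L P"
proof (induction p rule: mpoly_single_induct)
  case (single m c)
  have inj: "inj (Inl :: 'a \<Rightarrow> 'a + 'a)" "inj (Inr :: 'a \<Rightarrow> 'a + 'a)" by simp_all
  show ?case
    by (induction P rule: mpoly_single_induct)
      (simp_all add: subst_rename_single mult_single apply_y_single map_key_add[OF inj(1)] map_key_add[OF inj(2)]
        map_key_rename_exp[OF inj(1)] map_key_rename_exp_disjoint[OF inj(2,1)] apply_y_add distrib_left mult.assoc)
qed (simp add: subst_add distrib_right apply_y_add)

lemma apply_y_in_y_mult:
  assumes L: "is_functional L"
  shows "apply_y L (in_y p * P) = apply_y (\<lambda>F. L (p * F)) P"
proof (induction P rule: mpoly_single_induct)
  case (single \<mu> d)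
  have inj: "inj (Inl :: 'a \<Rightarrow> 'a + 'a)" "inj (Inr :: 'a \<Rightarrow> 'a + 'a)" by simp_all
  show ?case
  proof (induction p rule: mpoly_single_induct)
    case (single m c)
    have "c * L (Poly_Mapping.single (m + Poly_Mapping.map_key Inr \<mu>) 1) = L (Poly_Mapping.single m c * Poly_Mapping.single (Poly_Mapping.map_key Inr \<mu>) 1)"
      by (rule functional_single_mult[OF L])
    then show ?case
      by (simp add: subst_rename_single mult_single apply_y_single map_key_add[OF inj(1)] map_key_add[OF inj(2)]
        map_key_rename_exp[OF inj(2)] map_key_rename_exp_disjoint[OF inj(1,2)] mult.assoc mult.left_commute[of c d])
  next
    case (add p q)
    then show ?case
      by (simp add: subst_add distrib_right apply_y_add apply_y_single functional_add[OF L] distrib_left single_add)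
  qed
next
  case (add P Q)
  then show ?case by (simp add: distrib_left apply_y_add)
qed

lemma apply_y_0 [simp]: "apply_y (\<lambda>_. 0) P = 0"
  by (simp add: apply_y_def)

lemma apply_y_sum: "apply_y L (sum P I) = (\<Sum>i\<in>I. apply_y L (P i))"
  by (induction I rule: infinite_finite_induct) (simp_all add: apply_y_add apply_y_def[of L 0])

text \<open>The quotient of h(x) - h(y) by the difference of the k-th variables, for the monic
  polynomial h in the k-th variable, written out by the formula for differences of powers.\<close>

definition quotient_poly :: "('n \<Rightarrow> nat \<Rightarrow> 'a::field) \<Rightarrow> ('n \<Rightarrow> nat) \<Rightarrow> 'n \<Rightarrow> ('n + 'n, 'a) mpoly"
  where "quotient_poly a e k = (\<Sum>j<e k. X (Inr k) ^ (e k - Suc j) * X (Inl k) ^ j)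
    + (\<Sum>i<e k. scale (a k i) (\<Sum>j<i. X (Inr k) ^ (i - Suc j) * X (Inl k) ^ j))"

lemma quotient_poly_eq:
  fixes a :: "'n::finite \<Rightarrow> nat \<Rightarrow> 'a::field" and e :: "'n \<Rightarrow> nat"
  defines "h \<equiv> \<lambda>k. X k ^ e k + (\<Sum>j<e k. scale (a k j) (X k ^ j))"
  shows "(X (Inl k) - X (Inr k)) * quotient_poly a e k = in_x (h k) - in_y (h k)"
proof -
  have "(X (Inl k) - X (Inr k)) * quotient_poly a e k
      = (X (Inl k) ^ e k - X (Inr k) ^ e k) + (\<Sum>i<e k. scale (a k i) (X (Inl k) ^ i - X (Inr k) ^ i))"
    unfolding power_diff_sumr2
    by (simp add: quotient_poly_def scale_def distrib_left sum_distrib_left mult.left_commute[of "X _ - X _" "Poly_Mapping.single _ _"])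
  then show ?thesis
    by (simp add: h_def subst_add subst_sum subst_mult subst_power scale_def right_diff_distrib sum_subtractf)
qed

text \<open>In y, the product has the leading monomial with exponents \<open>e k - 1\<close>, with
  coefficient 1, and all other terms have lower total degree in y. Such a term has a smaller
  exponent at some \<open>k\<close>, where the recurrence still has the value 0.\<close>

lemma apply_y_quotient_poly:
  fixes a :: "'n::finite \<Rightarrow> nat \<Rightarrow> 'a::field"
  assumes e: "\<And>k. 0 < e k"
  shows "apply_y (rec_functional a e) (\<Prod>k\<in>UNIV. quotient_poly a e k) = 1"
proof -
  define d where "d k = int (e k) - 1" for k
  define T :: "'n \<Rightarrow> ('n + 'n, 'a) mpoly" where "T k = X (Inr k) ^ (e k - 1)" for k
  have mono: "deg_rel (\<le>) A (of_bool (Inr k \<in> A) * int r) (X (Inr k) ^ r * X (Inl k) ^ s :: ('n + 'n, 'a) mpoly)" if "A \<subseteq> range Inr" for A k r s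
  proof -
    have "finite A" "Inl k \<notin> A" using that by (auto intro: finite_subset)
    then show ?thesis by (simp add: X_power mult_single deg_in_add deg_in_single deg_rel_single)
  qed
  have deg: "deg_rel (\<le>) A (of_bool (Inr k \<in> A) * d k) (quotient_poly a e k)" if A: "A \<subseteq> range Inr" for A k
    unfolding quotient_poly_def sum_distrib_left scale_def
    by (intro deg_rel_add deg_rel_sum deg_rel_mult[of _ _ 0 _ "of_bool (Inr k \<in> A) * d k", simplified] deg_rel_le_mono[OF mono[OF A]] deg_rel_const)
      (auto simp: d_def)
  have deg': "deg_rel (\<le>) (range Inr) (d k - 1) (quotient_poly a e k - T k)" for k
  proof -
    have "quotient_poly a e k - T k = (\<Sum>j\<in>{1..<e k}. X (Inr k) ^ (e k - Suc j) * X (Inl k) ^ j)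
      + (\<Sum>i<e k. \<Sum>j<i. Poly_Mapping.single 0 (a k i) * (X (Inr k) ^ (i - Suc j) * X (Inl k) ^ j))"
    proof -
      have "{..<e k} = insert 0 {1..<e k}" using e[of k] by auto
      then show ?thesis by (simp add: quotient_poly_def T_def scale_def sum_distrib_left)
    qed
    also have "deg_rel (\<le>) (range Inr) (d k - 1) \<dots>"
      by (intro deg_rel_add deg_rel_sum deg_rel_mult[of _ _ 0 _ "d k - 1", simplified] deg_rel_le_mono[OF mono[OF order.refl]] deg_rel_const)
        (auto simp: d_def)
    finally show ?thesis .
  qed
  have T: "deg_rel (\<le>) A (of_bool (Inr k \<in> A) * d k) (T k)" if A: "A \<subseteq> range Inr" for A k
    using mono[OF A, of k "e k - 1" 0] e[of k] by (simp add: T_def d_def of_nat_diff)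
  have "deg_rel (\<le>) (range Inr) ((\<Sum>k\<in>UNIV. d k) - 1) ((\<Prod>k\<in>UNIV. quotient_poly a e k) - (\<Prod>k\<in>UNIV. T k))"
    using deg[of "range Inr"] T[of "range Inr"] deg' by (intro deg_rel_prod_diff) simp_all
  then have low: "int (deg_in (range Inr) m) \<le> (\<Sum>k\<in>UNIV. d k) - 1"
    if "m \<in> Poly_Mapping.keys ((\<Prod>k\<in>UNIV. quotient_poly a e k) - (\<Prod>k\<in>UNIV. T k))" for m
    using that by (simp add: deg_rel_def)
  have "deg_rel (\<le>) {Inr l} (d l) ((\<Prod>k\<in>UNIV. quotient_poly a e k) - (\<Prod>k\<in>UNIV. T k))" for l
  proof -
    have "(\<Sum>k\<in>UNIV. of_bool (Inr k \<in> {Inr l :: 'n + 'n}) * d k) = (\<Sum>k\<in>UNIV. if k = l then d k else 0)"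
      by (rule sum.cong) auto
    then have s: "(\<Sum>k\<in>UNIV. of_bool (Inr k \<in> {Inr l :: 'n + 'n}) * d k) = d l" by simp
    show ?thesis
      using deg_rel_prod[of "(\<le>)" UNIV "{Inr l}" "\<lambda>k. of_bool (Inr k \<in> {Inr l :: 'n + 'n}) * d k" "quotient_poly a e"]
        deg_rel_prod[of "(\<le>)" UNIV "{Inr l}" "\<lambda>k. of_bool (Inr k \<in> {Inr l :: 'n + 'n}) * d k" T]
        deg[of "{Inr l}"] T[of "{Inr l}"]
      unfolding s by (intro deg_rel_diff) simp_all
  qed
  then have le: "int (Poly_Mapping.lookup m (Inr l)) \<le> d l"
    if "m \<in> Poly_Mapping.keys ((\<Prod>k\<in>UNIV. quotient_poly a e k) - (\<Prod>k\<in>UNIV. T k))" for m l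
    using that by (simp add: deg_rel_def deg_in_def)
  have lookup_Inr: "Poly_Mapping.lookup (Poly_Mapping.map_key Inr m) k = Poly_Mapping.lookup m (Inr k)" for m :: "'n + 'n \<Rightarrow>\<^sub>0 nat" and k
    by (simp add: map_key.rep_eq)
  have zero: "rec_functional a e (Poly_Mapping.single (Poly_Mapping.map_key Inr m) 1) = 0"
    if m: "m \<in> Poly_Mapping.keys ((\<Prod>k\<in>UNIV. quotient_poly a e k) - (\<Prod>k\<in>UNIV. T k))" for m
  proof -
    have "(\<Sum>k\<in>UNIV. int (Poly_Mapping.lookup m (Inr k))) < (\<Sum>k\<in>UNIV. d k)"
      using low[OF m] by (simp add: deg_in_def sum.reindex)
    then obtain k where "int (Poly_Mapping.lookup m (Inr k)) < d k"
      using sum_mono[of UNIV d "\<lambda>k. int (Poly_Mapping.lookup m (Inr k))"] by (meson not_less)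
    then have "lin_rec (a k) (e k) (Poly_Mapping.lookup m (Inr k)) = 0"
      by (simp add: lin_rec_low d_def)
    then show ?thesis by (auto simp: rec_functional_def lookup_Inr intro!: prod_zero)
  qed
  have "apply_y (rec_functional a e) ((\<Prod>k\<in>UNIV. quotient_poly a e k) - (\<Prod>k\<in>UNIV. T k)) = 0"
    unfolding apply_y_def by (rule sum.neutral) (simp add: zero)
  then have "apply_y (rec_functional a e) (\<Prod>k\<in>UNIV. quotient_poly a e k) = apply_y (rec_functional a e) (\<Prod>k\<in>UNIV. T k)"
    using apply_y_add[of "rec_functional a e" "(\<Prod>k\<in>UNIV. quotient_poly a e k) - (\<Prod>k\<in>UNIV. T k)" "\<Prod>k\<in>UNIV. T k"] by simp
  also have "(\<Prod>k\<in>UNIV. T k) = Poly_Mapping.single (\<Sum>k\<in>UNIV. Poly_Mapping.single (Inr k) (e k - 1)) 1"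
    by (simp add: T_def X_power prod_single)
  also have "apply_y (rec_functional a e) \<dots> = 1"
  proof -
    have "Poly_Mapping.map_key Inl (\<Sum>k\<in>UNIV. Poly_Mapping.single (Inr k) (e k - 1)) = (0 :: 'n \<Rightarrow>\<^sub>0 nat)"
      by (rule poly_mapping_eqI) (simp add: map_key.rep_eq lookup_sum lookup_single)
    moreover have "Poly_Mapping.lookup (\<Sum>k\<in>UNIV. Poly_Mapping.single (Inr k) (e k - 1)) (Inr l :: 'n + 'n) = e l - 1" for l
      by (simp add: lookup_sum lookup_single when_def)
    moreover have "lin_rec (a l) (e l) (e l - 1) = 1" for l using e[of l] by (simp add: lin_rec_low)
    ultimately show ?thesis by (simp add: apply_y_single rec_functional_def lookup_Inr)
  qed
  finally show ?thesis .
qed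

section \<open>Congruences and Cramer's rule\<close>

definition cong_mod :: "('c::finite \<Rightarrow> 'r::comm_ring_1) \<Rightarrow> 'r \<Rightarrow> 'r \<Rightarrow> bool"
  where "cong_mod t a b \<longleftrightarrow> (\<exists>q. a - b = (\<Sum>c\<in>UNIV. t c * q c))"

lemma cong_mod_refl [simp]: "cong_mod t a a"
  unfolding cong_mod_def by (rule exI[of _ "\<lambda>_. 0"]) simp

lemma cong_mod_add: "cong_mod t a b \<Longrightarrow> cong_mod t a' b' \<Longrightarrow> cong_mod t (a + a') (b + b')"
  unfolding cong_mod_def
proof (elim exE)
  fix q q' assume "a - b = (\<Sum>c\<in>UNIV. t c * q c)" "a' - b' = (\<Sum>c\<in>UNIV. t c * q' c)"
  then show "\<exists>q. a + a' - (b + b') = (\<Sum>c\<in>UNIV. t c * q c)"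
    by (intro exI[of _ "\<lambda>c. q c + q' c"]) (simp add: distrib_left sum.distrib add_diff_add)
qed

lemma cong_mod_mult: "cong_mod t a b \<Longrightarrow> cong_mod t a' b' \<Longrightarrow> cong_mod t (a * a') (b * b')"
  unfolding cong_mod_def
proof (elim exE)
  fix q q' assume eq: "a - b = (\<Sum>c\<in>UNIV. t c * q c)" "a' - b' = (\<Sum>c\<in>UNIV. t c * q' c)"
  have "a * a' - b * b' = (a - b) * a' + b * (a' - b')" by (simp add: algebra_simps)
  also have "\<dots> = (\<Sum>c\<in>UNIV. t c * (q c * a' + b * q' c))"
    unfolding eq by (simp add: distrib_left sum.distrib sum_distrib_left sum_distrib_right mult.assoc mult.left_commute)
  finally show "\<exists>q. a * a' - b * b' = (\<Sum>c\<in>UNIV. t c * q c)"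
    by (rule exI[of _ "\<lambda>c. q c * a' + b * q' c"])
qed

lemma cong_mod_det: "(\<And>i j. cong_mod t (M i j) (M' i j)) \<Longrightarrow> cong_mod t (det (\<chi> i j. M i j)) (det (\<chi> i j. M' i j))"
  unfolding det_def
proof -
  assume M: "\<And>i j. cong_mod t (M i j) (M' i j)"
  have sum: "(\<And>i. cong_mod t (u i) (v i)) \<Longrightarrow> cong_mod t (sum u I) (sum v I)" for u v and I :: "'x set"
    by (induction I rule: infinite_finite_induct) (simp_all add: cong_mod_add)
  have prod: "(\<And>i. cong_mod t (u i) (v i)) \<Longrightarrow> cong_mod t (prod u I) (prod v I)" for u v and I :: "'x set"
    by (induction I rule: infinite_finite_induct) (simp_all add: cong_mod_mult)
  show "cong_mod t (\<Sum>p | p permutes UNIV. of_int (sign p) * (\<Prod>i\<in>UNIV. (\<chi> i j. M i j) $ i $ p i))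
      (\<Sum>p | p permutes UNIV. of_int (sign p) * (\<Prod>i\<in>UNIV. (\<chi> i j. M' i j) $ i $ p i))"
    by (intro sum cong_mod_mult prod cong_mod_refl) (simp add: M)
qed

text \<open>Row \<open>i\<close> is replaced by a combination of all rows, in which multiples of the
  others drop out. In the application the combined row consists of the monic polynomials
  \<open>h k\<close>.\<close>

lemma det_row_replace:
  fixes g :: "'n::finite \<Rightarrow> 'n \<Rightarrow> 'r::comm_ring_1"
  shows "f i * det (\<chi> r k. g r k) = det (\<chi> r k. if r = i then \<Sum>j\<in>UNIV. f j * g j k else g r k)"
proof -
  have *: "det (\<chi> r k. if r = i then g i k else g r k) = det (\<chi> r k. g r k)"
    by (rule arg_cong[where f = det]) (simp add: vec_eq_iff)
  have "det (\<chi> r k. if r = i then \<Sum>j\<in>UNIV. f j * g j k else g r k)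
      = (\<Sum>j\<in>UNIV. f j * det (\<chi> r k. if r = i then g j k else g r k))"
    by (rule det_row_linear) simp
  also have "det (\<chi> r k. if r = i then g j k else g r k) = 0" if "j \<noteq> i" for j
    using that by (intro det_identical_rows[of j i]) (auto simp: row_def vec_eq_iff)
  then have "(\<Sum>j\<in>UNIV. f j * det (\<chi> r k. if r = i then g j k else g r k)) = (\<Sum>j\<in>UNIV. if j = i then f i * det (\<chi> r k. g r k) else 0)"
    by (intro sum.cong refl) (use * in auto)
  finally show ?thesis by simp
qed

text \<open>With \<open>h\<^sub>k = \<Sum>\<^sub>i f\<^sub>i g\<^sub>i\<^sub>k\<close> monic in the single variable \<open>x\<^sub>k\<close>, a unit root functional \<open>E\<^sub>h\<close> of \<open>h\<close> is a product of
  linear recurrences, and \<open>F \<mapsto> E\<^sub>h(det g F)\<close> is one of \<open>f\<close>, as \<open>det g(y) det \<nabla>f\<close> and \<open>det \<nabla>h\<close> are congruent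
  modulo \<open>f(x)\<close> and \<open>h(y)\<close>.\<close>

lemma unit_root_functional_exists:
  fixes f :: "'n::finite \<Rightarrow> ('n, 'a::field) mpoly"
  assumes D: "difference_derivative D" and fin: "finite_dim_quotient (ideal_of f)"
  shows "\<exists>E. unit_root_functional D f E"
proof (cases "1 \<in> ideal_of f")
  case True
  \<comment> \<open>For the unit ideal the zero functional serves, since 0 = 1 + (- 1) with - 1 in
    the ideal.\<close>
  then have "- 1 * 1 \<in> ideal_of f" by (rule ideal_of_mult)
  then have "- 1 \<in> ideal_of f" by simp
  then obtain g where "(- 1 :: ('n, 'a) mpoly) = (\<Sum>i\<in>UNIV. f i * g i)" by (auto simp: ideal_of_def)
  then have "(0 :: ('n, 'a) mpoly) = 1 + (\<Sum>i\<in>UNIV. f i * g i)" by (metis add.right_inverse)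
  moreover have "is_functional (\<lambda>_ :: ('n, 'a) mpoly. 0 :: 'a)" by (rule is_functionalI) simp_all
  ultimately have "unit_root_functional D f (\<lambda>_. 0)"
    unfolding unit_root_functional_def annulling_def by (auto intro!: exI[of _ g])
  then show ?thesis by (rule exI[of _ "\<lambda>_. 0"])
next
  case False
  have "\<forall>k. \<exists>m a. X k ^ m + (\<Sum>j<m. scale (a j) (X k ^ j)) \<in> ideal_of f"
    using finite_dim_quotient_monic[OF fin] by blast
  from choice[OF this] obtain e where "\<forall>k. \<exists>a. X k ^ e k + (\<Sum>j<e k. scale (a j) (X k ^ j)) \<in> ideal_of f" by blast
  from choice[OF this] obtain a where ideal: "\<And>k. X k ^ e k + (\<Sum>j<e k. scale (a k j) (X k ^ j)) \<in> ideal_of f" by blast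
  define h where "h k = X k ^ e k + (\<Sum>j<e k. scale (a k j) (X k ^ j))" for k
  \<comment> \<open>For exponent 0 the monic polynomial would be 1, which is not in the ideal in
    this case.\<close>
  have e: "0 < e k" for k using ideal[of k] False by (cases "e k") auto
  have "\<forall>k. \<exists>g. h k = (\<Sum>i\<in>UNIV. f i * g i)" using ideal by (auto simp: ideal_of_def h_def)
  from choice[OF this] obtain g where g: "\<And>k. h k = (\<Sum>i\<in>UNIV. f i * g k i)" by blast
  define u where "u = det (\<chi> i k. g k i)"
  define Eh where "Eh = rec_functional a e"
  have Eh: "is_functional Eh" by (simp add: Eh_def)
  have Eh_h: "Eh (h k * q) = 0" for k q unfolding Eh_def h_def by (rule rec_functional_annuls)
  \<comment> \<open>Multiplication by the determinant \<open>u\<close> turns a functional annulling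
    the \<open>h k\<close> into one annulling the \<open>f i\<close>, by Cramer's rule.\<close>
  define E where "E F = Eh (u * F)" for F
  have E: "is_functional E"
    unfolding E_def by (rule is_functional_comp[OF Eh]) (simp_all add: distrib_left mult.left_commute)
  have E_f: "E (f i * q) = 0" for i q
  proof -
    have "f i * u = det (\<chi> r k. if r = i then h k else g k r)"
      unfolding u_def g det_row_replace[of f i "\<lambda>i k. g k i"] ..
    also have "\<dots> = (\<Sum>j\<in>UNIV. h j * det (\<chi> r k. if r = i then (if k = j then 1 else 0) else g k r))"
      by (rule det_row_expand)
    finally have "u * (f i * q) = (\<Sum>j\<in>UNIV. h j * det (\<chi> r k. if r = i then (if k = j then 1 else 0) else g k r)) * q"
      by (simp add: mult_ac)
    then show ?thesis
      unfolding E_def by (simp add: sum_distrib_right mult.assoc functional_sum[OF Eh] Eh_h)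
  qed
  \<comment> \<open>By the product rule \<open>W'\<close> is a difference matrix of
    \<open>h\<close>. Modulo the \<open>f i\<close> at x only \<open>W\<close> remains, which is the
    matrix of difference derivatives of \<open>f\<close> times the matrix \<open>g\<close> at
    y.\<close>
  define W where "W k l = (\<Sum>i\<in>UNIV. D k (f i) * in_y (g l i))" for k l
  define W' where "W' k l = W k l + (\<Sum>i\<in>UNIV. in_x (f i) * D k (g l i))" for k l
  \<comment> \<open>A second difference matrix of \<open>h\<close>, diagonal since each
    \<open>h k\<close> involves its own variable only.\<close>
  define S where "S k l = (if k = l then quotient_poly a e k else 0)" for k l
  have "(\<Sum>k\<in>UNIV. (X (Inl k) - X (Inr k)) * W' k l) = in_x (h l) - in_y (h l)" for l
  proof -
    have "(\<Sum>k\<in>UNIV. (X (Inl k) - X (Inr k)) * W' k l)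
        = (\<Sum>i\<in>UNIV. (\<Sum>k\<in>UNIV. (X (Inl k) - X (Inr k)) * D k (f i)) * in_y (g l i))
          + (\<Sum>i\<in>UNIV. in_x (f i) * (\<Sum>k\<in>UNIV. (X (Inl k) - X (Inr k)) * D k (g l i)))"
      unfolding W'_def W_def distrib_left sum.distrib sum_distrib_left sum_distrib_right
      by (rule arg_cong2[where f = "(+)"]; subst sum.swap) (simp_all only: mult_ac)
    also have "\<dots> = (\<Sum>i\<in>UNIV. in_x (f i) * in_x (g l i)) - (\<Sum>i\<in>UNIV. in_y (f i) * in_y (g l i))"
      unfolding difference_derivative_eq[OF D, symmetric]
      by (simp add: algebra_simps sum.distrib sum_subtractf)
    finally show ?thesis by (simp add: g subst_sum subst_mult)
  qed
  moreover have "(\<Sum>k\<in>UNIV. (X (Inl k) - X (Inr k)) * S k l) = in_x (h l) - in_y (h l)" for l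
    unfolding S_def h_def quotient_poly_eq[symmetric] by (simp add: if_distrib[of "(*) _"] cong: if_cong)
  ultimately obtain q where q: "det (\<chi> k l. W' k l) - det (\<chi> k l. S k l) = (\<Sum>l\<in>UNIV. (in_x (h l) - in_y (h l)) * q l)"
    using det_difference_vectors[of Inr Inl W' "\<lambda>l. in_x (h l) - in_y (h l)" S] by auto
  have "cong_mod (\<lambda>i. in_x (f i)) (det (\<chi> k l. W' k l)) (det (\<chi> k l. W k l))"
    by (rule cong_mod_det) (auto simp: cong_mod_def W'_def)
  then obtain r where r: "det (\<chi> k l. W' k l) - det (\<chi> k l. W k l) = (\<Sum>i\<in>UNIV. in_x (f i) * r i)"
    by (auto simp: cong_mod_def)
  \<comment> \<open>Multiples of \<open>h\<close> at x are rewritten as multiples of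
    \<open>f\<close> at x; those of \<open>h\<close> at y will be annulled by
    \<open>Eh\<close>.\<close>
  have "(\<Sum>l\<in>UNIV. in_x (h l) * q l) = (\<Sum>l\<in>UNIV. \<Sum>i\<in>UNIV. in_x (f i) * (in_x (g l i) * q l))"
    unfolding g subst_sum subst_mult sum_distrib_right by (simp only: mult.assoc)
  also have "\<dots> = (\<Sum>i\<in>UNIV. in_x (f i) * (\<Sum>l\<in>UNIV. in_x (g l i) * q l))"
    unfolding sum_distrib_left by (rule sum.swap)
  finally have hq: "(\<Sum>l\<in>UNIV. in_x (h l) * q l) = (\<Sum>i\<in>UNIV. in_x (f i) * (\<Sum>l\<in>UNIV. in_x (g l i) * q l))" .
  have "in_y u * det (nabla_matrix D f) = det (\<chi> k l. W k l)"
  proof -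
    have "in_y u * det (nabla_matrix D f) = det (nabla_matrix D f ** (\<chi> i k. in_y (g k i)))"
      by (simp add: det_mul u_def subst_det mult.commute)
    also have "nabla_matrix D f ** (\<chi> i k. in_y (g k i)) = (\<chi> k l. W k l)"
      by (simp add: matrix_matrix_mult_def nabla_matrix_def W_def)
    finally show ?thesis .
  qed
  also have "\<dots> = det (\<chi> k l. S k l) + (\<Sum>l\<in>UNIV. in_y (h l) * (- q l))
      + (\<Sum>i\<in>UNIV. in_x (f i) * ((\<Sum>l\<in>UNIV. in_x (g l i) * q l) - r i))"
  proof -
    have "det (\<chi> k l. W' k l) - det (\<chi> k l. S k l)
        = (\<Sum>i\<in>UNIV. in_x (f i) * (\<Sum>l\<in>UNIV. in_x (g l i) * q l)) - (\<Sum>l\<in>UNIV. in_y (h l) * q l)"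
      using q by (simp only: left_diff_distrib sum_subtractf hq)
    moreover have "w = s + - y + (z - v)" if "w' - s = z - y" "w' - w = v" for w w' s y z v :: "('n + 'n, 'a) mpoly"
      using that by (auto simp: algebra_simps)
    ultimately show ?thesis
      unfolding right_diff_distrib sum_subtractf mult_minus_right sum_negf using r by blast
  qed
  also have "det (\<chi> k l. S k l) = (\<Prod>k\<in>UNIV. quotient_poly a e k)"
    by (subst det_diagonal) (simp_all add: S_def)
  finally have "apply_y E (det (nabla_matrix D f)) = apply_y Eh ((\<Prod>k\<in>UNIV. quotient_poly a e k) + (\<Sum>l\<in>UNIV. in_y (h l) * (- q l))
      + (\<Sum>i\<in>UNIV. in_x (f i) * ((\<Sum>l\<in>UNIV. in_x (g l i) * q l) - r i)))"
    using apply_y_in_y_mult[OF Eh, of u "det (nabla_matrix D f)"] by (simp add: E_def[abs_def])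
  also have "\<dots> = 1 + (\<Sum>i\<in>UNIV. f i * apply_y Eh ((\<Sum>l\<in>UNIV. in_x (g l i) * q l) - r i))"
  proof -
    have "apply_y Eh (\<Prod>k\<in>UNIV. quotient_poly a e k) = 1"
      unfolding Eh_def by (rule apply_y_quotient_poly[OF e])
    then show ?thesis
      by (simp only: apply_y_add apply_y_sum apply_y_in_x_mult apply_y_in_y_mult[OF Eh] Eh_h apply_y_0 sum.neutral_const add_0_right)
  qed
  finally have "\<exists>g. apply_y E (det (nabla_matrix D f)) = 1 + (\<Sum>i\<in>UNIV. f i * g i)"
    by (rule exI[of _ "\<lambda>i. apply_y Eh ((\<Sum>l\<in>UNIV. in_x (g l i) * q l) - r i)"])
  moreover have "E \<in> annulling (ideal_of f)"
    by (auto simp: annulling_def ideal_of_def E functional_sum[OF E] E_f)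
  ultimately show ?thesis by (auto simp: unit_root_functional_def)
qed

section \<open>The algebra of functionals annulling a bounded part of the ideal\<close>

lemma polys_le_mono: "d \<le> e \<Longrightarrow> polys_le d \<subseteq> (polys_le e :: ('n::finite, 'a::zero) mpoly set)"
  by (auto simp: polys_le_def)

lemma ideal_le_mono: "d \<le> e \<Longrightarrow> ideal_le f d \<subseteq> ideal_le f e"
  using polys_le_mono[of "d - x" "e - x" for x] unfolding ideal_le_def by (simp, blast)

lemma ideal_le_subset: "ideal_le f d \<subseteq> ideal_of f"
  by (auto simp: ideal_le_def ideal_of_def)

lemma annulling_antimono: "S \<subseteq> T \<Longrightarrow> annulling T \<subseteq> annulling S"
  by (auto simp: annulling_def)

lemma hfun_cong:
  fixes L L' :: "('n::finite, 'a::field) functional"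
  assumes L: "\<And>F. F \<in> polys_le p \<Longrightarrow> L F = L' F"
  shows "hfun p L = hfun p L'"
proof -
  have "Poly_Mapping.single (dexp \<mu>) 1 \<in> (polys_le p :: ('n, 'a) mpoly set)" if "int (deg_in UNIV \<mu>) = p" for \<mu>
    using that unfolding polys_le_iff by (intro deg_rel_single) (simp add: deg_in_option)
  then show ?thesis unfolding hfun_def by (intro arg_cong[where f = wtsum] ext) (simp add: L)
qed

context
  fixes D :: "'n::finite \<Rightarrow> ('n, 'a::field) mpoly \<Rightarrow> ('n + 'n, 'a) mpoly" and f :: "'n \<Rightarrow> ('n, 'a) mpoly"
  assumes D: "difference_derivative D"
begin

lemma hfun_extension:
  assumes L: "L1 \<in> annulling (ideal_le f p)" "L2 \<in> annulling (ideal_le f q)" and F: "F \<in> polys_le E"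
  shows "hfun E (extension D f L1 L2) (homog E F) = extension D f L1 L2 F"
  using is_functional_extension[OF D] L(1)
  by (subst hfun_hom[OF _ deg_rel_homog[OF F]]) (auto simp: annulling_def dehom_homog)

text \<open>The product formula sees its factors only through \<open>hfun\<close>, hence through
  their values in degrees up to \<open>p\<close> and \<open>q\<close>. This makes the induced
  operation well defined.\<close>

lemma extension_cong:
  assumes L: "L1 \<in> annulling (ideal_le f p)" "L2 \<in> annulling (ideal_le f q)"
    and L': "L1' \<in> annulling (ideal_le f p)" "L2' \<in> annulling (ideal_le f q)"
    and eq: "\<And>F. F \<in> polys_le p \<Longrightarrow> L1 F = L1' F" "\<And>F. F \<in> polys_le q \<Longrightarrow> L2 F = L2' F"
    and pq: "delta f \<le> p" "delta f \<le> q" and F: "F \<in> polys_le (p + q - delta f + 1)"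
  shows "extension D f L1 L2 F = extension D f L1' L2' F"
proof -
  interpret hom_system "hsys f" None "hdeg f" by (rule hom_system_hsys)
  define Fh where "Fh = homog (p + q - delta f + 1) F"
  have hom: "deg_rel (=) UNIV (p + q - delta f + 1) Fh" unfolding Fh_def by (rule deg_rel_homog[OF F])
  obtain V where V: "is_diff_matrix V (cols Fh) Px Py" using diff_matrix_exists by blast
  have "hfun p L1 = hfun p L1'" "hfun q L2 = hfun q L2'" using eq by (auto intro: hfun_cong)
  then have "hfun (p + q - delta f + 1) (extension D f L1 L2) Fh = hfun (p + q - delta f + 1) (extension D f L1' L2') Fh"
    using is_product_extension[OF D L pq refl] is_product_extension[OF D L' pq refl] hom V
    by (simp add: is_product_def)
  then show ?thesis
    unfolding Fh_def by (simp only: hfun_extension[OF L F] hfun_extension[OF L' F])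
qed

lemma extension_commute:
  assumes L: "L1 \<in> annulling (ideal_le f p)" "L2 \<in> annulling (ideal_le f q)"
    and pq: "delta f \<le> p" "delta f \<le> q" and F: "F \<in> polys_le (p + q - delta f + 1)"
  shows "extension D f L1 L2 F = extension D f L2 L1 F"
proof -
  interpret hom_system "hsys f" None "hdeg f" by (rule hom_system_hsys)
  let ?E = "p + q - delta f + 1"
  have "hfun ?E (extension D f L1 L2) (homog ?E F) = hfun ?E (extension D f L2 L1) (homog ?E F)"
    by (rule is_product_comm[OF adm_hfun[OF L(1)] adm_hfun[OF L(2)] is_product_extension[OF D L pq refl]
          is_product_extension[OF D L(2,1) pq(2,1)] deg_rel_homog[OF F]]) (use pq in simp_all)
  then show ?thesis
    by (simp only: hfun_extension[OF L F] hfun_extension[OF L(2,1) F])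
qed

text \<open>\<open>is_product_assoc\<close> gives (L3 L2) L1; commutativity of the outer and then of
  the inner product leads to L1 (L2 L3), with \<open>extension_cong\<close> justifying the inner
  exchange.\<close>

lemma extension_assoc:
  assumes L: "L1 \<in> annulling (ideal_le f p)" "L2 \<in> annulling (ideal_le f q)" "L3 \<in> annulling (ideal_le f r)"
    and pq: "delta f \<le> p" "delta f \<le> q" "delta f \<le> r" and F: "F \<in> polys_le (p + q + r - 2 * delta f + 2)"
  shows "extension D f (extension D f L1 L2) L3 F = extension D f L1 (extension D f L2 L3) F"
proof -
  let ?d = "delta f" and ?E = "p + q + r - 2 * delta f + 2"
  interpret hom_system "hsys f" None "hdeg f" by (rule hom_system_hsys)
  have \<delta>: "\<delta> = ?d" by (rule delta_hsys)
  note L12 = extension_annulling[OF D L(1,2) pq(1,2)] and L32 = extension_annulling[OF D L(3,2) pq(3,2)]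
    and L23 = extension_annulling[OF D L(2,3) pq(2,3)]
  have ge: "?d \<le> p + q - ?d + 1" "?d \<le> r + q - ?d + 1" using pq by simp_all
  have E: "?E = (p + q - ?d + 1) + r - ?d + 1" "?E = (r + q - ?d + 1) + p - ?d + 1" by simp_all
  have "hfun ?E (extension D f (extension D f L1 L2) L3) (homog ?E F) = hfun ?E (extension D f (extension D f L3 L2) L1) (homog ?E F)"
    by (rule is_product_assoc[OF adm_hfun[OF L(1)] adm_hfun[OF L(2)] adm_hfun[OF L(3)], unfolded \<delta>,
          OF adm_hfun[OF L12] adm_hfun[OF L32] pq refl is_product_extension[OF D L(1,2) pq(1,2) refl]
          is_product_extension[OF D L12 L(3) ge(1) pq(3) E(1)] is_product_extension[OF D L(3,2) pq(3,2) refl]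
          is_product_extension[OF D L32 L(1) ge(2) pq(1) E(2)] deg_rel_homog[OF F]])
  then have "extension D f (extension D f L1 L2) L3 F = extension D f (extension D f L3 L2) L1 F"
    by (simp only: hfun_extension[OF L12 L(3) F] hfun_extension[OF L32 L(1) F])
  also have "\<dots> = extension D f L1 (extension D f L3 L2) F"
    using F unfolding E(2) by (rule extension_commute[OF L32 L(1) ge(2) pq(1)])
  also have "\<dots> = extension D f L1 (extension D f L2 L3) F"
  proof (rule extension_cong[OF L(1) _ L(1) L23 refl _ pq(1)])
    show "extension D f L3 L2 \<in> annulling (ideal_le f (q + r - ?d + 1))" using L32 by (simp only: add.commute)
    show "extension D f L3 L2 G = extension D f L2 L3 G" if "G \<in> polys_le (q + r - ?d + 1)" for G
      using that by (intro extension_commute[OF L(3,2) pq(3,2)]) (simp only: add.commute)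
    show "?d \<le> q + r - ?d + 1" using pq by simp
    show "F \<in> polys_le (p + (q + r - ?d + 1) - ?d + 1)" using F by (simp add: algebra_simps)
  qed
  finally show ?thesis .
qed

lemma extension_add_left: "extension D f (L1 + L1') L2 = extension D f L1 L2 + extension D f L1' L2"
  and extension_scale_left: "extension D f (fun_scale c L1) L2 = fun_scale c (extension D f L1 L2)"
  by (simp_all add: extension_def fun_eq_iff fun_scale_def)

lemma extension_add_right:
  "is_functional L1 \<Longrightarrow> extension D f L1 (L2 + L2') = extension D f L1 L2 + extension D f L1 L2'"
proof -
  assume L1: "is_functional L1"
  have "apply_y (L2 + L2') G = apply_y L2 G + apply_y L2' G" for G
    by (simp add: apply_y_def distrib_left single_add sum.distrib)
  then show ?thesis by (simp add: extension_def fun_eq_iff functional_add[OF L1])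
qed

lemma extension_scale_right:
  "is_functional L1 \<Longrightarrow> extension D f L1 (fun_scale c L2) = fun_scale c (extension D f L1 L2)"
proof -
  assume L1: "is_functional L1"
  have "apply_y (fun_scale c L2) G = Poly_Mapping.single 0 c * apply_y L2 G" for G
    by (simp add: apply_y_def fun_scale_def sum_distrib_left mult_single mult.left_commute)
  then show ?thesis by (simp add: extension_def fun_eq_iff functional_const_mult[OF L1] fun_scale_def)
qed

end

section \<open>Spaces of functionals and their restrictions\<close>

lemma subspace_annulling: "functional.subspace (annulling S)"
proof -
  have "is_functional (L + L')" if "is_functional L" "is_functional L'" for L L' :: "('b, 'a) functional"
    by (rule is_functionalI) (simp_all add: functional_add[OF that(1)] functional_add[OF that(2)]
        functional_const_mult[OF that(1)] functional_const_mult[OF that(2)] distrib_left)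
  moreover have "is_functional (fun_scale c L)" if "is_functional L" for c and L :: "('b, 'a) functional"
    by (rule is_functionalI) (simp_all add: fun_scale_def functional_add[OF that] functional_const_mult[OF that] distrib_left mult.left_commute)
  moreover have "is_functional (0 :: ('b, 'a) functional)" by (rule is_functionalI) simp_all
  ultimately show ?thesis by (auto simp: functional.subspace_def annulling_def fun_scale_def)
qed

lemma restr_add: "restr U (L + L') = restr U L + restr U (L' :: 'b \<Rightarrow> 'a::field)"
  and restr_fun_scale: "restr U (fun_scale c L) = fun_scale c (restr U L)"
  by (auto simp: restr_def fun_scale_def fun_eq_iff)

lemma restr_eq_iff: "restr U L = restr U L' \<longleftrightarrow> (\<forall>F\<in>U. L F = L' F)"
  unfolding restr_def fun_eq_iff by auto

lemma restr_span: "restr U ` functional.span S = functional.span (restr U ` (S :: ('b \<Rightarrow> 'a::field) set))"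
proof -
  have "module_hom fun_scale fun_scale (restr U :: ('b \<Rightarrow> 'a) \<Rightarrow> 'b \<Rightarrow> 'a)"
    by unfold_locales (simp_all add: restr_add restr_fun_scale functional.scale_right_distrib functional.scale_left_distrib)
  then interpret module_hom fun_scale fun_scale "restr U :: ('b \<Rightarrow> 'a) \<Rightarrow> 'b \<Rightarrow> 'a" .
  show ?thesis by (rule span_image[symmetric])
qed

lemma sign_map_option:
  assumes "p permutes (UNIV :: 'n::finite set)"
  shows "sign (map_option p) = sign p \<and> map_option p permutes UNIV"
  using assms finite
proof (induction p rule: permutes_induct)
  case id
  show ?case by (simp add: option.map_id0 permutes_id flip: id_def)
next
  case (swap a b p)
  have eq: "map_option (Transposition.transpose a b \<circ> p) = Transposition.transpose (Some a) (Some b) \<circ> map_option p"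
  proof
    show "map_option (Transposition.transpose a b \<circ> p) v = (Transposition.transpose (Some a) (Some b) \<circ> map_option p) v" for v
      by (cases v) (auto simp: Transposition.transpose_def)
  qed
  have p: "permutation p" "permutation (map_option p)"
    using swap by (auto simp: permutation_permutes intro: finite)
  have "Transposition.transpose (Some a) (Some b) \<circ> map_option p permutes UNIV"
    using swap by (intro permutes_compose permutes_swap_id) auto
  moreover have "sign (Transposition.transpose (Some a) (Some b) \<circ> map_option p) = sign (Transposition.transpose a b \<circ> p)"
    using swap by (simp only: sign_compose[OF permutation_swap_id p(1)] sign_compose[OF permutation_swap_id p(2)]
        sign_swap_id option.inject)
  ultimately show ?case unfolding eq by blast
qed

text \<open>Only permutations fixing \<open>None\<close> contribute. These are the maps
  \<open>map_option p\<close>, and they have the sign of \<open>p\<close>.\<close>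

lemma det_option:
  fixes M :: "'n::finite \<Rightarrow> 'n option \<Rightarrow> 'r::comm_ring_1"
  shows "det (\<chi> r c. case r of None \<Rightarrow> if c = None then 1 else 0 | Some k \<Rightarrow> M k c) = det (\<chi> k l. M k (Some l))"
proof -
  define N where "N r c = (case r of None \<Rightarrow> if c = None then 1 else 0 | Some k \<Rightarrow> M k c)" for r c
  define term' where "term' p = of_int (sign p) * (\<Prod>r\<in>UNIV. N r (p r))" for p
  have bij: "bij_betw map_option {p. p permutes (UNIV :: 'n set)} {p. p permutes (UNIV :: 'n option set) \<and> p None = None}"
  proof (rule bij_betwI'[where f = map_option])
    fix p q :: "'n \<Rightarrow> 'n"
    show "(map_option p = map_option q) = (p = q)"
    proof
      assume "map_option p = map_option q"
      then have "map_option p (Some i) = map_option q (Some i)" for i by simp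
      then show "p = q" by (simp add: fun_eq_iff)
    qed simp
  next
    fix p assume "p \<in> {p. p permutes (UNIV :: 'n set)}"
    then show "map_option p \<in> {p. p permutes UNIV \<and> p None = None}" using sign_map_option by auto
  next
    fix q assume q: "q \<in> {p. p permutes (UNIV :: 'n option set) \<and> p None = None}"
    then have inj: "inj q" by (auto dest: permutes_inj)
    define p where "p i = the (q (Some i))" for i
    have Some: "q (Some i) = Some (p i)" for i
      using injD[OF inj, of "Some i" None] q unfolding p_def by (cases "q (Some i)") auto
    have "inj p"
    proof (rule injI)
      fix i j assume "p i = p j"
      then have "q (Some i) = q (Some j)" by (simp add: Some)
      then show "i = j" using injD[OF inj] by blast
    qed
    then have "bij p" by (simp add: bij_def finite_UNIV_inj_surj)
    then have "p permutes UNIV" by (rule bij_imp_permutes) simp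
    moreover have "q = map_option p"
    proof
      show "q v = map_option p v" for v using q Some by (cases v) auto
    qed
    ultimately show "\<exists>p\<in>{p. p permutes UNIV}. q = map_option p" by blast
  qed
  have "(\<Sum>p | p permutes UNIV. term' p) = (\<Sum>p | p permutes UNIV \<and> p None = None. term' p)"
    by (rule sum.mono_neutral_right) (auto simp: term'_def N_def prod_option)
  also have "\<dots> = (\<Sum>p | p permutes UNIV. term' (map_option p))"
    by (rule sum.reindex_bij_betw[OF bij, symmetric])
  also have "\<dots> = (\<Sum>p | p permutes UNIV. of_int (sign p) * (\<Prod>k\<in>UNIV. M k (Some (p k))))"
    by (rule sum.cong) (auto simp: term'_def sign_map_option N_def prod_option)
  finally show ?thesis by (simp add: det_def term'_def N_def)
qed

text \<open>In the expansion along the last row \<open>L\<close> annuls the terms with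
  \<open>f i\<close>. The cofactor of \<open>F\<close> is the determinant that \<open>E\<close>
  evaluates to 1 modulo the ideal.\<close>

lemma extension_unit:
  fixes f :: "'n::finite \<Rightarrow> ('n, 'a::field) mpoly"
  assumes E: "unit_root_functional D f E" and L: "L \<in> annulling (ideal_of f)"
  shows "extension D f L E = L"
proof
  fix F
  have funL: "is_functional L" using L by (simp add: annulling_def)
  have L_f: "L (f i * q) = 0" for i q
  proof -
    have "f i \<in> ideal_of f"
      unfolding ideal_of_def by (rule CollectI, rule exI[of _ "\<lambda>j. if j = i then 1 else 0"])
        (simp add: if_distrib[of "(*) _"] cong: if_cong)
    then show ?thesis using L ideal_of_mult[of "f i" f q] by (simp add: annulling_def mult.commute)
  qed
  obtain g where g: "apply_y E (det (nabla_matrix D f)) = 1 + (\<Sum>i\<in>UNIV. f i * g i)"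
    using E by (auto simp: unit_root_functional_def)
  define h where "h c = (case c of Some i \<Rightarrow> f i | None \<Rightarrow> F)" for c
  define M where "M r c = (case r of Some k \<Rightarrow> D k (h c) | None \<Rightarrow> 0)" for r c
  define C where "C j = det (\<chi> r c. if r = None then (if c = j then 1 else 0) else M r c)" for j
  have "bordered_matrix D f F = (\<chi> r c. if r = None then in_x (h c) else M r c)"
    by (auto simp: bordered_matrix_def Let_def h_def M_def vec_eq_iff split: option.split)
  then have "det (bordered_matrix D f F) = (\<Sum>j\<in>UNIV. in_x (h j) * C j)"
    unfolding C_def by (simp only: det_row_expand[of None "\<lambda>c. in_x (h c)" M])
  moreover have "(\<chi> r c. if r = None then (if c = None then 1 else 0) else M r c)
      = (\<chi> r c. case r of None \<Rightarrow> if c = None then 1 else 0 | Some k \<Rightarrow> D k (h c))"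
    by (auto simp: vec_eq_iff M_def split: option.split)
  then have "C None = det (nabla_matrix D f)"
    unfolding C_def by (simp add: det_option nabla_matrix_def h_def)
  ultimately have "extension D f L E F = L (F * (1 + (\<Sum>i\<in>UNIV. f i * g i)))"
    by (simp add: extension_def apply_y_add apply_y_sum apply_y_in_x_mult sum_option functional_add[OF funL] functional_sum[OF funL] L_f h_def g)
  also have "\<dots> = L F"
    by (simp add: distrib_left sum_distrib_left mult.left_commute[of F] functional_add[OF funL] functional_sum[OF funL] L_f)
  finally show "extension D f L E F = L F" .
qed

section \<open>Powers of the algebra\<close>

lemma finite_bounded_exponents: "finite {m :: 'n::finite \<Rightarrow>\<^sub>0 nat. int (deg_in UNIV m) \<le> d}"
proof (rule finite_imageD)
  have "Poly_Mapping.lookup m i \<le> nat d" if "int (deg_in UNIV m) \<le> d" for m :: "'n \<Rightarrow>\<^sub>0 nat" and i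
  proof -
    have "Poly_Mapping.lookup m i \<le> deg_in UNIV m" unfolding deg_in_def by (rule member_le_sum) simp_all
    then show ?thesis using that by linarith
  qed
  then have "Poly_Mapping.lookup ` {m :: 'n \<Rightarrow>\<^sub>0 nat. int (deg_in UNIV m) \<le> d} \<subseteq> (UNIV \<rightarrow>\<^sub>E {..nat d})"
    by (auto simp: PiE_def)
  then show "finite (Poly_Mapping.lookup ` {m :: 'n \<Rightarrow>\<^sub>0 nat. int (deg_in UNIV m) \<le> d})"
    by (rule finite_subset) (simp add: finite_PiE)
  show "inj_on Poly_Mapping.lookup {m :: 'n \<Rightarrow>\<^sub>0 nat. int (deg_in UNIV m) \<le> d}"
    by (auto intro!: inj_onI poly_mapping_eqI)
qed

lemma polys_le_subset_span:
  "polys_le d \<subseteq> mpoly.span ((\<lambda>m. Poly_Mapping.single m (1 :: 'a::field)) ` {m :: 'n::finite \<Rightarrow>\<^sub>0 nat. int (deg_in UNIV m) \<le> d})"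
proof
  fix p :: "('n, 'a) mpoly" assume p: "p \<in> polys_le d"
  have "(\<Sum>m\<in>Poly_Mapping.keys p. scale (Poly_Mapping.lookup p m) (Poly_Mapping.single m 1))
      \<in> mpoly.span ((\<lambda>m. Poly_Mapping.single m 1) ` {m. int (deg_in UNIV m) \<le> d})"
    using p by (intro mpoly.span_sum mpoly.span_scale mpoly.span_base) (auto simp: polys_le_iff deg_rel_def)
  then show "p \<in> mpoly.span ((\<lambda>m. Poly_Mapping.single m 1) ` {m. int (deg_in UNIV m) \<le> d})"
    by (simp add: scale_single mpoly_sum_singles)
qed

lemma subspace_polys_le: "mpoly.subspace (polys_le d :: ('n::finite, 'a::field) mpoly set)"
proof -
  have "deg_rel (\<le>) UNIV d (scale c p)" if "deg_rel (\<le>) UNIV d p" for c and p :: "('n, 'a) mpoly"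
    using deg_rel_mult[of "(\<le>)" UNIV 0 "Poly_Mapping.single 0 c" d p] that by (simp add: scale_def)
  then show ?thesis by (auto simp: mpoly.subspace_def polys_le_iff deg_rel_add)
qed

lemma subspace_ideal_of: "mpoly.subspace (ideal_of f :: ('n::finite, 'a::field) mpoly set)"
  by (auto simp: mpoly.subspace_def scale_def ideal_of_add ideal_of_mult)

lemma subspace_ideal_le: "mpoly.subspace (ideal_le f d :: ('n::finite, 'a::field) mpoly set)"
proof -
  note P = subspace_polys_le[unfolded mpoly.subspace_def]
  have "0 \<in> ideal_le f d"
    unfolding ideal_le_def by (intro CollectI exI[of _ "\<lambda>_. 0"]) (simp add: P)
  moreover have "p + q \<in> ideal_le f d" if "p \<in> ideal_le f d" "q \<in> ideal_le f d" for p q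
  proof -
    obtain g g' where g: "p = (\<Sum>i\<in>UNIV. f i * g i)" "q = (\<Sum>i\<in>UNIV. f i * g' i)"
      "\<forall>i. g i \<in> polys_le (d - int (total_degree (f i)))" "\<forall>i. g' i \<in> polys_le (d - int (total_degree (f i)))"
      using \<open>p \<in> ideal_le f d\<close> \<open>q \<in> ideal_le f d\<close> by (auto simp: ideal_le_def)
    have "p + q = (\<Sum>i\<in>UNIV. f i * (g i + g' i))" by (simp add: g(1,2) distrib_left sum.distrib)
    moreover have "\<forall>i. g i + g' i \<in> polys_le (d - int (total_degree (f i)))" using g(3,4) P by blast
    ultimately show ?thesis
      unfolding ideal_le_def by (intro CollectI exI[of _ "\<lambda>i. g i + g' i"] conjI)
  qed
  moreover have "scale c p \<in> ideal_le f d" if p: "p \<in> ideal_le f d" for c p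
  proof -
    obtain g where g: "p = (\<Sum>i\<in>UNIV. f i * g i)" "\<forall>i. g i \<in> polys_le (d - int (total_degree (f i)))"
      using p by (auto simp: ideal_le_def)
    have "scale c p = (\<Sum>i\<in>UNIV. f i * scale c (g i))" by (simp add: g(1) scale_def sum_distrib_left mult.left_commute)
    moreover have "\<forall>i. scale c (g i) \<in> polys_le (d - int (total_degree (f i)))" using g(2) P by blast
    ultimately show ?thesis
      unfolding ideal_le_def by (intro CollectI exI[of _ "\<lambda>i. scale c (g i)"] conjI)
  qed
  ultimately show ?thesis by (simp add: mpoly.subspace_def)
qed

text \<open>The intersection is finite-dimensional: each element of a finite basis has some bound on
  its cofactors, and the largest of these bounds works for the whole span.\<close>

lemma ideal_of_inter_polys_le_bounded:
  fixes f :: "'n::finite \<Rightarrow> ('n, 'a::field) mpoly"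
  shows "\<exists>N. ideal_of f \<inter> polys_le d \<subseteq> ideal_le f N"
proof -
  obtain B where B: "B \<subseteq> ideal_of f \<inter> polys_le d" "mpoly.independent B" "ideal_of f \<inter> polys_le d \<subseteq> mpoly.span B"
    using mpoly.maximal_independent_subset[of "ideal_of f \<inter> polys_le d"] by blast
  have "B \<subseteq> mpoly.span ((\<lambda>m. Poly_Mapping.single m 1) ` {m. int (deg_in UNIV m) \<le> d})"
    using B(1) polys_le_subset_span by blast
  from mpoly.independent_span_bound[OF finite_imageI[OF finite_bounded_exponents] B(2) this]
  have fin: "finite B" by blast
  have "\<exists>n. b \<in> ideal_le f n" if b: "b \<in> ideal_of f" for b
  proof -
    obtain g where g: "b = (\<Sum>i\<in>UNIV. f i * g i)" using b by (auto simp: ideal_of_def)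
    define n where "n = (\<Sum>i\<in>UNIV. int (total_degree (f i)) + int (total_degree (g i)))"
    have "g i \<in> polys_le (n - int (total_degree (f i)))" for i
      using member_le_sum[of i UNIV "\<lambda>i. int (total_degree (f i)) + int (total_degree (g i))"]
      by (simp add: polys_le_def n_def)
    then have "b \<in> ideal_le f n" unfolding ideal_le_def using g by blast
    then show ?thesis ..
  qed
  then have "\<forall>b\<in>B. \<exists>n. b \<in> ideal_le f n" using B(1) by blast
  from bchoice[OF this] obtain n where n: "\<And>b. b \<in> B \<Longrightarrow> b \<in> ideal_le f (n b)" by blast
  define N where "N = Max (insert 0 (n ` B))"
  have "n b \<le> N" if "b \<in> B" for b using fin that by (simp add: N_def)
  then have "B \<subseteq> ideal_le f N" using n ideal_le_mono by blast
  then have "mpoly.span B \<subseteq> ideal_le f N" by (rule mpoly.span_minimal[OF _ subspace_ideal_le])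
  then show ?thesis using B(3) by blast
qed

text \<open>A basis of \<open>I\<close> is extended by elements of \<open>U\<close>. The new
  functional is 0 on basis elements in \<open>I\<close> and equals \<open>L\<close> on the others,
  which is consistent on \<open>U\<close> because \<open>L\<close> vanishes on I \<inter> U.\<close>

lemma functional_extend:
  fixes I U :: "('n, 'a::field) mpoly set"
  assumes L: "is_functional L" and I: "mpoly.subspace I" and U: "mpoly.subspace U"
    and zero: "\<And>F. F \<in> I \<inter> U \<Longrightarrow> L F = 0"
  shows "\<exists>L'\<in>annulling I. \<forall>F\<in>U. L' F = L F"
proof -
  interpret vector_space_pair "scale :: 'a \<Rightarrow> ('n, 'a) mpoly \<Rightarrow> _" "(*) :: 'a \<Rightarrow> 'a \<Rightarrow> 'a"
    by unfold_locales (simp_all add: algebra_simps)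
  obtain B1 where B1: "B1 \<subseteq> I" "mpoly.independent B1" "I \<subseteq> mpoly.span B1"
    using mpoly.maximal_independent_subset[of I] by blast
  obtain B where B: "B1 \<subseteq> B" "B \<subseteq> I \<union> U" "mpoly.independent B" "I \<union> U \<subseteq> mpoly.span B"
    using mpoly.maximal_independent_subset_extend[of B1 "I \<union> U"] B1 by blast
  obtain g where g: "is_functional g" "\<And>b. b \<in> B \<Longrightarrow> g b = (if b \<in> I then 0 else L b)"
    using linear_independent_extend[OF B(3), of "\<lambda>b. if b \<in> I then 0 else L b"] unfolding is_functional_def by blast
  have scale: "M (scale c x) = c * M x" if "is_functional M" for M :: "('n, 'a) functional" and c x
    using functional_const_mult[OF that] by (simp add: scale_def)
  \<comment> \<open>For \<open>x\<close> in \<open>U\<close>, the difference \<open>x - v\<close>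
    lies in both \<open>I\<close> and \<open>U\<close>, so \<open>L\<close> annuls it and the new
    functional agrees with \<open>L\<close> at \<open>x\<close>.\<close>
  have split: "\<exists>i\<in>I. \<exists>v\<in>U. x = i + v \<and> g x = L v" if "x \<in> mpoly.span B" for x
    using that
  proof (induction x rule: mpoly.span_induct_alt)
    case base
    show ?case
      using I U by (intro bexI[of _ 0]) (auto simp: mpoly.subspace_0 functional_0[OF g(1)] functional_0[OF L])
  next
    case (step c b y)
    then obtain i v where iv: "i \<in> I" "v \<in> U" "y = i + v" "g y = L v" by blast
    show ?case
    proof (cases "b \<in> I")
      case True
      then show ?thesis
        using iv step(1) I g(2)[of b]
        by (intro bexI[of _ "scale c b + i"] bexI[of _ v])
          (auto simp: functional_add[OF g(1)] scale[OF g(1)] mpoly.subspace_add mpoly.subspace_scale add.assoc)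
    next
      case False
      then have "b \<in> U" using step(1) B(2) by blast
      then show ?thesis
        using iv step(1) U g(2)[of b] False
        by (intro bexI[of _ i] bexI[of _ "scale c b + v"])
          (auto simp: functional_add[OF g(1)] functional_add[OF L] scale[OF g(1)] scale[OF L] mpoly.subspace_add mpoly.subspace_scale add.left_commute)
    qed
  qed
  have "g x = 0" if "x \<in> mpoly.span B1" for x
    using that
  proof (induction x rule: mpoly.span_induct_alt)
    case (step c b y)
    then have "b \<in> B" "b \<in> I" using B(1) B1(1) by auto
    then show ?case using step g(2)[of b] by (simp add: functional_add[OF g(1)] scale[OF g(1)])
  qed (simp add: functional_0[OF g(1)])
  then have "g \<in> annulling I" using B1(3) g(1) by (auto simp: annulling_def)
  moreover have "g x = L x" if x: "x \<in> U" for x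
  proof -
    obtain i v where iv: "i \<in> I" "v \<in> U" "x = i + v" "g x = L v" using split[of x] B(4) x by blast
    have "x - v \<in> U" using U x iv(2) by (rule mpoly.subspace_diff)
    then have "L i = 0" using iv zero[of i] by simp
    moreover have "L x = L i + L v" unfolding iv(3) by (rule functional_add[OF L])
    ultimately show ?thesis using iv(4) by simp
  qed
  ultimately show ?thesis by blast
qed

theorem theorem2:
  fixes D :: "'n::finite \<Rightarrow> ('n, 'a::field) mpoly \<Rightarrow> ('n + 'n, 'a) mpoly"
    and f :: "'n \<Rightarrow> ('n, 'a) mpoly"
    and \<epsilon> :: nat
    and A L :: "('n, 'a) functional set"
    and U :: "('n, 'a) mpoly set"
  assumes "difference_derivative D"
    and "finite_dim_quotient (ideal_of f)"
    and "A = annulling (ideal_le f (delta f + int \<epsilon>))"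
    and "L = annulling (ideal_of f)"
    and "U = polys_le (delta f + int \<epsilon>)"
  shows "(\<exists>E. unit_root_functional D f E) \<and>
    (\<forall>L1\<in>A. \<forall>L2\<in>A.
      induced U A (extension D f) (restr U L1) (restr U L2) = restr U (extension D f L1 L2)) \<and>
    comm_assoc_algebra (restr U ` A) (induced U A (extension D f)) \<and>
    (\<exists>d\<ge>1. restr U ` alg_power (extension D f) A d = restr U ` alg_power (extension D f) A (d + 1)) \<and>
    (\<forall>d\<ge>1. restr U ` alg_power (extension D f) A d = restr U ` alg_power (extension D f) A (d + 1) \<longrightarrow>
      restr U ` L = restr U ` alg_power (extension D f) A d \<and>
      restr U ` alg_power (extension D f) A d =
        alg_power (induced U A (extension D f)) (restr U ` A) d)"
proof -
  note D = assms(1)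
  define \<mu> where "\<mu> = delta f + int \<epsilon>"
  define star where "star = extension D f"
  define ind where "ind = induced U A star"
  define V where "V = restr U ` A"
  have A: "A = annulling (ideal_le f \<mu>)" and U: "U = polys_le \<mu>" using assms by (simp_all add: \<mu>_def)
  have \<mu>: "delta f \<le> \<mu>" by (simp add: \<mu>_def)
  have A_fun: "is_functional M" if "M \<in> A" for M using that by (simp add: A annulling_def)
  have A_sub: "functional.subspace A" unfolding A by (rule subspace_annulling)
  have mono: "annulling (ideal_le f p) \<subseteq> A" if "\<mu> \<le> p" for p
    unfolding A using that by (intro annulling_antimono ideal_le_mono)
  have U_mono: "F \<in> polys_le p" if "F \<in> U" "\<mu> \<le> p" for F p
    using that polys_le_mono[of \<mu> p] unfolding U by blast
  have star_A: "star M M' \<in> A" if "M \<in> A" "M' \<in> A" for M M'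
    using extension_annulling[OF D that[unfolded A] \<mu> \<mu>] mono[of "\<mu> + \<mu> - delta f + 1"] \<mu>
    by (auto simp: star_def)
  have star_cong: "restr U (star M1 M2) = restr U (star M1' M2')"
    if "M1 \<in> A" "M2 \<in> A" "M1' \<in> A" "M2' \<in> A" "restr U M1 = restr U M1'" "restr U M2 = restr U M2'" for M1 M2 M1' M2'
    unfolding restr_eq_iff star_def
  proof
    fix F assume "F \<in> U"
    then show "extension D f M1 M2 F = extension D f M1' M2' F"
      using that \<mu> unfolding A restr_eq_iff U
      by (intro extension_cong[OF D _ _ _ _ _ _ \<mu> \<mu>]) (auto intro: U_mono[unfolded U])
  qed
  \<comment> \<open>By \<open>star_cong\<close> the definite description has a unique solution on
    restrictions of elements of \<open>A\<close>.\<close>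
  have ind: "ind (restr U M1) (restr U M2) = restr U (star M1 M2)" if "M1 \<in> A" "M2 \<in> A" for M1 M2
    unfolding ind_def induced_def
  proof (rule the_equality)
    show "\<exists>L1\<in>A. \<exists>L2\<in>A. restr U L1 = restr U M1 \<and> restr U L2 = restr U M2 \<and> restr U (star M1 M2) = restr U (star L1 L2)"
      using that by blast
  next
    fix M assume "\<exists>L1\<in>A. \<exists>L2\<in>A. restr U L1 = restr U M1 \<and> restr U L2 = restr U M2 \<and> M = restr U (star L1 L2)"
    then obtain L1 L2 where "L1 \<in> A" "L2 \<in> A" "restr U L1 = restr U M1" "restr U L2 = restr U M2" "M = restr U (star L1 L2)"
      by blast
    then show "M = restr U (star M1 M2)" using star_cong[of L1 L2 M1 M2] that by simp
  qed
  have commute: "restr U (star M1 M2) = restr U (star M2 M1)" if "M1 \<in> A" "M2 \<in> A" for M1 M2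
    unfolding restr_eq_iff star_def using that \<mu>
    by (auto intro!: extension_commute[OF D _ _ \<mu> \<mu>] U_mono simp: A)
  have assoc: "restr U (star (star M1 M2) M3) = restr U (star M1 (star M2 M3))" if "M1 \<in> A" "M2 \<in> A" "M3 \<in> A" for M1 M2 M3
    unfolding restr_eq_iff star_def using that \<mu>
    by (auto intro!: extension_assoc[OF D _ _ _ \<mu> \<mu> \<mu>] U_mono simp: A)
  have algebra: "comm_assoc_algebra V ind"
    unfolding comm_assoc_algebra_def
  proof (intro conjI ballI allI)
    have "V = functional.span (restr U ` A)"
      using restr_span[of U A] A_sub by (simp add: V_def functional.span_eq_iff[THEN iffD2])
    then show "functional.subspace V" by simp
    fix u v w c assume "u \<in> V" "v \<in> V"
    then obtain M1 M2 where M: "M1 \<in> A" "M2 \<in> A" and uv: "u = restr U M1" "v = restr U M2" by (auto simp: V_def)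
    show "ind u v \<in> V" using M by (auto simp: uv ind V_def star_A)
    show "ind u v = ind v u" using M by (simp add: uv ind commute)
    have "fun_scale c M1 \<in> A" "fun_scale c M2 \<in> A" using A_sub M by (simp_all add: functional.subspace_scale)
    then show "ind (fun_scale c u) v = fun_scale c (ind u v)" "ind u (fun_scale c v) = fun_scale c (ind u v)"
      using M A_fun
      by (simp_all add: uv ind star_def extension_scale_left[OF D] extension_scale_right[OF D] flip: restr_fun_scale)
    assume "w \<in> V"
    then obtain M3 where M3: "M3 \<in> A" and w: "w = restr U M3" by (auto simp: V_def)
    show "ind (ind u v) w = ind u (ind v w)" using M M3 by (simp add: uv w ind star_A assoc)
    have "M1 + M2 \<in> A" "M2 + M3 \<in> A" using A_sub M M3 by (simp_all add: functional.subspace_add)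
    then show "ind (u + v) w = ind u w + ind v w" "ind u (v + w) = ind u v + ind u w"
      using M M3 A_fun
      by (simp_all add: uv w ind star_def extension_add_left[OF D] extension_add_right[OF D] flip: restr_add)
  qed
  \<comment> \<open>The index is shifted by one, as powers begin with exponent 1.\<close>
  define P where "P d = alg_power star A (Suc d)" for d
  define Q where "Q d = alg_power ind V (Suc d)" for d
  have P_Suc: "P (Suc d) = functional.span {star M M' |M M'. M \<in> P d \<and> M' \<in> A}" for d by (simp add: P_def)
  have Q_Suc: "Q (Suc d) = functional.span {ind S T |S T. S \<in> Q d \<and> T \<in> V}" for d by (simp add: Q_def)
  \<comment> \<open>Each further factor from \<open>A\<close> raises the degree by
    \<open>\<mu> - delta f + 1\<close>, which is \<epsilon> + 1 and hence positive even for
    \<epsilon> = 0.\<close>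
  have P_ann: "P d \<subseteq> annulling (ideal_le f (\<mu> + int d * (int \<epsilon> + 1)))" for d
  proof (induction d)
    case 0
    show ?case by (simp add: P_def A)
  next
    case (Suc d)
    let ?p = "\<mu> + int d * (int \<epsilon> + 1)"
    have p: "delta f \<le> ?p" and p': "?p + \<mu> - delta f + 1 = \<mu> + int (Suc d) * (int \<epsilon> + 1)"
      using \<mu> by (simp_all add: \<mu>_def algebra_simps)
    have "star M M' \<in> annulling (ideal_le f (\<mu> + int (Suc d) * (int \<epsilon> + 1)))" if "M \<in> P d" "M' \<in> A" for M M'
      using extension_annulling[OF D subsetD[OF Suc that(1)] that(2)[unfolded A] p \<mu>] unfolding p' star_def .
    then show ?case unfolding P_Suc by (intro functional.span_minimal subspace_annulling) blast
  qed
  have P_A: "P d \<subseteq> A" for d using P_ann[of d] mono[of "\<mu> + int d * (int \<epsilon> + 1)"] by auto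
  obtain E where E: "unit_root_functional D f E" using unit_root_functional_exists[OF D assms(2)] by blast
  have L_A: "L \<subseteq> A" unfolding A assms(4) by (intro annulling_antimono ideal_le_subset)
  \<comment> \<open>Multiplication by the unit root functional reproduces the elements of
    \<open>L\<close>, so they persist in every power.\<close>
  have L_P: "L \<subseteq> P d" for d
  proof (induction d)
    case 0
    show ?case using L_A by (simp add: P_def)
  next
    case (Suc d)
    have "E \<in> A" using E L_A unfolding assms(4) unit_root_functional_def by blast
    moreover have "M = star M E" if "M \<in> L" for M
      using extension_unit[OF E] that by (simp add: assms(4) star_def)
    ultimately show ?case unfolding P_Suc using Suc by (intro subsetI functional.span_base) blast
  qed
  \<comment> \<open>Restriction commutes with spans and, by \<open>ind\<close>, with
    products.\<close>
  have P_Q: "restr U ` P d = Q d" for d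
  proof (induction d)
    case 0
    show ?case by (simp add: P_def Q_def V_def)
  next
    case (Suc d)
    have "restr U ` {star M M' |M M'. M \<in> P d \<and> M' \<in> A} = {ind S T |S T. S \<in> Q d \<and> T \<in> V}"
      (is "?l = ?r")
    proof
      show "?l \<subseteq> ?r"
      proof
        fix R assume "R \<in> ?l"
        then obtain M M' where M: "M \<in> P d" "M' \<in> A" and R: "R = restr U (star M M')" by auto
        have "M \<in> A" using M(1) P_A by auto
        then have "R = ind (restr U M) (restr U M')" using M(2) by (simp add: R ind)
        moreover have "restr U M \<in> Q d" "restr U M' \<in> V" using M by (simp_all add: V_def flip: Suc)
        ultimately show "R \<in> ?r" by auto
      qed
      show "?r \<subseteq> ?l"
      proof
        fix R assume "R \<in> ?r"
        then obtain S T where "S \<in> Q d" "T \<in> V" and R: "R = ind S T" by auto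
        then obtain M M' where M: "M \<in> P d" "M' \<in> A" and ST: "S = restr U M" "T = restr U M'"
          by (auto simp: V_def simp flip: Suc)
        have "M \<in> A" using M(1) P_A by auto
        then have "R = restr U (star M M')" using M(2) by (simp add: R ST ind)
        then show "R \<in> ?l" using M by auto
      qed
    qed
    then show ?case unfolding P_Suc Q_Suc restr_span by simp
  qed
  obtain N where N: "ideal_of f \<inter> polys_le \<mu> \<subseteq> ideal_le f N" using ideal_of_inter_polys_le_bounded by blast
  \<comment> \<open>For such \<open>d\<close> the functionals in \<open>P d\<close> vanish on the
    intersection of the ideal with \<open>U\<close>, so on \<open>U\<close> they coincide with
    functionals annulling the whole ideal.\<close>
  have large: "restr U ` P d = restr U ` L" if d: "N \<le> \<mu> + int d" for d
  proof
    show "restr U ` L \<subseteq> restr U ` P d" using L_P by blast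
    show "restr U ` P d \<subseteq> restr U ` L"
    proof clarify
      fix M assume M: "M \<in> P d"
      have "N \<le> \<mu> + int d * (int \<epsilon> + 1)" 
        using d mult_nonneg_nonneg[of "int d" "int \<epsilon>"] unfolding distrib_left mult_1_right by linarith
      then have "ideal_of f \<inter> U \<subseteq> ideal_le f (\<mu> + int d * (int \<epsilon> + 1))"
        using N ideal_le_mono[of N "\<mu> + int d * (int \<epsilon> + 1)" f] unfolding U by blast
      then have "M F = 0" if "F \<in> ideal_of f \<inter> U" for F
        using that subsetD[OF P_ann M] by (auto simp: annulling_def)
      then have "\<exists>M'\<in>annulling (ideal_of f). \<forall>F\<in>U. M' F = M F"
        unfolding U by (rule functional_extend[OF A_fun[OF subsetD[OF P_A M]] subspace_ideal_of subspace_polys_le])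
      then obtain M' where "M' \<in> L" "\<forall>F\<in>U. M' F = M F" by (auto simp: assms(4))
      then show "restr U M \<in> restr U ` L" using restr_eq_iff[of U M M'] by auto
    qed
  qed
  \<comment> \<open>\<open>Q (Suc d)\<close> is determined by \<open>Q d\<close> alone, so one
    equality of consecutive powers makes the sequence constant from there on, and
    \<open>large\<close> identifies the constant value.\<close>
  have stable: "restr U ` L = restr U ` P d" if "Q d = Q (Suc d)" for d
  proof -
    have "Q (d + j) = Q d" for j
    proof (induction j)
      case (Suc j)
      have "Q (d + Suc j) = Q (Suc d)" unfolding Q_Suc add_Suc_right using Suc by simp
      then show ?case using that by simp
    qed simp
    from this[of "nat (N - \<mu>)"] show ?thesis
      using large[of "d + nat (N - \<mu>)"] by (simp add: P_Q)
  qed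
  have "Q (nat (N - \<mu>)) = Q (Suc (nat (N - \<mu>)))"
    using large[of "nat (N - \<mu>)"] large[of "Suc (nat (N - \<mu>))"] by (simp add: P_Q)
  then have "restr U ` alg_power star A (Suc (nat (N - \<mu>))) = restr U ` alg_power star A (Suc (nat (N - \<mu>)) + 1)"
    unfolding Suc_eq_plus1[symmetric] P_Q[unfolded P_def] .
  then have ex: "\<exists>d\<ge>1. restr U ` alg_power star A d = restr U ` alg_power star A (d + 1)"
    by (intro exI[of _ "Suc (nat (N - \<mu>))"]) simp
  have unique: "restr U ` L = restr U ` alg_power star A d \<and> restr U ` alg_power star A d = alg_power ind V d"
    if d: "1 \<le> d" "restr U ` alg_power star A d = restr U ` alg_power star A (d + 1)" for d
  proof -
    obtain d' where d': "d = Suc d'" using d(1) by (cases d) auto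
    have "Q d' = Q (Suc d')" using d(2) unfolding d' Suc_eq_plus1[symmetric] P_Q[unfolded P_def] .
    then show ?thesis using stable[of d'] P_Q[of d'] unfolding d' P_def Q_def by simp
  qed
  show ?thesis
    unfolding star_def[symmetric] ind_def[symmetric] V_def[symmetric]
  proof (intro conjI)
    show "\<exists>E. unit_root_functional D f E" using E by (rule exI[of _ E])
    show "\<forall>L1\<in>A. \<forall>L2\<in>A. ind (restr U L1) (restr U L2) = restr U (star L1 L2)" by (simp add: ind)
    show "comm_assoc_algebra V ind" by (rule algebra)
    show "\<exists>d\<ge>1. restr U ` alg_power star A d = restr U ` alg_power star A (d + 1)" by (rule ex)
    show "\<forall>d\<ge>1. restr U ` alg_power star A d = restr U ` alg_power star A (d + 1) \<longrightarrow>
      restr U ` L = restr U ` alg_power star A d \<and> restr U ` alg_power star A d = alg_power ind V d"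
      by (intro allI impI unique)
  qed
qed

end
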